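(* Suppose that $\omega ,v_1\in \mathscr P_E(\mathbf R^{2d})$ are such that $v_1$ is submultiplicative and $\omega$ is $v_1$-moderate, and suppose that $\mathscr B$ is an invariant QBF space on $\mathbf R^{2d}$ with respect to $v_0\in\mathscr P_E(\mathbf R^{2d})$ of order $r\in (0,1]$. Also let $$v(x)=v_1(x,0)v_0(x,0),\qquad x\in\mathbf R^d.$$ Then $$W\!L^{1,r}_{(v)}(\mathbf R^d) * M_0(\omega ,\mathscr B) = M_0(\omega ,\mathscr B) * W\!L^{1,r}_{(v)}(\mathbf R^d) = M_0(\omega ,\mathscr B).$$
   Context: Weights: a weight on $\mathbf R^n$ is a positive function $\omega$ with $\omega,1/\omega\in L^\infty_{loc}(\mathbf R^n)$. $\omega$ is $v$-moderate if $\omega(x+y)\le C\omega(x)v(y)$ for all $x,y$ and some constant $C>0$; $v$ is submultiplicative if it is even and $v$-moderate. $\mathscr P_E(\mathbf R^n)$ is the set of all weights that are $v$-moderate for some weight $v$. Gelfand–Shilov space: $\Sigma_1(\mathbf R^n)$ is the Fréchet space of all $f\in C^\infty(\mathbf R^n)$ with $\sup_{\alpha,\beta}\frac{\|x^\alpha D^\beta f\|_{L^\infty}}{h^{|\alpha+\beta|}\alpha!\beta!}<\infty$ for every $h>0$; $\Sigma_1'(\mathbf R^n)$ is its dual. Wiener amalgam space: $W\!L^{1,r}_{(v)}(\mathbf R^d)$ consists of all measurable $f$ on $\mathbf R^d$ with $\|f\|_{W\!L^{1,r}_{(v)}}=\big\|\{\|f\|_{L^1(k+[0,1]^d)}\,v(k)\}_{k\in\mathbf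 Z^d}\big\|_{\ell^r}<\infty$. Quasi-Banach space of order $r\in(0,1]$: a complete quasi-normed space whose quasi-norm satisfies $\|f+g\|^r\le\|f\|^r+\|g\|^r$. Invariant QBF space: let $\mathscr B$ be a quasi-Banach space of measurable functions on $\mathbf R^{2d}$ of order $r$ containing $\Sigma_1(\mathbf R^{2d})$ with continuous embedding, and $v_0\in\mathscr P_E(\mathbf R^{2d})$. $\mathscr B$ is an invariant QBF space (translation invariant quasi-Banach function space) with respect to $v_0$ of order $r$ if there is a constant $C$ such that (1) if $X\in\mathbf R^{2d}$ and $F\in\mathscr B$, then $F(\cdot-X)\in\mathscr B$ and $\|F(\cdot-X)\|_{\mathscr B}\le Cv_0(X)\|F\|_{\mathscr B}$; (2) if $F,G$ are measurable, $G\in\mathscr B$ and $|F|\le|G|$, then $F\in\mathscr B$ and $\|F\|_{\mathscr B}\le C\|G\|_{\mathscr B}$. Modulation spaces: with $(\mathscr F f)(\xi)=(2\pi)^{-d/2}\int f(x)e^{-i\langle x,\xi\rangle}dx$ and a fixed $\phi\in\Sigma_1(\mathbf R^d)\setminus0$, let $V_\phi f(x,\xi)=\mathscr F(f\cdot\overline{\phi(\cdot-x)})(\xi)$ for $f\in\Sigma_1'(\mathbf R^d)$. $M(\omega,\mathscr B)$ consists of all $f\in\Sigma_1'(\mathbf R^d)$ with $\|f\|_{M(\omega,\mathscr B)}=\|V_\phi f\cdot\omega\|_{\mathscr B}<\infty$. $M_0(\omega,\mathscr B)$ is the completion of $\Sigma_1(\mathbf R^d)$ under $\|\cdot\|_{M(\omega,\mathscr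 B)}$. Convolution between $W\!L^{1,r}_{(v)}(\mathbf R^d)$ and $M_0(\omega,\mathscr B)$ is the continuous extension, with values in $M_0(\omega,\mathscr B)$, of $(f,g)\mapsto f*g$ on $\Sigma_1(\mathbf R^d)\times\Sigma_1(\mathbf R^d)$. For sets $E,F$, $E*F=\{f*g:f\in E,\ g\in F\}$ (single products). *)

theory Defs
  imports "HOL-Analysis.Analysis"
begin

section \<open>Weights\<close>

definition Linf_loc :: "('a::euclidean_space \<Rightarrow> real) set" where
  "Linf_loc = {f \<in> borel_measurable lebesgue.
     \<forall>K. compact K \<longrightarrow> (\<exists>C. AE x in lebesgue. x \<in> K \<longrightarrow> \<bar>f x\<bar> \<le> C)}"

definition weight :: "('a::euclidean_space \<Rightarrow> real) \<Rightarrow> bool" where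
  "weight \<omega> \<longleftrightarrow> (\<forall>x. \<omega> x > 0) \<and> \<omega> \<in> Linf_loc \<and> (\<lambda>x. 1 / \<omega> x) \<in> Linf_loc"

definition moderate :: "('a::euclidean_space \<Rightarrow> real) \<Rightarrow> ('a \<Rightarrow> real) \<Rightarrow> bool" where
  "moderate v \<omega> \<longleftrightarrow> (\<exists>C>0. \<forall>x y. \<omega> (x + y) \<le> C * \<omega> x * v y)"

definition submultiplicative :: "('a::euclidean_space \<Rightarrow> real) \<Rightarrow> bool" where
  "submultiplicative v \<longleftrightarrow> (\<forall>x. v (- x) = v x) \<and> moderate v v"

definition P_E :: "('a::euclidean_space \<Rightarrow> real) set" where
  "P_E = {\<omega>. weight \<omega> \<and> (\<exists>v. weight v \<and> moderate v \<omega>)}"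


section \<open>Topologies from families of distances\<close>

text \<open>
  The topology on \<open>S\<close> whose neighbourhoods of a point contain a finite intersection of
  balls of distances from \<open>D\<close>. It serves for countably seminormed spaces and for spaces with
  one quasi-norm. Points at distance zero are not identified, so spaces of functions modulo
  null sets can be kept as spaces of functions.
\<close>

definition distance_topology :: "'a set \<Rightarrow> ('a \<Rightarrow> 'a \<Rightarrow> real) set \<Rightarrow> 'a topology" where
  "distance_topology S D = topology (\<lambda>U. U \<subseteq> S \<and>
     (\<forall>x\<in>U. \<exists>F \<epsilon>. F \<subseteq> D \<and> finite F \<and> \<epsilon> > 0 \<and> (\<forall>y\<in>S. (\<forall>d\<in>F. d x y < \<epsilon>) \<longrightarrow> y \<in> U)))"

lemma openin_distance_topology:
  "openin (distance_topology S D) U \<longleftrightarrow> U \<subseteq> S \<and>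
     (\<forall>x\<in>U. \<exists>F \<epsilon>. F \<subseteq> D \<and> finite F \<and> \<epsilon> > 0 \<and> (\<forall>y\<in>S. (\<forall>d\<in>F. d x y < \<epsilon>) \<longrightarrow> y \<in> U))"
proof -
  define Q where "Q U x F \<epsilon> \<longleftrightarrow> F \<subseteq> D \<and> finite F \<and> \<epsilon> > 0 \<and> (\<forall>y\<in>S. (\<forall>d\<in>F. d x y < \<epsilon>) \<longrightarrow> y \<in> U)"
    for U x F and \<epsilon> :: real
  define P where "P U \<longleftrightarrow> U \<subseteq> S \<and> (\<forall>x\<in>U. \<exists>F \<epsilon>. Q U x F \<epsilon>)" for U
  have inter: "Q (U \<inter> V) x (F \<union> G) (min \<epsilon> \<delta>)" if "Q U x F \<epsilon>" "Q V x G \<delta>" for U V x F G \<epsilon> \<delta>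
    using that unfolding Q_def by simp
  have mono: "Q V x F \<epsilon>" if "Q U x F \<epsilon>" "U \<subseteq> V" for U V x F \<epsilon>
    using that unfolding Q_def by (simp add: subset_eq)
  have "istopology P"
    unfolding istopology_def
  proof (intro conjI allI impI)
    fix U V assume "P U" "P V"
    then show "P (U \<inter> V)"
      unfolding P_def using inter by (metis IntD1 IntD2 le_infI1)
  next
    fix \<K> assume "\<forall>K\<in>\<K>. P K"
    then show "P (\<Union>\<K>)"
      unfolding P_def using mono by (metis Sup_least UnionE Union_upper)
  qed
  then have "openin (distance_topology S D) = P"
    unfolding distance_topology_def P_def[abs_def] Q_def by (rule topology_inverse')
  then show ?thesis by (simp add: P_def Q_def)
qed

lemma topspace_distance_topology [simp]: "topspace (distance_topology S D) = S"
proof (rule subset_antisym)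
  show "topspace (distance_topology S D) \<subseteq> S"
    using openin_topspace[of "distance_topology S D"] unfolding openin_distance_topology by (rule conjunct1)
  have "\<exists>F \<epsilon>. F \<subseteq> D \<and> finite F \<and> \<epsilon> > (0::real) \<and> (\<forall>y\<in>S. (\<forall>d\<in>F. d x y < \<epsilon>) \<longrightarrow> y \<in> S)" for x
    by (rule exI[of _ "{}"], rule exI[of _ 1]) simp
  then have "openin (distance_topology S D) S"
    unfolding openin_distance_topology by simp
  then show "S \<subseteq> topspace (distance_topology S D)"
    by (rule openin_subset)
qed


section \<open>Completion\<close>

text \<open>
  Classes of Cauchy sequences modulo null sequences. The distance of two classes is the limit of
  the distances of representatives. This limit exists and does not depend on the representatives
  when some power of \<open>d\<close> is a pseudometric, as for the distance of a quasi-norm of order \<open>r\<close>.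
\<close>

definition Cauchy_in :: "'a set \<Rightarrow> ('a \<Rightarrow> 'a \<Rightarrow> real) \<Rightarrow> (nat \<Rightarrow> 'a) set" where
  "Cauchy_in S d = {s. range s \<subseteq> S \<and> (\<forall>\<epsilon>>0. \<exists>n\<^sub>0. \<forall>m\<ge>n\<^sub>0. \<forall>n\<ge>n\<^sub>0. d (s m) (s n) < \<epsilon>)}"

definition null_rel :: "'a set \<Rightarrow> ('a \<Rightarrow> 'a \<Rightarrow> real) \<Rightarrow> ((nat \<Rightarrow> 'a) \<times> (nat \<Rightarrow> 'a)) set" where
  "null_rel S d = {(s, t). s \<in> Cauchy_in S d \<and> t \<in> Cauchy_in S d \<and> (\<lambda>n. d (s n) (t n)) \<longlonglongrightarrow> 0}"

definition completion :: "'a set \<Rightarrow> ('a \<Rightarrow> 'a \<Rightarrow> real) \<Rightarrow> (nat \<Rightarrow> 'a) set set" where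
  "completion S d = Cauchy_in S d // null_rel S d"

definition completion_dist :: "('a \<Rightarrow> 'a \<Rightarrow> real) \<Rightarrow> (nat \<Rightarrow> 'a) set \<Rightarrow> (nat \<Rightarrow> 'a) set \<Rightarrow> real" where
  "completion_dist d c c' = lim (\<lambda>n. d ((SOME s. s \<in> c) n) ((SOME t. t \<in> c') n))"

definition completion_embed :: "'a set \<Rightarrow> ('a \<Rightarrow> 'a \<Rightarrow> real) \<Rightarrow> 'a \<Rightarrow> (nat \<Rightarrow> 'a) set" where
  "completion_embed S d f = null_rel S d `` {\<lambda>_. f}"


section \<open>Gelfand--Shilov spaces\<close>

definition partial_deriv :: "'a::euclidean_space \<Rightarrow> ('a \<Rightarrow> complex) \<Rightarrow> 'a \<Rightarrow> complex" where
  "partial_deriv b f x = frechet_derivative f (at x) b"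

definition smooth :: "('a::euclidean_space \<Rightarrow> complex) \<Rightarrow> bool" where
  "smooth f \<longleftrightarrow> (\<forall>bs\<in>lists Basis. foldr partial_deriv bs f differentiable_on UNIV)"

text \<open>
  A multi-index is a function on \<open>Basis\<close>; its values elsewhere play no role. The partial
  derivatives are taken in a fixed enumeration of \<open>Basis\<close>, which is immaterial for smooth
  functions. The usual factors \<open>-\<i>\<close> in \<open>D\<close> are left out, as only absolute values of
  derivatives occur.
\<close>

definition basis_enum :: "'a::euclidean_space list" where
  "basis_enum = (SOME bs. distinct bs \<and> set bs = Basis)"

definition multi_deriv :: "('a::euclidean_space \<Rightarrow> nat) \<Rightarrow> ('a \<Rightarrow> complex) \<Rightarrow> 'a \<Rightarrow> complex" where
  "multi_deriv \<beta> f = foldr (\<lambda>b. partial_deriv b ^^ \<beta> b) basis_enum f"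

definition multi_pow :: "'a::euclidean_space \<Rightarrow> ('a \<Rightarrow> nat) \<Rightarrow> real" where
  "multi_pow x \<alpha> = (\<Prod>b\<in>Basis. (x \<bullet> b) ^ \<alpha> b)"

definition multi_abs :: "('a::euclidean_space \<Rightarrow> nat) \<Rightarrow> nat" where
  "multi_abs \<alpha> = (\<Sum>b\<in>Basis. \<alpha> b)"

definition multi_fact :: "('a::euclidean_space \<Rightarrow> nat) \<Rightarrow> real" where
  "multi_fact \<alpha> = (\<Prod>b\<in>Basis. fact (\<alpha> b))"

definition GS_quotients :: "real \<Rightarrow> ('a::euclidean_space \<Rightarrow> complex) \<Rightarrow> real set" where
  "GS_quotients h f =
     {\<bar>multi_pow x \<alpha>\<bar> * norm (multi_deriv \<beta> f x)
        / (h ^ (multi_abs \<alpha> + multi_abs \<beta>) * multi_fact \<alpha> * multi_fact \<beta>) | \<alpha> \<beta> x. True}"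

definition GS_norm :: "real \<Rightarrow> ('a::euclidean_space \<Rightarrow> complex) \<Rightarrow> real" where
  "GS_norm h f = Sup (GS_quotients h f)"

definition Sigma1 :: "('a::euclidean_space \<Rightarrow> complex) set" where
  "Sigma1 = {f. smooth f \<and> (\<forall>h>0. bdd_above (GS_quotients h f))}"

definition Sigma1_top :: "('a::euclidean_space \<Rightarrow> complex) topology" where
  "Sigma1_top = distance_topology Sigma1 {\<lambda>f g. GS_norm h (\<lambda>x. f x - g x) | h. h > 0}"

text \<open>Functionals vanish outside \<^term>\<open>Sigma1\<close>, so that equal distributions are equal functions.\<close>

definition Sigma1_dual :: "(('a::euclidean_space \<Rightarrow> complex) \<Rightarrow> complex) set" where
  "Sigma1_dual = {u. continuous_map Sigma1_top euclidean u
     \<and> (\<forall>f\<in>Sigma1. \<forall>g\<in>Sigma1. u (\<lambda>x. f x + g x) = u f + u g)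
     \<and> (\<forall>c. \<forall>f\<in>Sigma1. u (\<lambda>x. c * f x) = c * u f)
     \<and> (\<forall>f. f \<notin> Sigma1 \<longrightarrow> u f = 0)}"

definition distr :: "('a::euclidean_space \<Rightarrow> complex) \<Rightarrow> ('a \<Rightarrow> complex) \<Rightarrow> complex" where
  "distr f \<psi> = (if \<psi> \<in> Sigma1 then LINT x|lborel. f x * \<psi> x else 0)"

definition conv :: "('a::euclidean_space \<Rightarrow> complex) \<Rightarrow> ('a \<Rightarrow> complex) \<Rightarrow> 'a \<Rightarrow> complex" where
  "conv f g x = (LINT y|lborel. f (x - y) * g y)"


section \<open>Wiener amalgam spaces\<close>

definition lattice :: "(real^'d) set" where
  "lattice = {k. \<forall>i. k $ i \<in> \<int>}"

definition WL_term :: "real \<Rightarrow> (real^'d \<Rightarrow> real) \<Rightarrow> (real^'d \<Rightarrow> complex) \<Rightarrow> real^'d \<Rightarrow> real" where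
  "WL_term r v f k = ((LINT x:cbox k (\<chi> i. k $ i + 1)|lebesgue. norm (f x)) * v k) powr r"

definition WL :: "real \<Rightarrow> (real^'d \<Rightarrow> real) \<Rightarrow> (real^'d \<Rightarrow> complex) set" where
  "WL r v = {f \<in> borel_measurable lebesgue.
     (\<forall>k\<in>lattice. set_integrable lebesgue (cbox k (\<chi> i. k $ i + 1)) f)
     \<and> WL_term r v f summable_on lattice}"

definition WL_norm :: "real \<Rightarrow> (real^'d \<Rightarrow> real) \<Rightarrow> (real^'d \<Rightarrow> complex) \<Rightarrow> real" where
  "WL_norm r v f = (\<Sum>\<^sub>\<infinity>k\<in>lattice. WL_term r v f k) powr (1 / r)"

definition WL_top :: "real \<Rightarrow> (real^'d \<Rightarrow> real) \<Rightarrow> (real^'d \<Rightarrow> complex) topology" where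
  "WL_top r v = distance_topology (WL r v) {\<lambda>f g. WL_norm r v (\<lambda>x. f x - g x)}"


section \<open>Invariant quasi-Banach function spaces\<close>

text \<open>
  A space of measurable functions modulo null sets is given by the set \<open>B\<close> of all
  representatives of its elements and the quasi-norm \<open>N\<close>, of which only the values on \<open>B\<close>
  matter.
\<close>

definition quasi_Banach_fun_space ::
    "('a::euclidean_space \<Rightarrow> complex) set \<Rightarrow> (('a \<Rightarrow> complex) \<Rightarrow> real) \<Rightarrow> real \<Rightarrow> bool" where
  "quasi_Banach_fun_space B N r \<longleftrightarrow>
     0 < r \<and> r \<le> 1 \<and>
     B \<subseteq> borel_measurable lebesgue \<and>
     (\<forall>F\<in>B. \<forall>G\<in>borel_measurable lebesgue. (AE x in lebesgue. F x = G x) \<longrightarrow> G \<in> B) \<and>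
     (\<lambda>_. 0) \<in> B \<and>
     (\<forall>F\<in>B. \<forall>G\<in>B. (\<lambda>x. F x + G x) \<in> B) \<and>
     (\<forall>c. \<forall>F\<in>B. (\<lambda>x. c * F x) \<in> B) \<and>
     (\<forall>F\<in>B. N F \<ge> 0 \<and> (N F = 0 \<longleftrightarrow> (AE x in lebesgue. F x = 0))) \<and>
     (\<forall>c. \<forall>F\<in>B. N (\<lambda>x. c * F x) = norm c * N F) \<and>
     (\<forall>F\<in>B. \<forall>G\<in>B. N (\<lambda>x. F x + G x) powr r \<le> N F powr r + N G powr r) \<and>
     (\<forall>s\<in>Cauchy_in B (\<lambda>F G. N (\<lambda>x. F x - G x)).
        \<exists>F\<in>B. (\<lambda>n. N (\<lambda>x. s n x - F x)) \<longlonglongrightarrow> 0)"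

definition invariant_QBF ::
    "('a::euclidean_space \<Rightarrow> complex) set \<Rightarrow> (('a \<Rightarrow> complex) \<Rightarrow> real) \<Rightarrow> ('a \<Rightarrow> real) \<Rightarrow> real \<Rightarrow> bool"
  where
  "invariant_QBF B N v\<^sub>0 r \<longleftrightarrow>
     quasi_Banach_fun_space B N r \<and>
     Sigma1 \<subseteq> B \<and>
     continuous_map Sigma1_top (distance_topology B {\<lambda>F G. N (\<lambda>x. F x - G x)}) (\<lambda>F. F) \<and>
     v\<^sub>0 \<in> P_E \<and>
     (\<exists>C.
        (\<forall>X. \<forall>F\<in>B. (\<lambda>Y. F (Y - X)) \<in> B \<and> N (\<lambda>Y. F (Y - X)) \<le> C * v\<^sub>0 X * N F) \<and>
        (\<forall>F\<in>borel_measurable lebesgue. \<forall>G\<in>B.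
           (AE X in lebesgue. norm (F X) \<le> norm (G X)) \<longrightarrow> F \<in> B \<and> N F \<le> C * N G))"


section \<open>Modulation spaces\<close>

text \<open>
  For a distribution \<open>u\<close> the Fourier transform of \<open>u \<cdot> cnj (\<phi>(\<sqdot> - x))\<close> is the function of \<open>\<xi>\<close>
  obtained by pairing \<open>u\<close> bilinearly with the window times the exponential.
\<close>

definition STFT ::
    "(real^'d \<Rightarrow> complex) \<Rightarrow> ((real^'d \<Rightarrow> complex) \<Rightarrow> complex) \<Rightarrow> (real^'d) \<times> (real^'d) \<Rightarrow> complex" where
  "STFT \<phi> u = (\<lambda>(x, \<xi>). of_real ((2 * pi) powr (- (real CARD('d) / 2)))
      * u (\<lambda>y. cnj (\<phi> (y - x)) * exp (- \<i> * of_real (y \<bullet> \<xi>))))"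

definition mod_space ::
    "(real^'d \<Rightarrow> complex) \<Rightarrow> ((real^'d) \<times> (real^'d) \<Rightarrow> real) \<Rightarrow> ((real^'d) \<times> (real^'d) \<Rightarrow> complex) set
     \<Rightarrow> ((real^'d \<Rightarrow> complex) \<Rightarrow> complex) set" where
  "mod_space \<phi> \<omega> B = {u \<in> Sigma1_dual. (\<lambda>X. STFT \<phi> u X * of_real (\<omega> X)) \<in> B}"

definition mod_norm ::
    "(real^'d \<Rightarrow> complex) \<Rightarrow> ((real^'d) \<times> (real^'d) \<Rightarrow> real) \<Rightarrow> (((real^'d) \<times> (real^'d) \<Rightarrow> complex) \<Rightarrow> real)
     \<Rightarrow> ((real^'d \<Rightarrow> complex) \<Rightarrow> complex) \<Rightarrow> real" where
  "mod_norm \<phi> \<omega> N u = N (\<lambda>X. STFT \<phi> u X * of_real (\<omega> X))"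

definition mod_dist ::
    "(real^'d \<Rightarrow> complex) \<Rightarrow> ((real^'d) \<times> (real^'d) \<Rightarrow> real) \<Rightarrow> (((real^'d) \<times> (real^'d) \<Rightarrow> complex) \<Rightarrow> real)
     \<Rightarrow> (real^'d \<Rightarrow> complex) \<Rightarrow> (real^'d \<Rightarrow> complex) \<Rightarrow> real" where
  "mod_dist \<phi> \<omega> N f g = mod_norm \<phi> \<omega> N (distr (\<lambda>x. f x - g x))"

definition M0 ::
    "(real^'d \<Rightarrow> complex) \<Rightarrow> ((real^'d) \<times> (real^'d) \<Rightarrow> real) \<Rightarrow> (((real^'d) \<times> (real^'d) \<Rightarrow> complex) \<Rightarrow> real)
     \<Rightarrow> (nat \<Rightarrow> real^'d \<Rightarrow> complex) set set" where
  "M0 \<phi> \<omega> N = completion Sigma1 (mod_dist \<phi> \<omega> N)"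

definition M0_top ::
    "(real^'d \<Rightarrow> complex) \<Rightarrow> ((real^'d) \<times> (real^'d) \<Rightarrow> real) \<Rightarrow> (((real^'d) \<times> (real^'d) \<Rightarrow> complex) \<Rightarrow> real)
     \<Rightarrow> (nat \<Rightarrow> real^'d \<Rightarrow> complex) set topology" where
  "M0_top \<phi> \<omega> N = distance_topology (M0 \<phi> \<omega> N) {completion_dist (mod_dist \<phi> \<omega> N)}"

definition M0_embed ::
    "(real^'d \<Rightarrow> complex) \<Rightarrow> ((real^'d) \<times> (real^'d) \<Rightarrow> real) \<Rightarrow> (((real^'d) \<times> (real^'d) \<Rightarrow> complex) \<Rightarrow> real)
     \<Rightarrow> (real^'d \<Rightarrow> complex) \<Rightarrow> (nat \<Rightarrow> real^'d \<Rightarrow> complex) set" where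
  "M0_embed \<phi> \<omega> N = completion_embed Sigma1 (mod_dist \<phi> \<omega> N)"


section \<open>Convolution between amalgam and modulation spaces\<close>

text \<open>
  The continuous extensions are chosen by \<open>SOME\<close>. On the product of the two spaces they are
  unique, since \<^term>\<open>Sigma1\<close> is dense in both factors and \<^term>\<open>M0\<close> is Hausdorff. If no
  continuous extension existed, nothing could be derived about the chosen map.
\<close>

definition WL_M0_conv ::
    "(real^'d \<Rightarrow> complex) \<Rightarrow> ((real^'d) \<times> (real^'d) \<Rightarrow> real) \<Rightarrow> (((real^'d) \<times> (real^'d) \<Rightarrow> complex) \<Rightarrow> real)
     \<Rightarrow> real \<Rightarrow> (real^'d \<Rightarrow> real)
     \<Rightarrow> (real^'d \<Rightarrow> complex) \<times> (nat \<Rightarrow> real^'d \<Rightarrow> complex) set \<Rightarrow> (nat \<Rightarrow> real^'d \<Rightarrow> complex) set" where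
  "WL_M0_conv \<phi> \<omega> N r v = (SOME c.
     continuous_map (prod_topology (WL_top r v) (M0_top \<phi> \<omega> N)) (M0_top \<phi> \<omega> N) c \<and>
     (\<forall>f\<in>Sigma1. \<forall>g\<in>Sigma1. c (f, M0_embed \<phi> \<omega> N g) = M0_embed \<phi> \<omega> N (conv f g)))"

definition M0_WL_conv ::
    "(real^'d \<Rightarrow> complex) \<Rightarrow> ((real^'d) \<times> (real^'d) \<Rightarrow> real) \<Rightarrow> (((real^'d) \<times> (real^'d) \<Rightarrow> complex) \<Rightarrow> real)
     \<Rightarrow> real \<Rightarrow> (real^'d \<Rightarrow> real)
     \<Rightarrow> (nat \<Rightarrow> real^'d \<Rightarrow> complex) set \<times> (real^'d \<Rightarrow> complex) \<Rightarrow> (nat \<Rightarrow> real^'d \<Rightarrow> complex) set" where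
  "M0_WL_conv \<phi> \<omega> N r v = (SOME c.
     continuous_map (prod_topology (M0_top \<phi> \<omega> N) (WL_top r v)) (M0_top \<phi> \<omega> N) c \<and>
     (\<forall>f\<in>Sigma1. \<forall>g\<in>Sigma1. c (M0_embed \<phi> \<omega> N f, g) = M0_embed \<phi> \<omega> N (conv f g)))"

definition products :: "('a \<times> 'b \<Rightarrow> 'c) \<Rightarrow> 'a set \<Rightarrow> 'b set \<Rightarrow> 'c set" where
  "products c E F = {c (f, g) | f g. f \<in> E \<and> g \<in> F}"

end

theory Submission
 imports Defs "HOL-Probability.Probability" "HOL-Complex_Analysis.Complex_Analysis"
begin

text \<open>
  The estimate \<open>\<parallel>f * g\<parallel>\<^sup>r \<le> C \<parallel>f\<parallel>\<^sup>r \<parallel>g\<parallel>\<^sup>r\<close> for test functions comes from splitting \<open>f\<close> over unit cells: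
  the short-time Fourier transform of \<open>f * g\<close> is dominated by a lattice sum of translates of the
  local maximal function of that of \<open>g\<close>, and passing to the local maximal function costs
  only a constant. Density of test functions then gives the extension. For the factorization,
  as in Cohen's theorem, a class \<open>h\<close> is approximated by \<open>a\<^sub>n g\<^sub>n\<close>, where
  \<open>a\<^sub>n = (1-l)\<^sup>n + f\<^sub>n *\<close> is a product of operators \<open>(1-l) + l p *\<close> with Gaussian mollifiers \<open>p\<close>.
  These have approximate inverses by a Neumann series, and narrow mollifiers make \<open>f\<^sub>n\<close> and \<open>g\<^sub>n\<close> converge.
\<close>

text \<open>For \<open>r < 1\<close> the quasi-norm of an integral of translates is not bounded by
  the integral of their quasi-norms; only countable sums can be estimated, through r-th powers.
  Hence the cut into unit cells, the local integrals of \<open>f\<close> summed in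
  \<open>l^r\<close>, and the supremum over a ball in place of the other factor: it no longer
  depends on the point of the cell.

  Elements of \<open>M0\<close> are classes of Cauchy sequences, so the factorization works with
  test functions throughout and takes the limit once, at the end. Exact inverses would leave this
  class; approximate ones with a bound on the solution suffice. Inverting one factor costs 4,
  whatever the width of its mollifier, so that the width can be chosen last in each step. After
  \<open>n\<close> factors the cost is \<open>4 ^ n\<close>; a subsequence makes the increments of
  \<open>h\<close> at most \<open>(1 / 16) ^ n\<close>, and the corrections of \<open>g\<close>
  become summable. The chosen extension of the convolution enters only through its continuity and
  its values on test functions.\<close>

abbreviation decay :: "real => 'a::real_normed_vector => real" where
 "decay c x \<equiv> exp (- c * norm x)"

abbreviation pd :: "'a::euclidean_space => ('a => complex) => 'a => complex" where
 "pd \<equiv> partial_deriv"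

lemmas integrable_dominated = Bochner_Integration.integrable_bound

section \<open>Lattice sums and weights\<close>

text \<open>The counterpart of \<open>lattice\<close> on an arbitrary Euclidean space; it is also
  used on the phase space, which is a product type.\<close>

definition int_lattice :: "'a::euclidean_space set" where
 "int_lattice = {k. \<forall>b\<in>Basis. k \<bullet> b \<in> \<int>}"

text \<open>Half-open, so that the cells of lattice points partition the space. The closed cubes in
  \<open>WL_term\<close> overlap on faces.\<close>

definition cell :: "'a::euclidean_space => 'a set" where
 "cell k = {x. \<forall>b\<in>Basis. k \<bullet> b <= x \<bullet> b \<and> x \<bullet> b < k \<bullet> b + 1}"

definition corner :: "'a::euclidean_space => 'a" where
 "corner x = (\<Sum>b\<in>Basis. of_int \<lfloor>x \<bullet> b\<rfloor> *\<^sub>R b)"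

lemma corner_in_lattice: "corner x \<in> int_lattice"
 by (auto simp: corner_def int_lattice_def)

lemma in_cell_corner: "x \<in> cell (corner x)"
 by (auto simp: corner_def cell_def)

lemma in_cell_iff:
 assumes "k \<in> int_lattice" shows "x \<in> cell k \<longleftrightarrow> k = corner x"
proof
 assume x: "x \<in> cell k"
 show "k = corner x"
 proof (rule euclidean_eqI)
  fix b :: 'a assume b: "b \<in> Basis"
  then obtain z where z: "k \<bullet> b = of_int z" using assms by (auto simp: int_lattice_def elim!: Ints_cases)
  have "of_int z <= x \<bullet> b" "x \<bullet> b < of_int z + 1" using x b z by (auto simp: cell_def)
  then have "\<lfloor>x \<bullet> b\<rfloor> = z" by linarith
  then show "k \<bullet> b = corner x \<bullet> b" using b z by (simp add: corner_def)
 qed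
qed (simp add: in_cell_corner)

lemma cell_subset_cbox: "cell k \<subseteq> cbox k (k + One)"
 by (auto simp: cell_def mem_box inner_add_left less_imp_le)

lemma norm_diff_cell:
 fixes x :: "'a::euclidean_space"
 assumes "x \<in> cbox k (k + One)" shows "norm (x - k) <= DIM('a)"
proof -
 have "norm (x - k) <= (\<Sum>b\<in>Basis. \<bar>(x - k) \<bullet> b\<bar>)" by (rule norm_le_l1)
 also have "... <= (\<Sum>b\<in>(Basis::'a set). 1)"
  using assms by (intro sum_mono) (auto simp: mem_box inner_add_left inner_diff_left abs_le_iff)
 finally show ?thesis by simp
qed

lemma borel_cell [measurable]: "cell k \<in> sets borel"
proof -
 have "cell k = (\<Inter>b\<in>Basis. {x. k \<bullet> b <= x \<bullet> b} \<inter> {x. x \<bullet> b < k \<bullet> b + 1})"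
  by (auto simp: cell_def)
 also have "... \<in> sets borel" by (intro sets.finite_INT) auto
 finally show ?thesis .
qed

text \<open>Lattice points as integer-valued functions on \<open>Basis\<close>. Extensionality makes
  the correspondence injective, and sums of products over such functions factor.\<close>

lemma int_lattice_bij:
 "bij_betw (%g. \<Sum>b\<in>Basis. of_int (g b) *\<^sub>R b) (PiE Basis (%_. UNIV)) (int_lattice :: 'a::euclidean_space set)"
proof (rule bij_betw_byWitness[where f'="%k. \<lambda>b\<in>Basis. \<lfloor>k \<bullet> b\<rfloor>"])
 show "\<forall>a\<in>Basis \<rightarrow>\<^sub>E UNIV. (\<lambda>b\<in>Basis. \<lfloor>(\<Sum>b\<in>Basis. of_int (a b) *\<^sub>R (b::'a)) \<bullet> b\<rfloor>) = a"
  by (auto simp: fun_eq_iff PiE_def extensional_def)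
 show "\<forall>a'\<in>int_lattice. (\<Sum>b\<in>Basis. of_int ((\<lambda>b\<in>Basis. \<lfloor>a' \<bullet> b\<rfloor>) b) *\<^sub>R b) = (a'::'a)"
 proof
  fix a' :: 'a assume a: "a' \<in> int_lattice"
  have fl: "of_int \<lfloor>a' \<bullet> b\<rfloor> = a' \<bullet> b" if "b \<in> Basis" for b
   using a that by (simp add: int_lattice_def)
  show "(\<Sum>b\<in>Basis. of_int ((\<lambda>b\<in>Basis. \<lfloor>a' \<bullet> b\<rfloor>) b) *\<^sub>R b) = a'"
   by (rule euclidean_eqI) (simp add: fl)
 qed
 show "(%g. \<Sum>b\<in>Basis. of_int (g b) *\<^sub>R b) ` (Basis \<rightarrow>\<^sub>E UNIV) \<subseteq> (int_lattice::'a set)"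
  by (auto simp: int_lattice_def)
 show "(%k. \<lambda>b\<in>Basis. \<lfloor>k \<bullet> b\<rfloor>) ` int_lattice \<subseteq> Basis \<rightarrow>\<^sub>E UNIV" by auto
qed

lemma countable_int_lattice: "countable (int_lattice :: 'a::euclidean_space set)"
proof -
 have "countable (PiE (Basis::'a set) (%_. UNIV::int set))" by (intro countable_PiE) auto
 then show ?thesis
  unfolding bij_betw_imp_surj_on[OF int_lattice_bij, symmetric] by (rule countable_image)
qed

lemma infinite_int_lattice: "infinite (int_lattice :: 'a::euclidean_space set)"
proof
 assume fin: "finite (int_lattice :: 'a set)"
 obtain b :: 'a where b: "b \<in> Basis" using nonempty_Basis by blast
 have "range (%n::nat. real n *\<^sub>R b) \<subseteq> int_lattice"
  using b by (auto simp: int_lattice_def inner_Basis)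
 then have "finite (range (%n::nat. real n *\<^sub>R b))" using fin finite_subset by blast
 moreover have "inj (%n::nat. real n *\<^sub>R b)" using b by (auto simp: inj_on_def)
 ultimately show False using finite_imageD by fastforce
qed

section \<open>Exponential sums over the lattice\<close>

lemma abs_summable_on_iff_summable_real:
 fixes f :: "'i => real"
 assumes "!!x. x \<in> A ==> 0 <= f x"
 shows "Infinite_Set_Sum.abs_summable_on f A \<longleftrightarrow> f summable_on A"
proof -
 have "Infinite_Set_Sum.abs_summable_on f A \<longleftrightarrow> (%x. norm (f x)) summable_on A"
  by (rule abs_summable_equivalent[symmetric])
 also have "... \<longleftrightarrow> f summable_on A" using assms by (intro summable_on_cong) auto
 finally show ?thesis .
qed

lemma summable_exp_abs_int:
 assumes "c > 0" shows "(%j::int. exp (- c * \<bar>of_int j\<bar>) :: real) summable_on UNIV"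
proof -
 have geo: "(%n::nat. exp (- c * real n)) summable_on UNIV"
 proof (rule norm_summable_imp_summable_on)
  have "(%n::nat. exp (- c * real n)) = (%n. exp (- c) ^ n)"
   by (auto simp: fun_eq_iff exp_of_nat_mult[symmetric] mult.commute)
  then show "summable (%n::nat. norm (exp (- c * real n)))"
   using assms by (simp add: power_abs summable_geometric)
 qed
 have "(%j::int. exp (- c * \<bar>of_int j\<bar>) :: real) summable_on (range int \<union> range (%n. - int n))"
  using geo by (intro summable_on_union) (auto simp: summable_on_reindex inj_on_def o_def)
 moreover have "range int \<union> range (%n. - int n) = UNIV"
  by (auto intro: int_cases2)
 ultimately show ?thesis by simp
qed

text \<open>Each of the \<open>DIM('a)\<close> coordinates is bounded by the norm, so the summand is
  dominated by a product of one-dimensional geometric terms, one per coordinate.\<close>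

lemma summable_exp_lattice:
 assumes "c > 0" shows "(%k::'a::euclidean_space. decay c k) summable_on int_lattice"
proof -
 define d where "d = c / DIM('a)"
 have d: "d > 0" using assms by (simp add: d_def)
 have "Infinite_Set_Sum.abs_summable_on (%j::int. exp (- d * \<bar>of_int j\<bar>) :: real) UNIV"
  using summable_exp_abs_int[OF d] by (intro abs_summable_on_iff_summable_real[THEN iffD2]) auto
 then have "Infinite_Set_Sum.abs_summable_on (%g. \<Prod>b\<in>(Basis::'a set). exp (- d * \<bar>of_int (g b :: int)\<bar>) :: real) (PiE Basis (%_. UNIV))"
  by (intro abs_summable_on_prod_PiE) auto
 then have "(%g. \<Prod>b\<in>(Basis::'a set). exp (- d * \<bar>of_int (g b :: int)\<bar>) :: real) summable_on (PiE Basis (%_. UNIV))"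
  by (intro abs_summable_on_iff_summable_real[THEN iffD1]) (auto simp: prod_nonneg)
 also have "?this \<longleftrightarrow> ((%k. \<Prod>b\<in>(Basis::'a set). exp (- d * \<bar>k \<bullet> b\<bar>)) \<circ> (%g. \<Sum>b\<in>Basis. of_int (g b) *\<^sub>R b)) summable_on (PiE Basis (%_. UNIV))"
  by (intro summable_on_cong prod.cong) auto
 also have "... \<longleftrightarrow> (%k. \<Prod>b\<in>(Basis::'a set). exp (- d * \<bar>k \<bullet> b\<bar>)) summable_on int_lattice"
  unfolding o_def by (rule summable_on_reindex_bij_betw[OF int_lattice_bij])
 finally have *: "(%k. \<Prod>b\<in>(Basis::'a set). exp (- d * \<bar>k \<bullet> b\<bar>)) summable_on int_lattice" .
 show ?thesis
 proof (rule summable_on_comparison_test[OF *])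
  fix k :: 'a
  have "(\<Sum>b\<in>Basis. \<bar>k \<bullet> b\<bar>) <= (\<Sum>b\<in>(Basis::'a set). norm k)"
   by (intro sum_mono) (rule Basis_le_norm)
  then have "d * (\<Sum>b\<in>Basis. \<bar>k \<bullet> b\<bar>) <= c * norm k"
   using d mult_left_mono[of "\<Sum>b\<in>Basis. \<bar>k \<bullet> b\<bar>" "DIM('a) * norm k" d] by (simp add: d_def)
  then show "decay c k <= (\<Prod>b\<in>Basis. exp (- d * \<bar>k \<bullet> b\<bar>))"
   by (simp add: exp_sum[symmetric] sum_distrib_left[symmetric] sum_negf)
 qed auto
qed

section \<open>Integrals as sums over cells\<close>

lemma nn_integral_cells:
 fixes u :: "'a::euclidean_space => ennreal"
 assumes "u \<in> borel_measurable lebesgue"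
 shows "(\<integral>\<^sup>+x. u x \<partial>lebesgue) = (\<integral>\<^sup>+k. (\<integral>\<^sup>+x. u x * indicator (cell k) x \<partial>lebesgue) \<partial>count_space int_lattice)"
proof -
 have c: "cell k \<in> sets lebesgue" for k :: 'a using borel_cell by simp
 \<comment> \<open>Exactly one cell contains \<open>x\<close>, so the sum has a single term.\<close>
 have "u x = (\<integral>\<^sup>+k. u x * indicator (cell k) x \<partial>count_space int_lattice)" for x
 proof -
  have "(\<integral>\<^sup>+k. u x * indicator (cell k) x \<partial>count_space int_lattice)
    = (\<integral>\<^sup>+k. u x * indicator {corner x} k \<partial>count_space int_lattice)"
   by (intro nn_integral_cong) (auto simp: in_cell_iff indicator_def)
  also have "... = u x" 
   by (subst nn_integral_cmult_indicator) (auto simp: corner_in_lattice one_ennreal_def[symmetric])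
  finally show ?thesis by simp
 qed
 then have "(\<integral>\<^sup>+x. u x \<partial>lebesgue) = (\<integral>\<^sup>+x. (\<integral>\<^sup>+k. u x * indicator (cell k) x \<partial>count_space int_lattice) \<partial>lebesgue)"
  by (rule nn_integral_cong)
 also have "... = (\<integral>\<^sup>+k. (\<integral>\<^sup>+x. u x * indicator (cell k) x \<partial>lebesgue) \<partial>count_space int_lattice)"
  by (rule nn_integral_count_space_nn_integral[OF countable_int_lattice])
   (intro borel_measurable_times_ennreal assms borel_measurable_indicator c)
 finally show ?thesis .
qed

text \<open>The hypothesis bounds nonnegative integrals, so that integrability of \<open>u\<close>
  comes out as a conclusion.\<close>

lemma integral_le_sum_cells:
 fixes u :: "'a::euclidean_space => real"
 assumes u: "u \<in> borel_measurable lebesgue" "!!x. 0 <= u x"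
  and b: "!!k. k \<in> int_lattice ==> (\<integral>\<^sup>+x. ennreal (u x) * indicator (cell k) x \<partial>lebesgue) <= ennreal (b k)"
  and b0: "!!k. k \<in> int_lattice ==> 0 <= b k"
  and s: "b summable_on int_lattice"
 shows "integrable lebesgue u" "integral\<^sup>L lebesgue u <= infsum b int_lattice"
proof -
 have "(\<integral>\<^sup>+x. ennreal (u x) \<partial>lebesgue) <= (\<integral>\<^sup>+k. ennreal (b k) \<partial>count_space int_lattice)"
  using u by (subst nn_integral_cells) (auto intro!: nn_integral_mono b)
 also have "... = ennreal (\<integral>k. b k \<partial>count_space int_lattice)"
 proof (rule nn_integral_eq_integral)
  have "Infinite_Set_Sum.abs_summable_on b int_lattice"
   using s b0 by (intro abs_summable_on_iff_summable_real[THEN iffD2]) auto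
  then show "integrable (count_space int_lattice) b" by (simp add: abs_summable_on_def)
  show "AE k in count_space int_lattice. 0 <= b k" using b0 by (auto simp: AE_count_space)
 qed
 also have "(\<integral>k. b k \<partial>count_space int_lattice) = infsum b int_lattice"
  using infsetsum_infsum[of b int_lattice] abs_summable_on_iff_summable_real[of int_lattice b] s b0
  by (simp add: infsetsum_def[symmetric])
 finally have le: "(\<integral>\<^sup>+x. ennreal (u x) \<partial>lebesgue) <= ennreal (infsum b int_lattice)" .
 then show int: "integrable lebesgue u"
  using u le_less_trans[OF le] by (intro integrableI_bounded) auto
 have "ennreal (integral\<^sup>L lebesgue u) <= ennreal (infsum b int_lattice)"
  using le nn_integral_eq_integral[OF int] u(2) by simp
 then show "integral\<^sup>L lebesgue u <= infsum b int_lattice"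
  using b0 by (simp add: ennreal_le_iff infsum_nonneg)
qed

lemma emeasure_cell_le: "emeasure lebesgue (cell k) <= 1"
proof -
 have "emeasure lebesgue (cell k) <= emeasure lebesgue (cbox k (k + One))"
  by (intro emeasure_mono cell_subset_cbox) auto
 also have "... = 1" by (simp add: inner_add_left)
 finally show ?thesis .
qed

lemma exp_norm_cell:
 fixes x :: "'a::euclidean_space"
 assumes "c >= 0" "x \<in> cell k" shows "decay c x <= exp (c * DIM('a)) * decay c k"
proof -
 have "norm k <= norm x + DIM('a)"
  using norm_diff_cell[of x k] assms(2) cell_subset_cbox[of k] norm_triangle_ineq2[of k x]
  by (auto simp: norm_minus_commute)
 then have "c * norm k <= c * (norm x + DIM('a))" using assms(1) by (intro mult_left_mono)
 then show ?thesis by (simp add: exp_add[symmetric] algebra_simps)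
qed

lemma integrable_exp_norm:
 assumes "c > 0"
 shows "integrable lebesgue (%x::'a::euclidean_space. decay c x)"
  "integrable lborel (%x::'a::euclidean_space. decay c x)"
proof -
 let ?b = "%k::'a. exp (c * DIM('a)) * decay c k"
 show "integrable lebesgue (%x::'a::euclidean_space. decay c x)"
 proof (rule integral_le_sum_cells(1)[where b = ?b])
  fix k :: 'a
  have "(\<integral>\<^sup>+x. ennreal (decay c x) * indicator (cell k) x \<partial>lebesgue)
   <= (\<integral>\<^sup>+x. ennreal (?b k) * indicator (cell k) x \<partial>lebesgue)"
   using assms by (intro nn_integral_mono) (auto simp: indicator_def intro!: ennreal_leI dest: exp_norm_cell[of c, rotated])
  also have "... = ennreal (?b k) * emeasure lebesgue (cell k)"
   by (intro nn_integral_cmult_indicator) auto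
  also have "... <= ennreal (?b k)" using emeasure_cell_le[of k] mult_left_mono[of _ 1 "ennreal (?b k)"] by simp
  finally show "(\<integral>\<^sup>+x. ennreal (decay c x) * indicator (cell k) x \<partial>lebesgue) <= ennreal (?b k)" .
 next
  show "?b summable_on int_lattice" by (intro summable_on_cmult_right summable_exp_lattice assms)
  show "(%x::'a. decay c x) \<in> borel_measurable lebesgue"
   by (intro measurable_completion) measurable
 qed auto
 then show "integrable lborel (%x::'a::euclidean_space. decay c x)"
  by (subst (asm) integrable_completion) auto
qed

section \<open>Exponential growth of moderate weights\<close>

text \<open>A vector of norm at most \<open>n + 1\<close> is a sum of \<open>n + 1\<close> vectors
  of norm at most 1, and each of them costs one factor \<open>B\<close>.\<close>

lemma submultiplicative_exp_bound:
 fixes m :: "'a::real_normed_vector => real"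
 assumes sub: "!!x y. m (x + y) <= C * m x * m y" and pos: "!!x. 0 <= m x"
  and bd: "!!x. norm x <= 1 ==> m x <= A"
 shows "\<exists>D k. D > 0 \<and> k > 0 \<and> (\<forall>x. m x <= D * exp (k * norm x))"
proof -
 define B where "B = max 2 (max A 1 * max C 1)"
 have "max A 1 * 1 <= max A 1 * max C 1" by (intro mult_left_mono) auto
 then have B: "B >= 2" "A <= B" unfolding B_def by linarith+
 have CA: "C * A <= B" if "A >= 0"
 proof -
  have "C * A <= max C 1 * max A 1" using that by (intro mult_mono) auto
  then show ?thesis by (simp add: B_def mult.commute)
 qed
 have A0: "A >= 0" using bd[of 0] pos[of 0] by simp
 have step: "m x <= B ^ (n + 1)" if "norm x <= real n + 1" for n x
  using that
 proof (induction n arbitrary: x)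
  case 0 then show ?case using bd[of x] B by simp
 next
  case (Suc n)
  \<comment> \<open>The hypothesis now reads \<open>norm x <= n + 2\<close>, so \<open>y\<close> is
    a piece of norm at most 1 and \<open>x - y\<close> falls under the induction hypothesis.\<close>
  define y where "y = (1 / (real n + 2)) *\<^sub>R x"
  have y: "norm y <= 1" using Suc.prems by (simp add: y_def field_simps)
  have xy: "x - y = ((real n + 1) / (real n + 2)) *\<^sub>R x"
  proof -
   have "x - y = (1 - 1 / (real n + 2)) *\<^sub>R x" by (simp add: y_def scaleR_left_diff_distrib)
   also have "1 - 1 / (real n + 2) = (real n + 1) / (real n + 2)" by (simp add: field_simps)
   finally show ?thesis .
  qed
  have "norm (x - y) <= real n + 1"
  proof -
   have "norm (x - y) = (real n + 1) * (norm x / (real n + 2))" by (simp add: xy)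
   also have "... <= (real n + 1) * 1" using Suc.prems by (intro mult_left_mono) auto
   finally show ?thesis by simp
  qed
  then have 1: "m (x - y) <= B ^ (n + 1)" by (rule Suc.IH)
  have "m x <= C * m (x - y) * m y" using sub[of "x - y" y] by simp
  also have "... <= max C 1 * m (x - y) * max A 1" 
   using pos bd[OF y] by (intro mult_mono) auto
  also have "... = (max A 1 * max C 1) * m (x - y)" by simp
  also have "... <= B * m (x - y)" using pos by (intro mult_right_mono) (auto simp: B_def)
  also have "... <= B * B ^ (n + 1)" using 1 B by (intro mult_left_mono) auto
  finally show ?case by simp
 qed
 have "m x <= B * exp (ln B * norm x) * B" for x
 proof -
  define n where "n = nat \<lfloor>norm x\<rfloor>"
  have n: "real n <= norm x" "norm x <= real n + 1" 
   using of_nat_floor[OF norm_ge_zero[of x]] floor_less_iff[of "norm x" "\<lfloor>norm x\<rfloor> + 1"]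
   unfolding n_def by (auto simp: of_nat_nat le_less)
  have "m x <= B ^ (n + 1)" using step n(2) by blast
  also have "... = exp (ln B * real n) * B" using B by (simp add: exp_of_nat2_mult)
  also have "... <= exp (ln B * norm x) * B" using B n by (intro mult_right_mono) auto
  also have "... <= B * (exp (ln B * norm x) * B)" using B by simp
  finally show ?thesis by (simp add: mult_ac)
 qed
 then show ?thesis using B by (intro exI[of _ "B * B"] exI[of _ "ln B"]) (auto simp: mult_ac)
qed

text \<open>\<open>v\<close> is bounded only almost everywhere on a ball. Each \<open>z\<close> of
  the unit ball splits as \<open>x + (z - x)\<close> with both summands outside the exceptional set,
  because the points \<open>x\<close> that fail form a null set. Submultiplicativity then bounds
  \<open>m\<close> at every such \<open>z\<close>.\<close>

lemma weight_dominated_locally_bounded: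
 fixes m v :: "'a::euclidean_space => real"
 assumes sub: "!!x y. m (x + y) <= C * m x * m y" and pos: "!!x. 0 <= m x" and C: "C >= 0"
  and le: "!!x. m x <= v x" and v: "v \<in> Linf_loc"
 shows "\<exists>A. \<forall>x. norm x <= 1 --> m x <= A"
proof -
 have "\<forall>K. compact K --> (\<exists>C. AE x in lebesgue. x \<in> K --> \<bar>v x\<bar> <= C)"
  using v by (simp add: Linf_loc_def)
 from this[rule_format, OF compact_cball[of "0::'a" 2]]
 obtain K where K: "AE x in lebesgue. x \<in> cball (0::'a) 2 --> \<bar>v x\<bar> <= K" ..
 have "m z <= C * \<bar>K\<bar> * \<bar>K\<bar>" if z: "norm z <= 1" for z
 proof -
  obtain Nu where Nu: "!!x. x \<in> space lebesgue - Nu ==> x \<in> cball (0::'a) 2 --> \<bar>v x\<bar> <= K"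
    "Nu \<in> null_sets lebesgue"
   by (rule AE_E3[OF K]) (rule that)
  have neg: "negligible Nu" using Nu(2) by (simp add: negligible_iff_null_sets)
  \<comment> \<open>The set of all \<open>x\<close> for which \<open>z - x\<close> is exceptional,
    written as an affine image of \<open>Nu\<close>.\<close>
  have "negligible ((%x. z + - 1 *\<^sub>R x) ` Nu)"
   by (rule negligible_differentiable_image_negligible[OF order_refl neg]) (intro derivative_intros)
  then have "negligible (Nu \<union> (%x. z + - 1 *\<^sub>R x) ` Nu)" by (intro negligible_Un neg)
  then have "\<not> ball (0::'a) 1 \<subseteq> Nu \<union> (%x. z + - 1 *\<^sub>R x) ` Nu"
   using negligible_subset[of _ "ball (0::'a) 1"] open_not_negligible[OF open_ball[of "0::'a" 1]]
   by (metis centre_in_ball empty_iff zero_less_one)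
  then obtain x where x: "x \<in> ball 0 1" "x \<notin> Nu" "x \<notin> (%x. z + - 1 *\<^sub>R x) ` Nu" by blast
  have zx: "z - x \<notin> Nu"
  proof
   assume "z - x \<in> Nu"
   then have "z + - 1 *\<^sub>R (z - x) \<in> (%x. z + - 1 *\<^sub>R x) ` Nu" by (rule imageI)
   then show False using x(3) by simp
  qed
  have "norm (z - x) <= 2" using z x(1) norm_triangle_ineq4[of z x] by simp
  then have 1: "\<bar>v (z - x)\<bar> <= K" "\<bar>v x\<bar> <= K" using Nu(1)[of "z - x"] Nu(1)[of x] zx x by auto
  have "m z <= C * m x * m (z - x)" using sub[of x "z - x"] by simp
  also have "... <= C * \<bar>K\<bar> * \<bar>K\<bar>" 
   using 1 le[of x] le[of "z - x"] C pos by (intro mult_mono mult_nonneg_nonneg) auto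
  finally show ?thesis .
 qed
 then show ?thesis by blast
qed

text \<open>The given moderating weight need not be submultiplicative. The smallest possible one,
  \<open>m y = (SUP x. u (x + y) / u x)\<close>, is so with constant 1 and lies below a multiple of
  \<open>v\<close>; being locally bounded, it grows at most exponentially.\<close>

lemma P_E_exp_moderate:
 fixes u :: "'a::euclidean_space => real"
 assumes "u \<in> P_E"
 shows "\<exists>C k. C > 0 \<and> k > 0 \<and> (\<forall>x y. u (x + y) <= C * exp (k * norm y) * u x)"
proof -
 obtain v C where v: "weight v" "C > 0" "!!x y. u (x + y) <= C * u x * v y" and w: "weight u"
  using assms unfolding P_E_def moderate_def by auto
 have up: "u x > 0" for x using w by (simp add: weight_def)
 have vp: "v x > 0" for x using v by (simp add: weight_def)
 define m where "m y = (SUP x. u (x + y) / u x)" for y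
 have bdd: "bdd_above (range (%x. u (x + y) / u x))" for y
  using v(3)[of _ y] up by (intro bdd_aboveI[of _ "C * v y"]) (auto simp: field_simps)
 have um: "u (x + y) / u x <= m y" for x y
  unfolding m_def by (rule cSUP_upper[OF _ bdd]) simp
 have mp: "0 <= m y" for y using um[of 0 y] up[of 0] up[of y] by (auto intro: order_trans[rotated])
 have mv: "m y <= C * v y" for y
  unfolding m_def by (rule cSUP_least) (use v(3)[of _ y] up in \<open>auto simp: field_simps\<close>)
 have sub: "m (y + z) <= 1 * m y * m z" for y z
  unfolding m_def[of "y + z"]
 proof (rule cSUP_least, simp)
  fix x
  have "u (x + (y + z)) / u x = (u ((x + y) + z) / u (x + y)) * (u (x + y) / u x)"
   using up[of "x + y"] by (simp add: add.assoc)
  also have "... <= m z * m y" using up less_imp_le[OF up] by (intro mult_mono um mp) auto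
  finally show "u (x + (y + z)) / u x <= 1 * m y * m z" by (simp add: mult.commute)
 qed
 have "(%x. C * v x) \<in> Linf_loc"
  unfolding Linf_loc_def
 proof (safe)
  have "v \<in> Linf_loc" using v(1) by (simp add: weight_def)
  then have vm: "v \<in> borel_measurable lebesgue" and vb: "!!K. compact K ==> \<exists>M. AE x in lebesgue. x \<in> K --> \<bar>v x\<bar> <= M"
   by (auto simp: Linf_loc_def)
  show "(%x. C * v x) \<in> borel_measurable lebesgue" using vm by simp
  fix K :: "'a set" assume "compact K"
  then obtain M where "AE x in lebesgue. x \<in> K --> \<bar>v x\<bar> <= M" using vb by blast
  then have "AE x in lebesgue. x \<in> K --> \<bar>C * v x\<bar> <= C * M"
   by eventually_elim (use v(2) in \<open>auto simp: abs_mult\<close>)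
  then show "\<exists>M. AE x in lebesgue. x \<in> K --> \<bar>C * v x\<bar> <= M" by blast
 qed
 then obtain A where "\<forall>x. norm x <= 1 --> m x <= A"
  using weight_dominated_locally_bounded[of m 1 "%x. C * v x"] sub mp mv by auto
 then obtain D k where Dk: "D > 0" "k > 0" "!!x. m x <= D * exp (k * norm x)"
  using submultiplicative_exp_bound[of m 1 A] sub mp by blast
 have "u (x + y) <= D * exp (k * norm y) * u x" for x y
  using um[of x y] Dk(3)[of y] up[of x] by (auto simp: pos_divide_le_eq intro: order_trans mult_right_mono)
 then show ?thesis using Dk by blast
qed

section \<open>Smooth functions and iterated partial derivatives\<close>

abbreviation derivs :: "'a::euclidean_space list => ('a => complex) => 'a => complex" where
 "derivs bs f \<equiv> foldr pd bs f"

lemma partial_deriv_eqI: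
 assumes "!!x. (f has_derivative f' x) (at x)"
 shows "pd b f = (%x. f' x b)"
proof
 show "pd b f x = f' x b" for x
  unfolding partial_deriv_def frechet_derivative_at[OF assms[of x], symmetric] ..
qed

lemma smooth_derivs: "smooth f ==> bs \<in> lists Basis ==> smooth (derivs bs f)"
 unfolding smooth_def
proof
 fix cs :: "'a list"
 assume f: "\<forall>bs\<in>lists Basis. derivs bs f differentiable_on UNIV" and bs: "bs \<in> lists Basis" and cs: "cs \<in> lists Basis"
 have "derivs (cs @ bs) f differentiable_on UNIV" using f bs cs by (intro f[rule_format]) auto
 then show "derivs cs (derivs bs f) differentiable_on UNIV" by simp
qed

lemma smooth_partial_deriv: "smooth f ==> b \<in> Basis ==> smooth (pd b f)"
 using smooth_derivs[of f "[b]"] by simp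

lemma smooth_differentiable: "smooth f ==> f differentiable (at x)"
 unfolding smooth_def by (drule bspec[of _ _ "[]"]) (simp_all add: differentiable_on_def)

text \<open>Smoothness of the result of an operation is shown for the whole class of such results at
  once, once this class is closed under partial derivatives.\<close>

lemma smooth_coinduct:
 assumes "f \<in> S" and "!!f x. f \<in> S ==> f differentiable (at x)"
  and "!!f b. f \<in> S ==> b \<in> Basis ==> pd b f \<in> S"
 shows "smooth f"
proof -
 have "derivs bs f \<in> S" if "bs \<in> lists Basis" for bs
  using that by (induction bs) (auto intro: assms)
 then show ?thesis unfolding smooth_def differentiable_on_def
  using assms(2) by (auto intro: differentiable_at_withinI)
qed

lemma smooth_has_derivative:
 assumes "smooth f"
 shows "(f has_derivative (%h. \<Sum>b\<in>Basis. (h \<bullet> b) *\<^sub>R pd b f x)) (at x)"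
proof -
 have d: "(f has_derivative frechet_derivative f (at x)) (at x)"
  using smooth_differentiable[OF assms] by (simp add: frechet_derivative_works)
 then interpret bounded_linear "frechet_derivative f (at x)" by (rule has_derivative_bounded_linear)
 have "frechet_derivative f (at x) h = (\<Sum>b\<in>Basis. (h \<bullet> b) *\<^sub>R pd b f x)" for h
 proof -
  have "frechet_derivative f (at x) h = frechet_derivative f (at x) (\<Sum>b\<in>Basis. (h \<bullet> b) *\<^sub>R b)"
   by (simp add: euclidean_representation)
  also have "... = (\<Sum>b\<in>Basis. (h \<bullet> b) *\<^sub>R pd b f x)"
   by (simp add: sum scaleR partial_deriv_def)
  finally show ?thesis .
 qed
 then have "frechet_derivative f (at x) = (%h. \<Sum>b\<in>Basis. (h \<bullet> b) *\<^sub>R pd b f x)" by (rule ext)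
 with d show ?thesis by simp
qed

lemma smooth_continuous: "smooth f ==> continuous_on UNIV f"
 by (intro continuous_at_imp_continuous_on ballI differentiable_imp_continuous_within smooth_differentiable)

lemma smooth_borel: "smooth f ==> f \<in> borel_measurable borel"
 by (intro borel_measurable_continuous_onI smooth_continuous)

lemma smooth_line:
 assumes "smooth f" "b \<in> Basis"
 shows "((%s. f (x + s *\<^sub>R b)) has_vector_derivative pd b f (x + s *\<^sub>R b)) (at s)"
proof -
 have "((%s. f (x + s *\<^sub>R b)) has_derivative (%t. \<Sum>c\<in>Basis. ((t *\<^sub>R b) \<bullet> c) *\<^sub>R pd c f (x + s *\<^sub>R b))) (at s)"
  by (rule has_derivative_compose[OF _ smooth_has_derivative[OF assms(1)]]) (auto intro!: derivative_eq_intros)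
 moreover have "(\<Sum>c\<in>Basis. ((t *\<^sub>R b) \<bullet> c) *\<^sub>R pd c f (x + s *\<^sub>R b)) = t *\<^sub>R pd b f (x + s *\<^sub>R b)" for t
 proof -
  have "(\<Sum>c\<in>Basis. ((t *\<^sub>R b) \<bullet> c) *\<^sub>R pd c f (x + s *\<^sub>R b))
   = (\<Sum>c\<in>Basis. if c = b then t *\<^sub>R pd b f (x + s *\<^sub>R b) else 0)"
   using assms(2) by (intro sum.cong) (auto simp: inner_Basis)
  then show ?thesis using assms(2) by simp
 qed
 ultimately show ?thesis by (simp add: has_vector_derivative_def)
qed

section \<open>Symmetry of second derivatives\<close>

text \<open>Two uses of the mean value theorem: for the increment in direction \<open>b\<close> as a
  function along \<open>a\<close>, and then along \<open>b\<close>.\<close>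

lemma mixed_difference_mean_value:
 fixes u :: "'a::real_normed_vector => real"
 assumes ua: "!!x s. ((%s. u (x + s *\<^sub>R a)) has_real_derivative ua (x + s *\<^sub>R a)) (at s)"
  and uab: "!!x s. ((%s. ua (x + s *\<^sub>R b)) has_real_derivative uab (x + s *\<^sub>R b)) (at s)"
  and h: "h > 0"
 shows "\<exists>y. norm (y - x) <= h * (norm a + norm b) \<and>
  u (x + h *\<^sub>R a + h *\<^sub>R b) - u (x + h *\<^sub>R a) - u (x + h *\<^sub>R b) + u x = h\<^sup>2 * uab y"
proof -
 define g where "g s = u ((x + h *\<^sub>R b) + s *\<^sub>R a) - u (x + s *\<^sub>R a)" for s
 have "\<exists>z. 0 < z \<and> z < h \<and> g h - g 0 = (h - 0) * (ua ((x + h *\<^sub>R b) + z *\<^sub>R a) - ua (x + z *\<^sub>R a))"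
  unfolding g_def by (rule MVT2[OF h]) (intro DERIV_diff ua)
 then obtain z where z: "0 < z" "z < h" "g h - g 0 = h * (ua ((x + z *\<^sub>R a) + h *\<^sub>R b) - ua (x + z *\<^sub>R a))"
  by (auto simp: algebra_simps)
 have "\<exists>w. 0 < w \<and> w < h \<and> ua ((x + z *\<^sub>R a) + h *\<^sub>R b) - ua ((x + z *\<^sub>R a) + 0 *\<^sub>R b) = (h - 0) * uab ((x + z *\<^sub>R a) + w *\<^sub>R b)"
  by (rule MVT2[OF h]) (rule uab)
 then obtain w where w: "0 < w" "w < h" "ua ((x + z *\<^sub>R a) + h *\<^sub>R b) - ua (x + z *\<^sub>R a) = h * uab ((x + z *\<^sub>R a) + w *\<^sub>R b)"
  by auto
 have "norm (z *\<^sub>R a + w *\<^sub>R b) <= z * norm a + w * norm b"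
  using z w by (intro norm_triangle_le) simp
 also have "... <= h * norm a + h * norm b" using z w by (intro add_mono mult_right_mono) auto
 finally have "norm (((x + z *\<^sub>R a) + w *\<^sub>R b) - x) <= h * (norm a + norm b)" by (simp add: algebra_simps)
 moreover have "g h - g 0 = h\<^sup>2 * uab ((x + z *\<^sub>R a) + w *\<^sub>R b)"
  using z(3) w(3) by (simp add: power2_eq_square)
 moreover have "g h - g 0 = u (x + h *\<^sub>R a + h *\<^sub>R b) - u (x + h *\<^sub>R a) - u (x + h *\<^sub>R b) + u x"
  by (simp add: g_def algebra_simps)
 ultimately show ?thesis by (metis)
qed

text \<open>The second difference does not depend on the order of the directions, so at every small
  scale some value of \<open>uab\<close> near \<open>x\<close> equals some value of
  \<open>uba\<close> near \<open>x\<close>; continuity concludes.\<close>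

lemma mixed_derivatives_eq:
 fixes u :: "'a::real_normed_vector => real"
 assumes ua: "!!x s. ((%s. u (x + s *\<^sub>R a)) has_real_derivative ua (x + s *\<^sub>R a)) (at s)"
  and uab: "!!x s. ((%s. ua (x + s *\<^sub>R b)) has_real_derivative uab (x + s *\<^sub>R b)) (at s)"
  and ub: "!!x s. ((%s. u (x + s *\<^sub>R b)) has_real_derivative ub (x + s *\<^sub>R b)) (at s)"
  and uba: "!!x s. ((%s. ub (x + s *\<^sub>R a)) has_real_derivative uba (x + s *\<^sub>R a)) (at s)"
  and c1: "isCont uab x" and c2: "isCont uba x"
 shows "uab x = uba x"
proof (rule ccontr)
 assume ne: "uab x \<noteq> uba x"
 define e where "e = dist (uab x) (uba x) / 2"
 have e: "e > 0" using ne by (simp add: e_def)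
 obtain d1 where d1: "d1 > 0" "!!y. dist y x < d1 ==> dist (uab y) (uab x) < e"
  using c1 e unfolding continuous_at_eps_delta by blast
 obtain d2 where d2: "d2 > 0" "!!y. dist y x < d2 ==> dist (uba y) (uba x) < e"
  using c2 e unfolding continuous_at_eps_delta by blast
 \<comment> \<open>Both intermediate points lie within \<open>h * (norm a + norm b)\<close> of
   \<open>x\<close>; the added 1 avoids division by zero and makes this distance strictly smaller
   than \<open>d1\<close> and \<open>d2\<close>.\<close>
 define h where "h = min d1 d2 / (norm a + norm b + 1)"
 have nn: "norm a + norm b + 1 > 0" by (simp add: add_nonneg_pos)
 have h: "h > 0" using d1 d2 nn by (simp add: h_def)
 have hle: "h * (norm a + norm b) < min d1 d2"
 proof -
  have "h * (norm a + norm b) < h * (norm a + norm b + 1)" using h by simp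
  also have "... = min d1 d2" using nn unfolding h_def by (simp del: min_less_iff_conj)
  finally show ?thesis .
 qed
 obtain y where y: "norm (y - x) <= h * (norm a + norm b)"
  "u (x + h *\<^sub>R a + h *\<^sub>R b) - u (x + h *\<^sub>R a) - u (x + h *\<^sub>R b) + u x = h\<^sup>2 * uab y"
  using mixed_difference_mean_value[OF ua uab h] by blast
 obtain z where z: "norm (z - x) <= h * (norm b + norm a)"
  "u (x + h *\<^sub>R b + h *\<^sub>R a) - u (x + h *\<^sub>R b) - u (x + h *\<^sub>R a) + u x = h\<^sup>2 * uba z"
  using mixed_difference_mean_value[OF ub uba h] by blast
 have "h\<^sup>2 * uab y = h\<^sup>2 * uba z" using y(2) z(2) by (simp add: algebra_simps)
 then have eq: "uab y = uba z" using h by simp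
 have "dist (uab x) (uba x) <= dist (uab y) (uab x) + dist (uba z) (uba x)"
  unfolding eq by (rule dist_triangle3)
 also have "... < e + e" using y z hle by (intro add_strict_mono d1 d2) (auto simp: dist_norm add.commute)
 finally show False by (simp add: e_def)
qed

text \<open>The mean value theorem is real, hence the separate treatment of real and imaginary
  parts.\<close>

lemma partial_deriv_commute:
 assumes f: "smooth f" and a: "a \<in> Basis" and b: "b \<in> Basis"
 shows "pd a (pd b f) = pd b (pd a f)"
proof
 fix x
 have sm: "smooth (pd a f)" "smooth (pd b f)" 
  using smooth_partial_deriv f a b by auto
 have sm2: "smooth (pd b (pd a f))" "smooth (pd a (pd b f))"
  using smooth_partial_deriv sm a b by auto
 have dRe: "((%s. Re (g (x + s *\<^sub>R c))) has_real_derivative Re (pd c g (x + s *\<^sub>R c))) (at s)"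
  and dIm: "((%s. Im (g (x + s *\<^sub>R c))) has_real_derivative Im (pd c g (x + s *\<^sub>R c))) (at s)"
  if "smooth g" "c \<in> Basis" for g :: "'a => complex" and c x s
  using bounded_linear.has_vector_derivative[OF bounded_linear_Re smooth_line[OF that]]
   bounded_linear.has_vector_derivative[OF bounded_linear_Im smooth_line[OF that]]
  by (auto simp: has_real_derivative_iff_has_vector_derivative)
 have cont: "isCont g x" if "smooth g" for g :: "'a => complex"
  using smooth_continuous[OF that] by (simp add: continuous_on_eq_continuous_at)
 have "Re (pd b (pd a f) x) = Re (pd a (pd b f) x)"
  by (rule mixed_derivatives_eq[where u="%x. Re (f x)" and ua = "%x. Re (pd a f x)" and ub = "%x. Re (pd b f x)" and a=a and b=b])
   (intro dRe f a b sm isCont_Re cont sm2)+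
 moreover have "Im (pd b (pd a f) x) = Im (pd a (pd b f) x)"
  by (rule mixed_derivatives_eq[where u="%x. Im (f x)" and ua = "%x. Im (pd a f x)" and ub = "%x. Im (pd b f x)" and a=a and b=b])
   (intro dIm f a b sm isCont_Im cont sm2)+
 ultimately show "pd a (pd b f) x = pd b (pd a f) x"
  by (simp add: complex_eq_iff)
qed

lemma derivs_partial_deriv:
 assumes "smooth f" "bs \<in> lists Basis" "b \<in> Basis"
 shows "derivs bs (pd b f) = pd b (derivs bs f)"
 using assms(2)
proof (induction bs)
 case (Cons c cs)
 then have c: "c \<in> Basis" and cs: "cs \<in> lists Basis" by auto
 have "derivs (c # cs) (pd b f) = pd c (pd b (derivs cs f))"
  using Cons.IH by simp
 also have "... = pd b (derivs (c # cs) f)"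
  using partial_deriv_commute[OF smooth_derivs[OF assms(1) cs] c assms(3)] by simp
 finally show ?case .
qed simp

text \<open>Iterated derivatives depend only on the multiset of directions. This links lists, which
  suit inductions, with the multi-indices of \<open>GS_quotients\<close>.\<close>

lemma derivs_mset_eq:
 assumes "smooth f" "bs \<in> lists Basis" "cs \<in> lists Basis" "mset bs = mset cs"
 shows "derivs bs f = derivs cs f"
 using assms(2-)
proof (induction bs arbitrary: cs)
 case (Cons b bs)
 then have "b \<in> set cs" by (metis list.set_intros(1) mset_eq_setD)
 then obtain c1 c2 where cs: "cs = c1 @ b # c2" by (auto simp: in_set_conv_decomp)
 have "c1 @ b # c2 \<in> lists Basis" "bs \<in> lists Basis" using Cons.prems Cons.hyps unfolding cs by blast+
 then have l: "b \<in> Basis" "c1 \<in> lists Basis" "c2 \<in> lists Basis" and l2: "bs \<in> lists Basis" by auto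
 have ms: "mset (b # bs) = mset cs" using Cons.prems by blast
 have "derivs cs f = derivs c1 (pd b (derivs c2 f))" by (simp add: cs)
 also have "... = pd b (derivs (c1 @ c2) f)"
  using derivs_partial_deriv[OF smooth_derivs[OF assms(1) l(3)] l(2,1)] by simp
 also have "derivs (c1 @ c2) f = derivs bs f"
  using Cons.IH[of "c1 @ c2"] l l2 ms by (simp add: cs)
 finally show ?case by simp
qed simp

lemma basis_enum: "distinct (basis_enum :: 'a::euclidean_space list)" "set (basis_enum :: 'a list) = Basis"
proof -
 have "\<exists>bs. distinct bs \<and> set bs = (Basis::'a set)" using finite_distinct_list[OF finite_Basis] by blast
 then have "distinct (basis_enum :: 'a list) \<and> set (basis_enum :: 'a list) = Basis"
  unfolding basis_enum_def by (rule someI_ex)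
 then show "distinct (basis_enum :: 'a list)" "set (basis_enum :: 'a list) = Basis" by auto
qed

text \<open>The directions in which \<open>multi_deriv\<close> differentiates, in its order, so that
  \<open>multi_deriv\<close> becomes an instance of \<open>derivs\<close>.\<close>

definition index_list :: "('a::euclidean_space => nat) => 'a list" where
 "index_list beta = concat (map (%b. replicate (beta b) b) basis_enum)"

lemma index_list_in: "index_list beta \<in> lists Basis"
 by (auto simp: index_list_def basis_enum(2))

lemma derivs_replicate: "derivs (replicate n b) f = (pd b ^^ n) f"
 by (induction n) auto

lemma multi_deriv_eq_derivs: "multi_deriv beta f = derivs (index_list beta) f"
proof -
 have "foldr (%b. pd b ^^ beta b) es f = derivs (concat (map (%b. replicate (beta b) b) es)) f" for es
  by (induction es) (auto simp: derivs_replicate)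
 then show ?thesis by (simp add: multi_deriv_def index_list_def)
qed

lemma count_index_list:
 assumes "b \<in> Basis" shows "count (mset (index_list beta)) b = beta b"
proof -
 have "count (mset (concat (map (%b. replicate (beta b) b) es))) b = (if b \<in> set es then beta b else 0)" if "distinct es" for es
  using that by (induction es) auto
 from this[OF basis_enum(1)] show ?thesis using assms by (simp add: index_list_def basis_enum(2))
qed

lemma length_index_list: "length (index_list beta) = multi_abs beta"
proof -
 have "length (concat (map (%b. replicate (beta b) b) es)) = (\<Sum>b\<in>set es. beta b)" if "distinct es" for es
  using that by (induction es) auto
 from this[OF basis_enum(1)] show ?thesis by (simp add: index_list_def multi_abs_def basis_enum(2))
qed

lemma derivs_eq_multi_deriv:
 assumes "smooth f" "bs \<in> lists Basis"
 shows "derivs bs f = multi_deriv (%b. count (mset bs) b) f"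
 unfolding multi_deriv_eq_derivs
proof (rule derivs_mset_eq[OF assms index_list_in], rule multiset_eqI)
 fix b
 show "count (mset bs) b = count (mset (index_list (count (mset bs)))) b"
 proof (cases "b \<in> Basis")
  case False
  have "b \<notin> set bs" "b \<notin> set (index_list (count (mset bs)))"
   using False assms(2) index_list_in[of "count (mset bs)"] by (auto simp: in_lists_conv_set)
  then show ?thesis by (metis not_in_iff set_mset_mset)
 qed (simp add: count_index_list)
qed

lemma multi_abs_count:
 assumes "bs \<in> lists Basis" shows "multi_abs (%b. count (mset bs) b) = length bs"
proof -
 have "sum (count_list bs) Basis = length bs" using assms by (intro sum_count_set) auto
 then show ?thesis by (simp only: multi_abs_def count_mset)
qed

lemma prod_fact_le_fact_sum:
 "finite A ==> (\<Prod>b\<in>A. fact (beta b :: nat)) <= (fact (\<Sum>b\<in>A. beta b) :: real)"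
proof (induction rule: finite_induct)
 case (insert x F)
 have "(fact (beta x) * fact (sum beta F) :: nat) <= fact (beta x + sum beta F)"
  by (intro dvd_imp_le fact_fact_dvd_fact) auto
 then have "(fact (beta x) * fact (sum beta F) :: real) <= fact (beta x + sum beta F)"
  by (metis of_nat_fact of_nat_le_iff of_nat_mult)
 moreover have "fact (beta x) * (\<Prod>b\<in>F. fact (beta b)) <= (fact (beta x) * fact (sum beta F) :: real)"
  using insert.IH by (intro mult_left_mono) auto
 ultimately have "fact (beta x) * (\<Prod>b\<in>F. fact (beta b)) <= (fact (beta x + sum beta F) :: real)" by linarith
 then show ?case using insert.hyps by simp
qed simp

text \<open>Together with \<open>prod_fact_le_fact_sum\<close> this makes the factorial of a
  multi-index and the factorial of its order interchangeable up to a geometric factor, which a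
  change of \<open>h\<close> absorbs. In the induction, one term of the binomial expansion of
  \<open>(c + 1) ^ (n + m)\<close> controls the binomial coefficient.\<close>

lemma fact_sum_le_prod_fact:
 "finite A ==> (fact (\<Sum>b\<in>A. beta b) :: real) <= real (card A) ^ (\<Sum>b\<in>A. beta b) * (\<Prod>b\<in>A. fact (beta b :: nat))"
proof (induction rule: finite_induct)
 case (insert x F)
 define m where "m = sum beta F"
 define n where "n = beta x"
 define c where "c = real (card F)"
 have "real ((n + m) choose m) * c ^ m * 1 ^ (n + m - m) <= (\<Sum>k\<le>n + m. real ((n + m) choose k) * c ^ k * 1 ^ (n + m - k))"
  by (rule member_le_sum) (auto simp: c_def)
 also have "... = (c + 1) ^ (n + m)" by (rule binomial_ring[symmetric])
 finally have bin: "real ((n + m) choose m) * c ^ m <= (c + 1) ^ (n + m)" by simp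
 have "(fact (n + m) :: real) = real ((n + m) choose m) * (fact n * fact m)"
  using binomial_fact[of m "n + m", where ?'a = real] by (simp add: field_simps)
 also have "... <= real ((n + m) choose m) * (fact n * (c ^ m * (\<Prod>b\<in>F. fact (beta b))))"
  using insert.IH by (intro mult_left_mono) (auto simp: c_def m_def)
 also have "... = (real ((n + m) choose m) * c ^ m) * (fact n * (\<Prod>b\<in>F. fact (beta b)))" by simp
 also have "... <= (c + 1) ^ (n + m) * (fact n * (\<Prod>b\<in>F. fact (beta b)))"
  by (intro mult_right_mono bin mult_nonneg_nonneg prod_nonneg) auto
 finally show ?case using insert.hyps by (simp add: n_def m_def c_def add_ac)
qed simp

text \<open>Decay in the norm can thus be read off from powers of one coordinate, chosen depending
  on the point.\<close>

lemma norm_le_coordinate: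
 fixes x :: "'a::euclidean_space"
 obtains b where "b \<in> Basis" "norm x <= DIM('a) * \<bar>x \<bullet> b\<bar>"
proof -
 have "Max ((%c. \<bar>x \<bullet> c\<bar>) ` Basis) \<in> (%c. \<bar>x \<bullet> c\<bar>) ` Basis" by (rule Max_in) auto
 then obtain b where b: "b \<in> Basis" "Max ((%c. \<bar>x \<bullet> c\<bar>) ` Basis) = \<bar>x \<bullet> b\<bar>" by blast
 have b2: "\<bar>x \<bullet> c\<bar> <= \<bar>x \<bullet> b\<bar>" if "c \<in> Basis" for c
  unfolding b(2)[symmetric] using that by (intro Max_ge) auto
 have "norm x <= (\<Sum>c\<in>Basis. \<bar>x \<bullet> c\<bar>)" by (rule norm_le_l1)
 also have "... <= (\<Sum>c\<in>(Basis::'a set). \<bar>x \<bullet> b\<bar>)" using b2 by (intro sum_mono) auto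
 finally show ?thesis using b(1) that by simp
qed

text \<open>Multiply the exponential series by \<open>y\<close> and insert the bounds termwise. Half
  of the rate \<open>a / h\<close> leaves a geometric series of ratio 1/2, whose sum is the factor
  2.\<close>

lemma exp_le_of_power_bounds:
 fixes a :: real
 assumes h: "h > 0" and a: "a >= 0" and A: "!!n. a ^ n * y <= A * h ^ n * fact n"
 shows "exp (a / (2 * h)) * y <= 2 * A"
proof -
 have "(%n. (a / (2 * h)) ^ n /\<^sub>R fact n * y) sums (exp (a / (2 * h)) * y)"
  by (intro sums_mult2 exp_converges)
 moreover have "(%n. (1/2) ^ n * A) sums (2 * A)"
  using sums_mult2[OF geometric_sums[of "1/2::real"], of A] by simp
 ultimately show ?thesis
 proof (rule sums_le[rotated])
  fix n
  have "(a / (2 * h)) ^ n /\<^sub>R fact n * y = (a ^ n * y) / (2 ^ n * h ^ n * fact n)"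
   by (simp add: field_simps power_mult_distrib power_divide)
  also have "... <= (A * h ^ n * fact n) / (2 ^ n * h ^ n * fact n)"
   using A[of n] h by (intro divide_right_mono) auto
  also have "... = (1/2) ^ n * A" using h by (simp add: field_simps power_divide)
  finally show "(a / (2 * h)) ^ n /\<^sub>R fact n * y <= (1/2) ^ n * A" .
 qed
qed

text \<open>A single term of the exponential series is at most its sum.\<close>

lemma power_le_fact_exp:
 fixes a h :: real assumes "h > 0" "a >= 0" shows "a ^ n <= fact n * h ^ n * exp (a / h)"
proof -
 have "(%n. (a / h) ^ n /\<^sub>R fact n) sums exp (a / h)" by (rule exp_converges)
 then have "(\<Sum>k\<in>{n}. (a / h) ^ k /\<^sub>R fact k) <= exp (a / h)"
  using assms by (intro sum_le_suminf[of "%n. (a / h) ^ n /\<^sub>R fact n", THEN order_trans]) (auto simp: sums_iff)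
 then show ?thesis using assms by (simp add: field_simps power_divide)
qed

section \<open>Exponential bounds characterizing the Gelfand--Shilov space\<close>

lemma Sigma1_smooth: "f \<in> Sigma1 ==> smooth f"
 by (simp add: Sigma1_def)

lemma Sigma1_multi_bound:
 fixes f :: "'a::euclidean_space => complex"
 assumes f: "f \<in> Sigma1" and h: "h > 0"
 shows "\<exists>C\<ge>0. \<forall>alpha beta x. \<bar>multi_pow x alpha\<bar> * norm (multi_deriv beta f x)
  <= C * (h ^ (multi_abs alpha + multi_abs beta) * multi_fact alpha * multi_fact beta)"
proof -
 obtain C where C: "!!y. y \<in> GS_quotients h f ==> y <= C"
  using f h unfolding Sigma1_def bdd_above_def by blast
 have pos: "h ^ (multi_abs alpha + multi_abs beta) * multi_fact alpha * multi_fact beta > 0" for alpha beta :: "'a => nat"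
  using h by (auto simp: multi_fact_def intro!: mult_pos_pos prod_pos)
 have "\<bar>multi_pow x alpha\<bar> * norm (multi_deriv beta f x) <= max C 0 * (h ^ (multi_abs alpha + multi_abs beta) * multi_fact alpha * multi_fact beta)"
  for alpha beta x
 proof -
  have "\<bar>multi_pow x alpha\<bar> * norm (multi_deriv beta f x) / (h ^ (multi_abs alpha + multi_abs beta) * multi_fact alpha * multi_fact beta) <= C"
   by (rule C) (auto simp: GS_quotients_def)
  then have "\<bar>multi_pow x alpha\<bar> * norm (multi_deriv beta f x) <= C * (h ^ (multi_abs alpha + multi_abs beta) * multi_fact alpha * multi_fact beta)"
   using pos[of alpha beta] by (simp add: pos_divide_le_eq)
  also have "... <= max C 0 * (h ^ (multi_abs alpha + multi_abs beta) * multi_fact alpha * multi_fact beta)"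
   using pos[of alpha beta] by (intro mult_right_mono) auto
  finally show ?thesis .
 qed
 then show ?thesis by (intro exI[of _ "max C 0"]) auto
qed

text \<open>The bounds for all powers of a dominant coordinate add up to an exponential bound. As
  \<open>h0\<close> may be taken small in dependence on \<open>k\<close>, every rate of decay is
  reached.\<close>

lemma Sigma1_derivs_bound:
 fixes f :: "'a::euclidean_space => complex"
 assumes f: "f \<in> Sigma1" and h: "h > 0" and k: "k > 0"
 shows "\<exists>C\<ge>0. \<forall>bs\<in>lists Basis. \<forall>x. norm (derivs bs f x) <= C * h ^ length bs * fact (length bs) * decay k x"
proof -
 define D where "D = real DIM('a)"
 have D: "D > 0" by (simp add: D_def)
 \<comment> \<open>The condition \<open>2 * h0 * (D * k) <= 1\<close> makes the exponent
   \<open>\<bar>x \<bullet> b\<bar> / (2 * h0)\<close> at least \<open>k * norm x\<close> for a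
   dominant coordinate \<open>b\<close>.\<close>
 define h0 where "h0 = min h (1 / (2 * D * k))"
 have h0: "h0 > 0" "h0 <= h" "2 * h0 * (D * k) <= 1"
  using h k D by (auto simp: h0_def field_simps min_def)
 obtain C where C: "C >= 0" "!!alpha beta x. \<bar>multi_pow x alpha\<bar> * norm (multi_deriv beta f x)
  <= C * (h0 ^ (multi_abs alpha + multi_abs beta) * multi_fact alpha * multi_fact beta)"
  using Sigma1_multi_bound[OF f h0(1)] by blast
 show ?thesis
 proof (intro exI[of _ "2 * C"] conjI ballI allI)
  fix bs :: "'a list" and x :: 'a assume bs: "bs \<in> lists Basis"
  define beta where "beta = (%b. count (mset bs) b)"
  define y where "y = norm (derivs bs f x)"
  have y: "y = norm (multi_deriv beta f x)"
   unfolding y_def beta_def using derivs_eq_multi_deriv[OF Sigma1_smooth[OF f] bs] by simp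
  obtain b where b: "b \<in> Basis" "norm x <= D * \<bar>x \<bullet> b\<bar>" using norm_le_coordinate[of x] by (auto simp: D_def)
  have "exp (\<bar>x \<bullet> b\<bar> / (2 * h0)) * y <= 2 * (C * h0 ^ length bs * fact (length bs))"
  proof (rule exp_le_of_power_bounds[OF h0(1)])
   fix n :: nat
   \<comment> \<open>The multi-index that tests the coordinate \<open>b\<close> alone.\<close>
   define alpha where "alpha = (%c::'a. if c = b then n else 0)"
   have "(\<Prod>c\<in>Basis. (x \<bullet> c) ^ alpha c) = (\<Prod>c\<in>Basis. if c = b then (x \<bullet> b) ^ n else 1)"
    "(\<Prod>c\<in>Basis. fact (alpha c)) = (\<Prod>c\<in>Basis. if c = b then fact n else (1::real))"
    by ((rule prod.cong, rule refl, simp add: alpha_def)+)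
   then have 1: "multi_pow x alpha = (x \<bullet> b) ^ n" "multi_fact alpha = fact n" "multi_abs alpha = n"
    using b(1) by (simp_all add: multi_pow_def multi_fact_def multi_abs_def) (simp add: alpha_def)
   have 2: "multi_fact beta <= fact (length bs)"
    using prod_fact_le_fact_sum[OF finite_Basis, of beta] multi_abs_count[OF bs]
    by (simp add: multi_fact_def multi_abs_def beta_def)
   have "\<bar>x \<bullet> b\<bar> ^ n * y <= C * (h0 ^ (n + length bs) * fact n * multi_fact beta)"
    using C(2)[of x alpha beta] multi_abs_count[OF bs] by (simp add: 1 y power_abs beta_def)
   also have "... <= C * (h0 ^ (n + length bs) * fact n * fact (length bs))"
    using C(1) h0 2 by (intro mult_left_mono) auto
   finally show "\<bar>x \<bullet> b\<bar> ^ n * y <= (C * h0 ^ length bs * fact (length bs)) * h0 ^ n * fact n"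
    by (simp add: power_add mult_ac)
  qed simp
  also have "... <= 2 * (C * h ^ length bs * fact (length bs))"
   using C(1) h0 by (intro mult_left_mono mult_right_mono power_mono) auto
  finally have 3: "exp (\<bar>x \<bullet> b\<bar> / (2 * h0)) * y <= 2 * (C * h ^ length bs * fact (length bs))" .
  have "k * norm x <= k * (D * \<bar>x \<bullet> b\<bar>)" using b(2) k by (intro mult_left_mono) auto
  also have "... <= \<bar>x \<bullet> b\<bar> / (2 * h0)"
   using h0 mult_right_mono[OF h0(3), of "\<bar>x \<bullet> b\<bar>"] by (simp add: field_simps)
  finally have "exp (k * norm x) * y <= exp (\<bar>x \<bullet> b\<bar> / (2 * h0)) * y"
   by (intro mult_right_mono) (auto simp: y_def)
  with 3 have "exp (k * norm x) * y <= 2 * (C * h ^ length bs * fact (length bs))" by simp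
  then have "y <= 2 * (C * h ^ length bs * fact (length bs)) / exp (k * norm x)"
   by (simp add: pos_le_divide_eq mult.commute)
  then show "norm (derivs bs f x) <= 2 * C * h ^ length bs * fact (length bs) * decay k x"
   by (simp add: y_def exp_minus field_simps)
 qed (use C in simp)
qed

text \<open>Conversely, the power of each coordinate is bounded by an exponential in that
  coordinate, and exponential decay of a suitable rate outweighs their product.\<close>

lemma Sigma1I_multi:
 fixes f :: "'a::euclidean_space => complex"
 assumes sm: "smooth f"
  and bd: "!!h k. h > 0 ==> k > 0 ==> \<exists>C. \<forall>beta x. norm (multi_deriv beta f x) <= C * h ^ multi_abs beta * multi_fact beta * decay k x"
 shows "f \<in> Sigma1"
 unfolding Sigma1_def
proof (safe intro!: sm)
 fix h :: real assume h: "h > 0"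
 \<comment> \<open>The absolute values of the coordinates sum to at most
   \<open>DIM('a) * norm x\<close>, so this rate cancels the product of the
   \<open>exp (\<bar>x \<bullet> b\<bar> / h)\<close>.\<close>
 define k where "k = DIM('a) / h"
 have k: "k > 0" using h by (simp add: k_def)
 obtain C where C: "!!beta x. norm (multi_deriv beta f x) <= C * h ^ multi_abs beta * multi_fact beta * decay k x"
  using bd[OF h k] by blast
 show "bdd_above (GS_quotients h f)"
 proof (rule bdd_aboveI[of _ C])
  fix q assume "q \<in> GS_quotients h f"
  then obtain alpha beta x where q: "q = \<bar>multi_pow x alpha\<bar> * norm (multi_deriv beta f x)
    / (h ^ (multi_abs alpha + multi_abs beta) * multi_fact alpha * multi_fact beta)" by (auto simp: GS_quotients_def)
  have mf: "multi_fact alpha > 0" "multi_fact beta > 0" by (auto simp: multi_fact_def intro!: prod_pos)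
  have "\<bar>multi_pow x alpha\<bar> = (\<Prod>b\<in>Basis. \<bar>x \<bullet> b\<bar> ^ alpha b)" by (simp add: multi_pow_def abs_prod power_abs)
  also have "... <= (\<Prod>b\<in>Basis. fact (alpha b) * h ^ alpha b * exp (\<bar>x \<bullet> b\<bar> / h))"
   using h by (intro prod_mono) (auto intro: power_le_fact_exp)
  also have "... = multi_fact alpha * h ^ multi_abs alpha * exp ((\<Sum>b\<in>Basis. \<bar>x \<bullet> b\<bar>) / h)"
   by (simp add: prod.distrib multi_fact_def multi_abs_def power_sum exp_sum sum_divide_distrib)
  also have "... <= multi_fact alpha * h ^ multi_abs alpha * exp (k * norm x)"
  proof -
   have "(\<Sum>b\<in>Basis. \<bar>x \<bullet> b\<bar>) <= (\<Sum>b\<in>(Basis::'a set). norm x)" by (intro sum_mono Basis_le_norm)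
   then have "(\<Sum>b\<in>Basis. \<bar>x \<bullet> b\<bar>) / h <= k * norm x" using h by (simp add: k_def divide_right_mono)
   then show ?thesis using mf h by (intro mult_left_mono) auto
  qed
  finally have "\<bar>multi_pow x alpha\<bar> * norm (multi_deriv beta f x)
    <= (multi_fact alpha * h ^ multi_abs alpha * exp (k * norm x)) * (C * h ^ multi_abs beta * multi_fact beta * decay k x)"
   using C h mf by (intro mult_mono) auto
  also have "... = C * (h ^ (multi_abs alpha + multi_abs beta) * multi_fact alpha * multi_fact beta) * (exp (k * norm x) * decay k x)"
   by (simp add: power_add)
  also have "exp (k * norm x) * decay k x = 1" by (simp add: exp_minus)
  finally show "q <= C" using h mf by (simp add: q pos_divide_le_eq)
 qed
qed

lemma Sigma1I:
 fixes f :: "'a::euclidean_space => complex"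
 assumes sm: "smooth f"
  and bd: "!!h k. h > 0 ==> k > 0 ==> \<exists>C. \<forall>bs\<in>lists Basis. \<forall>x. norm (derivs bs f x) <= C * h ^ length bs * fact (length bs) * decay k x"
 shows "f \<in> Sigma1"
proof (rule Sigma1I_multi[OF sm])
 fix h k :: real assume hk: "h > 0" "k > 0"
 define D where "D = real DIM('a)"
 have D: "D > 0" by (simp add: D_def)
 \<comment> \<open>The smaller parameter pays for the factor \<open>D ^ multi_abs beta\<close> from
   \<open>fact_sum_le_prod_fact\<close>.\<close>
 have "h / D > 0" using hk D by simp
 then obtain C where C: "!!bs x. bs \<in> lists Basis ==> norm (derivs bs f x) <= C * (h / D) ^ length bs * fact (length bs) * decay k x"
  using bd hk(2) by blast
 have "norm (derivs [] f 0) <= C" using C[of "[]" 0] by simp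
 then have C0: "C >= 0" using norm_ge_zero order_trans by blast
 have "norm (multi_deriv beta f x) <= C * h ^ multi_abs beta * multi_fact beta * decay k x" for beta x
 proof -
  have "norm (multi_deriv beta f x) <= C * (h / D) ^ multi_abs beta * fact (multi_abs beta) * decay k x"
   using C[OF index_list_in, of beta x] by (simp add: multi_deriv_eq_derivs length_index_list)
  also have "... <= C * (h / D) ^ multi_abs beta * (D ^ multi_abs beta * multi_fact beta) * decay k x"
   using fact_sum_le_prod_fact[OF finite_Basis, of beta] C0 hk D
   by (intro mult_right_mono mult_left_mono) (auto simp: multi_abs_def multi_fact_def D_def)
  also have "... = C * h ^ multi_abs beta * multi_fact beta * decay k x"
   using D by (simp add: power_divide)
  finally show ?thesis .
 qed
 then show "\<exists>C. \<forall>beta x. norm (multi_deriv beta f x) <= C * h ^ multi_abs beta * multi_fact beta * decay k x" by blast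
qed

section \<open>Affine substitutions in Lebesgue integrals\<close>

lemma lborel_integral_affine:
 fixes f :: "'a::euclidean_space => 'b::{banach, second_countable_topology}" and t :: 'a
 assumes f: "f \<in> borel_measurable borel" and c: "c \<noteq> 0"
 shows "(LINT x|lborel. f x) = \<bar>c\<bar> ^ DIM('a) *\<^sub>R (LINT x|lborel. f (t + c *\<^sub>R x))"
proof -
 have "(LINT x|lborel. f x) = (LINT x|density (Measure_Space.distr lborel borel (%x. t + c *\<^sub>R x)) (%_. ennreal (\<bar>c\<bar> ^ DIM('a))). f x)"
  using lborel_affine[OF c, of t] by simp
 also have "... = (LINT x|Measure_Space.distr lborel borel (%x. t + c *\<^sub>R x). \<bar>c\<bar> ^ DIM('a) *\<^sub>R f x)"
  using f by (intro integral_density) auto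
 also have "... = (LINT x|lborel. \<bar>c\<bar> ^ DIM('a) *\<^sub>R f (t + c *\<^sub>R x))"
  using f by (intro integral_distr) auto
 finally show ?thesis by simp
qed

lemma lborel_integrable_affine:
 fixes f :: "'a::euclidean_space => 'b::{banach, second_countable_topology}" and t :: 'a
 assumes f: "integrable lborel f" and c: "c \<noteq> 0"
 shows "integrable lborel (%x. f (t + c *\<^sub>R x))"
proof -
 have fm: "f \<in> borel_measurable borel" using f by auto
 have "integrable (density (Measure_Space.distr lborel borel (%x. t + c *\<^sub>R x)) (%_. ennreal (\<bar>c\<bar> ^ DIM('a)))) f"
  using f lborel_affine[OF c, of t] by simp
 then have "integrable (Measure_Space.distr lborel borel (%x. t + c *\<^sub>R x)) (%x. \<bar>c\<bar> ^ DIM('a) *\<^sub>R f x)"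
  using fm by (subst (asm) integrable_density) auto
 then have "integrable lborel (%x. \<bar>c\<bar> ^ DIM('a) *\<^sub>R f (t + c *\<^sub>R x))"
  using fm by (subst (asm) integrable_distr_eq) auto
 then have "integrable lborel (%x. inverse (\<bar>c\<bar> ^ DIM('a)) *\<^sub>R (\<bar>c\<bar> ^ DIM('a) *\<^sub>R f (t + c *\<^sub>R x)))"
  by (rule integrable_scaleR_right)
 then show ?thesis using c by simp
qed

section \<open>Closure properties of the Gelfand--Shilov space\<close>

lemma smooth_frechet: "smooth f ==> (f has_derivative frechet_derivative f (at x)) (at x)"
 using smooth_differentiable frechet_derivative_works by blast

lemma partial_deriv_add:
 assumes "smooth f" "smooth g"
 shows "pd b (%x. f x + g x) = (%x. pd b f x + pd b g x)"
 by (subst partial_deriv_eqI[OF has_derivative_add[OF smooth_frechet[OF assms(1)] smooth_frechet[OF assms(2)]]])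
  (simp add: partial_deriv_def)

lemma partial_deriv_cmult:
 assumes "smooth f"
 shows "pd b (%x. c * f x) = (%x. c * pd b f x)"
 by (subst partial_deriv_eqI[OF has_derivative_mult_right[OF smooth_frechet[OF assms]]])
  (simp add: partial_deriv_def)

lemma partial_deriv_cnj:
 assumes "smooth f"
 shows "pd b (%x. cnj (f x)) = (%x. cnj (pd b f x))"
 by (subst partial_deriv_eqI[OF bounded_linear.has_derivative[OF bounded_linear_cnj smooth_frechet[OF assms]]])
  (simp add: partial_deriv_def)

lemma smooth_add:
 assumes "smooth f" "smooth g" shows "smooth (%x. f x + g x)"
proof (rule smooth_coinduct[where S="{%x. f x + g x | f g. smooth f \<and> smooth g}"])
 fix h :: "'a => complex" and b :: 'a and x :: 'a
 assume "h \<in> {%x. f x + g x | f g. smooth f \<and> smooth g}"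
 then obtain f g where h: "h = (%x. f x + g x)" "smooth f" "smooth g" by blast
 show "h differentiable (at x)" unfolding h(1) by (intro differentiable_add smooth_differentiable h)
 assume "b \<in> Basis"
 then show "pd b h \<in> {%x. f x + g x | f g. smooth f \<and> smooth g}"
  using h partial_deriv_add[OF h(2,3)] smooth_partial_deriv by blast
qed (use assms in blast)

lemma smooth_cmult:
 assumes "smooth f" shows "smooth (%x. c * f x)"
proof (rule smooth_coinduct[where S="{%x. c * f x | f. smooth f}"])
 fix h :: "'a => complex" and b :: 'a and x :: 'a
 assume "h \<in> {%x. c * f x | f. smooth f}"
 then obtain f where h: "h = (%x. c * f x)" "smooth f" by blast
 show "h differentiable (at x)" unfolding h(1) differentiable_def
  using has_derivative_mult_right[OF smooth_frechet[OF h(2)]] by blast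
 assume "b \<in> Basis"
 then show "pd b h \<in> {%x. c * f x | f. smooth f}"
  using h partial_deriv_cmult[OF h(2)] smooth_partial_deriv by blast
qed (use assms in blast)

lemma smooth_cnj:
 assumes "smooth f" shows "smooth (%x. cnj (f x))"
proof (rule smooth_coinduct[where S="{%x. cnj (f x) | f. smooth f}"])
 fix h :: "'a => complex" and b :: 'a and x :: 'a
 assume "h \<in> {%x. cnj (f x) | f. smooth f}"
 then obtain f where h: "h = (%x. cnj (f x))" "smooth f" by blast
 show "h differentiable (at x)" unfolding h(1) differentiable_def
  using bounded_linear.has_derivative[OF bounded_linear_cnj smooth_frechet[OF h(2)]] by blast
 assume "b \<in> Basis"
 then show "pd b h \<in> {%x. cnj (f x) | f. smooth f}"
  using h partial_deriv_cnj[OF h(2)] smooth_partial_deriv by blast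
qed (use assms in blast)

lemma derivs_add:
 assumes "smooth f" "smooth g" "bs \<in> lists Basis"
 shows "derivs bs (%x. f x + g x) = (%x. derivs bs f x + derivs bs g x)"
 using assms(3)
proof (induction bs)
 case (Cons b bs)
 then show ?case
  using partial_deriv_add[OF smooth_derivs[OF assms(1), of bs] smooth_derivs[OF assms(2), of bs], of b] by simp
qed simp

lemma derivs_cmult:
 assumes "smooth f" "bs \<in> lists Basis"
 shows "derivs bs (%x. c * f x) = (%x. c * derivs bs f x)"
 using assms(2)
proof (induction bs)
 case (Cons b bs)
 then show ?case using partial_deriv_cmult[OF smooth_derivs[OF assms(1), of bs], of b] by simp
qed simp

lemma derivs_cnj:
 assumes "smooth f" "bs \<in> lists Basis"
 shows "derivs bs (%x. cnj (f x)) = (%x. cnj (derivs bs f x))"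
 using assms(2)
proof (induction bs)
 case (Cons b bs)
 then show ?case using partial_deriv_cnj[OF smooth_derivs[OF assms(1), of bs], of b] by simp
qed simp

lemma Sigma1_add:
 assumes f: "f \<in> Sigma1" and g: "g \<in> Sigma1" shows "(%x. f x + g x) \<in> Sigma1"
proof (rule Sigma1I)
 show "smooth (%x. f x + g x)" using f g by (intro smooth_add Sigma1_smooth)
 fix h k :: real assume hk: "h > 0" "k > 0"
 obtain C where C: "!!bs x. bs \<in> lists Basis ==> norm (derivs bs f x) <= C * h ^ length bs * fact (length bs) * decay k x"
  using Sigma1_derivs_bound[OF f hk] by blast
 obtain D where D: "!!bs x. bs \<in> lists Basis ==> norm (derivs bs g x) <= D * h ^ length bs * fact (length bs) * decay k x"
  using Sigma1_derivs_bound[OF g hk] by blast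
 show "\<exists>C. \<forall>bs\<in>lists Basis. \<forall>x. norm (derivs bs (%x. f x + g x) x) <= C * h ^ length bs * fact (length bs) * decay k x"
 proof (intro exI[of _ "C + D"] ballI allI)
  fix bs :: "'a list" and x assume bs: "bs \<in> lists Basis"
  have "norm (derivs bs f x + derivs bs g x) <= norm (derivs bs f x) + norm (derivs bs g x)" by (rule norm_triangle_ineq)
  also have "... <= (C + D) * h ^ length bs * fact (length bs) * decay k x"
   using add_mono[OF C[OF bs, of x] D[OF bs, of x]] by (simp add: algebra_simps)
  finally show "norm (derivs bs (%x. f x + g x) x) <= (C + D) * h ^ length bs * fact (length bs) * decay k x"
   using f g bs by (simp add: derivs_add Sigma1_smooth)
 qed
qed

lemma Sigma1_cmult:
 assumes f: "f \<in> Sigma1" shows "(%x. c * f x) \<in> Sigma1"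
proof (rule Sigma1I)
 show "smooth (%x. c * f x)" using f by (intro smooth_cmult Sigma1_smooth)
 fix h k :: real assume hk: "h > 0" "k > 0"
 obtain C where C: "!!bs x. bs \<in> lists Basis ==> norm (derivs bs f x) <= C * h ^ length bs * fact (length bs) * decay k x"
  using Sigma1_derivs_bound[OF f hk] by blast
 show "\<exists>C. \<forall>bs\<in>lists Basis. \<forall>x. norm (derivs bs (%x. c * f x) x) <= C * h ^ length bs * fact (length bs) * decay k x"
 proof (intro exI[of _ "norm c * C"] ballI allI)
  fix bs :: "'a list" and x assume bs: "bs \<in> lists Basis"
  show "norm (derivs bs (%x. c * f x) x) <= (norm c * C) * h ^ length bs * fact (length bs) * decay k x"
   using f bs mult_left_mono[OF C[OF bs, of x], of "norm c"]
   by (simp add: derivs_cmult Sigma1_smooth norm_mult mult.assoc)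
 qed
qed

lemma Sigma1_diff:
 assumes f: "f \<in> Sigma1" and g: "g \<in> Sigma1" shows "(%x. f x - g x) \<in> Sigma1"
 using Sigma1_add[OF f Sigma1_cmult[OF g, of "-1"]] by simp

lemma Sigma1_cnj:
 assumes f: "f \<in> Sigma1" shows "(%x. cnj (f x)) \<in> Sigma1"
proof (rule Sigma1I)
 show "smooth (%x. cnj (f x))" using f by (intro smooth_cnj Sigma1_smooth)
 fix h k :: real assume hk: "h > 0" "k > 0"
 show "\<exists>C. \<forall>bs\<in>lists Basis. \<forall>x. norm (derivs bs (%x. cnj (f x)) x) <= C * h ^ length bs * fact (length bs) * decay k x"
  using Sigma1_derivs_bound[OF f hk] f by (auto simp: derivs_cnj Sigma1_smooth)
qed

lemma partial_deriv_affine: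
 assumes "smooth f"
 shows "pd b (%x. f (s *\<^sub>R x + a)) = (%x. of_real s * pd b f (s *\<^sub>R x + a))"
  "(%x. f (s *\<^sub>R x + a)) differentiable (at x)"
proof -
 have d: "((%x. f (s *\<^sub>R x + a)) has_derivative (%h. frechet_derivative f (at (s *\<^sub>R x + a)) (s *\<^sub>R h))) (at x)" for x
  by (rule has_derivative_compose[OF _ smooth_frechet[OF assms]]) (auto intro!: derivative_eq_intros)
 have lin: "frechet_derivative f (at y) (s *\<^sub>R b) = s *\<^sub>R frechet_derivative f (at y) b" for y
  using linear_frechet_derivative[OF smooth_differentiable[OF assms]] by (simp add: linear_cmul)
 show "pd b (%x. f (s *\<^sub>R x + a)) = (%x. of_real s * pd b f (s *\<^sub>R x + a))"
  by (subst partial_deriv_eqI[OF d]) (simp add: lin partial_deriv_def scaleR_conv_of_real)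
 show "(%x. f (s *\<^sub>R x + a)) differentiable (at x)" using d differentiable_def by blast
qed

lemma smooth_affine:
 assumes "smooth f" shows "smooth (%x. f (s *\<^sub>R x + a))"
proof (rule smooth_coinduct[where S="{%x. f (s *\<^sub>R x + a) | f. smooth f}"])
 fix h :: "'a => complex" and b :: 'a and x :: 'a
 assume "h \<in> {%x. f (s *\<^sub>R x + a) | f. smooth f}"
 then obtain f where h: "h = (%x. f (s *\<^sub>R x + a))" "smooth f" by blast
 show "h differentiable (at x)" using h partial_deriv_affine(2)[OF h(2)] by simp
 assume b: "b \<in> Basis"
 have "smooth (%x. of_real s * pd b f x)" using h b by (intro smooth_cmult smooth_partial_deriv)
 then show "pd b h \<in> {%x. f (s *\<^sub>R x + a) | f. smooth f}"
  unfolding h(1) partial_deriv_affine(1)[OF h(2)]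
  by (intro CollectI exI[of _ "%x. of_real s * pd b f x"]) auto
qed (use assms in blast)

lemma derivs_affine:
 assumes "smooth f" "bs \<in> lists Basis"
 shows "derivs bs (%x. f (s *\<^sub>R x + a)) = (%x. of_real s ^ length bs * derivs bs f (s *\<^sub>R x + a))"
 using assms(2)
proof (induction bs)
 case (Cons b bs)
 have sm: "smooth (derivs bs f)" using Cons assms by (intro smooth_derivs) auto
 have "derivs (b # bs) (%x. f (s *\<^sub>R x + a)) = pd b (%x. of_real s ^ length bs * derivs bs f (s *\<^sub>R x + a))"
  using Cons by simp
 also have "... = (%x. of_real s ^ length bs * (of_real s * pd b (derivs bs f) (s *\<^sub>R x + a)))"
  by (simp only: partial_deriv_cmult[OF smooth_affine[OF sm]] partial_deriv_affine(1)[OF sm])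
 finally show ?case by (simp add: mult_ac)
qed simp

lemma Sigma1_affine:
 fixes f :: "'a::euclidean_space => complex"
 assumes f: "f \<in> Sigma1" and s: "s \<noteq> 0" shows "(%x. f (s *\<^sub>R x + a)) \<in> Sigma1"
proof (rule Sigma1I)
 show "smooth (%x. f (s *\<^sub>R x + a))" using f by (intro smooth_affine Sigma1_smooth)
 fix h k :: real assume hk: "h > 0" "k > 0"
 \<comment> \<open>Each derivative brings out a factor \<open>s\<close>, and the dilation multiplies
   the rate of decay by \<open>\<bar>s\<bar>\<close>.\<close>
 have hk': "h / \<bar>s\<bar> > 0" "k / \<bar>s\<bar> > 0" using hk s by auto
 obtain C where C: "C >= 0" "!!bs x. bs \<in> lists Basis ==> norm (derivs bs f x) <= C * (h / \<bar>s\<bar>) ^ length bs * fact (length bs) * decay (k / \<bar>s\<bar>) x"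
  using Sigma1_derivs_bound[OF f hk'] by blast
 show "\<exists>C. \<forall>bs\<in>lists Basis. \<forall>x. norm (derivs bs (%x. f (s *\<^sub>R x + a)) x) <= C * h ^ length bs * fact (length bs) * decay k x"
 proof (intro exI[of _ "C * exp (k / \<bar>s\<bar> * norm a)"] ballI allI)
  fix bs :: "'a list" and x assume bs: "bs \<in> lists Basis"
  have "norm (s *\<^sub>R x) <= norm (s *\<^sub>R x + a) + norm a" using norm_triangle_ineq4[of "s *\<^sub>R x + a" a] by simp
  then have "(k / \<bar>s\<bar>) * (\<bar>s\<bar> * norm x) <= (k / \<bar>s\<bar>) * (norm (s *\<^sub>R x + a) + norm a)"
   using hk by (intro mult_left_mono) (auto intro: less_imp_le)
  then have e: "decay (k / \<bar>s\<bar>) (s *\<^sub>R x + a) <= exp (k / \<bar>s\<bar> * norm a) * decay k x"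
   using s by (simp add: exp_add[symmetric] algebra_simps)
  have "norm (derivs bs (%x. f (s *\<^sub>R x + a)) x) = \<bar>s\<bar> ^ length bs * norm (derivs bs f (s *\<^sub>R x + a))"
   using f bs by (simp add: derivs_affine Sigma1_smooth norm_mult norm_power)
  also have "... <= \<bar>s\<bar> ^ length bs * (C * (h / \<bar>s\<bar>) ^ length bs * fact (length bs) * decay (k / \<bar>s\<bar>) (s *\<^sub>R x + a))"
   by (intro mult_left_mono C bs) auto
  also have "... = C * h ^ length bs * fact (length bs) * decay (k / \<bar>s\<bar>) (s *\<^sub>R x + a)"
   using s by (simp add: power_divide)
  also have "... <= C * h ^ length bs * fact (length bs) * (exp (k / \<bar>s\<bar> * norm a) * decay k x)"
   using C hk by (intro mult_left_mono e) auto
  finally show "norm (derivs bs (%x. f (s *\<^sub>R x + a)) x) <= C * exp (k / \<bar>s\<bar> * norm a) * h ^ length bs * fact (length bs) * decay k x"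
   by (simp add: mult_ac)
 qed
qed

lemma Sigma1_translate: "f \<in> Sigma1 ==> (%x. f (x - a)) \<in> Sigma1"
 using Sigma1_affine[of f 1 "- a"] by simp

section \<open>Modulations\<close>

text \<open>The kernel of the Fourier transform, sign included; shifting to the frequency
  \<open>eta\<close> is therefore multiplication by \<open>character (- eta)\<close>.\<close>

definition character :: "'a::euclidean_space => 'a => complex" where
 "character xi x = exp (- \<i> * of_real (x \<bullet> xi))"

lemma norm_character [simp]: "norm (character xi x) = 1"
 by (simp add: character_def norm_exp_eq_Re)

lemma character_has_derivative:
 "(character xi has_derivative (%h. (- \<i> * of_real (h \<bullet> xi)) * character xi x)) (at x)"
proof -
 have "((%x. - \<i> * of_real (x \<bullet> xi)) has_derivative (%h. - \<i> * of_real (h \<bullet> xi))) (at x)"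
  by (intro bounded_linear_imp_has_derivative bounded_linear_const_mult
    bounded_linear_compose[OF bounded_linear_of_real] bounded_linear_inner_left)
 from has_derivative_compose[OF this has_field_derivative_imp_has_derivative[OF DERIV_exp]]
 show ?thesis by (simp add: character_def[abs_def] mult.commute)
qed

lemma partial_deriv_modulate:
 assumes "smooth f"
 shows "pd b (%x. f x * character xi x) = (%x. (pd b f x + (- \<i> * of_real (b \<bullet> xi)) * f x) * character xi x)"
  "(%x. f x * character xi x) differentiable (at x)"
proof -
 have d: "((%x. f x * character xi x) has_derivative (%h. f x * ((- \<i> * of_real (h \<bullet> xi)) * character xi x) + frechet_derivative f (at x) h * character xi x)) (at x)" for x
  by (rule has_derivative_mult[OF smooth_frechet[OF assms] character_has_derivative])
 show "pd b (%x. f x * character xi x) = (%x. (pd b f x + (- \<i> * of_real (b \<bullet> xi)) * f x) * character xi x)"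
  by (subst partial_deriv_eqI[OF d]) (simp add: partial_deriv_def algebra_simps)
 show "(%x. f x * character xi x) differentiable (at x)" using d differentiable_def by blast
qed

text \<open>Partial derivatives conjugated by the character: differentiating the modulated function
  applies these operators to \<open>f\<close> and keeps the character as a factor.\<close>

definition twisted_derivs :: "'a::euclidean_space => 'a list => ('a => complex) => 'a => complex" where
 "twisted_derivs xi = foldr (%b g x. pd b g x + (- \<i> * of_real (b \<bullet> xi)) * g x)"

lemma smooth_twisted:
 assumes "smooth f" "bs \<in> lists Basis" shows "smooth (twisted_derivs xi bs f)"
 using assms(2)
proof (induction bs)
 case (Cons b bs)
 then have "smooth (%x. pd b (twisted_derivs xi bs f) x + (- \<i> * of_real (b \<bullet> xi)) * twisted_derivs xi bs f x)"
  by (intro smooth_add smooth_cmult smooth_partial_deriv) auto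
 then show ?case by (simp add: twisted_derivs_def)
qed (simp add: twisted_derivs_def assms(1))

lemma derivs_modulate:
 assumes "smooth f" "bs \<in> lists Basis"
 shows "derivs bs (%x. f x * character xi x) = (%x. twisted_derivs xi bs f x * character xi x)"
 using assms(2)
proof (induction bs)
 case (Cons b bs)
 have "derivs (b # bs) (%x. f x * character xi x) = pd b (%x. twisted_derivs xi bs f x * character xi x)"
  using Cons by simp
 also have "... = (%x. twisted_derivs xi (b # bs) f x * character xi x)"
  using Cons by (subst partial_deriv_modulate(1)[OF smooth_twisted[OF assms(1)]]) (auto simp: twisted_derivs_def)
 finally show ?case .
qed (simp add: twisted_derivs_def)

lemma smooth_modulate:
 assumes "smooth f" shows "smooth (%x. f x * character xi x)"
proof -
 have "derivs bs (%x. f x * character xi x) differentiable (at x)" if "bs \<in> lists Basis" for bs x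
  unfolding derivs_modulate[OF assms that] by (rule partial_deriv_modulate(2)[OF smooth_twisted[OF assms that]])
 then show ?thesis by (auto simp: smooth_def differentiable_on_def intro: differentiable_at_withinI)
qed

lemma fact_mult_le: "fact m * fact n <= (fact (m + n) :: real)"
proof -
 have "(fact m * fact n :: nat) <= fact (m + n)" by (intro dvd_imp_le fact_fact_dvd_fact) auto
 then show ?thesis by (metis of_nat_fact of_nat_le_iff of_nat_mult)
qed

text \<open>Each operator is a derivative plus a multiplication by a coordinate of
  \<open>xi\<close>, whence a factor 2 per letter. Multiplications are counted like derivatives,
  because \<open>norm xi ^ j\<close> is at most \<open>fact j * h ^ j * exp (norm xi / h)\<close>.
  The outer derivatives \<open>cs\<close> and the power \<open>j\<close> generalize the
  induction.\<close>

lemma twisted_derivs_bound: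
 fixes f :: "'a::euclidean_space => complex"
 assumes f: "smooth f" and h: "h > 0" and E: "E >= 0" and C0: "C >= 0"
  and C: "!!cs. cs \<in> lists Basis ==> norm (derivs cs f x) <= C * h ^ length cs * fact (length cs) * E"
  and bs: "bs \<in> lists Basis"
 shows "cs \<in> lists Basis ==> norm xi ^ j * norm (derivs cs (twisted_derivs xi bs f) x)
  <= 2 ^ length bs * (C * exp (norm xi / h)) * h ^ (length cs + length bs + j) * fact (length cs + length bs + j) * E"
 using bs
proof (induction bs arbitrary: cs j)
 case Nil
 have "norm xi ^ j * norm (derivs cs f x) <= (fact j * h ^ j * exp (norm xi / h)) * (C * h ^ length cs * fact (length cs) * E)"
  using h by (intro mult_mono power_le_fact_exp C Nil) auto
 also have "... = (C * exp (norm xi / h)) * h ^ (length cs + j) * (fact (length cs) * fact j) * E"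
  by (simp add: power_add mult_ac)
 also have "... <= (C * exp (norm xi / h)) * h ^ (length cs + j) * fact (length cs + j) * E"
  using h C0 E by (intro mult_right_mono mult_left_mono fact_mult_le) auto
 finally show ?case by (simp add: twisted_derivs_def)
next
 case (Cons b bs)
 then have b: "b \<in> Basis" and bs: "bs \<in> lists Basis" by auto
 let ?g = "twisted_derivs xi bs f"
 have sm: "smooth ?g" by (rule smooth_twisted[OF f bs])
 let ?K = "2 ^ length bs * (C * exp (norm xi / h)) * h ^ (length cs + length (b # bs) + j) * fact (length cs + length (b # bs) + j) * E"
 have "derivs cs (twisted_derivs xi (b # bs) f) x = derivs (cs @ [b]) ?g x + (- \<i> * of_real (b \<bullet> xi)) * derivs cs ?g x"
 proof -
  have "derivs cs (%x. pd b ?g x + (- \<i> * of_real (b \<bullet> xi)) * ?g x)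
   = (%x. derivs cs (pd b ?g) x + (- \<i> * of_real (b \<bullet> xi)) * derivs cs ?g x)"
   by (simp only: derivs_add[OF smooth_partial_deriv[OF sm b] smooth_cmult[OF sm] Cons.prems(1)] derivs_cmult[OF sm Cons.prems(1)])
  then show ?thesis by (simp add: twisted_derivs_def)
 qed
 then have "norm (derivs cs (twisted_derivs xi (b # bs) f) x) <= norm (derivs (cs @ [b]) ?g x) + \<bar>b \<bullet> xi\<bar> * norm (derivs cs ?g x)"
  by (metis norm_triangle_ineq norm_mult norm_minus_cancel norm_ii mult_1 norm_of_real mult_minus_left)
 also have "... <= norm (derivs (cs @ [b]) ?g x) + norm xi * norm (derivs cs ?g x)"
  using Basis_le_norm[OF b, of xi] by (intro add_left_mono mult_right_mono) (auto simp: inner_commute)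
 finally have "norm xi ^ j * norm (derivs cs (twisted_derivs xi (b # bs) f) x)
  <= norm xi ^ j * (norm (derivs (cs @ [b]) ?g x) + norm xi * norm (derivs cs ?g x))"
  by (intro mult_left_mono) auto
 also have "... = norm xi ^ j * norm (derivs (cs @ [b]) ?g x) + norm xi ^ Suc j * norm (derivs cs ?g x)"
  by (simp add: algebra_simps)
 also have "... <= ?K + ?K"
  using Cons.IH[of "cs @ [b]" j] Cons.IH[of cs "Suc j"] Cons.prems b bs by (intro add_mono) auto
 finally show ?case by (simp add: mult_ac)
qed

lemma Sigma1_modulate:
 fixes f :: "'a::euclidean_space => complex"
 assumes f: "f \<in> Sigma1" shows "(%x. f x * character xi x) \<in> Sigma1"
proof (rule Sigma1I)
 show "smooth (%x. f x * character xi x)" using f by (intro smooth_modulate Sigma1_smooth)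
 fix h k :: real assume hk: "h > 0" "k > 0"
 \<comment> \<open>Halving \<open>h\<close> absorbs the factor \<open>2 ^ length bs\<close>.\<close>
 then have h2: "h / 2 > 0" by simp
 obtain C where C: "C >= 0" "!!bs x. bs \<in> lists Basis ==> norm (derivs bs f x) <= C * (h / 2) ^ length bs * fact (length bs) * decay k x"
  using Sigma1_derivs_bound[OF f h2 hk(2)] by blast
 have "norm (derivs bs (%x. f x * character xi x) x) <= (C * exp (norm xi / (h / 2))) * h ^ length bs * fact (length bs) * decay k x"
  if bs: "bs \<in> lists Basis" for bs x
 proof -
  have "norm (twisted_derivs xi bs f x) <= 2 ^ length bs * (C * exp (norm xi / (h / 2))) * (h / 2) ^ length bs * fact (length bs) * decay k x"
   using twisted_derivs_bound[OF Sigma1_smooth[OF f] h2 _ C(1) C(2) bs, of x "[]" xi 0] by simp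
  also have "... = (C * exp (norm xi / (h / 2))) * h ^ length bs * fact (length bs) * decay k x"
   by (simp add: power_divide)
  finally show ?thesis using f bs by (simp add: derivs_modulate Sigma1_smooth norm_mult)
 qed
 then show "\<exists>C. \<forall>bs\<in>lists Basis. \<forall>x. norm (derivs bs (%x. f x * character xi x) x) <= C * h ^ length bs * fact (length bs) * decay k x"
  by blast
qed



section \<open>Decay, Lipschitz bounds and convolution\<close>

lemma Sigma1_exp_decay:
 fixes f :: "'a::euclidean_space => complex"
 assumes "f \<in> Sigma1" "k > 0"
 shows "\<exists>C\<ge>0. \<forall>x. norm (f x) <= C * decay k x"
proof -
 obtain C where C: "C >= 0" "!!bs x. bs \<in> lists Basis ==> norm (derivs bs f x) <= C * 1 ^ length bs * fact (length bs) * decay k x"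
  using Sigma1_derivs_bound[OF assms(1) zero_less_one assms(2)] by blast
 show ?thesis using C(1) C(2)[of "[]"] by (intro exI[of _ C]) auto
qed

lemma Sigma1_continuous: "f \<in> Sigma1 ==> continuous_on UNIV f"
 by (intro smooth_continuous Sigma1_smooth)

lemma Sigma1_borel: "f \<in> Sigma1 ==> f \<in> borel_measurable borel"
 by (intro smooth_borel Sigma1_smooth)

lemma Sigma1_bounded:
 assumes "f \<in> Sigma1" shows "\<exists>C\<ge>0. \<forall>x. norm (f x) <= C"
proof -
 obtain C where "C >= 0" "!!x. norm (f x) <= C * decay 1 x" using Sigma1_exp_decay[OF assms zero_less_one] by blast
 moreover have "C * decay 1 x <= C" for x using \<open>C >= 0\<close> by (simp add: mult_left_le)
 ultimately show ?thesis using order_trans by (intro exI[of _ C]) blast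
qed

lemma Sigma1_exp_integrable:
 fixes f :: "'a::euclidean_space => complex"
 assumes f: "f \<in> Sigma1"
 shows "integrable lborel (%x. exp (k * norm x) * norm (f x))"
proof -
 \<comment> \<open>One unit of decay more than the weight grows; what remains is integrable.\<close>
 have k: "\<bar>k\<bar> + 1 > 0" by simp
 obtain C where C: "C >= 0" "!!x. norm (f x) <= C * decay (\<bar>k\<bar> + 1) x"
  using Sigma1_exp_decay[OF f k] by blast
 have "integrable lborel (%x::'a. C * decay 1 x)"
  by (intro integrable_mult_right integrable_exp_norm) simp
 then show ?thesis
 proof (rule integrable_dominated)
  show "(%x. exp (k * norm x) * norm (f x)) \<in> borel_measurable lborel"
   using Sigma1_borel[OF f] by measurable
  show "AE x in lborel. norm (exp (k * norm x) * norm (f x)) <= norm (C * decay 1 x)"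
  proof (rule AE_I2)
   fix x
   have "exp (k * norm x) * norm (f x) <= exp (\<bar>k\<bar> * norm x) * (C * decay (\<bar>k\<bar> + 1) x)"
    using C by (intro mult_mono) (auto intro!: mult_right_mono)
   also have "... = C * decay 1 x" by (simp add: exp_add[symmetric] algebra_simps)
   finally show "norm (exp (k * norm x) * norm (f x)) <= norm (C * decay 1 x)" using C by simp
  qed
 qed
qed

lemma Sigma1_integrable:
 assumes f: "f \<in> Sigma1" shows "integrable lborel f"
 using Sigma1_exp_integrable[OF f, of 0] Sigma1_borel[OF f]
 by (simp add: integrable_norm_iff)

lemma norm_gradient_le:
 fixes v :: "'a::euclidean_space => complex" and M :: real
 assumes "!!b. b \<in> Basis ==> norm (v b) <= M"
 shows "norm (\<Sum>b\<in>Basis. (h \<bullet> b) *\<^sub>R v b) <= DIM('a) * M * norm h"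
proof -
 have "norm (\<Sum>b\<in>Basis. (h \<bullet> b) *\<^sub>R v b) <= (\<Sum>b\<in>Basis. norm ((h \<bullet> b) *\<^sub>R v b))" by (rule norm_sum)
 also have "... <= (\<Sum>b\<in>(Basis::'a set). norm h * M)"
  using assms by (intro sum_mono) (auto intro!: mult_mono Basis_le_norm)
 finally show ?thesis by (simp add: mult_ac)
qed

text \<open>The derivatives are bounded on the segment only, which is what preserves the decay in
  \<open>Sigma1_Lipschitz\<close>.\<close>

lemma smooth_segment_bound:
 fixes f :: "'a::euclidean_space => complex" and M :: real
 assumes f: "smooth f" and M: "!!w b. w \<in> closed_segment x y ==> b \<in> Basis ==> norm (pd b f w) <= M"
 shows "norm (f y - f x) <= DIM('a) * M * norm (y - x)"
proof (rule differentiable_bound[where S="closed_segment x y" and f'="%w h. \<Sum>b\<in>Basis. (h \<bullet> b) *\<^sub>R pd b f w"])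
 fix w assume w: "w \<in> closed_segment x y"
 show "(f has_derivative (%h. \<Sum>b\<in>Basis. (h \<bullet> b) *\<^sub>R pd b f w)) (at w within closed_segment x y)"
  by (rule has_derivative_at_withinI[OF smooth_has_derivative[OF f]])
 show "onorm (%h. \<Sum>b\<in>Basis. (h \<bullet> b) *\<^sub>R pd b f w) <= DIM('a) * M"
  by (intro onorm_le norm_gradient_le M w)
qed auto

text \<open>The function minus its linear part at \<open>x\<close> has, by the mean value
  inequality, a gradient of order \<open>norm h\<close> along the segment; a second use of that
  inequality gives the square.\<close>

lemma smooth_taylor_bound:
 fixes f :: "'a::euclidean_space => complex" and M :: real
 assumes f: "smooth f" and M: "!!w b c. b \<in> Basis ==> c \<in> Basis ==> norm (pd c (pd b f) w) <= M"
 shows "norm (f (x + h) - f x - (\<Sum>b\<in>Basis. (h \<bullet> b) *\<^sub>R pd b f x)) <= (real DIM('a))\<^sup>2 * M * (norm h)\<^sup>2"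
proof -
 define phi where "phi w = f w - (\<Sum>b\<in>Basis. (w \<bullet> b) *\<^sub>R pd b f x)" for w
 have "norm (phi (x + h) - phi x) <= (DIM('a) * (DIM('a) * M * norm h)) * norm ((x + h) - x)"
 proof (rule differentiable_bound[where S="closed_segment x (x + h)" and f'="%w h. \<Sum>b\<in>Basis. (h \<bullet> b) *\<^sub>R (pd b f w - pd b f x)"])
  fix w assume w: "w \<in> closed_segment x (x + h)"
  have "((%w. \<Sum>b\<in>Basis. (w \<bullet> b) *\<^sub>R pd b f x) has_derivative (%w. \<Sum>b\<in>Basis. (w \<bullet> b) *\<^sub>R pd b f x)) (at w)"
   by (auto intro!: derivative_eq_intros)
  from has_derivative_diff[OF smooth_has_derivative[OF f] this]
  have "(phi has_derivative (%h. \<Sum>b\<in>Basis. (h \<bullet> b) *\<^sub>R (pd b f w - pd b f x))) (at w)"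
   by (simp add: phi_def[abs_def] sum_subtractf scaleR_diff_right)
  then show "(phi has_derivative (%h. \<Sum>b\<in>Basis. (h \<bullet> b) *\<^sub>R (pd b f w - pd b f x))) (at w within closed_segment x (x + h))"
   by (rule has_derivative_at_withinI)
  show "onorm (%h. \<Sum>b\<in>Basis. (h \<bullet> b) *\<^sub>R (pd b f w - pd b f x)) <= DIM('a) * (DIM('a) * M * norm h)"
  proof (intro onorm_le norm_gradient_le)
   fix b :: 'a assume b: "b \<in> Basis"
   have "norm (pd b f w - pd b f x) <= DIM('a) * M * norm (w - x)"
    by (rule smooth_segment_bound[OF smooth_partial_deriv[OF f b]]) (rule M[OF b])
   also have "... <= DIM('a) * M * norm h"
   proof (intro mult_left_mono)
    show "norm (w - x) <= norm h" using segment_bound1[OF w] by simp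
    have "0 <= M" using M[OF b b] norm_ge_zero order_trans by blast
    then show "0 <= DIM('a) * M" by simp
   qed
   finally show "norm (pd b f w - pd b f x) <= DIM('a) * M * norm h" .
  qed
 qed auto
 moreover have "phi (x + h) - phi x = f (x + h) - f x - (\<Sum>b\<in>Basis. (h \<bullet> b) *\<^sub>R pd b f x)"
  by (simp add: phi_def inner_add_left scaleR_add_left sum.distrib)
 ultimately show ?thesis by (simp add: power2_eq_square mult_ac)
qed

lemma has_derivative_quadratic_remainder:
 fixes F :: "'a::real_normed_vector => 'b::real_normed_vector"
 assumes L: "bounded_linear L" and r: "!!h. norm (F (x + h) - F x - L h) <= C * (norm h)\<^sup>2"
 shows "(F has_derivative L) (at x)"
 unfolding has_derivative_at
proof (intro conjI L)
 have "((%h::'a. norm h) \<longlongrightarrow> 0) (at 0)" by (rule tendsto_norm_zero) (rule tendsto_ident_at)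
 from tendsto_mult_left[OF this, of C] have lim: "((%h::'a. C * norm h) \<longlongrightarrow> 0) (at 0)" by simp
 show "(%h. norm (F (x + h) - F x - L h) / norm h) \<midarrow>0\<rightarrow> 0"
 proof (rule Lim_null_comparison[OF always_eventually lim], intro allI)
  fix h :: 'a
  have "norm (F (x + h) - F x - L h) / norm h <= C * (norm h)\<^sup>2 / norm h" by (intro divide_right_mono r) simp
  then show "norm (norm (F (x + h) - F x - L h) / norm h) <= C * norm h" by (simp add: power2_eq_square split: if_splits)
 qed
qed

section \<open>Convolution of test functions\<close>

lemma integrable_conv:
 fixes f g :: "'a::euclidean_space => complex"
 assumes f: "f \<in> borel_measurable borel" "!!x. norm (f x) <= C" and g: "integrable lborel g"
 shows "integrable lborel (%y. f (x - y) * g y)"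
proof (rule integrable_dominated)
 show "integrable lborel (%y. C * norm (g y))" using g by auto
 have "g \<in> borel_measurable borel" using g by auto
 then show "(%y. f (x - y) * g y) \<in> borel_measurable lborel" using f(1) by measurable
 have C: "C >= 0" using f(2)[of 0] norm_ge_zero order_trans by blast
 show "AE y in lborel. norm (f (x - y) * g y) <= norm (C * norm (g y))"
  using f(2) C by (intro AE_I2) (simp add: norm_mult mult_right_mono)
qed

text \<open>With bounded second derivatives Taylor's estimate is uniform in the integration
  variable, so the remainder of the convolution is again quadratic and no limit is interchanged with
  the integral.\<close>

lemma conv_has_derivative:
 fixes f g :: "'a::euclidean_space => complex"
 assumes f: "smooth f" and bd: "!!bs. bs \<in> lists Basis ==> \<exists>C. \<forall>x. norm (derivs bs f x) <= C"
  and g: "integrable lborel g"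
 shows "(conv f g has_derivative (%h. \<Sum>b\<in>Basis. (h \<bullet> b) *\<^sub>R conv (pd b f) g x)) (at x)"
proof -
 obtain C where C: "!!bs x. bs \<in> lists Basis ==> norm (derivs bs f x) <= C bs" using bd by metis
 \<comment> \<open>One bound for all second derivatives: the sum over the finitely many pairs of
   directions dominates each of their bounds.\<close>
 define M where "M = (\<Sum>b\<in>(Basis::'a set). \<Sum>c\<in>(Basis::'a set). \<bar>C [c, b]\<bar>)"
 have M: "norm (pd c (pd b f) w) <= M" if "b \<in> Basis" "c \<in> Basis" for b c w
 proof -
  have "norm (pd c (pd b f) w) <= \<bar>C [c, b]\<bar>" using C[of "[c, b]" w] that by simp
  also have "... <= (\<Sum>c\<in>(Basis::'a set). \<bar>C [c, b]\<bar>)" using that(2) by (intro member_le_sum) auto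
  also have "... <= M" unfolding M_def using that(1) by (intro member_le_sum[of b Basis "%b. \<Sum>c\<in>(Basis::'a set). \<bar>C [c, b]\<bar>"]) (auto intro: sum_nonneg)
  finally show ?thesis .
 qed
 have i0: "integrable lborel (%y. f (z - y) * g y)" for z
  using C[of "[]"] by (intro integrable_conv[OF smooth_borel[OF f] _ g]) auto
 have i1: "integrable lborel (%y. pd b f (z - y) * g y)" if "b \<in> Basis" for z b
  using C[of "[b]"] that by (intro integrable_conv[OF smooth_borel[OF smooth_partial_deriv[OF f]] _ g]) auto
 show ?thesis
 proof (rule has_derivative_quadratic_remainder)
  show "bounded_linear (%h. \<Sum>b\<in>Basis. (h \<bullet> b) *\<^sub>R conv (pd b f) g x)"
   by (intro bounded_linear_sum bounded_linear_scaleR_const bounded_linear_inner_left)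
  fix h
  let ?R = "%y. f (x - y + h) - f (x - y) - (\<Sum>b\<in>Basis. (h \<bullet> b) *\<^sub>R pd b f (x - y))"
  have i2: "integrable lborel (%y. \<Sum>b\<in>Basis. (h \<bullet> b) *\<^sub>R (pd b f (x - y) * g y))"
   by (intro Bochner_Integration.integrable_sum integrable_scaleR_right i1)
  have i3: "integrable lborel (%y. f (x + h - y) * g y - f (x - y) * g y)"
   by (intro Bochner_Integration.integrable_diff i0)
  have "(\<Sum>b\<in>Basis. (h \<bullet> b) *\<^sub>R conv (pd b f) g x) = (LINT y|lborel. (\<Sum>b\<in>Basis. (h \<bullet> b) *\<^sub>R (pd b f (x - y) * g y)))"
   by (subst Bochner_Integration.integral_sum) (auto simp: conv_def i1)
  then have "conv f g (x + h) - conv f g x - (\<Sum>b\<in>Basis. (h \<bullet> b) *\<^sub>R conv (pd b f) g x)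
   = (LINT y|lborel. f (x + h - y) * g y - f (x - y) * g y - (\<Sum>b\<in>Basis. (h \<bullet> b) *\<^sub>R (pd b f (x - y) * g y)))"
   by (simp add: conv_def Bochner_Integration.integral_diff[OF i3 i2] Bochner_Integration.integral_diff[OF i0 i0])
  also have "... = (LINT y|lborel. ?R y * g y)"
   by (intro Bochner_Integration.integral_cong refl) (simp add: algebra_simps sum_distrib_left)
  finally have eq: "conv f g (x + h) - conv f g x - (\<Sum>b\<in>Basis. (h \<bullet> b) *\<^sub>R conv (pd b f) g x) = (LINT y|lborel. ?R y * g y)" .
  have "(%y. f (x + h - y) * g y - f (x - y) * g y - (\<Sum>b\<in>Basis. (h \<bullet> b) *\<^sub>R (pd b f (x - y) * g y))) = (%y. ?R y * g y)"
   by (simp add: fun_eq_iff algebra_simps sum_distrib_left)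
  then have i4: "integrable lborel (%y. ?R y * g y)"
   using Bochner_Integration.integrable_diff[OF i3 i2] by simp
  have "norm (LINT y|lborel. ?R y * g y) <= (LINT y|lborel. ((real DIM('a))\<^sup>2 * M * (norm h)\<^sup>2) * norm (g y))"
  proof (rule Bochner_Integration.integral_norm_bound_integral[OF i4])
   show "integrable lborel (%y. ((real DIM('a))\<^sup>2 * M * (norm h)\<^sup>2) * norm (g y))" using g by auto
   fix y show "norm (?R y * g y) <= ((real DIM('a))\<^sup>2 * M * (norm h)\<^sup>2) * norm (g y)"
    unfolding norm_mult using M by (intro mult_right_mono smooth_taylor_bound[OF f]) auto
  qed
  also have "... = ((real DIM('a))\<^sup>2 * M * (LINT y|lborel. norm (g y))) * (norm h)\<^sup>2" by simp
  finally show "norm (conv f g (x + h) - conv f g x - (\<Sum>b\<in>Basis. (h \<bullet> b) *\<^sub>R conv (pd b f) g x)) <= ((real DIM('a))\<^sup>2 * M * (LINT y|lborel. norm (g y))) * (norm h)\<^sup>2"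
   unfolding eq .
 qed
qed

lemma derivs_conv:
 fixes f g :: "'a::euclidean_space => complex"
 assumes f: "smooth f" and bd: "!!bs. bs \<in> lists Basis ==> \<exists>C. \<forall>x. norm (derivs bs f x) <= C"
  and g: "integrable lborel g" and bs: "bs \<in> lists Basis"
 shows "derivs bs (conv f g) = conv (derivs bs f) g" "conv (derivs bs f) g differentiable (at x)"
proof -
 have bd2: "\<exists>C. \<forall>x. norm (derivs cs (derivs ds f) x) <= C" if "cs \<in> lists Basis" "ds \<in> lists Basis" for cs ds
  using bd[of "cs @ ds"] that by simp
 note d = conv_has_derivative[OF smooth_derivs[OF f] bd2 g]
 show "conv (derivs bs f) g differentiable (at x)"
  unfolding differentiable_def using d[OF bs _ bs, of x] by blast
 show "derivs bs (conv f g) = conv (derivs bs f) g" using bs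
 proof (induction bs)
  case (Cons b bs)
  have "derivs (b # bs) (conv f g) = pd b (conv (derivs bs f) g)" using Cons by simp
  also have "... = (%x. \<Sum>c\<in>Basis. (b \<bullet> c) *\<^sub>R conv (pd c (derivs bs f)) g x)"
   using Cons.hyps by (intro partial_deriv_eqI d) auto
  also have "... = conv (derivs (b # bs) f) g"
  proof
   fix x
   have "(\<Sum>c\<in>Basis. (b \<bullet> c) *\<^sub>R conv (pd c (derivs bs f)) g x)
    = (\<Sum>c\<in>Basis. if c = b then conv (pd b (derivs bs f)) g x else 0)"
    using Cons.hyps by (intro sum.cong) (auto simp: inner_Basis)
   then show "(\<Sum>c\<in>Basis. (b \<bullet> c) *\<^sub>R conv (pd c (derivs bs f)) g x) = conv (derivs (b # bs) f) g x"
    using Cons.hyps by simp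
  qed
  finally show ?case .
 qed simp
qed

text \<open>All derivatives fall on \<open>f\<close>, while \<open>g\<close> contributes its
  exponential moments. In this form the statement also covers the mollification of compactly
  supported Lipschitz functions.\<close>

lemma Sigma1_conv:
 fixes f g :: "'a::euclidean_space => complex"
 assumes f: "f \<in> Sigma1" and gm: "g \<in> borel_measurable borel"
  and g: "!!k. integrable lborel (%x. exp (k * norm x) * norm (g x))"
 shows "conv f g \<in> Sigma1"
proof (rule Sigma1I)
 have gi: "integrable lborel g" using g[of 0] gm by (simp add: integrable_norm_iff)
 have bd: "\<exists>C. \<forall>x. norm (derivs bs f x) <= C" if bs: "bs \<in> lists Basis" for bs
 proof -
  obtain C where C: "C >= 0" "!!bs x. bs \<in> lists Basis ==> norm (derivs bs f x) <= C * 1 ^ length bs * fact (length bs) * decay 1 x"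
   using Sigma1_derivs_bound[OF f zero_less_one zero_less_one] by blast
  have "norm (derivs bs f x) <= C * fact (length bs)" for x
  proof -
   have "norm (derivs bs f x) <= C * fact (length bs) * decay 1 x" using C(2)[OF bs, of x] by simp
   also have "... <= C * fact (length bs)" using C(1) by (intro mult_right_le_one_le) auto
   finally show ?thesis .
  qed
  then show ?thesis by blast
 qed
 have dc: "derivs bs (conv f g) = conv (derivs bs f) g" if "bs \<in> lists Basis" for bs
  by (rule derivs_conv(1)[OF Sigma1_smooth[OF f] _ gi that]) (rule bd)
 have dd: "conv (derivs bs f) g differentiable (at x)" if "bs \<in> lists Basis" for bs x
  by (rule derivs_conv(2)[OF Sigma1_smooth[OF f] _ gi that]) (rule bd)
 show "smooth (conv f g)" unfolding smooth_def differentiable_on_def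
 proof (intro ballI)
  fix bs x assume bs: "bs \<in> lists (Basis :: 'a set)"
  show "derivs bs (conv f g) differentiable (at x within UNIV)" 
   by (subst dc[OF bs]) (rule dd[OF bs])
 qed
 fix h k :: real assume hk: "h > 0" "k > 0"
 obtain C where C: "C >= 0" "!!bs x. bs \<in> lists Basis ==> norm (derivs bs f x) <= C * h ^ length bs * fact (length bs) * decay k x"
  using Sigma1_derivs_bound[OF f hk] by blast
 have "norm (derivs bs (conv f g) x) <= (C * (LINT y|lborel. exp (k * norm y) * norm (g y))) * h ^ length bs * fact (length bs) * decay k x"
  if bs: "bs \<in> lists Basis" for bs x
 proof -
  let ?A = "C * h ^ length bs * fact (length bs)"
  have "norm (conv (derivs bs f) g x) <= (LINT y|lborel. (?A * decay k x) * (exp (k * norm y) * norm (g y)))"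
   unfolding conv_def
  proof (rule Bochner_Integration.integral_norm_bound_integral)
   obtain D where "!!x. norm (derivs bs f x) <= D" using bd[OF bs] by blast
   then show "integrable lborel (%y. derivs bs f (x - y) * g y)"
    by (intro integrable_conv[OF smooth_borel[OF smooth_derivs[OF Sigma1_smooth[OF f] bs]] _ gi])
   show "integrable lborel (%y. (?A * decay k x) * (exp (k * norm y) * norm (g y)))"
    by (intro integrable_mult_right g)
   fix y
   have "norm x <= norm (x - y) + norm y" using norm_triangle_ineq[of "x - y" y] by simp
   then have "k * norm x <= k * (norm (x - y) + norm y)" using hk by (intro mult_left_mono) auto
   then have e: "decay k (x - y) <= decay k x * exp (k * norm y)"
    by (simp add: exp_add[symmetric] algebra_simps)
   have "norm (derivs bs f (x - y)) <= ?A * decay k (x - y)" by (rule C(2)[OF bs])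
   also have "... <= ?A * (decay k x * exp (k * norm y))"
    using C(1) hk by (intro mult_left_mono e) auto
   finally have "norm (derivs bs f (x - y)) * norm (g y) <= ?A * (decay k x * exp (k * norm y)) * norm (g y)"
    by (intro mult_right_mono) auto
   then show "norm (derivs bs f (x - y) * g y) <= (?A * decay k x) * (exp (k * norm y) * norm (g y))"
    by (simp add: norm_mult mult_ac)
  qed
  also have "... = (?A * decay k x) * (LINT y|lborel. exp (k * norm y) * norm (g y))"
   by (rule integral_mult_right_zero)
  finally show ?thesis by (simp add: dc[OF bs] mult_ac)
 qed
 then show "\<exists>C. \<forall>bs\<in>lists Basis. \<forall>x. norm (derivs bs (conv f g) x) <= C * h ^ length bs * fact (length bs) * decay k x"
  by blast
qed

lemma Sigma1_conv_Sigma1: "f \<in> Sigma1 ==> g \<in> Sigma1 ==> conv f g \<in> Sigma1"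
 by (intro Sigma1_conv Sigma1_borel Sigma1_exp_integrable)

lemma conv_commute:
 fixes f g :: "'a::euclidean_space => complex"
 assumes "f \<in> borel_measurable borel" "g \<in> borel_measurable borel"
 shows "conv f g = conv g f"
proof
 fix x
 have "(%y. f (x - y) * g y) \<in> borel_measurable borel" using assms by measurable
 from lborel_integral_affine[OF this, of "-1" x]
 show "conv f g x = conv g f x" by (simp add: conv_def mult.commute)
qed

text \<open>The factor \<open>exp (k * norm y)\<close> appears because the segment from
  \<open>x\<close> to \<open>x - y\<close> can come closer to the origin than
  \<open>x\<close>.\<close>

lemma Sigma1_Lipschitz:
 fixes f :: "'a::euclidean_space => complex"
 assumes f: "f \<in> Sigma1" and k: "k > 0"
 shows "\<exists>C\<ge>0. \<forall>x y. norm (f (x - y) - f x) <= C * norm y * exp (k * norm y) * decay k x"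
proof -
 obtain C where C: "C >= 0" "!!bs x. bs \<in> lists Basis ==> norm (derivs bs f x) <= C * 1 ^ length bs * fact (length bs) * decay k x"
  using Sigma1_derivs_bound[OF f zero_less_one k] by blast
 show ?thesis
 proof (intro exI[of _ "DIM('a) * C"] conjI allI)
  fix x y :: 'a
  have "norm (f (x - y) - f x) <= DIM('a) * (C * (exp (k * norm y) * decay k x)) * norm ((x - y) - x)"
  proof (rule smooth_segment_bound[OF Sigma1_smooth[OF f]])
   fix w b :: 'a assume w: "w \<in> closed_segment x (x - y)" and b: "b \<in> Basis"
   have "norm (w - x) <= norm y" using segment_bound1[OF w] by simp
   then have "norm x <= norm w + norm y" using norm_triangle_ineq4[of w "w - x"] by simp
   then have "k * norm x <= k * (norm w + norm y)" using k by (intro mult_left_mono) auto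
   then have e: "decay k w <= exp (k * norm y) * decay k x"
    by (simp add: exp_add[symmetric] algebra_simps)
   have "norm (pd b f w) <= C * decay k w" using C(2)[of "[b]" w] b by simp
   also have "... <= C * (exp (k * norm y) * decay k x)" using C(1) by (intro mult_left_mono e)
   finally show "norm (pd b f w) <= C * (exp (k * norm y) * decay k x)" .
  qed
  then show "norm (f (x - y) - f x) <= DIM('a) * C * norm y * exp (k * norm y) * decay k x"
   by (simp add: mult_ac)
 qed (use C in simp)
qed

section \<open>Gaussians\<close>

text \<open>One function of a complex variable per coordinate: for entire factors the partial
  derivatives are complex derivatives, so Cauchy's estimates apply.\<close>

definition tensor :: "('a::euclidean_space => complex => complex) => 'a => complex" where
 "tensor G x = (\<Prod>b\<in>Basis. G b (of_real (x \<bullet> b)))"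

lemma tensor_has_derivative:
 fixes G :: "'a::euclidean_space => complex => complex"
 assumes "!!b. b \<in> Basis ==> G b holomorphic_on UNIV"
 shows "(tensor G has_derivative (%h. \<Sum>b\<in>Basis. deriv (G b) (of_real (x \<bullet> b)) * of_real (h \<bullet> b) * (\<Prod>c\<in>Basis - {b}. G c (of_real (x \<bullet> c))))) (at x)"
 unfolding tensor_def[abs_def]
proof (rule has_derivative_prod)
 fix b :: 'a assume b: "b \<in> Basis"
 have "(G b has_field_derivative deriv (G b) (of_real (x \<bullet> b))) (at (of_real (x \<bullet> b)))"
  using holomorphic_derivI[OF assms[OF b] open_UNIV] by simp
 then have d: "(G b has_derivative (*) (deriv (G b) (of_real (x \<bullet> b)))) (at (of_real (x \<bullet> b)))"
  by (rule has_field_derivative_imp_has_derivative)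
 have "((%x. complex_of_real (x \<bullet> b)) has_derivative (%h. of_real (h \<bullet> b))) (at x)"
  by (intro bounded_linear_imp_has_derivative bounded_linear_compose[OF bounded_linear_of_real] bounded_linear_inner_left)
 from has_derivative_compose[OF this d]
 show "((%x. G b (of_real (x \<bullet> b))) has_derivative (%h. deriv (G b) (of_real (x \<bullet> b)) * of_real (h \<bullet> b))) (at x)" .
qed

lemma partial_deriv_tensor:
 fixes G :: "'a::euclidean_space => complex => complex"
 assumes G: "!!b. b \<in> Basis ==> G b holomorphic_on UNIV" and b: "b \<in> Basis"
 shows "pd b (tensor G) = tensor (G(b := deriv (G b)))"
proof
 fix x
 have "pd b (tensor G) x = (\<Sum>c\<in>Basis. deriv (G c) (of_real (x \<bullet> c)) * of_real (b \<bullet> c) * (\<Prod>d\<in>Basis - {c}. G d (of_real (x \<bullet> d))))"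
  by (subst partial_deriv_eqI[OF tensor_has_derivative[OF G]]) auto
 also have "... = (\<Sum>c\<in>Basis. if c = b then deriv (G b) (of_real (x \<bullet> b)) * (\<Prod>d\<in>Basis - {b}. G d (of_real (x \<bullet> d))) else 0)"
  using b by (intro sum.cong) (auto simp: inner_Basis)
 also have "... = deriv (G b) (of_real (x \<bullet> b)) * (\<Prod>d\<in>Basis - {b}. G d (of_real (x \<bullet> d)))"
  using b by simp
 also have "... = tensor (G(b := deriv (G b))) x"
  unfolding tensor_def using b by (subst prod.remove[of Basis b]) (auto intro!: prod.cong)
 finally show "pd b (tensor G) x = tensor (G(b := deriv (G b))) x" .
qed

lemma smooth_tensor:
 fixes G :: "'a::euclidean_space => complex => complex"
 assumes "!!b. b \<in> Basis ==> G b holomorphic_on UNIV"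
 shows "smooth (tensor G)"
proof (rule smooth_coinduct[where S="{tensor G | G. \<forall>b\<in>Basis. G b holomorphic_on UNIV}"])
 fix f :: "'a => complex" and b x :: 'a
 assume "f \<in> {tensor G | G. \<forall>b\<in>Basis. G b holomorphic_on UNIV}"
 then obtain G where G: "f = tensor G" "!!b. b \<in> Basis ==> G b holomorphic_on UNIV" by blast
 show "f differentiable (at x)" unfolding G(1) differentiable_def using tensor_has_derivative[of G, OF G(2)] by blast
 assume b: "b \<in> Basis"
 have "\<forall>c\<in>Basis. (G(b := deriv (G b))) c holomorphic_on UNIV" using G(2) b by (auto intro: holomorphic_deriv)
 then show "pd b f \<in> {tensor G | G. \<forall>b\<in>Basis. G b holomorphic_on UNIV}"
  unfolding G(1) using partial_deriv_tensor[of G b, OF G(2) b] by blast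
qed (use assms in blast)

lemma holomorphic_higher_deriv_UNIV: "g holomorphic_on UNIV ==> (deriv ^^ n) g holomorphic_on UNIV"
 by (induction n) (auto intro: holomorphic_deriv)

lemma multi_deriv_tensor:
 fixes G :: "'a::euclidean_space => complex => complex"
 assumes G: "!!b. b \<in> Basis ==> G b holomorphic_on UNIV"
 shows "multi_deriv beta (tensor G) = tensor (%b. (deriv ^^ beta b) (G b))"
proof -
 have pow: "(pd b ^^ n) (tensor H) = tensor (H(b := (deriv ^^ n) (H b)))"
  if H: "!!b. b \<in> Basis ==> H b holomorphic_on UNIV" and b: "b \<in> Basis" for H :: "'a => complex => complex" and b n
 proof (induction n)
  case (Suc n)
  have "(pd b ^^ Suc n) (tensor H) = pd b (tensor (H(b := (deriv ^^ n) (H b))))"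
   by (simp only: funpow.simps o_apply Suc.IH)
  also have "... = tensor (H(b := (deriv ^^ n) (H b), b := deriv ((H(b := (deriv ^^ n) (H b))) b)))"
   using H b by (intro partial_deriv_tensor) (auto intro: holomorphic_higher_deriv_UNIV)
  also have "H(b := (deriv ^^ n) (H b), b := deriv ((H(b := (deriv ^^ n) (H b))) b)) = H(b := (deriv ^^ Suc n) (H b))"
   by (simp add: fun_eq_iff)
  finally show ?case .
 qed simp
 have "foldr (%b. pd b ^^ beta b) es (tensor G) = tensor (%b. if b \<in> set es then (deriv ^^ beta b) (G b) else G b)"
  if "distinct es" "set es \<subseteq> Basis" for es
  using that
 proof (induction es)
  case (Cons e es)
  let ?H = "%b. if b \<in> set es then (deriv ^^ beta b) (G b) else G b"
  have "foldr (%b. pd b ^^ beta b) (e # es) (tensor G) = tensor (?H(e := (deriv ^^ beta e) (?H e)))"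
   using Cons G by (simp add: pow holomorphic_higher_deriv_UNIV)
  also have "?H(e := (deriv ^^ beta e) (?H e)) = (%b. if b \<in> set (e # es) then (deriv ^^ beta b) (G b) else G b)"
   using Cons.prems(1) by (auto simp: fun_eq_iff)
  finally show ?case .
 qed simp
 from this[OF basis_enum(1)] show ?thesis
  unfolding multi_deriv_def by (auto simp: basis_enum(2) tensor_def fun_eq_iff intro!: prod.cong)
qed

text \<open>Cauchy's estimate on the disc of radius \<open>1 / h\<close> around \<open>s\<close>.
  There the Gaussian is at most a constant times \<open>exp (- k * \<bar>s\<bar>)\<close>, since
  \<open>2 * k * \<bar>Re w\<bar>\<close> is at most the sum of the squares of \<open>Re w\<close>
  and \<open>k\<close>.\<close>

lemma deriv_gauss_bound:
 fixes h k s :: real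
 assumes h: "h > 0" and k: "k > 0"
 shows "norm ((deriv ^^ n) (%z::complex. exp (- z\<^sup>2 / 2)) (of_real s))
  <= (1 + exp (1 / h\<^sup>2 / 2 + k / h + k\<^sup>2 / 2)) * h ^ n * fact n * exp (- k * \<bar>s\<bar>)"
proof -
 define R where "R = 1 / h"
 define A where "A = exp (R\<^sup>2 / 2 + k * R + k\<^sup>2 / 2)"
 have R: "R > 0" using h by (simp add: R_def)
 let ?g = "%z::complex. exp (- z\<^sup>2 / 2)"
 have bound: "norm (?g w) <= A * exp (- k * \<bar>s\<bar>)" if "norm (w - of_real s) <= R" for w
 proof -
  have 1: "\<bar>Re w - s\<bar> <= R" "\<bar>Im w\<bar> <= R"
   using that abs_Re_le_cmod[of "w - of_real s"] abs_Im_le_cmod[of "w - of_real s"] by auto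
  have "(Im w)\<^sup>2 <= R\<^sup>2" using 1(2) R by (simp add: abs_le_square_iff[symmetric])
  moreover have "\<bar>s\<bar> - R <= \<bar>Re w\<bar>" using 1(1) by linarith
  then have "k * (\<bar>s\<bar> - R) <= k * \<bar>Re w\<bar>" using k by (intro mult_left_mono) auto
  moreover have "0 <= (\<bar>Re w\<bar> - k)\<^sup>2" by simp
  then have "2 * k * \<bar>Re w\<bar> <= (Re w)\<^sup>2 + k\<^sup>2" by (simp add: power2_diff algebra_simps)
  ultimately have "(Im w)\<^sup>2 / 2 - (Re w)\<^sup>2 / 2 <= R\<^sup>2 / 2 + k * R + k\<^sup>2 / 2 - k * \<bar>s\<bar>"
   by (simp add: algebra_simps)
  then have "exp (Re (- w\<^sup>2 / 2)) <= exp (R\<^sup>2 / 2 + k * R + k\<^sup>2 / 2 - k * \<bar>s\<bar>)"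
   by (simp add: power2_eq_square diff_divide_distrib)
  also have "exp (R\<^sup>2 / 2 + k * R + k\<^sup>2 / 2 - k * \<bar>s\<bar>) = A * exp (- k * \<bar>s\<bar>)"
   unfolding A_def mult_exp_exp by simp
  finally show ?thesis by simp
 qed
 \<comment> \<open>The added 1 makes the bound strict, as Cauchy's estimate asks for values in an
   open ball.\<close>
 define B0 where "B0 = (1 + A) * exp (- k * \<bar>s\<bar>)"
 have AB: "A * exp (- k * \<bar>s\<bar>) < B0" by (simp add: B0_def)
 have "norm ((deriv ^^ n) ?g (of_real s)) <= fact n * B0 / R ^ n"
 proof (cases "n = 0")
  case True
  have "norm (?g (of_real s)) <= A * exp (- k * \<bar>s\<bar>)" using R by (intro bound) simp
  then have "norm (?g (of_real s)) <= B0" using AB by linarith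
  then show ?thesis using True by simp
 next
  case False
  show ?thesis
  proof (rule Cauchy_higher_deriv_bound[where y=0])
   show "?g holomorphic_on ball (of_real s) R" by (intro holomorphic_intros) auto
   show "continuous_on (cball (of_real s) R) ?g" by (intro continuous_intros) auto
   show "?g w \<in> ball 0 B0" if "w \<in> ball (of_real s) R" for w
    using bound[of w] that AB by (simp add: dist_norm norm_minus_commute)
  qed (use R False in auto)
 qed
 also have "fact n * B0 / R ^ n = (1 + A) * h ^ n * fact n * exp (- k * \<bar>s\<bar>)"
  using h by (simp add: B0_def R_def power_divide)
 also have "A = exp (1 / h\<^sup>2 / 2 + k / h + k\<^sup>2 / 2)" by (simp add: A_def R_def power_divide)
 finally show ?thesis .
qed

lemma gauss_tensor: "tensor (%_ z. exp (- z\<^sup>2 / 2)) x = of_real (exp (- (norm x)\<^sup>2 / 2))"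
proof -
 have "tensor (%_ z. exp (- z\<^sup>2 / 2)) x = exp (\<Sum>b\<in>Basis. - (of_real (x \<bullet> b))\<^sup>2 / 2)"
  by (simp add: tensor_def exp_sum)
 also have "(\<Sum>b\<in>Basis. - (of_real (x \<bullet> b))\<^sup>2 / 2) = (of_real (- (norm x)\<^sup>2 / 2) :: complex)"
 proof -
  have "(norm x)\<^sup>2 = (\<Sum>b\<in>Basis. (x \<bullet> b)\<^sup>2)"
   by (subst power2_norm_eq_inner, subst euclidean_inner) (simp add: power2_eq_square)
  then show ?thesis by (simp add: sum_negf sum_divide_distrib)
 qed
 finally show ?thesis by (simp add: exp_of_real[symmetric])
qed

lemma Sigma1_gauss: "(%x::'a::euclidean_space. of_real (exp (- (norm x)\<^sup>2 / 2))) \<in> Sigma1"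
proof -
 let ?G = "%_::'a. %z::complex. exp (- z\<^sup>2 / 2)"
 have hol: "?G b holomorphic_on UNIV" for b by (intro holomorphic_intros) auto
 have "tensor ?G \<in> Sigma1"
 proof (rule Sigma1I_multi[OF smooth_tensor[OF hol]])
  fix h k :: real assume hk: "h > 0" "k > 0"
  define A where "A = 1 + exp (1 / h\<^sup>2 / 2 + k / h + k\<^sup>2 / 2)"
  have A: "A > 0" by (simp add: A_def add_pos_pos)
  have "norm (multi_deriv beta (tensor ?G) x) <= A ^ DIM('a) * h ^ multi_abs beta * multi_fact beta * decay k x" for beta x
  proof -
   have "norm (multi_deriv beta (tensor ?G) x) = (\<Prod>b\<in>Basis. norm ((deriv ^^ beta b) (?G b) (of_real (x \<bullet> b))))"
    unfolding multi_deriv_tensor[of ?G, OF hol] tensor_def by (rule prod_norm[symmetric])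
   also have "... <= (\<Prod>b\<in>Basis. A * h ^ beta b * fact (beta b) * exp (- k * \<bar>x \<bullet> b\<bar>))"
    unfolding A_def by (intro prod_mono conjI norm_ge_zero deriv_gauss_bound hk)
   also have "... = A ^ DIM('a) * h ^ multi_abs beta * multi_fact beta * exp (- k * (\<Sum>b\<in>Basis. \<bar>x \<bullet> b\<bar>))"
    by (simp add: prod.distrib multi_abs_def multi_fact_def power_sum exp_sum sum_distrib_left sum_negf[symmetric])
   also have "... <= A ^ DIM('a) * h ^ multi_abs beta * multi_fact beta * decay k x"
    using A hk norm_le_l1[of x] by (intro mult_left_mono) (auto simp: multi_fact_def intro!: mult_nonneg_nonneg prod_nonneg)
   finally show ?thesis .
  qed
  then show "\<exists>C. \<forall>beta x. norm (multi_deriv beta (tensor ?G) x) <= C * h ^ multi_abs beta * multi_fact beta * decay k x" by blast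
 qed
 moreover have "tensor ?G = (%x. of_real (exp (- (norm x)\<^sup>2 / 2)))" by (rule ext) (rule gauss_tensor)
 ultimately show ?thesis by (simp only:)
qed

section \<open>Fourier inversion\<close>

lemma borel_measurable_cnj [measurable]:
 "f \<in> borel_measurable M ==> (%x. cnj (f x)) \<in> borel_measurable M"
 by (rule measurable_compose[OF _ borel_measurable_continuous_onI]) (auto intro: continuous_intros)

lemma lborel_integral_tensor:
 fixes f :: "'a::euclidean_space => real => complex"
 assumes "!!b. b \<in> Basis ==> integrable lborel (f b)"
 shows "(LINT x|lborel. (\<Prod>b\<in>Basis. f b (x \<bullet> b))) = (\<Prod>b\<in>Basis. (LINT x|lborel. f b x))"
proof -
 interpret product_sigma_finite "%_::'a. lborel :: real measure" ..
 have m: "f b \<in> borel_measurable borel" if "b \<in> Basis" for b using assms[OF that] by auto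
 have fm: "(%x. \<Prod>b\<in>Basis. f b (x \<bullet> b)) \<in> borel_measurable borel"
  by (intro borel_measurable_prod measurable_compose[OF _ m]) auto
 have mm: "(%g. \<Sum>b\<in>Basis. g b *\<^sub>R b) \<in> measurable (Pi\<^sub>M Basis (%_::'a. lborel)) borel"
  by measurable
 have "(LINT x|lborel. (\<Prod>b\<in>Basis. f b (x \<bullet> b)))
  = (LINT x|Measure_Space.distr (Pi\<^sub>M Basis (%_::'a. lborel)) borel (%g. \<Sum>b\<in>Basis. g b *\<^sub>R b). (\<Prod>b\<in>Basis. f b (x \<bullet> b)))"
  by (subst lborel_eq) simp
 also have "... = (LINT g|Pi\<^sub>M Basis (%_::'a. lborel). (\<Prod>b\<in>Basis. f b ((\<Sum>b\<in>Basis. g b *\<^sub>R b) \<bullet> b)))"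
  by (rule integral_distr[OF mm fm])
 also have "... = (LINT g|Pi\<^sub>M Basis (%_::'a. lborel). (\<Prod>b\<in>Basis. f b (g b)))"
  by (intro Bochner_Integration.integral_cong refl prod.cong) simp_all
 also have "... = (\<Prod>b\<in>Basis. (LINT x|lborel. f b x))"
  by (rule product_integral_prod) (auto intro: assms)
 finally show ?thesis .
qed

abbreviation gauss :: "'a::real_normed_vector => real" where
 "gauss x \<equiv> exp (- (norm x)\<^sup>2 / 2)"

text \<open>Read off from the characteristic function of the standard normal distribution.\<close>

lemma gauss_integral_1d:
 fixes t :: real
 shows "integrable lborel (%s. exp (- \<i> * of_real (s * t)) * of_real (exp (- s\<^sup>2 / 2)))"
  "(LINT s|lborel. exp (- \<i> * of_real (s * t)) * of_real (exp (- s\<^sup>2 / 2))) = of_real (sqrt (2 * pi) * exp (- t\<^sup>2 / 2))"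
proof -
 have d: "std_normal_density s = exp (- s\<^sup>2 / 2) / sqrt (2 * pi)" for s
  by (simp add: std_normal_density_def)
 have "integrable lborel std_normal_density" by simp
 then have "integrable lborel (%s. sqrt (2 * pi) * std_normal_density s)" by (rule integrable_mult_right)
 then have i: "integrable lborel (%s::real. exp (- s\<^sup>2 / 2))" by (simp add: d)
 show int: "integrable lborel (%s. exp (- \<i> * of_real (s * t)) * of_real (exp (- s\<^sup>2 / 2)))"
  by (rule integrable_dominated[OF i]) (auto simp: norm_mult)
 have "of_real (exp (- t\<^sup>2 / 2)) = char std_normal_distribution (- t)"
  by (simp add: char_std_normal_distribution)
 also have "... = (LINT s|lborel. std_normal_density s *\<^sub>R exp (\<i> * of_real (- t * s)))"
  unfolding char_def by (subst integral_density) (auto simp: normal_density_nonneg)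
 also have "... = (LINT s|lborel. of_real (1 / sqrt (2 * pi)) * (exp (- \<i> * of_real (s * t)) * of_real (exp (- s\<^sup>2 / 2))))"
  by (intro Bochner_Integration.integral_cong refl) (simp add: d scaleR_conv_of_real mult_ac)
 also have "... = of_real (1 / sqrt (2 * pi)) * (LINT s|lborel. exp (- \<i> * of_real (s * t)) * of_real (exp (- s\<^sup>2 / 2)))"
  by (rule integral_mult_right_zero)
 finally show "(LINT s|lborel. exp (- \<i> * of_real (s * t)) * of_real (exp (- s\<^sup>2 / 2))) = of_real (sqrt (2 * pi) * exp (- t\<^sup>2 / 2))"
  by (simp add: field_simps)
qed

text \<open>The integral of \<open>gauss\<close>. As \<open>character\<close> carries no
  normalization, the constant of Fourier inversion is the square of this number.\<close>

definition gauss_mass :: "'a::euclidean_space itself => real" where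
 "gauss_mass _ = sqrt (2 * pi) ^ DIM('a)"

lemma gauss_mass_pos: "gauss_mass (TYPE('a::euclidean_space)) > 0"
 by (simp add: gauss_mass_def)

lemma norm_power2_sum: "(norm x)\<^sup>2 = (\<Sum>b\<in>Basis. (x \<bullet> b)\<^sup>2)"
 by (subst power2_norm_eq_inner, subst euclidean_inner) (simp add: power2_eq_square)

lemma gauss_fourier:
 fixes xi :: "'a::euclidean_space"
 shows "(LINT x|lborel. character xi x * of_real (gauss x)) = of_real (gauss_mass TYPE('a) * gauss xi)"
proof -
 have "character xi x * of_real (gauss x) = (\<Prod>b\<in>Basis. exp (- \<i> * of_real ((x \<bullet> b) * (xi \<bullet> b))) * of_real (exp (- (x \<bullet> b)\<^sup>2 / 2)))" for x
 proof -
  have "character xi x = (\<Prod>b\<in>Basis. exp (- \<i> * of_real ((x \<bullet> b) * (xi \<bullet> b))))"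
   unfolding character_def by (subst euclidean_inner) (simp add: exp_sum[symmetric] sum_distrib_left sum_negf)
  moreover have "(of_real (gauss x) :: complex) = (\<Prod>b\<in>Basis. of_real (exp (- (x \<bullet> b)\<^sup>2 / 2)))"
   unfolding norm_power2_sum of_real_prod[symmetric] by (simp add: exp_sum[symmetric] sum_negf sum_divide_distrib)
  ultimately show ?thesis by (simp only: prod.distrib)
 qed
 then have "(LINT x|lborel. character xi x * of_real (gauss x))
  = (LINT x|lborel. (\<Prod>b\<in>Basis. exp (- \<i> * of_real ((x \<bullet> b) * (xi \<bullet> b))) * of_real (exp (- (x \<bullet> b)\<^sup>2 / 2))))"
  by simp
 also have "... = (\<Prod>b\<in>Basis. (LINT s|lborel. exp (- \<i> * of_real (s * (xi \<bullet> b))) * of_real (exp (- s\<^sup>2 / 2))))"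
  by (rule lborel_integral_tensor) (rule gauss_integral_1d(1))
 also have "... = (\<Prod>b\<in>Basis. of_real (sqrt (2 * pi) * exp (- (xi \<bullet> b)\<^sup>2 / 2)))"
  by (simp only: gauss_integral_1d(2))
 also have "... = of_real (\<Prod>b\<in>Basis. sqrt (2 * pi) * exp (- (xi \<bullet> b)\<^sup>2 / 2))" by (rule of_real_prod[symmetric])
 also have "(\<Prod>b\<in>Basis. sqrt (2 * pi) * exp (- (xi \<bullet> b)\<^sup>2 / 2)) = gauss_mass TYPE('a) * gauss xi"
  unfolding norm_power2_sum by (simp add: prod.distrib gauss_mass_def exp_sum[symmetric] sum_negf sum_divide_distrib)
 finally show ?thesis .
qed

lemma integrable_gauss: "integrable lborel (gauss :: 'a::euclidean_space => real)"
proof -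
 have "integrable lborel (%x::'a. complex_of_real (gauss x))" by (rule Sigma1_integrable[OF Sigma1_gauss])
 then have "integrable lborel (%x::'a. Re (complex_of_real (gauss x)))" by (rule integrable_Re)
 then show ?thesis by simp
qed

lemma gauss_integral: "(LINT x|lborel. gauss (x::'a::euclidean_space)) = gauss_mass TYPE('a)"
proof -
 have "complex_of_real (LINT x|lborel. gauss (x::'a)) = (LINT x|lborel. complex_of_real (gauss (x::'a)))" by simp
 also have "... = of_real (gauss_mass TYPE('a))" using gauss_fourier[of "0::'a"] by (simp add: character_def)
 finally show ?thesis by (simp only: of_real_eq_iff)
qed

section \<open>Fubini and Fourier inversion\<close>

text \<open>A majorant of product form is what makes Fubini's theorem applicable to the double
  integrals below.\<close>

lemma lborel_integrable_prod_bound: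
 fixes F :: "'a::euclidean_space \<times> 'b::euclidean_space => complex"
 assumes F: "F \<in> borel_measurable borel" and a: "integrable lborel a" and b: "integrable lborel b"
  and le: "!!x y. norm (F (x, y)) <= a x * b y"
 shows "integrable lborel F"
proof -
 have am: "a \<in> borel_measurable borel" and bm: "b \<in> borel_measurable borel" using a b by auto
 have "integrable (lborel \<Otimes>\<^sub>M lborel) (%(x, y). a x * b y)"
 proof (rule lborel_pair.Fubini_integrable)
  show "(%(x, y). a x * b y) \<in> borel_measurable (lborel \<Otimes>\<^sub>M lborel)" using am bm by measurable
  have "(%x. LINT y|lborel. norm (case (x, y) of (x, y) => a x * b y)) = (%x. \<bar>a x\<bar> * (LINT y|lborel. \<bar>b y\<bar>))"
   by (simp add: abs_mult)
  then show "integrable lborel (%x. LINT y|lborel. norm (case (x, y) of (x, y) => a x * b y))"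
   using a by simp
  show "AE x in lborel. integrable lborel (%y. case (x, y) of (x, y) => a x * b y)" using b by simp
 qed
 then have i: "integrable lborel (%(x, y). a x * b y)" by (simp add: lborel_prod)
 show ?thesis
 proof (rule integrable_dominated[OF i])
  show "F \<in> borel_measurable lborel" using F by simp
  show "AE x in lborel. norm (F x) <= norm (case x of (x, y) => a x * b y)"
   using le by (intro AE_I2) (auto split: prod.splits intro: order_trans[OF le abs_ge_self])
 qed
qed

lemma lborel_Fubini:
 fixes F :: "'a::euclidean_space \<times> 'b::euclidean_space => complex"
 assumes "integrable lborel F"
 shows "(LINT y|lborel. (LINT x|lborel. F (x, y))) = (LINT z|lborel. F z)"
  "(LINT x|lborel. (LINT y|lborel. F (x, y))) = (LINT z|lborel. F z)"
proof -
 have i: "integrable (lborel \<Otimes>\<^sub>M lborel) F" using assms by (simp add: lborel_prod)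
 show 1: "(LINT x|lborel. (LINT y|lborel. F (x, y))) = (LINT z|lborel. F z)"
  using lborel_pair.integral_fst'[OF i] by (simp add: lborel_prod)
 have "integrable (lborel \<Otimes>\<^sub>M lborel) (case_prod (%x y. F (x, y)))" using i by simp
 from lborel_pair.Fubini_integral[OF this]
 show "(LINT y|lborel. (LINT x|lborel. F (x, y))) = (LINT z|lborel. F z)" using 1 by simp
qed

lemma character_borel [measurable]: "character xi \<in> borel_measurable borel"
 unfolding character_def[abs_def] by measurable

text \<open>Gaussian summation: the damping factor \<open>gauss (e n *\<^sub>R eta)\<close> makes
  the double integral absolutely convergent. The integral over \<open>eta\<close> is then a Gaussian
  by \<open>gauss_fourier\<close>, and what remains is an average of \<open>u\<close> near
  \<open>t\<close>. Both descriptions of \<open>J n\<close> have limits as \<open>e n\<close> tends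
  to 0.\<close>

lemma fourier_inversion:
 fixes u :: "'a::euclidean_space => complex"
 assumes cont: "continuous_on UNIV u" and ui: "integrable lborel u" and bd: "!!x. norm (u x) <= K"
  and U: "integrable lborel U" "!!eta. U eta = (LINT s|lborel. u s * character eta s)"
 shows "(LINT eta|lborel. U eta * cnj (character eta t)) = of_real ((gauss_mass TYPE('a))\<^sup>2) * u t"
proof -
 let ?c = "gauss_mass TYPE('a)"
 define e where "e n = 1 / (real n + 1)" for n
 have e: "e n > 0" for n by (simp add: e_def)
 have elim: "e \<longlonglongrightarrow> 0"
  unfolding e_def using LIMSEQ_inverse_real_of_nat by (simp add: inverse_eq_divide add.commute)
 define J where "J n = (LINT eta|lborel. U eta * cnj (character eta t) * of_real (gauss (e n *\<^sub>R eta)))" for n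
 have Um: "U \<in> borel_measurable borel" using U(1) by auto
 have um: "u \<in> borel_measurable borel" using ui by auto
 have cm: "(%eta. character eta t) \<in> borel_measurable borel" for t :: 'a
  unfolding character_def by measurable
 have lim1: "J \<longlonglongrightarrow> (LINT eta|lborel. U eta * cnj (character eta t))"
  unfolding J_def
 proof (rule integral_dominated_convergence[where w = "%eta. norm (U eta)"])
  show "(%eta. U eta * cnj (character eta t)) \<in> borel_measurable lborel" using Um cm by measurable
  show "(%eta. U eta * cnj (character eta t) * of_real (gauss (e n *\<^sub>R eta))) \<in> borel_measurable lborel" for n
   using Um cm by measurable
  show "integrable lborel (%eta. norm (U eta))" by (rule integrable_norm[OF U(1)])
  show "AE eta in lborel. (%n. U eta * cnj (character eta t) * of_real (gauss (e n *\<^sub>R eta))) \<longlonglongrightarrow> U eta * cnj (character eta t)"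
  proof (rule AE_I2)
   fix eta
   have "(%n. U eta * cnj (character eta t) * of_real (gauss (e n *\<^sub>R eta))) \<longlonglongrightarrow> U eta * cnj (character eta t) * of_real (gauss (0 *\<^sub>R eta))"
    by (intro tendsto_intros elim) simp
   then show "(%n. U eta * cnj (character eta t) * of_real (gauss (e n *\<^sub>R eta))) \<longlonglongrightarrow> U eta * cnj (character eta t)" by simp
  qed
  show "AE eta in lborel. norm (U eta * cnj (character eta t) * of_real (gauss (e n *\<^sub>R eta))) <= norm (U eta)" for n
   by (intro AE_I2) (simp add: norm_mult mult_left_le)
 qed
 \<comment> \<open>The two substitutions produce reciprocal powers of \<open>e n\<close>, which
   cancel.\<close>
 have J: "J n = of_real ?c * (LINT z|lborel. u (t + e n *\<^sub>R z) * of_real (gauss z))" for n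
 proof -
  define F where "F z = u (fst z) * character (snd z) (fst z) * cnj (character (snd z) t) * of_real (gauss (e n *\<^sub>R snd z))" for z :: "'a \<times> 'a"
  have Fc: "continuous_on UNIV F"
   unfolding F_def character_def by (intro continuous_intros continuous_on_compose2[OF cont]) auto
  have Fi: "integrable lborel F"
  proof (rule lborel_integrable_prod_bound)
   show "F \<in> borel_measurable borel" by (rule borel_measurable_continuous_onI[OF Fc])
   show "integrable lborel (%x. norm (u x))" using ui by auto
   show "integrable lborel (%y::'a. gauss (e n *\<^sub>R y))"
    using lborel_integrable_affine[OF integrable_gauss, of "e n" 0] e[of n] by simp
   show "norm (F (x, y)) <= norm (u x) * gauss (e n *\<^sub>R y)" for x y by (simp add: F_def norm_mult)
  qed
  have "J n = (LINT eta|lborel. LINT s|lborel. F (s, eta))"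
   unfolding J_def
  proof (intro Bochner_Integration.integral_cong refl)
   fix eta
   have "(LINT s|lborel. F (s, eta)) = (LINT s|lborel. u s * character eta s * (cnj (character eta t) * of_real (gauss (e n *\<^sub>R eta))))"
    by (simp only: F_def fst_conv snd_conv mult.assoc)
   also have "... = U eta * (cnj (character eta t) * of_real (gauss (e n *\<^sub>R eta)))"
    unfolding U(2) by (rule integral_mult_left_zero)
   finally show "U eta * cnj (character eta t) * of_real (gauss (e n *\<^sub>R eta)) = (LINT s|lborel. F (s, eta))"
    by (simp only: mult.assoc)
  qed
  also have "... = (LINT s|lborel. LINT eta|lborel. F (s, eta))" using lborel_Fubini[OF Fi] by simp
  also have "... = (LINT s|lborel. u s * ((1 / (e n) ^ DIM('a)) *\<^sub>R (of_real (?c * gauss ((1 / e n) *\<^sub>R (s - t))))))"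
  proof (intro Bochner_Integration.integral_cong refl)
   fix s
   let ?h = "%\<zeta>. character ((1 / e n) *\<^sub>R (s - t)) \<zeta> * of_real (gauss \<zeta>)"
   have "character eta s * cnj (character eta t) * of_real (gauss (e n *\<^sub>R eta)) = ?h (0 + e n *\<^sub>R eta)" for eta
   proof -
    have "character eta s * cnj (character eta t) = character ((1 / e n) *\<^sub>R (s - t)) (e n *\<^sub>R eta)"
     using e[of n] by (simp add: character_def exp_cnj exp_add[symmetric] inner_diff_left inner_diff_right algebra_simps inner_commute)
    then show ?thesis by simp
   qed
   then have "(LINT eta|lborel. F (s, eta)) = (LINT eta|lborel. u s * ?h (0 + e n *\<^sub>R eta))"
    by (simp add: F_def mult.assoc)
   also have "... = u s * (LINT eta|lborel. ?h (0 + e n *\<^sub>R eta))" by (rule integral_mult_right_zero)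
   also have "(LINT eta|lborel. ?h (0 + e n *\<^sub>R eta)) = (1 / (e n) ^ DIM('a)) *\<^sub>R (LINT \<zeta>|lborel. ?h \<zeta>)"
    using lborel_integral_affine[of ?h "e n" 0] e[of n] by simp
   also have "(LINT \<zeta>|lborel. ?h \<zeta>) = of_real (?c * gauss ((1 / e n) *\<^sub>R (s - t)))" by (rule gauss_fourier)
   finally show "(LINT eta|lborel. F (s, eta)) = u s * ((1 / (e n) ^ DIM('a)) *\<^sub>R (of_real (?c * gauss ((1 / e n) *\<^sub>R (s - t)))))" .
  qed
  also have "... = \<bar>e n\<bar> ^ DIM('a) *\<^sub>R (LINT z|lborel. u (t + e n *\<^sub>R z) * ((1 / (e n) ^ DIM('a)) *\<^sub>R (of_real (?c * gauss ((1 / e n) *\<^sub>R ((t + e n *\<^sub>R z) - t))))))"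
   using um e[of n] by (intro lborel_integral_affine) auto
  also have "... = of_real ?c * (LINT z|lborel. u (t + e n *\<^sub>R z) * of_real (gauss z))"
   using e[of n] by (simp add: scaleR_conv_of_real mult_ac)
  finally show ?thesis .
 qed
 have "(%n. LINT z|lborel. u (t + e n *\<^sub>R z) * of_real (gauss z)) \<longlonglongrightarrow> (LINT z|lborel. u t * of_real (gauss (z::'a)))"
 proof (rule integral_dominated_convergence[where w = "%z. K * gauss z"])
  show "(%z. u t * of_real (gauss z)) \<in> borel_measurable lborel" by measurable
  show "(%z. u (t + e n *\<^sub>R z) * of_real (gauss z)) \<in> borel_measurable lborel" for n using um by measurable
  show "integrable lborel (%z::'a. K * gauss z)" by (intro integrable_mult_right integrable_gauss)
  show "AE z in lborel. (%n. u (t + e n *\<^sub>R z) * of_real (gauss z)) \<longlonglongrightarrow> u t * of_real (gauss z)"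
  proof (rule AE_I2)
   fix z
   have "isCont u t" using cont by (simp add: continuous_on_eq_continuous_at)
   moreover have "(%n. t + e n *\<^sub>R z) \<longlonglongrightarrow> t + 0 *\<^sub>R z" by (intro tendsto_intros elim)
   ultimately have "(%n. u (t + e n *\<^sub>R z)) \<longlonglongrightarrow> u t" using isCont_tendsto_compose[of t u] by simp
   then show "(%n. u (t + e n *\<^sub>R z) * of_real (gauss z)) \<longlonglongrightarrow> u t * of_real (gauss z)" by (intro tendsto_intros)
  qed
  show "AE z in lborel. norm (u (t + e n *\<^sub>R z) * of_real (gauss z)) <= K * gauss z" for n
   using bd by (intro AE_I2) (simp add: norm_mult mult_right_mono)
 qed
 then have "J \<longlonglongrightarrow> of_real ?c * (LINT z|lborel. u t * of_real (gauss (z::'a)))"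
  unfolding J by (intro tendsto_intros)
 also have "(LINT z|lborel. u t * of_real (gauss (z::'a))) = u t * (LINT z|lborel. complex_of_real (gauss (z::'a)))"
  by (rule integral_mult_right_zero)
 also have "(LINT z|lborel. complex_of_real (gauss (z::'a))) = of_real ?c"
  using gauss_fourier[of "0::'a"] by (simp add: character_def)
 finally have lim2: "J \<longlonglongrightarrow> of_real (?c\<^sup>2) * u t" by (simp add: power2_eq_square mult_ac)
 show ?thesis by (rule LIMSEQ_unique[OF lim1 lim2])
qed

section \<open>Short-time Fourier transforms of test functions\<close>

text \<open>The transform \<open>STFT\<close> for functions, on any Euclidean space and without the
  normalizing factor; \<open>STFT_distr\<close> relates the two.\<close>

definition stft :: "('a::euclidean_space => complex) => ('a => complex) => 'a \<times> 'a => complex" where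
 "stft phi g X = (LINT t|lborel. g t * cnj (phi (t - fst X)) * character (snd X) t)"

lemma stft_integrable:
 assumes g: "integrable lborel g" and phi: "phi \<in> Sigma1"
 shows "integrable lborel (%t. g t * cnj (phi (t - x)) * character xi t)"
proof -
 obtain C where C: "C >= 0" "!!x. norm (phi x) <= C" using Sigma1_bounded[OF phi] by blast
 show ?thesis
 proof (rule integrable_dominated)
  show "integrable lborel (%t. C * norm (g t))" using g by auto
  have "g \<in> borel_measurable borel" using g by auto
  then show "(%t. g t * cnj (phi (t - x)) * character xi t) \<in> borel_measurable lborel"
   using Sigma1_borel[OF phi] by measurable
  show "AE t in lborel. norm (g t * cnj (phi (t - x)) * character xi t) <= norm (C * norm (g t))"
  proof (rule AE_I2)
   fix t
   show "norm (g t * cnj (phi (t - x)) * character xi t) <= norm (C * norm (g t))"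
    using C(1) mult_right_mono[OF C(2)[of "t - x"] norm_ge_zero[of "g t"]] by (simp add: norm_mult mult.commute)
  qed
 qed
qed

lemma stft_bound:
 assumes g: "integrable lborel g" and phi: "phi \<in> Sigma1" and C: "!!x. norm (phi x) <= C"
 shows "norm (stft phi g X) <= C * (LINT t|lborel. norm (g t))"
proof -
 have "norm (stft phi g X) <= (LINT t|lborel. C * norm (g t))"
  unfolding stft_def
 proof (rule Bochner_Integration.integral_norm_bound_integral[OF stft_integrable[OF g phi]])
  show "integrable lborel (%t. C * norm (g t))" using g by auto
  fix t show "norm (g t * cnj (phi (t - fst X)) * character (snd X) t) <= C * norm (g t)"
   using mult_right_mono[OF C[of "t - fst X"] norm_ge_zero[of "g t"]] by (simp add: norm_mult mult.commute)
 qed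
 then show ?thesis by simp
qed

lemma stft_continuous:
 fixes g phi :: "'a::euclidean_space => complex"
 assumes g: "integrable lborel g" and phi: "phi \<in> Sigma1"
 shows "continuous_on UNIV (stft phi g)"
 unfolding continuous_on_sequentially
proof (intro ballI allI impI)
 fix X :: "'a \<times> 'a" and s assume "(\<forall>n. s n \<in> UNIV) \<and> s \<longlonglongrightarrow> X"
 then have s: "s \<longlonglongrightarrow> X" by simp
 obtain C where C: "C >= 0" "!!x. norm (phi x) <= C" using Sigma1_bounded[OF phi] by blast
 show "(stft phi g \<circ> s) \<longlonglongrightarrow> stft phi g X"
  unfolding stft_def o_def
 proof (rule integral_dominated_convergence[where w = "%t. C * norm (g t)"])
  show "(%t. g t * cnj (phi (t - fst X)) * character (snd X) t) \<in> borel_measurable lborel"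
   using stft_integrable[OF g phi] by (rule borel_measurable_integrable)
  show "(%t. g t * cnj (phi (t - fst (s n))) * character (snd (s n)) t) \<in> borel_measurable lborel" for n
   using stft_integrable[OF g phi] by (rule borel_measurable_integrable)
  show "integrable lborel (%t. C * norm (g t))" using g by auto
  show "AE t in lborel. (%n. g t * cnj (phi (t - fst (s n))) * character (snd (s n)) t) \<longlonglongrightarrow> g t * cnj (phi (t - fst X)) * character (snd X) t"
  proof (rule AE_I2)
   fix t
   have "isCont phi (t - fst X)" using Sigma1_continuous[OF phi] by (simp add: continuous_on_eq_continuous_at)
   moreover have "(%n. t - fst (s n)) \<longlonglongrightarrow> t - fst X" by (intro tendsto_intros s)
   ultimately have 1: "(%n. phi (t - fst (s n))) \<longlonglongrightarrow> phi (t - fst X)" by (rule isCont_tendsto_compose)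
   show "(%n. g t * cnj (phi (t - fst (s n))) * character (snd (s n)) t) \<longlonglongrightarrow> g t * cnj (phi (t - fst X)) * character (snd X) t"
    unfolding character_def by (intro tendsto_intros 1 s)
  qed
  show "AE t in lborel. norm (g t * cnj (phi (t - fst (s n))) * character (snd (s n)) t) <= C * norm (g t)" for n
   using mult_right_mono[OF C(2)[of "_ - fst (s n)"] norm_ge_zero[of "g _"]] by (intro AE_I2) (simp add: norm_mult mult.commute)
 qed
qed

section \<open>Integration by parts and decay of the transform\<close>

text \<open>The difference quotients of \<open>w\<close> have integral zero by translation
  invariance, and they converge to \<open>w'\<close> under an integrable majorant.\<close>

lemma integral_directional_derivative_zero:
 fixes w w' :: "'a::euclidean_space => complex"
 assumes w: "integrable lborel w" and b: "b \<in> Basis"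
  and d: "!!t s. ((%s. w (t + s *\<^sub>R b)) has_vector_derivative w' (t + s *\<^sub>R b)) (at s)"
  and bd: "!!t. norm (w' t) <= C * exp (- norm t)"
  and m: "w' \<in> borel_measurable borel"
 shows "(LINT t|lborel. w' t) = 0"
proof -
 have "0 <= C * exp (- norm (0::'a))" by (rule order_trans[OF norm_ge_zero bd])
 then have C: "C >= 0" by simp
 define e where "e n = 1 / (real n + 1)" for n
 have e: "e n > 0" "e n <= 1" for n by (auto simp: e_def)
 have elim: "e \<longlonglongrightarrow> 0"
  unfolding e_def using LIMSEQ_inverse_real_of_nat by (simp add: inverse_eq_divide add.commute)
 have wm: "w \<in> borel_measurable borel" using w by auto
 let ?q = "%n t. (1 / e n) *\<^sub>R (w (t + e n *\<^sub>R b) - w t)"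
 have lim: "(%n. LINT t|lborel. ?q n t) \<longlonglongrightarrow> (LINT t|lborel. w' t)"
 proof (rule integral_dominated_convergence[where w = "%t. (C * exp 1) * decay 1 t"])
  show "w' \<in> borel_measurable lborel" using m by simp
  show "?q n \<in> borel_measurable lborel" for n using wm by measurable
  show "integrable lborel (%t::'a. (C * exp 1) * decay 1 t)"
   by (intro integrable_mult_right integrable_exp_norm) simp
  show "AE t in lborel. (%n. ?q n t) \<longlonglongrightarrow> w' t"
  proof (rule AE_I2)
   fix t
   have "((%s. w (t + s *\<^sub>R b)) has_derivative (%h. h *\<^sub>R w' t)) (at 0)"
    using d[of t 0] by (simp add: has_vector_derivative_def)
   then have "((%h. norm (w (t + h *\<^sub>R b) - w t - h *\<^sub>R w' t) / norm h) \<longlongrightarrow> 0) (at 0)"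
    by (simp add: has_derivative_at)
   moreover have "filterlim e (at 0) sequentially"
    unfolding filterlim_at using elim e by (auto simp: less_imp_neq[symmetric] intro!: always_eventually)
   ultimately have "(%n. norm (w (t + e n *\<^sub>R b) - w t - e n *\<^sub>R w' t) / norm (e n)) \<longlonglongrightarrow> 0"
    by (rule filterlim_compose)
   moreover have "norm (w (t + e n *\<^sub>R b) - w t - e n *\<^sub>R w' t) / norm (e n) = norm (?q n t - w' t)" for n
   proof -
    have "?q n t - w' t = (1 / e n) *\<^sub>R (w (t + e n *\<^sub>R b) - w t - e n *\<^sub>R w' t)"
     using e[of n] by (simp add: scaleR_diff_right)
    then show ?thesis using e[of n] by (simp add: divide_inverse)
   qed
   ultimately have "(%n. norm (?q n t - w' t)) \<longlonglongrightarrow> 0" by simp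
   then show "(%n. ?q n t) \<longlonglongrightarrow> w' t" by (simp add: tendsto_norm_zero_iff LIM_zero_iff)
  qed
  \<comment> \<open>The steps \<open>e n\<close> are at most 1, so moving along \<open>b\<close>
    costs at most a factor \<open>exp 1\<close> in the decay.\<close>
  show "AE t in lborel. norm (?q n t) <= (C * exp 1) * decay 1 t" for n
  proof (rule AE_I2)
   fix t
   have "norm (w (t + e n *\<^sub>R b) - w (t + 0 *\<^sub>R b)) <= (C * exp 1 * exp (- norm t)) * norm (e n - 0)"
   proof (rule differentiable_bound[where S="{0..e n}" and f'="%s h. h *\<^sub>R w' (t + s *\<^sub>R b)"])
    fix s assume s: "s \<in> {0..e n}"
    show "((%s. w (t + s *\<^sub>R b)) has_derivative (%h. h *\<^sub>R w' (t + s *\<^sub>R b))) (at s within {0..e n})"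
     using d[of t s] has_derivative_at_withinI by (auto simp: has_vector_derivative_def)
    have "norm (s *\<^sub>R b) <= 1" using s e(2)[of n] b by simp
    then have "norm t <= norm (t + s *\<^sub>R b) + 1" using norm_triangle_ineq4[of "t + s *\<^sub>R b" "s *\<^sub>R b"] by simp
    then have "exp (- norm (t + s *\<^sub>R b)) <= exp 1 * exp (- norm t)" by (simp add: exp_add[symmetric])
    then have "norm (w' (t + s *\<^sub>R b)) <= C * (exp 1 * exp (- norm t))"
     using bd[of "t + s *\<^sub>R b"] C by (meson mult_left_mono order_trans)
    then show "onorm (%h. h *\<^sub>R w' (t + s *\<^sub>R b)) <= C * exp 1 * exp (- norm t)"
     by (intro onorm_le) (simp add: mult.commute mult_left_mono)
   qed (use e[of n] in auto)
   moreover have "norm (?q n t) = norm (w (t + e n *\<^sub>R b) - w t) / e n"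
    using e[of n] by (simp only: norm_scaleR) (simp add: divide_inverse)
   ultimately show "norm (?q n t) <= (C * exp 1) * decay 1 t"
    using e[of n] by (simp only: pos_divide_le_eq) simp
  qed
 qed
 have zero: "(LINT t|lborel. ?q n t) = 0" for n
 proof -
  have "integrable lborel (%t. w (e n *\<^sub>R b + 1 *\<^sub>R t))" by (rule lborel_integrable_affine[OF w]) simp
  then have i: "integrable lborel (%t. w (t + e n *\<^sub>R b))" by (simp add: add.commute)
  have "(LINT t|lborel. w (t + e n *\<^sub>R b)) = (LINT t|lborel. w t)"
   using lborel_integral_affine[OF wm, of 1 "e n *\<^sub>R b"] by (simp add: add.commute)
  then show ?thesis using i w by simp
 qed
 have "(%n::nat. 0) \<longlonglongrightarrow> (LINT t|lborel. w' t)" using lim unfolding zero .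
 then show ?thesis using LIMSEQ_unique tendsto_const by blast
qed


lemma Sigma1_partial_deriv:
 fixes f :: "'a::euclidean_space => complex"
 assumes f: "f \<in> Sigma1" and b: "b \<in> Basis" shows "pd b f \<in> Sigma1"
proof (rule Sigma1I)
 show "smooth (pd b f)" by (intro smooth_partial_deriv Sigma1_smooth f b)
 fix h k :: real assume hk: "h > 0" "k > 0"
 \<comment> \<open>With \<open>h / 2\<close> the factor \<open>n + 1\<close> gained by the factorial
   is absorbed by \<open>2 ^ (n + 1)\<close>.\<close>
 then have h2: "h / 2 > 0" by simp
 obtain C where C: "C >= 0" "!!bs x. bs \<in> lists Basis ==> norm (derivs bs f x) <= C * (h / 2) ^ length bs * fact (length bs) * decay k x"
  using Sigma1_derivs_bound[OF f h2 hk(2)] by blast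
 show "\<exists>C. \<forall>bs\<in>lists Basis. \<forall>x. norm (derivs bs (pd b f) x) <= C * h ^ length bs * fact (length bs) * decay k x"
 proof (intro exI[of _ "C * h"] ballI allI)
  fix bs :: "'a list" and x assume bs: "bs \<in> lists Basis"
  define n where "n = length bs"
  have "real (n + 1) <= 2 ^ n * 2"
   using less_exp[of "Suc n"] by (metis Suc_eq_plus1 less_imp_le of_nat_le_iff of_nat_numeral of_nat_power power_Suc2)
  then have n: "(h / 2) ^ (n + 1) * fact (n + 1) <= h * h ^ n * fact n"
   using hk mult_right_mono[of "real (n + 1)" "2 ^ n * 2" "h * h ^ n * fact n"] by (simp add: power_divide field_simps)
  have "norm (derivs (bs @ [b]) f x) <= C * (h / 2) ^ (n + 1) * fact (n + 1) * decay k x"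
   using C(2)[of "bs @ [b]" x] bs b by (simp add: n_def)
  also have "... = C * ((h / 2) ^ (n + 1) * fact (n + 1)) * decay k x" by simp
  also have "... <= C * (h * h ^ n * fact n) * decay k x"
   using C(1) by (intro mult_right_mono mult_left_mono n) auto
  finally show "norm (derivs bs (pd b f) x) <= C * h * h ^ length bs * fact (length bs) * decay k x"
   by (simp add: n_def mult_ac)
 qed
qed

lemma Sigma1_derivs: "f \<in> Sigma1 ==> bs \<in> lists Basis ==> derivs bs f \<in> Sigma1"
 by (induction bs) (auto intro: Sigma1_partial_deriv)

text \<open>The derivative of the integrand in direction \<open>b\<close> has integral zero; its
  three terms stem from \<open>g\<close>, from the window and from the character.\<close>

lemma stft_partial_deriv:
 fixes g phi :: "'a::euclidean_space => complex"
 assumes g: "g \<in> Sigma1" and phi: "phi \<in> Sigma1" and b: "b \<in> Basis"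
 shows "\<i> * of_real (b \<bullet> xi) * stft phi g (x, xi) = stft phi (pd b g) (x, xi) + stft (pd b phi) g (x, xi)"
proof -
 define w where "w t = g t * cnj (phi (t - x)) * character xi t" for t
 define w1 where "w1 t = pd b g t * cnj (phi (t - x)) * character xi t" for t
 define w2 where "w2 t = g t * cnj (pd b phi (t - x)) * character xi t" for t
 define w' where "w' t = w1 t + w2 t - \<i> * of_real (b \<bullet> xi) * w t" for t
 have dg: "pd b g \<in> Sigma1" and dphi: "pd b phi \<in> Sigma1"
  using Sigma1_partial_deriv b g phi by auto
 have iw: "integrable lborel w" unfolding w_def by (rule stft_integrable[OF Sigma1_integrable[OF g] phi])
 have iw1: "integrable lborel w1" unfolding w1_def by (rule stft_integrable[OF Sigma1_integrable[OF dg] phi])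
 have iw2: "integrable lborel w2" unfolding w2_def by (rule stft_integrable[OF Sigma1_integrable[OF g] dphi])
 obtain C1 where C1: "C1 >= 0" "!!t. norm (g t) <= C1 * decay 1 t" using Sigma1_exp_decay[OF g zero_less_one] by blast
 obtain C2 where C2: "C2 >= 0" "!!t. norm (pd b g t) <= C2 * decay 1 t" using Sigma1_exp_decay[OF dg zero_less_one] by blast
 obtain K1 where K1: "K1 >= 0" "!!t. norm (phi t) <= K1" using Sigma1_bounded[OF phi] by blast
 obtain K2 where K2: "K2 >= 0" "!!t. norm (pd b phi t) <= K2" using Sigma1_bounded[OF dphi] by blast
 have "(LINT t|lborel. w' t) = 0"
 proof (rule integral_directional_derivative_zero[OF iw b])
  fix t s
  let ?y = "t + s *\<^sub>R b"
  have 1: "((%s. g (t + s *\<^sub>R b)) has_vector_derivative pd b g ?y) (at s)"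
   by (rule smooth_line[OF Sigma1_smooth[OF g] b])
  have "((%s. phi ((t - x) + s *\<^sub>R b)) has_vector_derivative pd b phi ((t - x) + s *\<^sub>R b)) (at s)"
   by (rule smooth_line[OF Sigma1_smooth[OF phi] b])
  then have 2: "((%s. cnj (phi (t + s *\<^sub>R b - x))) has_vector_derivative cnj (pd b phi (?y - x))) (at s)"
   using bounded_linear.has_vector_derivative[OF bounded_linear_cnj] by (simp add: algebra_simps)
  have "((%s. t + s *\<^sub>R b) has_derivative (%h. h *\<^sub>R b)) (at s)"
   by (auto intro!: derivative_eq_intros)
  from has_derivative_compose[OF this character_has_derivative]
  have 3: "((%s. character xi (t + s *\<^sub>R b)) has_vector_derivative (- \<i> * of_real (b \<bullet> xi)) * character xi ?y) (at s)"
   by (simp add: has_vector_derivative_def scaleR_conv_of_real mult_ac)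
  show "((%s. w (t + s *\<^sub>R b)) has_vector_derivative w' ?y) (at s)"
   unfolding w_def using has_vector_derivative_mult[OF has_vector_derivative_mult[OF 1 2] 3]
   by (rule has_vector_derivative_eq_rhs) (simp add: w'_def w1_def w2_def w_def algebra_simps)
 next
  fix t
  have "norm (w' t) <= norm (w1 t + w2 t) + norm (\<i> * of_real (b \<bullet> xi) * w t)"
   unfolding w'_def by (rule norm_triangle_ineq4)
  also have "... <= norm (w1 t) + norm (w2 t) + \<bar>b \<bullet> xi\<bar> * norm (w t)"
   using norm_triangle_ineq[of "w1 t" "w2 t"] by (simp add: norm_mult)
  finally have 0: "norm (w' t) <= norm (w1 t) + norm (w2 t) + \<bar>b \<bullet> xi\<bar> * norm (w t)" .
  have 1: "norm (w1 t) <= (C2 * decay 1 t) * K1"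
   unfolding w1_def norm_mult norm_character complex_mod_cnj mult_1_right using C2 K1 by (intro mult_mono) auto
  have 2: "norm (w2 t) <= (C1 * decay 1 t) * K2"
   unfolding w2_def norm_mult norm_character complex_mod_cnj mult_1_right using C1 K2 by (intro mult_mono) auto
  have "norm (w t) <= (C1 * decay 1 t) * K1"
   unfolding w_def norm_mult norm_character complex_mod_cnj mult_1_right using C1 K1 by (intro mult_mono) auto
  then have 3: "\<bar>b \<bullet> xi\<bar> * norm (w t) <= \<bar>b \<bullet> xi\<bar> * ((C1 * decay 1 t) * K1)"
   by (intro mult_left_mono) auto
  have "norm (w' t) <= (C2 * decay 1 t) * K1 + (C1 * decay 1 t) * K2 + \<bar>b \<bullet> xi\<bar> * ((C1 * decay 1 t) * K1)"
   using 0 1 2 3 by linarith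
  then show "norm (w' t) <= (C2 * K1 + C1 * K2 + \<bar>b \<bullet> xi\<bar> * (C1 * K1)) * exp (- norm t)"
   by (simp add: algebra_simps)
 next
  have "w \<in> borel_measurable borel" "w1 \<in> borel_measurable borel" "w2 \<in> borel_measurable borel"
   using iw iw1 iw2 by auto
  then show "w' \<in> borel_measurable borel" unfolding w'_def by measurable
 qed
 also have "(LINT t|lborel. w' t) = (LINT t|lborel. w1 t) + (LINT t|lborel. w2 t) - \<i> * of_real (b \<bullet> xi) * (LINT t|lborel. w t)"
  unfolding w'_def using iw iw1 iw2 by simp
 finally show ?thesis by (simp add: stft_def w_def w1_def w2_def)
qed

lemma stft_derivs_bound:
 fixes g phi :: "'a::euclidean_space => complex"
 assumes g: "g \<in> Sigma1" and phi: "phi \<in> Sigma1" and h: "h > 0" and k: "k > 0"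
 shows "\<exists>C\<ge>0. \<forall>bs\<in>lists Basis. \<forall>cs\<in>lists Basis. \<forall>x xi.
  norm (stft (derivs cs phi) (derivs bs g) (x, xi)) <= C * h ^ (length bs + length cs) * fact (length bs + length cs) * decay k x"
proof -
 \<comment> \<open>One unit of the decay of \<open>g\<close> is reserved for the integral over
   \<open>t\<close>; the rest combines with that of the window into decay in
   \<open>x\<close>.\<close>
 have k1: "k + 1 > 0" using k by simp
 obtain A where A: "A >= 0" "!!bs t. bs \<in> lists Basis ==> norm (derivs bs g t) <= A * h ^ length bs * fact (length bs) * decay (k + 1) t"
  using Sigma1_derivs_bound[OF g h k1] by blast
 obtain B where B: "B >= 0" "!!bs t. bs \<in> lists Basis ==> norm (derivs bs phi t) <= B * h ^ length bs * fact (length bs) * decay k t"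
  using Sigma1_derivs_bound[OF phi h k] by blast
 let ?I = "LINT t|lborel. decay 1 (t::'a)"
 have I: "?I >= 0" by (intro integral_nonneg_AE AE_I2) auto
 show ?thesis
 proof (intro exI[of _ "A * B * ?I"] conjI ballI allI)
  show "0 <= A * B * ?I" using A B I by simp
  fix bs cs :: "'a list" and x xi :: 'a assume bs: "bs \<in> lists Basis" and cs: "cs \<in> lists Basis"
  let ?m = "length bs" and ?n = "length cs"
  let ?K = "A * B * h ^ (?m + ?n) * fact (?m + ?n) * decay k x"
  have "norm (stft (derivs cs phi) (derivs bs g) (x, xi)) <= (LINT t|lborel. ?K * decay 1 (t::'a))"
   unfolding stft_def fst_conv snd_conv
  proof (rule Bochner_Integration.integral_norm_bound_integral)
   show "integrable lborel (%t. derivs bs g t * cnj (derivs cs phi (t - x)) * character xi t)"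
    by (intro stft_integrable Sigma1_integrable Sigma1_derivs g phi bs cs)
   show "integrable lborel (%t::'a. ?K * decay 1 t)" by (intro integrable_mult_right integrable_exp_norm) simp
   fix t
   have "norm x <= norm t + norm (t - x)" using norm_triangle_ineq4[of t "t - x"] by simp
   then have "k * norm x <= k * (norm t + norm (t - x))" using k by (intro mult_left_mono) auto
   then have e: "decay (k + 1) t * decay k (t - x) <= decay k x * decay 1 t"
    unfolding mult_exp_exp by (simp add: algebra_simps)
   have "norm (derivs bs g t * cnj (derivs cs phi (t - x)) * character xi t) = norm (derivs bs g t) * norm (derivs cs phi (t - x))"
    by (simp add: norm_mult)
   also have "... <= (A * h ^ ?m * fact ?m * decay (k + 1) t) * (B * h ^ ?n * fact ?n * decay k (t - x))"
    using A B h bs cs by (intro mult_mono) auto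
   also have "... = (A * B * h ^ (?m + ?n)) * (fact ?m * fact ?n) * (decay (k + 1) t * decay k (t - x))"
    by (simp add: power_add mult_ac)
   also have "... <= (A * B * h ^ (?m + ?n)) * fact (?m + ?n) * (decay k x * decay 1 t)"
    using A B h by (intro mult_mono e mult_left_mono fact_mult_le) auto
   finally show "norm (derivs bs g t * cnj (derivs cs phi (t - x)) * character xi t) <= ?K * decay 1 t"
    by (simp add: mult_ac)
  qed
  also have "... = ?K * ?I" by (rule integral_mult_right_zero)
  finally show "norm (stft (derivs cs phi) (derivs bs g) (x, xi)) <= A * B * ?I * h ^ (?m + ?n) * fact (?m + ?n) * decay k x"
   by (simp add: mult_ac)
 qed
qed

text \<open>Multiplication by a frequency coordinate distributes one derivative over
  \<open>g\<close> and the window. The \<open>n\<close>-th power thus leads to \<open>2 ^ n\<close>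
  terms with factorial bounds, which \<open>exp_le_of_power_bounds\<close> turns into decay in the
  frequency.\<close>

lemma stft_exp_decay:
 fixes g phi :: "'a::euclidean_space => complex"
 assumes g: "g \<in> Sigma1" and phi: "phi \<in> Sigma1" and k: "k > 0"
 shows "\<exists>C\<ge>0. \<forall>X. norm (stft phi g X) <= C * decay k X"
proof -
 define D where "D = real DIM('a)"
 have D: "D > 0" by (simp add: D_def)
 \<comment> \<open>Solves \<open>1 / (2 * (2 * h)) = D * k\<close>: one factor 2 stems from the
   \<open>2 ^ n\<close> terms, the other from the exponential series.\<close>
 define h where "h = 1 / (4 * D * k)"
 have h: "h > 0" using D k by (simp add: h_def)
 obtain C where C: "C >= 0" "!!bs cs x xi. bs \<in> lists Basis ==> cs \<in> lists Basis ==>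
  norm (stft (derivs cs phi) (derivs bs g) (x, xi)) <= C * h ^ (length bs + length cs) * fact (length bs + length cs) * decay k x"
  using stft_derivs_bound[OF g phi h k] by blast
 have step: "\<bar>b \<bullet> xi\<bar> ^ n * norm (stft (derivs cs phi) (derivs bs g) (x, xi))
  <= 2 ^ n * (C * h ^ (n + length bs + length cs) * fact (n + length bs + length cs) * decay k x)"
  if b: "b \<in> Basis" and "bs \<in> lists Basis" "cs \<in> lists Basis" for b n bs cs x xi
  using that(2,3)
 proof (induct n arbitrary: bs cs)
  case 0
  then show ?case using C(2) by simp
 next
  case (Suc n)
  let ?V = "%cs bs. stft (derivs cs phi) (derivs bs g) (x, xi)"
  let ?B = "2 ^ n * (C * h ^ (Suc n + length bs + length cs) * fact (Suc n + length bs + length cs) * decay k x)"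
  have "\<i> * of_real (b \<bullet> xi) * ?V cs bs = ?V cs (b # bs) + ?V (b # cs) bs"
   using stft_partial_deriv[OF Sigma1_derivs[OF g Suc.prems(1)] Sigma1_derivs[OF phi Suc.prems(2)] b] by simp
  then have "norm (\<i> * of_real (b \<bullet> xi) * ?V cs bs) <= norm (?V cs (b # bs)) + norm (?V (b # cs) bs)"
   by (metis norm_triangle_ineq)
  then have "\<bar>b \<bullet> xi\<bar> * norm (?V cs bs) <= norm (?V cs (b # bs)) + norm (?V (b # cs) bs)"
   by (simp add: norm_mult)
  then have "\<bar>b \<bullet> xi\<bar> ^ n * (\<bar>b \<bullet> xi\<bar> * norm (?V cs bs)) <= \<bar>b \<bullet> xi\<bar> ^ n * (norm (?V cs (b # bs)) + norm (?V (b # cs) bs))"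
   by (intro mult_left_mono) auto
  also have "... = \<bar>b \<bullet> xi\<bar> ^ n * norm (?V cs (b # bs)) + \<bar>b \<bullet> xi\<bar> ^ n * norm (?V (b # cs) bs)"
   by (simp only: distrib_left)
  also have "... <= ?B + ?B"
   using Suc(1)[of "b # bs" cs] Suc(1)[of bs "b # cs"] Suc.prems b by (intro add_mono) (simp_all add: mult_ac)
  finally show ?case by (simp add: mult_ac)
 qed
 show ?thesis
 proof (intro exI[of _ "2 * C"] conjI allI)
  fix X :: "'a \<times> 'a"
  obtain x xi where X: "X = (x, xi)" by (cases X)
  obtain b where b: "b \<in> Basis" "norm xi <= D * \<bar>xi \<bullet> b\<bar>" using norm_le_coordinate[of xi] by (auto simp: D_def)
  have "exp (\<bar>b \<bullet> xi\<bar> / (2 * (2 * h))) * norm (stft phi g (x, xi)) <= 2 * (C * decay k x)"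
  proof (rule exp_le_of_power_bounds)
   fix n :: nat
   show "\<bar>b \<bullet> xi\<bar> ^ n * norm (stft phi g (x, xi)) <= (C * decay k x) * (2 * h) ^ n * fact n"
    using step[OF b(1), of "[]" "[]" xi n x] by (simp add: power_mult_distrib mult_ac)
  qed (use h in auto)
  also have "\<bar>b \<bullet> xi\<bar> / (2 * (2 * h)) = k * (D * \<bar>xi \<bullet> b\<bar>)" using D k by (simp add: h_def inner_commute)
  finally have 1: "exp (k * (D * \<bar>xi \<bullet> b\<bar>)) * norm (stft phi g (x, xi)) <= 2 * (C * decay k x)" .
  have "k * norm xi <= k * (D * \<bar>xi \<bullet> b\<bar>)" using b k by (intro mult_left_mono) auto
  then have "exp (k * norm xi) * norm (stft phi g (x, xi)) <= exp (k * (D * \<bar>xi \<bullet> b\<bar>)) * norm (stft phi g (x, xi))"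
   by (intro mult_right_mono) auto
  with 1 have "exp (k * norm xi) * norm (stft phi g (x, xi)) <= 2 * (C * decay k x)" by linarith
  then have "norm (stft phi g (x, xi)) <= 2 * (C * decay k x) / exp (k * norm xi)"
   by (simp add: pos_le_divide_eq mult.commute)
  also have "... = 2 * C * exp (- k * (norm x + norm xi))" 
  proof -
   have "decay k x / exp (k * norm xi) = exp (- k * (norm x + norm xi))"
    unfolding exp_diff[symmetric] by (simp add: algebra_simps)
   then show ?thesis by (metis mult.assoc times_divide_eq_right)
  qed
  also have "... <= 2 * C * decay k X"
   using C(1) k norm_Pair_le[of x xi] by (intro mult_left_mono) (auto simp: X)
  finally show "norm (stft phi g X) <= 2 * C * decay k X" by (simp add: X)
 qed (use C in simp)
qed

section \<open>Covariance, reconstruction and change of window\<close>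

text \<open>Moving the argument amounts to moving the window, up to a unimodular factor. Values at
  nearby points thus become values at one point for nearby windows.\<close>

lemma stft_covariance:
 fixes g phi :: "'a::euclidean_space => complex"
 shows "norm (stft phi g (x + u, xi + eta)) = norm (stft (%s. phi (s - u) * character (- eta) s) g (x, xi))"
proof -
 have "stft (%s. phi (s - u) * character (- eta) s) g (x, xi) = (LINT t|lborel. cnj (character eta x) * (g t * cnj (phi (t - (x + u))) * character (xi + eta) t))"
  unfolding stft_def fst_conv snd_conv
 proof (intro Bochner_Integration.integral_cong refl)
  fix t
  have "cnj (character (- eta) (t - x)) * character xi t = cnj (character eta x) * character (xi + eta) t"
   by (simp add: character_def exp_cnj exp_add[symmetric] inner_diff_left inner_add_right algebra_simps)
  then show "g t * cnj (phi (t - x - u) * character (- eta) (t - x)) * character xi t = cnj (character eta x) * (g t * cnj (phi (t - (x + u))) * character (xi + eta) t)"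
   by (simp add: mult_ac diff_diff_eq)
 qed
 also have "... = cnj (character eta x) * stft phi g (x + u, xi + eta)" by (simp add: stft_def)
 finally show ?thesis by (simp add: norm_mult)
qed

lemma exp_norm_pair_le:
 assumes "k > 0"
 shows "decay (2 * k) (x, y) <= decay k x * decay k y"
proof -
 have "norm x <= norm (x, y)" "norm y <= norm (x, y)" 
  by (rule norm_fst_le, rule norm_snd_le)
 then have "k * (norm x + norm y) <= k * (2 * norm (x, y))" using assms by (intro mult_left_mono) auto
 then show ?thesis unfolding mult_exp_exp by (simp add: algebra_simps)
qed

lemma stft_integrable_pair:
 fixes g phi :: "'a::euclidean_space => complex"
 assumes g: "g \<in> Sigma1" and phi: "phi \<in> Sigma1"
 shows "integrable lborel (stft phi g)"
proof -
 obtain C where C: "C >= 0" "!!X. norm (stft phi g X) <= C * decay 2 X"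
  using stft_exp_decay[OF g phi, of 2] by auto
 show ?thesis
 proof (rule lborel_integrable_prod_bound)
  show "stft phi g \<in> borel_measurable borel"
   by (intro borel_measurable_continuous_onI stft_continuous Sigma1_integrable g phi)
  show "integrable lborel (%x::'a. C * decay 1 x)" "integrable lborel (%x::'a. decay 1 x)"
   by (intro integrable_mult_right integrable_exp_norm; simp)+
  fix x y
  have "norm (stft phi g (x, y)) <= C * decay (2 * 1) (x, y)" using C(2)[of "(x, y)"] by simp
  also have "... <= C * (decay 1 x * decay 1 y)"
   by (intro mult_left_mono exp_norm_pair_le C) auto
  finally show "norm (stft phi g (x, y)) <= (C * decay 1 x) * decay 1 y" by (simp add: mult_ac)
 qed
qed

text \<open>For a fixed position \<open>y\<close> the transform is the Fourier transform of
  \<open>g\<close> times the conjugate window at \<open>y\<close>. Inversion, multiplication by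
  \<open>phi (t - y)\<close> and integration over \<open>y\<close> leave the squared norm of the
  window.\<close>

lemma stft_reconstruction:
 fixes g phi :: "'a::euclidean_space => complex"
 assumes g: "g \<in> Sigma1" and phi: "phi \<in> Sigma1"
 shows "(LINT Y|lborel. stft phi g Y * cnj (character (snd Y) t) * phi (t - fst Y))
  = of_real ((gauss_mass TYPE('a))\<^sup>2 * (LINT s|lborel. (norm (phi s))\<^sup>2)) * g t"
proof -
 let ?c2 = "(gauss_mass TYPE('a))\<^sup>2"
 obtain K where K: "K >= 0" "!!x. norm (phi x) <= K" using Sigma1_bounded[OF phi] by blast
 obtain C where C: "C >= 0" "!!X. norm (stft phi g X) <= C * decay 2 X"
  using stft_exp_decay[OF g phi, of 2] by auto
 have C2: "norm (stft phi g (x, y)) <= (C * decay 1 x) * decay 1 y" for x y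
 proof -
  have "norm (stft phi g (x, y)) <= C * decay (2 * 1) (x, y)" using C(2)[of "(x, y)"] by simp
  also have "... <= C * (decay 1 x * decay 1 y)"
   by (intro mult_left_mono exp_norm_pair_le C) auto
  finally show ?thesis by (simp add: mult_ac)
 qed
 have Vc: "continuous_on UNIV (stft phi g)" by (intro stft_continuous Sigma1_integrable g phi)
 define H where "H Y = stft phi g Y * cnj (character (snd Y) t) * phi (t - fst Y)" for Y
 have Hi: "integrable lborel H"
 proof (rule lborel_integrable_prod_bound)
  have "continuous_on UNIV H" unfolding H_def character_def
   by (intro continuous_intros Vc continuous_on_compose2[OF Sigma1_continuous[OF phi]]) auto
  then show "H \<in> borel_measurable borel" by (rule borel_measurable_continuous_onI)
  show "integrable lborel (%x::'a. K * (C * decay 1 x))" "integrable lborel (%x::'a. decay 1 x)"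
   by (intro integrable_mult_right integrable_exp_norm; simp)+
  fix x y
  have "norm (H (x, y)) = norm (stft phi g (x, y)) * norm (phi (t - x))" by (simp add: H_def norm_mult)
  also have "... <= ((C * decay 1 x) * decay 1 y) * K"
   using C(1) by (intro mult_mono C2 K(2)) auto
  finally show "norm (H (x, y)) <= (K * (C * decay 1 x)) * decay 1 y" by (simp add: mult_ac)
 qed
 have "(LINT Y|lborel. H Y) = (LINT y|lborel. (LINT eta|lborel. H (y, eta)))" by (rule lborel_Fubini(2)[OF Hi, symmetric])
 also have "... = (LINT y|lborel. (of_real ?c2 * g t) * of_real ((norm (phi (t - y)))\<^sup>2))"
 proof (intro Bochner_Integration.integral_cong refl)
  fix y
  define u where "u s = g s * cnj (phi (s - y))" for s
  have ui: "integrable lborel u" using stft_integrable[OF Sigma1_integrable[OF g] phi, of y 0] by (simp add: u_def[abs_def] character_def)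
  obtain G where G: "G >= 0" "!!x. norm (g x) <= G" using Sigma1_bounded[OF g] by blast
  have "(LINT eta|lborel. stft phi g (y, eta) * cnj (character eta t)) = of_real ?c2 * u t"
  proof (rule fourier_inversion[OF _ ui])
   show "continuous_on UNIV u" unfolding u_def
    by (intro continuous_intros Sigma1_continuous[OF g] continuous_on_compose2[OF Sigma1_continuous[OF phi]]) auto
   show "norm (u x) <= G * K" for x unfolding u_def norm_mult complex_mod_cnj using G K by (intro mult_mono) auto
   show "stft phi g (y, eta) = (LINT s|lborel. u s * character eta s)" for eta by (simp add: stft_def u_def)
   show "integrable lborel (%eta. stft phi g (y, eta))"
   proof (rule integrable_dominated)
    show "integrable lborel (%eta::'a. (C * decay 1 y) * decay 1 eta)"
     by (intro integrable_mult_right integrable_exp_norm) simp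
    have "continuous_on UNIV (%eta. stft phi g (y, eta))"
     by (intro continuous_on_compose2[OF Vc] continuous_intros) auto
    then show "(%eta. stft phi g (y, eta)) \<in> borel_measurable lborel"
     using borel_measurable_continuous_onI by simp
    show "AE eta in lborel. norm (stft phi g (y, eta)) <= norm ((C * decay 1 y) * decay 1 eta)"
     using C2[of y] C(1) by (intro AE_I2) simp
   qed
  qed
  then have "phi (t - y) * (LINT eta|lborel. stft phi g (y, eta) * cnj (character eta t)) = phi (t - y) * (of_real ?c2 * u t)" by simp
  also have "... = (of_real ?c2 * g t) * of_real ((norm (phi (t - y)))\<^sup>2)"
   unfolding u_def complex_norm_square by (simp only: mult_ac)
  also have "phi (t - y) * (LINT eta|lborel. stft phi g (y, eta) * cnj (character eta t)) = (LINT eta|lborel. phi (t - y) * (stft phi g (y, eta) * cnj (character eta t)))"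
   by (rule integral_mult_right_zero[symmetric])
  also have "... = (LINT eta|lborel. H (y, eta))" by (simp only: H_def fst_conv snd_conv mult_ac)
  finally show "(LINT eta|lborel. H (y, eta)) = (of_real ?c2 * g t) * of_real ((norm (phi (t - y)))\<^sup>2)" .
 qed
 also have "... = (of_real ?c2 * g t) * (LINT y|lborel. complex_of_real ((norm (phi (t - y)))\<^sup>2))"
  by (rule integral_mult_right_zero)
 also have "(LINT y|lborel. complex_of_real ((norm (phi (t - y)))\<^sup>2)) = of_real (LINT y|lborel. (norm (phi (t - y)))\<^sup>2)"
  by (rule integral_complex_of_real)
 also have "(LINT y|lborel. (norm (phi (t - y)))\<^sup>2) = (LINT s|lborel. (norm (phi s))\<^sup>2)"
 proof -
  have "(%s. (norm (phi s))\<^sup>2) \<in> borel_measurable borel" using Sigma1_borel[OF phi] by measurable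
  from lborel_integral_affine[OF this, of "-1" t] show ?thesis by simp
 qed
 finally show ?thesis by (simp add: H_def mult_ac)
qed

text \<open>Insert the reconstruction formula into the transform with window \<open>psi\<close>. The
  inner integral over \<open>t\<close> is, up to a phase, the transform of \<open>phi\<close> with
  window \<open>psi\<close> at \<open>X - Y\<close>, so the old transform controls the new one by a
  convolution.\<close>

lemma stft_window_change:
 fixes g phi psi :: "'a::euclidean_space => complex"
 assumes g: "g \<in> Sigma1" and phi: "phi \<in> Sigma1" and psi: "psi \<in> Sigma1"
 shows "(gauss_mass TYPE('a))\<^sup>2 * (LINT s|lborel. (norm (phi s))\<^sup>2) * norm (stft psi g X)
  <= (LINT Y|lborel. norm (stft phi g Y) * norm (stft psi phi (X - Y)))"
  and "integrable lborel (%Y. norm (stft phi g Y) * norm (stft psi phi (X - Y)))"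
proof -
 obtain x xi where X: "X = (x, xi)" by (cases X)
 let ?M = "(gauss_mass TYPE('a))\<^sup>2 * (LINT s|lborel. (norm (phi s))\<^sup>2)"
 have Mnn: "0 <= ?M" by (intro mult_nonneg_nonneg integral_nonneg_AE AE_I2) auto
 obtain K where K: "K >= 0" "!!x. norm (phi x) <= K" using Sigma1_bounded[OF phi] by blast
 have Vi: "integrable lborel (stft phi g)" by (rule stft_integrable_pair[OF g phi])
 have Vc: "continuous_on UNIV (stft phi g)" by (intro stft_continuous Sigma1_integrable g phi)
 define G where "G z = stft phi g (snd z) * cnj (character (snd (snd z)) (fst z)) * phi (fst z - fst (snd z)) * (cnj (psi (fst z - x)) * character xi (fst z))"
  for z :: "'a \<times> ('a \<times> 'a)"
 have Gi: "integrable lborel G"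
 proof (rule lborel_integrable_prod_bound)
  have "continuous_on UNIV G" unfolding G_def character_def
   by (intro continuous_intros continuous_on_compose2[OF Vc] continuous_on_compose2[OF Sigma1_continuous[OF phi]] continuous_on_compose2[OF Sigma1_continuous[OF psi]]) auto
  then show "G \<in> borel_measurable borel" by (rule borel_measurable_continuous_onI)
  have "integrable lborel (%t. norm (psi (- x + 1 *\<^sub>R t)))"
   by (rule integrable_norm, rule lborel_integrable_affine[OF Sigma1_integrable[OF psi]]) simp
  then show "integrable lborel (%t. norm (psi (t - x)))" by simp
  show "integrable lborel (%Y. K * norm (stft phi g Y))" by (intro integrable_mult_right integrable_norm Vi)
  fix t Y
  have "norm (G (t, Y)) = norm (psi (t - x)) * (norm (phi (t - fst Y)) * norm (stft phi g Y))"
   by (simp add: G_def norm_mult)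
  also have "... <= norm (psi (t - x)) * (K * norm (stft phi g Y))"
   by (intro mult_left_mono mult_right_mono K) auto
  finally show "norm (G (t, Y)) <= norm (psi (t - x)) * (K * norm (stft phi g Y))" .
 qed
 have inner: "(LINT t|lborel. G (t, Y)) = stft phi g Y * (character (xi - snd Y) (fst Y) * stft psi phi (X - Y))" for Y
 proof -
  obtain y eta where Y: "Y = (y, eta)" by (cases Y)
  let ?f = "%t. phi (t - y) * cnj (psi (t - x)) * character (xi - eta) t"
  have ch: "cnj (character eta t) * character xi t = character (xi - eta) t" for t
   by (simp add: character_def exp_cnj exp_add[symmetric] inner_diff_right algebra_simps)
  have "(LINT t|lborel. G (t, Y)) = (LINT t|lborel. stft phi g Y * ?f t)"
   unfolding ch[symmetric] by (intro Bochner_Integration.integral_cong refl) (simp add: G_def Y mult_ac)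
  also have "... = stft phi g Y * (LINT t|lborel. ?f t)" by (rule integral_mult_right_zero)
  \<comment> \<open>Centering at \<open>y\<close> brings out the phase
    \<open>character (xi - eta) y\<close>, which disappears in absolute values.\<close>
  also have "(LINT t|lborel. ?f t) = (LINT t|lborel. ?f (y + 1 *\<^sub>R t))"
  proof -
   have "?f \<in> borel_measurable borel" using Sigma1_borel[OF phi] Sigma1_borel[OF psi] by measurable
   from lborel_integral_affine[OF this, of 1 y] show ?thesis by simp
  qed
  also have "... = (LINT t|lborel. character (xi - eta) y * (phi t * cnj (psi (t - (x - y))) * character (xi - eta) t))"
   by (intro Bochner_Integration.integral_cong refl)
    (simp add: character_def inner_add_left exp_add[symmetric] algebra_simps)
  also have "... = character (xi - eta) y * stft psi phi (X - Y)"
   by (simp add: stft_def X Y)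
  finally show ?thesis by (simp add: Y)
 qed
 have "of_real ?M * stft psi g X = (LINT t|lborel. (of_real ?M * g t) * (cnj (psi (t - x)) * character xi t))"
  by (simp add: stft_def X mult.assoc)
 also have "... = (LINT t|lborel. (LINT Y|lborel. G (t, Y)))"
 proof (intro Bochner_Integration.integral_cong refl)
  fix t
  have "(LINT Y|lborel. G (t, Y)) = (LINT Y|lborel. stft phi g Y * cnj (character (snd Y) t) * phi (t - fst Y) * (cnj (psi (t - x)) * character xi t))"
   by (simp only: G_def fst_conv snd_conv)
  also have "... = (LINT Y|lborel. stft phi g Y * cnj (character (snd Y) t) * phi (t - fst Y)) * (cnj (psi (t - x)) * character xi t)"
   by (rule integral_mult_left_zero)
  finally show "(of_real ?M * g t) * (cnj (psi (t - x)) * character xi t) = (LINT Y|lborel. G (t, Y))"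
   unfolding stft_reconstruction[OF g phi] by simp
 qed
 also have "... = (LINT Y|lborel. (LINT t|lborel. G (t, Y)))" using lborel_Fubini[OF Gi] by simp
 also have "... = (LINT Y|lborel. stft phi g Y * (character (xi - snd Y) (fst Y) * stft psi phi (X - Y)))"
  by (simp only: inner)
 finally have eq: "of_real ?M * stft psi g X = (LINT Y|lborel. stft phi g Y * (character (xi - snd Y) (fst Y) * stft psi phi (X - Y)))" .
 obtain B where B: "B >= 0" "!!x. norm (psi x) <= B" using Sigma1_bounded[OF psi] by blast
 have Vb: "norm (stft psi phi Z) <= B * (LINT t|lborel. norm (phi t))" for Z
  by (rule stft_bound[OF Sigma1_integrable[OF phi] psi B(2)])
 show int: "integrable lborel (%Y. norm (stft phi g Y) * norm (stft psi phi (X - Y)))"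
 proof (rule integrable_dominated)
  show "integrable lborel (%Y. norm (stft phi g Y) * (B * (LINT t|lborel. norm (phi t))))"
   by (intro integrable_mult_left integrable_norm Vi)
  have "continuous_on UNIV (%Y. norm (stft phi g Y) * norm (stft psi phi (X - Y)))"
   by (intro continuous_intros Vc continuous_on_compose2[OF stft_continuous[OF Sigma1_integrable[OF phi] psi]]) auto
  from borel_measurable_continuous_onI[OF this]
  show "(%Y. norm (stft phi g Y) * norm (stft psi phi (X - Y))) \<in> borel_measurable lborel" by simp
  show "AE Y in lborel. norm (norm (stft phi g Y) * norm (stft psi phi (X - Y))) <= norm (norm (stft phi g Y) * (B * (LINT t|lborel. norm (phi t))))"
  proof (rule AE_I2)
   fix Y
   have "norm (stft phi g Y) * norm (stft psi phi (X - Y)) <= norm (stft phi g Y) * (B * (LINT t|lborel. norm (phi t)))"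
    by (intro mult_left_mono Vb) auto
   then show "norm (norm (stft phi g Y) * norm (stft psi phi (X - Y))) <= norm (norm (stft phi g Y) * (B * (LINT t|lborel. norm (phi t))))"
    by simp
  qed
 qed
 have "norm (of_real ?M * stft psi g X) <= (LINT Y|lborel. norm (stft phi g Y * (character (xi - snd Y) (fst Y) * stft psi phi (X - Y))))"
  unfolding eq by (rule integral_norm_bound)
 also have "... = (LINT Y|lborel. norm (stft phi g Y) * norm (stft psi phi (X - Y)))" by (simp add: norm_mult)
 finally show "?M * norm (stft psi g X) <= (LINT Y|lborel. norm (stft phi g Y) * norm (stft psi phi (X - Y)))"
  by (simp only: norm_mult norm_of_real abs_of_nonneg[OF Mnn])
qed

text \<open>A continuous function that vanishes almost everywhere vanishes, as nonempty open sets
  are not negligible.\<close>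

lemma Sigma1_norm2_pos:
 fixes phi :: "'a::euclidean_space => complex"
 assumes phi: "phi \<in> Sigma1" and nz: "phi \<noteq> (%_. 0)"
 shows "(LINT s|lborel. (norm (phi s))\<^sup>2) > 0"
proof -
 obtain K where K: "K >= 0" "!!x. norm (phi x) <= K" using Sigma1_bounded[OF phi] by blast
 have m: "phi \<in> borel_measurable borel" by (rule Sigma1_borel[OF phi])
 have int: "integrable lborel (%s. (norm (phi s))\<^sup>2)"
 proof (rule integrable_dominated)
  show "integrable lborel (%s. K * norm (phi s))" by (intro integrable_mult_right integrable_norm Sigma1_integrable phi)
  show "(%s. (norm (phi s))\<^sup>2) \<in> borel_measurable lborel" using m by measurable
  show "AE s in lborel. norm ((norm (phi s))\<^sup>2) <= norm (K * norm (phi s))"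
   using K by (intro AE_I2) (simp add: power2_eq_square mult_right_mono)
 qed
 have "(LINT s|lborel. (norm (phi s))\<^sup>2) \<noteq> 0"
 proof
  assume "(LINT s|lborel. (norm (phi s))\<^sup>2) = 0"
  then have "AE s in lborel. (norm (phi s))\<^sup>2 = 0"
   using integral_nonneg_eq_0_iff_AE[OF int] by simp
  moreover have op: "open {s. phi s \<noteq> 0}"
   by (intro open_Collect_neq Sigma1_continuous phi continuous_on_const)
  ultimately have "AE s in lborel. phi s = 0" by simp
  then have "{s. phi s \<noteq> 0} \<in> null_sets lborel"
   using op by (subst (asm) AE_iff_null) auto
  then have neg: "negligible {s. phi s \<noteq> 0}"
   by (simp add: negligible_iff_null_sets null_sets_completionI)
  have "{s. phi s \<noteq> 0} \<noteq> {}" using nz by auto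
  then show False using op neg open_not_negligible by blast
 qed
 moreover have "(LINT s|lborel. (norm (phi s))\<^sup>2) >= 0" by (intro integral_nonneg_AE AE_I2) auto
 ultimately show ?thesis by (metis less_le)
qed

lemma stft_diff_window:
 assumes g: "g \<in> Sigma1" and "phi \<in> Sigma1" "psi \<in> Sigma1"
 shows "stft (%s. phi s - psi s) g X = stft phi g X - stft psi g X"
 unfolding stft_def using stft_integrable[OF Sigma1_integrable[OF g] assms(2)] stft_integrable[OF Sigma1_integrable[OF g] assms(3)]
 by (subst Bochner_Integration.integral_diff[symmetric]) (auto simp: algebra_simps)



section \<open>Local oscillation of the transform\<close>

lemma norm_character_minus_1: "norm (character xi x - 1) <= norm x * norm xi"
proof -
 have "norm (exp (\<i> * of_real (- (x \<bullet> xi))) - 1) = 2 * \<bar>sin (- (x \<bullet> xi) / 2)\<bar>" by (rule dist_exp_i_1)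
 also have "... <= \<bar>x \<bullet> xi\<bar>" using abs_sin_x_le_abs_x[of "- (x \<bullet> xi) / 2"] by simp
 also have "... <= norm x * norm xi" by (rule Cauchy_Schwarz_ineq2)
 finally show ?thesis by (simp add: character_def)
qed

text \<open>Interpolates between a bound that is small and a bound that decays.\<close>

lemma sqrt_bound_of_two_bounds:
 fixes y a b :: real
 assumes "0 <= y" "y <= a" "y <= b" shows "y <= sqrt a * sqrt b"
proof -
 have "y = sqrt (y * y)" using assms by simp
 also have "... <= sqrt (a * b)" using assms by (intro real_sqrt_le_mono mult_mono) auto
 finally show ?thesis by (simp add: real_sqrt_mult)
qed

lemma sqrt_exp: "sqrt (exp (2 * (x::real))) = exp x"
 by (metis exp_double exp_ge_zero real_sqrt_unique)

text \<open>The difference of the windows is small with \<open>norm (u, eta)\<close>, but this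
  yields no decay in \<open>Z\<close>; the two transforms separately decay at rate
  \<open>2 * k\<close>, but are not small. The geometric mean has both properties, at the price of a
  square root and of half the rate.\<close>

lemma stft_shifted_window_bound:
 fixes phi :: "'a::euclidean_space => complex"
 assumes phi: "phi \<in> Sigma1" and k: "k > 0"
 shows "\<exists>C\<ge>0. \<forall>u eta Z. norm (u, eta) <= 1 -->
  norm (stft (%s. phi (s - u) * character (- eta) s - phi s) phi Z) <= C * sqrt (norm (u, eta)) * decay k Z"
proof -
 have k2: "2 * k > 0" using k by simp
 obtain A where A: "A >= 0" "!!Z. norm (stft phi phi Z) <= A * decay (2 * k) Z"
  using stft_exp_decay[OF phi phi k2] by blast
 obtain L where L: "L >= 0" "!!x y. norm (phi (x - y) - phi x) <= L * norm y * exp (1 * norm y) * decay 1 x"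
  using Sigma1_Lipschitz[OF phi zero_less_one] by blast
 obtain K where K: "K >= 0" "!!x. norm (phi x) <= K" using Sigma1_bounded[OF phi] by blast
 define I where "I = (LINT s|lborel. L * exp 1 * decay 1 (s::'a) + exp (1 * norm s) * norm (phi s))"
 have Ii: "integrable lborel (%s::'a. L * exp 1 * decay 1 s + exp (1 * norm s) * norm (phi s))"
  by (intro Bochner_Integration.integrable_add integrable_mult_right integrable_exp_norm Sigma1_exp_integrable phi) simp
 have I: "I >= 0" unfolding I_def using L by (intro integral_nonneg_AE AE_I2) auto
 let ?A2 = "A * (exp (2 * k) + 1)"
 show ?thesis
 proof (intro exI[of _ "sqrt ?A2 * sqrt (K * I)"] conjI allI impI)
  show "0 <= sqrt ?A2 * sqrt (K * I)" using A K I by simp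
  fix u eta :: 'a and Z :: "'a \<times> 'a" assume U: "norm (u, eta) <= 1"
  let ?psi = "%s. phi (s - u) * character (- eta) s"
  obtain z \<zeta> where Z: "Z = (z, \<zeta>)" by (cases Z)
  have psi: "?psi \<in> Sigma1" by (intro Sigma1_modulate Sigma1_translate phi)
  have d: "(%s. ?psi s - phi s) \<in> Sigma1" by (intro Sigma1_diff psi phi)
  have u: "norm u <= norm (u, eta)" "norm eta <= norm (u, eta)" by (rule norm_fst_le, rule norm_snd_le)
  let ?y = "norm (stft (%s. ?psi s - phi s) phi Z)"
  have "norm (stft ?psi phi Z) = norm (stft phi phi (Z + (u, eta)))" by (simp add: Z stft_covariance)
  also have "... <= A * decay (2 * k) (Z + (u, eta))" by (rule A)
  also have "... <= A * (exp (2 * k) * decay (2 * k) Z)"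
  proof (intro mult_left_mono A)
   have "norm Z <= norm (Z + (u, eta)) + 1" using norm_triangle_ineq4[of "Z + (u, eta)" "(u, eta)"] U by simp
   then have "k * norm Z <= k * (norm (Z + (u, eta)) + 1)" using k by (intro mult_left_mono) auto
   then show "decay (2 * k) (Z + (u, eta)) <= exp (2 * k) * decay (2 * k) Z"
    unfolding mult_exp_exp by (simp add: algebra_simps)
  qed
  finally have "norm (stft ?psi phi Z) <= A * (exp (2 * k) * decay (2 * k) Z)" .
  moreover have "?y <= norm (stft ?psi phi Z) + norm (stft phi phi Z)"
   unfolding stft_diff_window[OF phi psi phi] by (rule norm_triangle_ineq4)
  ultimately have 1: "?y <= ?A2 * exp (2 * (- k * norm Z))"
   using A(2)[of Z] by (simp add: algebra_simps)
  \<comment> \<open>The bound without decay: \<open>phi\<close> satisfies a weighted Lipschitz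
    condition, and the character differs from 1 by at most \<open>norm s * norm eta\<close>.\<close>
  have "?y <= (LINT t|lborel. (K * norm (u, eta)) * (L * exp 1 * decay 1 (t - z) + exp (1 * norm (t - z)) * norm (phi (t - z))))"
   unfolding stft_def
  proof (rule Bochner_Integration.integral_norm_bound_integral)
   show "integrable lborel (%t. phi t * cnj (?psi (t - fst Z) - phi (t - fst Z)) * character (snd Z) t)"
    by (rule stft_integrable[OF Sigma1_integrable[OF phi] d])
   have "integrable lborel (%t. L * exp 1 * decay 1 (- z + 1 *\<^sub>R t) + exp (1 * norm (- z + 1 *\<^sub>R t)) * norm (phi (- z + 1 *\<^sub>R t)))"
    by (rule lborel_integrable_affine[OF Ii]) simp
   then show "integrable lborel (%t. (K * norm (u, eta)) * (L * exp 1 * decay 1 (t - z) + exp (1 * norm (t - z)) * norm (phi (t - z))))"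
    by (intro integrable_mult_right) simp
   fix t
   define s where "s = t - z"
   have "norm (?psi s - phi s) = norm ((phi (s - u) - phi s) * character (- eta) s + phi s * (character (- eta) s - 1))"
    by (simp add: algebra_simps)
   also have "... <= norm (phi (s - u) - phi s) + norm (phi s) * norm (character (- eta) s - 1)"
    by (rule order_trans[OF norm_triangle_ineq]) (simp add: norm_mult)
   also have "... <= L * norm (u, eta) * exp 1 * decay 1 s + norm (phi s) * (exp (1 * norm s) * norm (u, eta))"
   proof (intro add_mono mult_left_mono)
    have "norm (phi (s - u) - phi s) <= L * norm u * exp (1 * norm u) * decay 1 s" by (rule L)
    also have "... <= L * norm (u, eta) * exp 1 * decay 1 s"
     using L u U by (intro mult_mono mult_left_mono) auto
    finally show "norm (phi (s - u) - phi s) <= L * norm (u, eta) * exp 1 * decay 1 s" .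
    have "norm s <= exp (1 * norm s)" using exp_ge_add_one_self[of "norm s"] by (simp del: exp_ge_add_one_self)
    then have "norm s * norm (- eta) <= exp (1 * norm s) * norm (u, eta)" using u by (intro mult_mono) auto
    then show "norm (character (- eta) s - 1) <= exp (1 * norm s) * norm (u, eta)"
     using norm_character_minus_1[of "- eta" s] by linarith
   qed auto
   finally have b: "norm (?psi s - phi s) <= norm (u, eta) * (L * exp 1 * decay 1 s + exp (1 * norm s) * norm (phi s))"
    by (simp add: algebra_simps)
   have "norm (phi t * cnj (?psi s - phi s) * character (snd Z) t) = norm (phi t) * norm (?psi s - phi s)"
    by (simp only: norm_mult complex_mod_cnj norm_character mult_1_right)
   also have "... <= K * (norm (u, eta) * (L * exp 1 * decay 1 s + exp (1 * norm s) * norm (phi s)))"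
    using K by (intro mult_mono b) auto
   finally show "norm (phi t * cnj (?psi (t - fst Z) - phi (t - fst Z)) * character (snd Z) t)
    <= (K * norm (u, eta)) * (L * exp 1 * decay 1 (t - z) + exp (1 * norm (t - z)) * norm (phi (t - z)))"
    by (simp add: Z s_def mult_ac)
  qed
  also have "... = (K * norm (u, eta)) * (LINT t|lborel. L * exp 1 * decay 1 (t - z) + exp (1 * norm (t - z)) * norm (phi (t - z)))"
   by (rule integral_mult_right_zero)
  also have "(LINT t|lborel. L * exp 1 * decay 1 (t - z) + exp (1 * norm (t - z)) * norm (phi (t - z))) = I"
  proof -
   have "(%s::'a. L * exp 1 * decay 1 s + exp (1 * norm s) * norm (phi s)) \<in> borel_measurable borel"
    using Sigma1_borel[OF phi] by measurable
   from lborel_integral_affine[OF this, of 1 "- z"] show ?thesis by (simp add: I_def)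
  qed
  finally have 2: "?y <= (K * I) * norm (u, eta)" by (simp add: mult_ac)
  have "?y <= sqrt (?A2 * exp (2 * (- k * norm Z))) * sqrt ((K * I) * norm (u, eta))"
   by (rule sqrt_bound_of_two_bounds[OF norm_ge_zero 1 2])
  also have "... = sqrt ?A2 * sqrt (K * I) * sqrt (norm (u, eta)) * decay k Z"
   unfolding real_sqrt_mult[of ?A2] real_sqrt_mult[of "K * I"] sqrt_exp by (simp only: mult_ac)
  finally show "?y <= sqrt ?A2 * sqrt (K * I) * sqrt (norm (u, eta)) * decay k Z" .
 qed
qed

text \<open>By covariance the value at \<open>X + U\<close> is a value at \<open>X\<close> for a
  shifted window; the change of window is then applied to the difference of the two windows.\<close>

lemma stft_local_comparison:
 fixes phi :: "'a::euclidean_space => complex"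
 assumes phi: "phi \<in> Sigma1" and nz: "phi \<noteq> (%_. 0)" and k: "k > 0"
 shows "\<exists>C\<ge>0. \<forall>g\<in>Sigma1. \<forall>X U. norm U <= 1 -->
  norm (stft phi g (X + U)) <= norm (stft phi g X) + C * sqrt (norm U) * (LINT Y|lborel. norm (stft phi g Y) * decay k (X - Y))"
proof -
 let ?M = "(gauss_mass TYPE('a))\<^sup>2 * (LINT s|lborel. (norm (phi s))\<^sup>2)"
 have M: "?M > 0" using Sigma1_norm2_pos[OF phi nz] gauss_mass_pos[where 'a='a] by simp
 obtain C where C: "C >= 0" "!!u eta Z. norm (u, eta) <= 1 ==>
  norm (stft (%s. phi (s - u) * character (- eta) s - phi s) phi Z) <= C * sqrt (norm (u, eta)) * decay k Z"
  using stft_shifted_window_bound[OF phi k] by blast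
 show ?thesis
 proof (intro exI[of _ "C / ?M"] conjI ballI allI impI)
  show "0 <= C / ?M" using C M by simp
  fix g :: "'a => complex" and X U :: "'a \<times> 'a" assume g: "g \<in> Sigma1" and U: "norm U <= 1"
  obtain x xi where X: "X = (x, xi)" by (cases X)
  obtain u eta where U': "U = (u, eta)" by (cases U)
  let ?psi = "%s. phi (s - u) * character (- eta) s"
  have psi: "?psi \<in> Sigma1" by (intro Sigma1_modulate Sigma1_translate phi)
  have d: "(%s. ?psi s - phi s) \<in> Sigma1" by (intro Sigma1_diff psi phi)
  have "norm (stft phi g (X + U)) = norm (stft ?psi g X)" by (simp add: X U' stft_covariance)
  also have "... = norm (stft phi g X + stft (%s. ?psi s - phi s) g X)" by (simp add: stft_diff_window[OF g psi phi])
  also have "... <= norm (stft phi g X) + norm (stft (%s. ?psi s - phi s) g X)" by (rule norm_triangle_ineq)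
  also have "norm (stft (%s. ?psi s - phi s) g X) <= C / ?M * sqrt (norm U) * (LINT Y|lborel. norm (stft phi g Y) * decay k (X - Y))"
  proof -
   have "?M * norm (stft (%s. ?psi s - phi s) g X) <= (LINT Y|lborel. norm (stft phi g Y) * norm (stft (%s. ?psi s - phi s) phi (X - Y)))"
    by (rule stft_window_change(1)[OF g phi d])
   also have "... <= (LINT Y|lborel. (C * sqrt (norm U)) * (norm (stft phi g Y) * decay k (X - Y)))"
   proof (rule integral_mono[OF stft_window_change(2)[OF g phi d]])
    have "integrable lborel (%Y. norm (stft phi g Y) * decay k (X - Y))"
    proof (rule integrable_dominated[OF integrable_norm[OF stft_integrable_pair[OF g phi]]])
     have "continuous_on UNIV (%Y. norm (stft phi g Y) * decay k (X - Y))"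
      by (intro continuous_intros stft_continuous Sigma1_integrable g phi)
     from borel_measurable_continuous_onI[OF this]
     show "(%Y. norm (stft phi g Y) * decay k (X - Y)) \<in> borel_measurable lborel" by simp
     show "AE Y in lborel. norm (norm (stft phi g Y) * decay k (X - Y)) <= norm (norm (stft phi g Y))"
      using k by (intro AE_I2) (simp add: mult_left_le)
    qed
    then show "integrable lborel (%Y. (C * sqrt (norm U)) * (norm (stft phi g Y) * decay k (X - Y)))"
     by (rule integrable_mult_right)
    fix Y
    have "norm (stft phi g Y) * norm (stft (%s. ?psi s - phi s) phi (X - Y)) <= norm (stft phi g Y) * (C * sqrt (norm U) * decay k (X - Y))"
     using C(2) U unfolding U' by (intro mult_left_mono) auto
    then show "norm (stft phi g Y) * norm (stft (%s. ?psi s - phi s) phi (X - Y)) <= (C * sqrt (norm U)) * (norm (stft phi g Y) * decay k (X - Y))"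
     by (simp add: mult_ac)
   qed
   also have "... = (C * sqrt (norm U)) * (LINT Y|lborel. norm (stft phi g Y) * decay k (X - Y))"
    by (rule integral_mult_right_zero)
   finally show ?thesis using M by (simp add: pos_le_divide_eq mult_ac)
  qed
  finally show "norm (stft phi g (X + U)) <= norm (stft phi g X) + C / ?M * sqrt (norm U) * (LINT Y|lborel. norm (stft phi g Y) * decay k (X - Y))"
   by simp
 qed
qed

section \<open>The transform of a convolution\<close>

text \<open>Convolution acts on the position variable alone, as a superposition of translates up to
  phases. This is why the weight of the amalgam space involves the points \<open>(x, 0)\<close>
  only.\<close>

lemma stft_conv:
 fixes f g phi :: "'a::euclidean_space => complex"
 assumes f: "f \<in> Sigma1" and g: "g \<in> Sigma1" and phi: "phi \<in> Sigma1"
 shows "stft phi (conv f g) (x, xi) = (LINT y|lborel. f y * character xi y * stft phi g (x - y, xi))"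
proof -
 obtain K where K: "K >= 0" "!!x. norm (g x) <= K" using Sigma1_bounded[OF g] by blast
 define G where "G z = f (snd z) * g (fst z - snd z) * (cnj (phi (fst z - x)) * character xi (fst z))" for z :: "'a \<times> 'a"
 have Gi: "integrable lborel G"
 proof (rule lborel_integrable_prod_bound)
  have "continuous_on UNIV G" unfolding G_def character_def
   by (intro continuous_intros continuous_on_compose2[OF Sigma1_continuous[OF f]] continuous_on_compose2[OF Sigma1_continuous[OF g]] continuous_on_compose2[OF Sigma1_continuous[OF phi]]) auto
  then show "G \<in> borel_measurable borel" by (rule borel_measurable_continuous_onI)
  have "integrable lborel (%t. norm (phi (- x + 1 *\<^sub>R t)))"
   by (rule integrable_norm, rule lborel_integrable_affine[OF Sigma1_integrable[OF phi]]) simp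
  then show "integrable lborel (%t. norm (phi (t - x)))" by simp
  show "integrable lborel (%y. K * norm (f y))" by (intro integrable_mult_right integrable_norm Sigma1_integrable f)
  fix t y
  have "norm (G (t, y)) = norm (phi (t - x)) * (norm (g (t - y)) * norm (f y))" by (simp add: G_def norm_mult)
  also have "... <= norm (phi (t - x)) * (K * norm (f y))" by (intro mult_left_mono mult_right_mono K) auto
  finally show "norm (G (t, y)) <= norm (phi (t - x)) * (K * norm (f y))" .
 qed
 have "stft phi (conv f g) (x, xi) = (LINT t|lborel. (LINT y|lborel. G (t, y)))"
  unfolding stft_def fst_conv snd_conv
 proof (intro Bochner_Integration.integral_cong refl)
  fix t
  have "conv f g t = (LINT y|lborel. f y * g (t - y))"
   unfolding conv_commute[OF Sigma1_borel[OF f] Sigma1_borel[OF g]] by (simp add: conv_def mult.commute)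
  then have "conv f g t * cnj (phi (t - x)) * character xi t = (LINT y|lborel. f y * g (t - y)) * (cnj (phi (t - x)) * character xi t)"
   by (simp only: mult.assoc)
  also have "... = (LINT y|lborel. f y * g (t - y) * (cnj (phi (t - x)) * character xi t))"
   by (rule integral_mult_left_zero[symmetric])
  finally show "conv f g t * cnj (phi (t - x)) * character xi t = (LINT y|lborel. G (t, y))" by (simp only: G_def fst_conv snd_conv)
 qed
 also have "... = (LINT y|lborel. (LINT t|lborel. G (t, y)))" using lborel_Fubini[OF Gi] by simp
 also have "... = (LINT y|lborel. f y * character xi y * stft phi g (x - y, xi))"
 proof (intro Bochner_Integration.integral_cong refl)
  fix y
  let ?h = "%t. f y * (g (t - y) * (cnj (phi (t - x)) * character xi t))"
  have "?h \<in> borel_measurable borel" using Sigma1_borel[OF g] Sigma1_borel[OF phi] by measurable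
  from lborel_integral_affine[OF this, of 1 y]
  have "(LINT t|lborel. G (t, y)) = (LINT t|lborel. ?h (y + t))" by (simp add: G_def mult.assoc)
  also have "... = (LINT t|lborel. (f y * character xi y) * (g t * cnj (phi (t - (x - y))) * character xi t))"
   by (intro Bochner_Integration.integral_cong refl)
    (simp add: character_def inner_add_left exp_add[symmetric] algebra_simps)
  also have "... = f y * character xi y * stft phi g (x - y, xi)" by (simp add: stft_def)
  finally show "(LINT t|lborel. G (t, y)) = f y * character xi y * stft phi g (x - y, xi)" .
 qed
 finally show ?thesis .
qed

lemma stft_conv_integrable:
 fixes f g phi :: "'a::euclidean_space => complex"
 assumes f: "f \<in> Sigma1" and g: "g \<in> Sigma1" and phi: "phi \<in> Sigma1"
 shows "integrable lborel (%y. norm (f y) * norm (stft phi g (x - y, xi)))"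
proof -
 obtain B where B: "B >= 0" "!!x. norm (phi x) <= B" using Sigma1_bounded[OF phi] by blast
 let ?B = "B * (LINT t|lborel. norm (g t))"
 show ?thesis
 proof (rule integrable_dominated)
  show "integrable lborel (%y. norm (f y) * ?B)" by (intro integrable_mult_left integrable_norm Sigma1_integrable f)
  have "continuous_on UNIV (%y. norm (f y) * norm (stft phi g (x - y, xi)))"
   by (intro continuous_intros Sigma1_continuous f continuous_on_compose2[OF stft_continuous[OF Sigma1_integrable[OF g] phi]]) auto
  from borel_measurable_continuous_onI[OF this]
  show "(%y. norm (f y) * norm (stft phi g (x - y, xi))) \<in> borel_measurable lborel" by simp
  show "AE y in lborel. norm (norm (f y) * norm (stft phi g (x - y, xi))) <= norm (norm (f y) * ?B)"
  proof (rule AE_I2)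
   fix y
   have "norm (f y) * norm (stft phi g (x - y, xi)) <= norm (f y) * ?B"
    by (intro mult_left_mono stft_bound Sigma1_integrable g phi B) auto
   then show "norm (norm (f y) * norm (stft phi g (x - y, xi))) <= norm (norm (f y) * ?B)" by simp
  qed
 qed
qed

lemma stft_conv_bound:
 fixes f g phi :: "'a::euclidean_space => complex"
 assumes f: "f \<in> Sigma1" and g: "g \<in> Sigma1" and phi: "phi \<in> Sigma1"
 shows "norm (stft phi (conv f g) (x, xi)) <= (LINT y|lborel. norm (f y) * norm (stft phi g (x - y, xi)))"
proof -
 have "norm (stft phi (conv f g) (x, xi)) <= (LINT y|lborel. norm (f y * character xi y * stft phi g (x - y, xi)))"
  unfolding stft_conv[OF f g phi] by (rule integral_norm_bound)
 then show ?thesis by (simp add: norm_mult)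
qed

lemma STFT_distr:
 fixes f phi :: "real^'d => complex"
 assumes phi: "phi \<in> Sigma1"
 shows "STFT phi (distr f) X = of_real ((2 * pi) powr (- (real CARD('d) / 2))) * stft phi f X"
proof -
 obtain x xi where X: "X = (x, xi)" by (cases X)
 have "(%y. cnj (phi (y - x)) * character xi y) \<in> Sigma1"
  by (intro Sigma1_modulate Sigma1_cnj Sigma1_translate phi)
 then show ?thesis
  by (simp add: STFT_def distr_def stft_def X character_def mult.assoc)
qed

section \<open>Invariant quasi-Banach function spaces\<close>

lemma summable_nonneg_lattice_enum:
 fixes f :: "'i => real"
 assumes e: "bij_betw e (UNIV :: nat set) I" and s: "f summable_on I" and nn: "!!i. i \<in> I ==> 0 <= f i"
 shows "summable (%n. f (e n))" "(\<Sum>n. f (e n)) = infsum f I"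
proof -
 have "(f has_sum infsum f I) I" using s by (rule has_sum_infsum)
 then have "((%n. f (e n)) has_sum infsum f I) UNIV" by (subst has_sum_reindex_bij_betw[OF e])
 then have "(%n. f (e n)) sums infsum f I" by (rule has_sum_imp_sums)
 then show "summable (%n. f (e n))" "(\<Sum>n. f (e n)) = infsum f I" by (auto simp: sums_iff)
qed

locale qbf =
 fixes B :: "('a::euclidean_space => complex) set" and N :: "('a => complex) => real" and v0 :: "'a => real" and r :: real
 assumes inv: "invariant_QBF B N v0 r"
begin

lemma qb: "quasi_Banach_fun_space B N r" and Sigma1_B: "Sigma1 \<subseteq> B" and v0_P_E: "v0 \<in> P_E"
 using inv unfolding invariant_QBF_def by blast+

lemma r_pos: "0 < r" and r_le1: "r <= 1"
 using qb unfolding quasi_Banach_fun_space_def by blast+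

lemma B_meas: "F \<in> B ==> F \<in> borel_measurable lebesgue"
 using qb unfolding quasi_Banach_fun_space_def by blast

lemma B_zero: "(%_. 0) \<in> B"
 using qb unfolding quasi_Banach_fun_space_def by blast

lemma B_add: "F \<in> B ==> G \<in> B ==> (%x. F x + G x) \<in> B"
 using qb unfolding quasi_Banach_fun_space_def by blast

lemma B_cmult: "F \<in> B ==> (%x. c * F x) \<in> B"
 using qb unfolding quasi_Banach_fun_space_def by blast

lemma B_diff: "F \<in> B ==> G \<in> B ==> (%x. F x - G x) \<in> B"
 using B_add[of F "%x. - 1 * G x"] B_cmult[of G "-1"] by simp

lemma N_nonneg: "F \<in> B ==> 0 <= N F"
 using qb unfolding quasi_Banach_fun_space_def by blast

lemma N_eq_0: "F \<in> B ==> N F = 0 \<longleftrightarrow> (AE x in lebesgue. F x = 0)"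
 using qb unfolding quasi_Banach_fun_space_def by blast

lemma N_zero: "N (%_. 0) = 0"
 using N_eq_0[OF B_zero] by simp

lemma N_cmult: "F \<in> B ==> N (%x. c * F x) = norm c * N F"
 using qb unfolding quasi_Banach_fun_space_def by blast

lemma N_minus: "F \<in> B ==> N (%x. - F x) = N F"
 using N_cmult[of F "-1"] by simp

lemma N_minus_commute: "F \<in> B ==> G \<in> B ==> N (%x. F x - G x) = N (%x. G x - F x)"
 using N_minus[OF B_diff[of G F]] by simp

lemma N_triangle: "F \<in> B ==> G \<in> B ==> N (%x. F x + G x) powr r <= N F powr r + N G powr r"
 using qb unfolding quasi_Banach_fun_space_def by blast

lemma N_complete:
 assumes "s \<in> Cauchy_in B (%F G. N (%x. F x - G x))"
 shows "\<exists>F\<in>B. (%n. N (%x. s n x - F x)) \<longlonglongrightarrow> 0"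
 using qb assms unfolding quasi_Banach_fun_space_def by blast

text \<open>One constant for both axioms; \<open>C >= 1\<close> makes it positive, as quotients and
  monotonicity require.\<close>

definition K :: real where
 "K = (SOME C. C >= 1 \<and> (\<forall>X. \<forall>F\<in>B. (%Y. F (Y - X)) \<in> B \<and> N (%Y. F (Y - X)) <= C * v0 X * N F) \<and>
    (\<forall>F\<in>borel_measurable lebesgue. \<forall>G\<in>B.
     (AE X in lebesgue. norm (F X) <= norm (G X)) --> F \<in> B \<and> N F <= C * N G))"

lemma v0_pos: "v0 X > 0"
 using v0_P_E by (simp add: P_E_def weight_def)

lemma K: "K >= 1" "!!X F. F \<in> B ==> (%Y. F (Y - X)) \<in> B" "!!X F. F \<in> B ==> N (%Y. F (Y - X)) <= K * v0 X * N F"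
 "!!F G. F \<in> borel_measurable lebesgue ==> G \<in> B ==> AE X in lebesgue. norm (F X) <= norm (G X) ==> F \<in> B"
 "!!F G. F \<in> borel_measurable lebesgue ==> G \<in> B ==> AE X in lebesgue. norm (F X) <= norm (G X) ==> N F <= K * N G"
proof -
 let ?P = "%C. C >= 1 \<and> (\<forall>X. \<forall>F\<in>B. (%Y. F (Y - X)) \<in> B \<and> N (%Y. F (Y - X)) <= C * v0 X * N F) \<and>
    (\<forall>F\<in>borel_measurable lebesgue. \<forall>G\<in>B.
     (AE X in lebesgue. norm (F X) <= norm (G X)) --> F \<in> B \<and> N F <= C * N G)"
 obtain C where C: "!!X F. F \<in> B ==> (%Y. F (Y - X)) \<in> B" "!!X F. F \<in> B ==> N (%Y. F (Y - X)) <= C * v0 X * N F"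
  "!!F G. F \<in> borel_measurable lebesgue ==> G \<in> B ==> AE X in lebesgue. norm (F X) <= norm (G X) ==> F \<in> B"
  "!!F G. F \<in> borel_measurable lebesgue ==> G \<in> B ==> AE X in lebesgue. norm (F X) <= norm (G X) ==> N F <= C * N G"
  using inv unfolding invariant_QBF_def by blast
 have "?P (max C 1)"
 proof (intro conjI allI ballI impI)
  fix X and F :: "'a => complex" assume F: "F \<in> B"
  have "N (%Y. F (Y - X)) <= C * (v0 X * N F)" using C(2)[OF F, of X] by (simp add: mult.assoc)
  also have "... <= max C 1 * (v0 X * N F)" using less_imp_le[OF v0_pos] N_nonneg[OF F] by (intro mult_right_mono) auto
  finally show "N (%Y. F (Y - X)) <= max C 1 * v0 X * N F" by (simp add: mult.assoc)
 next
  fix F G :: "'a => complex" assume F: "F \<in> borel_measurable lebesgue" and G: "G \<in> B" and le: "AE X in lebesgue. norm (F X) <= norm (G X)"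
  have "N F <= C * N G" by (rule C(4)[OF F G le])
  also have "... <= max C 1 * N G" using N_nonneg[OF G] by (intro mult_right_mono) auto
  finally show "N F <= max C 1 * N G" .
  show "F \<in> B" by (rule C(3)[OF F G le])
 qed (use C in auto)
 then have "?P K" unfolding K_def by (rule someI)
 then show "K >= 1" "!!X F. F \<in> B ==> (%Y. F (Y - X)) \<in> B" "!!X F. F \<in> B ==> N (%Y. F (Y - X)) <= K * v0 X * N F"
 "!!F G. F \<in> borel_measurable lebesgue ==> G \<in> B ==> AE X in lebesgue. norm (F X) <= norm (G X) ==> F \<in> B"
 "!!F G. F \<in> borel_measurable lebesgue ==> G \<in> B ==> AE X in lebesgue. norm (F X) <= norm (G X) ==> N F <= K * N G"
  by blast+
qed

lemma N_sum:
 assumes "finite I" "!!i. i \<in> I ==> G i \<in> B"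
 shows "(%x. \<Sum>i\<in>I. G i x) \<in> B" "N (%x. \<Sum>i\<in>I. G i x) powr r <= (\<Sum>i\<in>I. N (G i) powr r)"
proof -
 have "(%x. \<Sum>i\<in>I. G i x) \<in> B \<and> N (%x. \<Sum>i\<in>I. G i x) powr r <= (\<Sum>i\<in>I. N (G i) powr r)"
  using assms
 proof (induction rule: finite_induct)
  case empty then show ?case by (simp add: B_zero N_zero)
 next
  case (insert i I)
  have "N (%x. G i x + (\<Sum>i\<in>I. G i x)) powr r <= N (G i) powr r + N (%x. \<Sum>i\<in>I. G i x) powr r"
   using insert by (intro N_triangle) auto
  then show ?case using insert B_add[of "G i" "%x. \<Sum>i\<in>I. G i x"] by simp
 qed
 then show "(%x. \<Sum>i\<in>I. G i x) \<in> B" "N (%x. \<Sum>i\<in>I. G i x) powr r <= (\<Sum>i\<in>I. N (G i) powr r)" by auto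
qed

lemma solid_powr:
 assumes "F \<in> borel_measurable lebesgue" "G \<in> B" "AE X in lebesgue. norm (F X) <= norm (G X)"
 shows "N F powr r <= K powr r * N G powr r"
proof -
 have "N F powr r <= (K * N G) powr r" using K(4,5)[OF assms] N_nonneg r_pos by (intro powr_mono2) auto
 then show ?thesis using K(1) N_nonneg[OF assms(2)] by (simp add: powr_mult)
qed

lemma abs_in_B:
 assumes "G \<in> B" shows "(%x. of_real (norm (G x))) \<in> B" "N (%x. of_real (norm (G x))) powr r <= K powr r * N G powr r"
proof -
 have m: "(%x. complex_of_real (norm (G x))) \<in> borel_measurable lebesgue"
  using B_meas[OF assms] by measurable
 show "(%x. of_real (norm (G x))) \<in> B" by (rule K(4)[OF m assms]) simp
 show "N (%x. of_real (norm (G x))) powr r <= K powr r * N G powr r" by (rule solid_powr[OF m assms]) simp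
qed

text \<open>
 Completeness only yields a limit in quasi-norm; solidity identifies it with a pointwise
 majorant, because the positive parts of \<open>s\<^sub>m - F\<close> are dominated by \<open>s\<^sub>n - F\<close> for all \<open>n >= m\<close>.
\<close>

lemma N_suminf:
 assumes G: "!!n. G n \<in> B" and S: "summable (%n. N (G n) powr r)"
  and H: "H \<in> borel_measurable lebesgue" and s: "!!X. summable (%n. norm (G n X))" "!!X. norm (H X) <= (\<Sum>n. norm (G n X))"
 shows "H \<in> B" "N H powr r <= (K powr r)\<^sup>2 * (\<Sum>n. N (G n) powr r)"
proof -
 define A where "A n X = complex_of_real (norm (G n X))" for n X
 define S where "S = (\<Sum>n. N (G n) powr r)"
 have AB: "A n \<in> B" "N (A n) powr r <= K powr r * N (G n) powr r" for n
  unfolding A_def using abs_in_B[OF G] by auto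
 define s where "s n X = (\<Sum>i<n. A i X)" for n X
 have sB: "s n \<in> B" "N (s n) powr r <= K powr r * S" for n
 proof -
  show "s n \<in> B" unfolding s_def using N_sum(1)[of "{..<n}" A] AB by simp
  have "N (s n) powr r <= (\<Sum>i<n. N (A i) powr r)" unfolding s_def using N_sum(2)[of "{..<n}" A] AB by simp
  also have "... <= (\<Sum>i<n. K powr r * N (G i) powr r)" by (intro sum_mono AB)
  also have "... = K powr r * (\<Sum>i<n. N (G i) powr r)" by (simp add: sum_distrib_left)
  also have "... <= K powr r * S" unfolding S_def by (intro mult_left_mono sum_le_suminf assms(2)) auto
  finally show "N (s n) powr r <= K powr r * S" .
 qed
 have diffs: "N (%x. s n x - s m x) powr r <= K powr r * (\<Sum>i\<in>{m..<n}. N (G i) powr r)" if "m <= n" for m n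
 proof -
  have "s n x - s m x = (\<Sum>i\<in>{m..<n}. A i x)" for x
   using sum_diff_nat_ivl[of 0 m n "%i. A i x"] that by (simp add: s_def atLeast0LessThan)
  then have "N (%x. s n x - s m x) powr r = N (%x. \<Sum>i\<in>{m..<n}. A i x) powr r" by simp
  also have "... <= (\<Sum>i\<in>{m..<n}. N (A i) powr r)" by (rule N_sum(2)) (auto simp: AB)
  also have "... <= (\<Sum>i\<in>{m..<n}. K powr r * N (G i) powr r)" by (intro sum_mono AB)
  finally show ?thesis by (simp add: sum_distrib_left)
 qed
 have "s \<in> Cauchy_in B (%F G. N (%x. F x - G x))"
  unfolding Cauchy_in_def
 proof (intro CollectI conjI allI impI)
  show "range s \<subseteq> B" using sB by auto
  fix epsilon :: real assume epsilon: "epsilon > 0"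
  have "(epsilon powr r) / K powr r > 0" using epsilon K(1) by simp
  then obtain n0 where n0: "!!m n. m >= n0 ==> norm (\<Sum>i\<in>{m..<n}. N (G i) powr r) < (epsilon powr r) / K powr r"
   using assms(2) unfolding summable_Cauchy by blast
  have lt: "N (%x. s n x - s m x) < epsilon" if "n0 <= m" "m <= n" for m n
  proof -
   have "N (%x. s n x - s m x) powr r <= K powr r * (\<Sum>i\<in>{m..<n}. N (G i) powr r)" by (rule diffs[OF that(2)])
   also have "... < K powr r * ((epsilon powr r) / K powr r)"
    using n0[OF that(1), of n] K(1) by (intro mult_strict_left_mono) auto
   also have "... = epsilon powr r" using K(1) by simp
   finally show ?thesis using r_pos epsilon N_nonneg[OF B_diff[OF sB(1) sB(1)]]
    by (metis linorder_not_le powr_mono2 less_imp_le)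
  qed
  show "\<exists>n\<^sub>0. \<forall>m\<ge>n\<^sub>0. \<forall>n\<ge>n\<^sub>0. N (%x. s m x - s n x) < epsilon"
  proof (intro exI[of _ n0] allI impI)
   fix m n assume mn: "n0 <= m" "n0 <= n"
   show "N (%x. s m x - s n x) < epsilon"
    using lt[of m n] lt[of n m] N_minus_commute[OF sB(1) sB(1), of m n] mn by (cases "m <= n") auto
  qed
 qed
 then obtain F where F: "F \<in> B" "(%n. N (%x. s n x - F x)) \<longlonglongrightarrow> 0" using N_complete by blast
 have "AE X in lebesgue. (\<Sum>i<m. norm (G i X)) <= norm (F X)" for m
 proof -
  define T where "T X = complex_of_real (max 0 ((\<Sum>i<m. norm (G i X)) - Re (F X)))" for X
  have Tm: "T \<in> borel_measurable lebesgue"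
   unfolding T_def using B_meas[OF G] B_meas[OF F(1)] by measurable
  have le: "norm (T X) <= norm (s n X - F X)" if "m <= n" for n X
  proof -
   have "(\<Sum>i<m. norm (G i X)) <= (\<Sum>i<n. norm (G i X))" using that by (intro sum_mono2) auto
   moreover have "Re (s n X) = (\<Sum>i<n. norm (G i X))" by (simp add: s_def A_def)
   moreover have "\<bar>Re (s n X - F X)\<bar> <= norm (s n X - F X)" by (rule abs_Re_le_cmod)
   ultimately show ?thesis by (simp add: T_def)
  qed
  have TB: "T \<in> B" by (rule K(4)[OF Tm B_diff[OF sB(1)[of m] F(1)]]) (simp add: le)
  have "N T <= K * N (%x. s n x - F x)" if "n >= m" for n
   by (rule K(5)[OF Tm B_diff[OF sB(1)[of n] F(1)]]) (simp add: le[OF that])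
  moreover have "(%n. K * N (%x. s n x - F x)) \<longlonglongrightarrow> K * 0" by (intro tendsto_intros F)
  ultimately have "N T <= K * 0" by (intro LIMSEQ_le_const) auto
  then have "N T = 0" using N_nonneg[OF TB] by simp
  then have "AE X in lebesgue. T X = 0" using N_eq_0[OF TB] by simp
  then show ?thesis
  proof eventually_elim
   case (elim X)
   then have "(\<Sum>i<m. norm (G i X)) <= Re (F X)" by (simp add: T_def max_def split: if_splits)
   then show ?case using complex_Re_le_cmod order_trans by blast
  qed
 qed
 then have "AE X in lebesgue. \<forall>m. (\<Sum>i<m. norm (G i X)) <= norm (F X)" by (simp add: AE_all_countable)
 then have HF: "AE X in lebesgue. norm (H X) <= norm (F X)"
 proof eventually_elim
  case (elim X)
  have "(\<Sum>n. norm (G n X)) <= norm (F X)" by (rule suminf_le_const[OF assms(4)]) (use elim in auto)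
  then show ?case using assms(5)[of X] by linarith
 qed
 show "H \<in> B" by (rule K(4)[OF H F(1) HF])
 have "N F powr r <= K powr r * S"
 proof (rule LIMSEQ_le_const)
  have "(%n. K powr r * S + N (%x. s n x - F x) powr r) \<longlonglongrightarrow> K powr r * S + 0 powr r"
   by (intro tendsto_add tendsto_const tendsto_powr2[OF F(2) tendsto_const] always_eventually allI
     N_nonneg[OF B_diff[OF sB(1) F(1)]] r_pos)
  then show "(%n. K powr r * S + N (%x. s n x - F x) powr r) \<longlonglongrightarrow> K powr r * S" by simp
  have "N F powr r <= K powr r * S + N (%x. s n x - F x) powr r" for n
  proof -
   have "N F powr r <= N (s n) powr r + N (%x. F x - s n x) powr r"
    using N_triangle[OF sB(1)[of n] B_diff[OF F(1) sB(1)[of n]]] by simp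
   then show ?thesis using sB(2)[of n] N_minus_commute[OF F(1) sB(1)[of n]] by simp
  qed
  then show "\<exists>N'. \<forall>n\<ge>N'. N F powr r <= K powr r * S + N (%x. s n x - F x) powr r" by blast
 qed
 then have "K powr r * N F powr r <= K powr r * (K powr r * S)" by (intro mult_left_mono) auto
 then show "N H powr r <= (K powr r)\<^sup>2 * S"
  using solid_powr[OF H F(1) HF] by (simp add: power2_eq_square mult.assoc)
qed

text \<open>Unordered sums are reduced to \<open>N_suminf\<close> by an enumeration of the index
  set.\<close>

lemma N_infsum:
 fixes I :: "'i set"
 assumes I: "countable I" "infinite I" and G: "!!i. i \<in> I ==> G i \<in> B" and S: "(%i. N (G i) powr r) summable_on I"
  and H: "H \<in> borel_measurable lebesgue" and s: "!!X. (%i. norm (G i X)) summable_on I" "!!X. norm (H X) <= infsum (%i. norm (G i X)) I"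
 shows "H \<in> B" "N H powr r <= (K powr r)\<^sup>2 * infsum (%i. N (G i) powr r) I"
proof -
 obtain f :: "'i => nat" where f: "bij_betw f I UNIV" by (rule countableE_infinite[OF I])
 define e where "e = inv_into I f"
 have e: "bij_betw e UNIV I" unfolding e_def by (rule bij_betw_inv_into[OF f])
 have eI: "e n \<in> I" for n using e by (auto simp: bij_betw_def)
 note S' = summable_nonneg_lattice_enum[OF e S]
 have s': "summable (%n. norm (G (e n) X))" "(\<Sum>n. norm (G (e n) X)) = infsum (%i. norm (G i X)) I" for X
  by (rule summable_nonneg_lattice_enum[OF e s(1)]; simp)+
 have 1: "summable (%n. N (G (e n)) powr r)" "(\<Sum>n. N (G (e n)) powr r) = infsum (%i. N (G i) powr r) I"
  by (rule S'; simp)+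
 have "H \<in> B \<and> N H powr r <= (K powr r)\<^sup>2 * (\<Sum>n. N (G (e n)) powr r)"
  using N_suminf[of "%n. G (e n)" H, OF G[OF eI] 1(1) H s'(1)] s(2) s'(2) by auto
 then show "H \<in> B" "N H powr r <= (K powr r)\<^sup>2 * infsum (%i. N (G i) powr r) I" using 1(2) by auto
qed

text \<open>The constant \<open>c\<close> measures the change of \<open>omega\<close> under the
  translation by \<open>U\<close>; one factor \<open>K\<close> comes from the translation, the other
  from solidity.\<close>

lemma weighted_translate:
 assumes omega: "omega \<in> borel_measurable lebesgue" "!!X. 0 < omega X" and c: "!!X. omega X <= c * omega (X - U)"
  and F: "F \<in> borel_measurable borel" "(%X. F X * of_real (omega X)) \<in> B"
 shows "(%X. F (X - U) * of_real (omega X)) \<in> B"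
  "N (%X. F (X - U) * of_real (omega X)) <= K\<^sup>2 * c * v0 U * N (%X. F X * of_real (omega X))"
proof -
 have c0: "c > 0" using c[of U] omega(2)[of U] omega(2)[of "U - U"] by (metis less_le_trans zero_less_mult_pos2)
 let ?G = "%X. of_real c * (F (X - U) * of_real (omega (X - U)))"
 let ?F = "%X. F X * of_real (omega X)"
 have T: "(%X. ?F (X - U)) \<in> B" "N (%X. ?F (X - U)) <= K * v0 U * N ?F" using K(2,3)[OF F(2)] by auto
 have GB: "?G \<in> B" by (rule B_cmult[OF T(1)])
 have NG: "N ?G <= c * (K * v0 U * N ?F)"
  using N_cmult[OF T(1), of "of_real c"] T(2) c0 by simp
 have m: "(%X. F (X - U) * of_real (omega X)) \<in> borel_measurable lebesgue"
 proof -
  have "(%X. F (X - U)) \<in> borel_measurable borel" by (rule measurable_compose[OF _ F(1)]) simp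
  then have "(%X. F (X - U)) \<in> borel_measurable lebesgue" by (intro measurable_completion) simp
  then show ?thesis using omega(1) by measurable
 qed
 have le: "AE X in lebesgue. norm (F (X - U) * of_real (omega X)) <= norm (?G X)"
 proof (rule AE_I2)
  fix X
  have "norm (F (X - U)) * omega X <= norm (F (X - U)) * (c * omega (X - U))" by (intro mult_left_mono c) auto
  then show "norm (F (X - U) * of_real (omega X)) <= norm (?G X)"
   using c0 less_imp_le[OF omega(2)] by (simp add: norm_mult mult_ac)
 qed
 show "(%X. F (X - U) * of_real (omega X)) \<in> B" by (rule K(4)[OF m GB le])
 have "N (%X. F (X - U) * of_real (omega X)) <= K * N ?G" by (rule K(5)[OF m GB le])
 also have "... <= K * (c * (K * v0 U * N ?F))" using NG K(1) by (intro mult_left_mono) auto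
 finally show "N (%X. F (X - U) * of_real (omega X)) <= K\<^sup>2 * c * v0 U * N ?F" by (simp add: power2_eq_square mult_ac)
qed

text \<open>\<open>B\<close> is known to contain test functions, but \<open>omega\<close> need not
  be smooth. The function is therefore dominated by a lattice sum of translated Gaussians with
  exponentially small coefficients.\<close>

lemma exp_weight_in_B:
 assumes omega: "omega \<in> P_E"
 shows "\<exists>kappa>0. (%X. complex_of_real (decay kappa X * omega X)) \<in> B"
proof -
 obtain C1 k1 where C1: "C1 > 0" "k1 > 0" "!!x y. omega (x + y) <= C1 * exp (k1 * norm y) * omega x"
  using P_E_exp_moderate[OF omega] by blast
 obtain C2 k2 where C2: "C2 > 0" "k2 > 0" "!!x y. v0 (x + y) <= C2 * exp (k2 * norm y) * v0 x"
  using P_E_exp_moderate[OF v0_P_E] by blast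
 have omegap: "omega x > 0" for x using omega by (simp add: P_E_def weight_def)
 have omegam: "omega \<in> borel_measurable lebesgue" using omega by (simp add: P_E_def weight_def Linf_loc_def)
 define D where "D = real DIM('a)"
 \<comment> \<open>\<open>k2\<close> pays for the growth of \<open>v0\<close> in the translations,
   the 1 is left for summation over the lattice, and \<open>k1\<close> in \<open>kappa\<close> pays
   for the growth of \<open>omega\<close>.\<close>
 define k where "k = k2 + 1"
 define kappa where "kappa = k1 + k"
 have k: "k > 0" "kappa > 0" using C1 C2 by (auto simp: k_def kappa_def)
 \<comment> \<open>\<open>exp (k * D)\<close> compares the decay in a cell with that at its corner,
   and \<open>exp (D\<^sup>2 / 2)\<close> compensates the smallest value of the Gaussian within
   distance \<open>D\<close> of its center.\<close>
 define c where "c = C1 * omega 0 * exp (k * D) * exp (D\<^sup>2 / 2)"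
 have c: "c > 0" using C1 omegap by (simp add: c_def)
 let ?g = "%x::'a. complex_of_real (gauss x)"
 have gB: "?g \<in> B" using Sigma1_gauss Sigma1_B by blast
 define G where "G l X = complex_of_real (c * decay k l) * ?g (X - l)" for l X
 have GB: "G l \<in> B" for l unfolding G_def by (intro B_cmult K(2) gB)
 have NG: "N (G l) powr r <= (c * K * C2 * v0 0 * N ?g) powr r * decay r l" for l
 proof -
  have "N (G l) = c * decay k l * N (%X. ?g (X - l))"
   unfolding G_def using c by (subst N_cmult[OF K(2)[OF gB]]) (simp add: norm_mult)
  also have "... <= c * decay k l * (K * (C2 * exp (k2 * norm l) * v0 0) * N ?g)"
  proof (intro mult_left_mono)
   have "N (%X. ?g (X - l)) <= K * v0 l * N ?g" by (rule K(3)[OF gB])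
   also have "... <= K * (C2 * exp (k2 * norm l) * v0 0) * N ?g"
    using C2(3)[of 0 l] K(1) N_nonneg[OF gB] by (intro mult_right_mono mult_left_mono) auto
   finally show "N (%X. ?g (X - l)) <= K * (C2 * exp (k2 * norm l) * v0 0) * N ?g" .
  qed (use c in auto)
  also have "... = (c * K * C2 * v0 0 * N ?g) * (decay k l * exp (k2 * norm l))" by (simp only: mult_ac)
  also have "decay k l * exp (k2 * norm l) = exp (- norm l)"
   unfolding mult_exp_exp by (simp add: k_def algebra_simps)
  finally have "N (G l) powr r <= ((c * K * C2 * v0 0 * N ?g) * exp (- norm l)) powr r"
   using N_nonneg[OF GB] r_pos by (intro powr_mono2) auto
  also have "... = (c * K * C2 * v0 0 * N ?g) powr r * exp (- norm l) powr r"
   by (rule powr_mult)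
  also have "exp (- norm l) powr r = decay r l" by (simp add: powr_def)
  finally show ?thesis .
 qed
 have nG: "norm (G l X) <= c * decay k l" for l X
  using c by (simp add: G_def norm_mult mult_left_le)
 have sX: "(%l. norm (G l X)) summable_on int_lattice" for X
  by (rule summable_on_comparison_test[OF summable_on_cmult_right[OF summable_exp_lattice[OF k(1)], of c]]) (rule nG norm_ge_zero)+
 have "(%X. complex_of_real (decay kappa X * omega X)) \<in> B"
 proof (rule N_infsum(1)[OF countable_int_lattice infinite_int_lattice, of G])
  show "(%l. N (G l) powr r) summable_on int_lattice"
   by (rule summable_on_comparison_test[OF summable_on_cmult_right[OF summable_exp_lattice[OF r_pos]]]) (rule NG powr_ge_zero)+
  have "(%X::'a. decay kappa X) \<in> borel_measurable lebesgue" by (intro measurable_completion) measurable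
  then show "(%X. complex_of_real (decay kappa X * omega X)) \<in> borel_measurable lebesgue" using omegam by measurable
  fix X :: 'a
  \<comment> \<open>One term of the lattice sum, that of the cell containing \<open>X\<close>, is
    already large enough.\<close>
  let ?l = "corner X"
  have nl: "norm (X - ?l) <= D" unfolding D_def
   using norm_diff_cell[OF subsetD[OF cell_subset_cbox in_cell_corner[of X]]] by simp
  have "norm (complex_of_real (decay kappa X * omega X)) = decay kappa X * omega X"
   using less_imp_le[OF omegap] by (simp add: norm_mult)
  also have "... <= decay kappa X * (C1 * exp (k1 * norm X) * omega 0)"
   using C1(3)[of 0 X] by (intro mult_left_mono) auto
  also have "... = C1 * omega 0 * (decay kappa X * exp (k1 * norm X))" by (simp only: mult_ac)
  also have "decay kappa X * exp (k1 * norm X) = decay k X"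
   unfolding mult_exp_exp by (simp add: kappa_def algebra_simps)
  also have "C1 * omega 0 * decay k X <= C1 * omega 0 * (exp (k * D) * exp (- k * norm ?l))"
   using exp_norm_cell[of k X ?l] k in_cell_corner[of X] C1 less_imp_le[OF omegap] unfolding D_def by (intro mult_left_mono) auto
  also have "... <= C1 * omega 0 * (exp (k * D) * exp (- k * norm ?l)) * (exp (D\<^sup>2 / 2) * gauss (X - ?l))"
  proof -
   have "(norm (X - ?l))\<^sup>2 <= D\<^sup>2" using nl by (intro power_mono) auto
   then have "1 <= exp (D\<^sup>2 / 2) * gauss (X - ?l)" unfolding mult_exp_exp by simp
   then show ?thesis using C1 less_imp_le[OF omegap, of 0] mult_left_mono[of 1 "exp (D\<^sup>2 / 2) * gauss (X - ?l)" "C1 * omega 0 * (exp (k * D) * exp (- k * norm ?l))"] by simp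
  qed
  also have "... = norm (G ?l X)" using c C1(1) omegap[of 0] by (simp add: G_def c_def norm_mult mult_ac abs_mult)
  also have "... = (\<Sum>\<^sub>\<infinity>l\<in>{?l}. norm (G l X))" by simp
  also have "... <= infsum (%l. norm (G l X)) int_lattice"
   by (intro infsum_mono_neutral sX) (auto simp: corner_in_lattice)
  finally show "norm (complex_of_real (decay kappa X * omega X)) <= infsum (%l. norm (G l X)) int_lattice" .
 qed (use GB sX in auto)
 then show ?thesis using k by blast
qed

end

section \<open>The Wiener estimate for short-time Fourier transforms\<close>

locale modulation = qbf B N v0 r
 for B :: "('a::euclidean_space \<times> 'a => complex) set" and N :: "('a \<times> 'a => complex) => real" and v0 :: "'a \<times> 'a => real" and r :: real +
 fixes omega :: "'a \<times> 'a => real" and phi :: "'a => complex"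
 assumes omega_P_E: "omega \<in> P_E" and phi: "phi \<in> Sigma1" and phi_nz: "phi \<noteq> (%_. 0)"
begin

lemma omega_pos: "omega X > 0" and omega_meas: "omega \<in> borel_measurable lebesgue"
 using omega_P_E unfolding P_E_def weight_def Linf_loc_def by blast+

text \<open>Points of a unit cell lie within \<open>DIM('a \<times> 'a)\<close> of its corner; the
  added 1 makes this strict, because the balls in \<open>loc_max\<close> are open.\<close>

definition R :: real where "R = real DIM('a \<times> 'a) + 1"

lemma R_pos: "R >= 1"
 by (simp add: R_def)

text \<open>The local maximal function of the transform, taken over open balls: this makes it lower
  semicontinuous, hence Borel.\<close>

definition loc_max :: "('a => complex) => 'a \<times> 'a => real" where
 "loc_max g X = (SUP Z\<in>ball X R. norm (stft phi g Z))"

text \<open>The modulation quasi-norm of a test function up to the normalizing constant of the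
  Fourier transform.\<close>

definition q :: "('a => complex) => real" where
 "q g = N (%X. stft phi g X * of_real (omega X))"

lemma stft_bounded:
 assumes "g \<in> Sigma1" shows "\<exists>C. \<forall>X. norm (stft phi g X) <= C"
proof -
 obtain K' where K': "!!x. norm (phi x) <= K'" using Sigma1_bounded[OF phi] by blast
 show ?thesis using stft_bound[OF Sigma1_integrable[OF assms] phi K'] by blast
qed

lemma loc_max_bdd: "g \<in> Sigma1 ==> bdd_above ((%Z. norm (stft phi g Z)) ` ball X R)"
proof -
 assume "g \<in> Sigma1"
 then obtain C where "!!X. norm (stft phi g X) <= C" using stft_bounded by blast
 then show ?thesis by (intro bdd_aboveI2[of _ _ C])
qed

lemma loc_max_ge: "g \<in> Sigma1 ==> norm (Z - X) < R ==> norm (stft phi g Z) <= loc_max g X"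
 unfolding loc_max_def by (rule cSUP_upper[OF _ loc_max_bdd]) (auto simp: dist_norm norm_minus_commute)

lemma loc_max_nonneg: "g \<in> Sigma1 ==> 0 <= loc_max g X"
 using loc_max_ge[of g X X] R_pos norm_ge_zero order_trans by (metis diff_self less_le_trans norm_zero zero_less_one)

lemma loc_max_le:
 assumes "!!Z. norm (Z - X) < R ==> norm (stft phi g Z) <= c"
 shows "loc_max g X <= c"
 unfolding loc_max_def by (rule cSUP_least) (use R_pos assms in \<open>auto simp: dist_norm norm_minus_commute\<close>)

lemma loc_max_borel: assumes g: "g \<in> Sigma1" shows "loc_max g \<in> borel_measurable borel"
proof (rule borel_measurableI_greater)
 fix a
 \<comment> \<open>Superlevel sets are unions of open balls.\<close>
 have "{X \<in> space borel. a < loc_max g X} = (\<Union>Z\<in>{Z. a < norm (stft phi g Z)}. ball Z R)"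
 proof (intro set_eqI iffI)
  fix X assume "X \<in> {X \<in> space borel. a < loc_max g X}"
  then have "a < (SUP Z\<in>ball X R. norm (stft phi g Z))" by (simp add: loc_max_def)
  then obtain Z where "Z \<in> ball X R" "a < norm (stft phi g Z)"
   using less_cSUP_iff[OF _ loc_max_bdd[OF g]] R_pos by (metis centre_in_ball empty_iff less_le_trans zero_less_one)
  then show "X \<in> (\<Union>Z\<in>{Z. a < norm (stft phi g Z)}. ball Z R)"
   by (intro UN_I[of Z]) (simp_all add: dist_commute)
 next
  fix X assume "X \<in> (\<Union>Z\<in>{Z. a < norm (stft phi g Z)}. ball Z R)"
  then obtain Z where "a < norm (stft phi g Z)" "norm (Z - X) < R" by (auto simp: dist_norm)
  then show "X \<in> {X \<in> space borel. a < loc_max g X}" using loc_max_ge[OF g, of Z X] by simp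
 qed
 then show "{X \<in> space borel. a < loc_max g X} \<in> sets borel" by (simp add: open_UN)
qed

text \<open>Secures membership in \<open>B\<close> before any estimate; the absorption in
  \<open>wiener_estimate\<close> relies on this.\<close>

lemma exp_decay_in_B:
 assumes F: "F \<in> borel_measurable borel" and le: "!!k. k > 0 ==> \<exists>C. \<forall>X. norm (F X) <= C * decay k X"
 shows "(%X. F X * of_real (omega X)) \<in> B"
proof -
 obtain kappa where kappa: "kappa > 0" "(%X. complex_of_real (decay kappa X * omega X)) \<in> B"
  using exp_weight_in_B[OF omega_P_E] by blast
 obtain C where C: "!!X. norm (F X) <= C * decay kappa X" using le[OF kappa(1)] by blast
 have "F \<in> borel_measurable lebesgue" using F by (intro measurable_completion) simp
 then have m: "(%X. F X * of_real (omega X)) \<in> borel_measurable lebesgue" using omega_meas by measurable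
 show ?thesis
 proof (rule K(4)[OF m B_cmult[OF kappa(2), of "of_real C"]], rule AE_I2)
  fix X
  have "norm (F X) * omega X <= (C * decay kappa X) * omega X" using omega_pos[of X] by (intro mult_right_mono C) auto
  also have "... <= \<bar>C\<bar> * decay kappa X * omega X" using omega_pos[of X] by (intro mult_right_mono) auto
  finally show "norm (F X * of_real (omega X)) <= norm (of_real C * complex_of_real (decay kappa X * omega X))"
   using omega_pos[of X] by (simp add: norm_mult abs_mult mult_ac)
 qed
qed

lemma stft_borel: "g \<in> Sigma1 ==> stft phi g \<in> borel_measurable borel"
 by (intro borel_measurable_continuous_onI stft_continuous Sigma1_integrable phi)

lemma stft_in_B: "g \<in> Sigma1 ==> (%X. stft phi g X * of_real (omega X)) \<in> B"
 using stft_exp_decay[OF _ phi] by (intro exp_decay_in_B stft_borel) blast+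

lemma loc_max_in_B:
 assumes g: "g \<in> Sigma1"
 shows "(%X. of_real (loc_max g X) * of_real (omega X)) \<in> B"
proof (rule exp_decay_in_B)
 show "(%X. complex_of_real (loc_max g X)) \<in> borel_measurable borel" using loc_max_borel[OF g] by measurable
 fix k :: real assume k: "k > 0"
 obtain C where C: "C >= 0" "!!X. norm (stft phi g X) <= C * decay k X" using stft_exp_decay[OF g phi k] by blast
 have "norm (complex_of_real (loc_max g X)) <= C * exp (k * R) * decay k X" for X
 proof -
  have "loc_max g X <= C * (exp (k * R) * decay k X)"
  proof (rule loc_max_le)
   fix Z assume Z: "norm (Z - X) < R"
   have "norm X <= norm Z + R" using Z norm_triangle_ineq4[of Z "Z - X"] by simp
   then have "k * norm X <= k * (norm Z + R)" using k by (intro mult_left_mono) auto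
   then have e: "decay k Z <= exp (k * R) * decay k X" unfolding mult_exp_exp by (simp add: algebra_simps)
   show "norm (stft phi g Z) <= C * (exp (k * R) * decay k X)"
    by (rule order_trans[OF C(2)]) (intro mult_left_mono e C(1))
  qed
  then show ?thesis using loc_max_nonneg[OF g, of X] by (simp add: mult.assoc)
 qed
 then show "\<exists>C. \<forall>X. norm (complex_of_real (loc_max g X)) <= C * decay k X" by blast
qed

text \<open>For \<open>Z\<close> in the cell of \<open>l\<close> the transform at
  \<open>X - Z\<close> is at most the maximal function at \<open>X - l\<close>. This trades an
  integral, to which the r-triangle inequality does not apply, for a lattice sum.\<close>

lemma stft_conv_exp_le_sum:
 assumes g: "g \<in> Sigma1" and k: "k > 0"
 shows "(LINT Y|lborel. norm (stft phi g Y) * decay k (X - Y))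
  <= exp (k * R) * infsum (%l. decay k l * loc_max g (X - l)) int_lattice"
  and "(%l. decay k l * loc_max g (X - l)) summable_on int_lattice"
proof -
 obtain C where C: "!!X. norm (stft phi g X) <= C" using stft_bounded[OF g] by blast
 have mC: "loc_max g X <= C" for X by (rule loc_max_le) (rule C)
 show s: "(%l. decay k l * loc_max g (X - l)) summable_on int_lattice"
 proof (rule summable_on_comparison_test[OF summable_on_cmult_left[OF summable_exp_lattice[OF k], of C]])
  show "decay k l * loc_max g (X - l) <= decay k l * C" for l :: "'a \<times> 'a"
   by (intro mult_left_mono mC) auto
  show "0 <= decay k l * loc_max g (X - l)" for l :: "'a \<times> 'a" using loc_max_nonneg[OF g] by simp
 qed
 let ?u = "%Z. norm (stft phi g (X - Z)) * decay k Z"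
 let ?b = "%l. exp (k * R) * (decay k l * loc_max g (X - l))"
 have um: "?u \<in> borel_measurable borel"
 proof -
  have "(%Z. stft phi g (X - Z)) \<in> borel_measurable borel" by (rule measurable_compose[OF _ stft_borel[OF g]]) simp
  then show ?thesis by measurable
 qed
 then have um': "?u \<in> borel_measurable lebesgue" by (intro measurable_completion) simp
 have "(LINT Y|lborel. norm (stft phi g Y) * decay k (X - Y)) = (LINT Z|lborel. ?u Z)"
 proof -
  have "(%Y. norm (stft phi g Y) * decay k (X - Y)) \<in> borel_measurable borel"
   using stft_borel[OF g] by measurable
  from lborel_integral_affine[OF this, of "-1" X] show ?thesis by simp
 qed
 also have "... = (LINT Z|lebesgue. ?u Z)" by (rule integral_completion[symmetric]) (use um in simp)
 also have "... <= infsum ?b int_lattice"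
 proof (rule integral_le_sum_cells(2)[OF um'])
  show "?b summable_on int_lattice" by (intro summable_on_cmult_right s)
  fix l :: "'a \<times> 'a" assume "l \<in> int_lattice"
  show "0 <= ?b l" using loc_max_nonneg[OF g] by simp
  have "ennreal (?u Z) * indicator (cell l) Z <= ennreal (?b l) * indicator (cell l) Z" for Z
  proof (cases "Z \<in> cell l")
   case True
   have "norm (Z - l) <= real DIM('a \<times> 'a)" using True by (intro norm_diff_cell subsetD[OF cell_subset_cbox])
   then have "norm ((X - Z) - (X - l)) < R" by (simp add: R_def norm_minus_commute)
   then have 1: "norm (stft phi g (X - Z)) <= loc_max g (X - l)" by (rule loc_max_ge[OF g])
   have "decay k Z <= exp (k * DIM('a \<times> 'a)) * decay k l" by (rule exp_norm_cell[OF _ True]) (use k in simp)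
   also have "... <= exp (k * R) * decay k l" using k by (intro mult_right_mono) (auto simp: R_def)
   finally have "?u Z <= loc_max g (X - l) * (exp (k * R) * decay k l)"
    using 1 loc_max_nonneg[OF g] by (intro mult_mono) auto
   then show ?thesis using True by (simp add: mult_ac ennreal_leI)
  qed simp
  then have "(\<integral>\<^sup>+Z. ennreal (?u Z) * indicator (cell l) Z \<partial>lebesgue) <= (\<integral>\<^sup>+Z. ennreal (?b l) * indicator (cell l) Z \<partial>lebesgue)"
   by (intro nn_integral_mono)
  also have "... = ennreal (?b l) * emeasure lebesgue (cell l)" by (intro nn_integral_cmult_indicator) auto
  also have "... <= ennreal (?b l) * 1" by (intro mult_left_mono emeasure_cell_le) auto
  finally show "(\<integral>\<^sup>+Z. ennreal (?u Z) * indicator (cell l) Z \<partial>lebesgue) <= ennreal (?b l)" by simp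
 qed simp
 also have "... = exp (k * R) * infsum (%l. decay k l * loc_max g (X - l)) int_lattice"
  by (rule infsum_cmult_right[OF s])
 finally show "(LINT Y|lborel. norm (stft phi g Y) * decay k (X - Y))
  <= exp (k * R) * infsum (%l. decay k l * loc_max g (X - l)) int_lattice" .
qed

text \<open>Every point of the ball is within \<open>delta\<close> of a net point, where the local
  comparison has the factor \<open>sqrt delta\<close>. The constant \<open>C\<close> depends neither
  on \<open>delta\<close> nor on the net, which permits the later absorption.\<close>

lemma loc_max_le_net:
 fixes k :: real
 assumes k: "k > 0"
 shows "\<exists>C\<ge>0. \<forall>delta. 0 < delta --> delta <= 1 --> (\<exists>T. finite T \<and> (\<forall>g\<in>Sigma1. \<forall>X. loc_max g X
  <= (\<Sum>u\<in>T. norm (stft phi g (X - u))) + C * sqrt delta * infsum (%l. decay k l * loc_max g (X - l)) int_lattice))"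
proof -
 obtain C where C: "C >= 0" "!!g X U. g \<in> Sigma1 ==> norm U <= 1 ==>
  norm (stft phi g (X + U)) <= norm (stft phi g X) + C * sqrt (norm U) * (LINT Y|lborel. norm (stft phi g Y) * decay k (X - Y))"
  using stft_local_comparison[OF phi phi_nz k] by blast
 show ?thesis
 proof (intro exI[of _ "C * exp (k * (R + 1)) * exp (k * R)"] conjI allI impI)
  show "0 <= C * exp (k * (R + 1)) * exp (k * R)" using C by simp
  fix delta :: real assume delta: "0 < delta" "delta <= 1"
  obtain T' where T': "finite T'" "cball (0::'a \<times> 'a) R \<subseteq> (\<Union>u\<in>T'. ball u delta)"
   using compact_cball[of "0::'a\<times>'a" R] delta(1) unfolding compact_eq_totally_bounded by blast
  \<comment> \<open>Reflected, because the terms are to be translates at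
    \<open>X - u\<close>.\<close>
  define T where "T = uminus ` T'"
  show "\<exists>T. finite T \<and> (\<forall>g\<in>Sigma1. \<forall>X. loc_max g X
   <= (\<Sum>u\<in>T. norm (stft phi g (X - u))) + C * exp (k * (R + 1)) * exp (k * R) * sqrt delta * infsum (%l. decay k l * loc_max g (X - l)) int_lattice)"
  proof (intro exI[of _ T] conjI ballI allI)
   show fT: "finite T" using T' by (simp add: T_def)
   fix g X assume g: "g \<in> (Sigma1 :: ('a => complex) set)"
   let ?S = "infsum (%l. decay k l * loc_max g (X - l)) int_lattice"
   show "loc_max g X <= (\<Sum>u\<in>T. norm (stft phi g (X - u))) + C * exp (k * (R + 1)) * exp (k * R) * sqrt delta * ?S"
   proof (rule loc_max_le)
    fix Z assume Z: "norm (Z - X) < R"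
    then have "Z - X \<in> cball 0 R" by simp
    then obtain u where u: "u \<in> T'" "Z - X \<in> ball u delta" using T'(2) by blast
    define U where "U = Z - X - u"
    have U: "norm U <= delta" "norm U <= 1" using u(2) delta by (auto simp: U_def dist_norm norm_minus_commute)
    have "norm u <= norm (Z - X) + norm U" using norm_triangle_ineq4[of "Z - X" U] by (simp add: U_def)
    then have uR: "norm u <= R + 1" using Z U by simp
    let ?I = "LINT Y|lborel. norm (stft phi g Y) * decay k (X + u - Y)"
    let ?J = "LINT Y|lborel. norm (stft phi g Y) * decay k (X - Y)"
    have ii: "integrable lborel (%Y. norm (stft phi g Y) * decay k (W - Y))" for W
    proof (rule integrable_dominated[OF integrable_norm[OF stft_integrable_pair[OF g phi]]])
     show "(%Y. norm (stft phi g Y) * decay k (W - Y)) \<in> borel_measurable lborel"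
      using stft_borel[OF g] by measurable
     show "AE Y in lborel. norm (norm (stft phi g Y) * decay k (W - Y)) <= norm (norm (stft phi g Y))"
      using k by (intro AE_I2) (simp add: mult_left_le)
    qed
    \<comment> \<open>Moves the center of the exponential from \<open>X + u\<close> to
      \<open>X\<close>, at a cost controlled by \<open>norm u <= R + 1\<close>.\<close>
    have "?I <= (LINT Y|lborel. exp (k * (R + 1)) * (norm (stft phi g Y) * decay k (X - Y)))"
    proof (rule integral_mono[OF ii integrable_mult_right[OF ii]])
     fix Y
     have "norm (X - Y) <= norm (X + u - Y) + (R + 1)" using norm_triangle_ineq4[of "X + u - Y" u] uR by simp
     then have "k * norm (X - Y) <= k * (norm (X + u - Y) + (R + 1))" using k by (intro mult_left_mono) auto
     then have "decay k (X + u - Y) <= exp (k * (R + 1)) * decay k (X - Y)"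
      unfolding mult_exp_exp using k by (simp add: algebra_simps)
     then have "norm (stft phi g Y) * decay k (X + u - Y) <= norm (stft phi g Y) * (exp (k * (R + 1)) * decay k (X - Y))"
      by (intro mult_left_mono) auto
     then show "norm (stft phi g Y) * decay k (X + u - Y) <= exp (k * (R + 1)) * (norm (stft phi g Y) * decay k (X - Y))"
      by (simp only: mult_ac)
    qed
    also have "... = exp (k * (R + 1)) * ?J" by (rule integral_mult_right_zero)
    also have "... <= exp (k * (R + 1)) * (exp (k * R) * ?S)"
     by (intro mult_left_mono stft_conv_exp_le_sum(1) g k) auto
    finally have I: "?I <= exp (k * (R + 1)) * (exp (k * R) * ?S)" .
    have I0: "?I >= 0" by (intro integral_nonneg_AE AE_I2) auto
    have "norm (stft phi g Z) <= norm (stft phi g (X + u)) + C * sqrt (norm U) * ?I"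
     using C(2)[OF g U(2), of "X + u"] by (simp add: U_def)
    also have "C * sqrt (norm U) * ?I <= C * sqrt delta * (exp (k * (R + 1)) * (exp (k * R) * ?S))"
     using C(1) U(1) delta by (intro mult_mono I I0) auto
    also have "norm (stft phi g (X + u)) <= (\<Sum>u\<in>T. norm (stft phi g (X - u)))"
     using member_le_sum[of "- u" T "%u. norm (stft phi g (X - u))"] u(1) fT by (simp add: T_def)
    finally show "norm (stft phi g Z) <= (\<Sum>u\<in>T. norm (stft phi g (X - u))) + C * exp (k * (R + 1)) * exp (k * R) * sqrt delta * ?S"
     by (simp add: mult_ac)
   qed
  qed
 qed
qed


text \<open>Absolute values turn the sum into a pointwise majorant; solidity is used once for the
  sum and once for each absolute value.\<close>

lemma N_triangle_dominated:
 assumes H: "H \<in> borel_measurable lebesgue" and F: "F \<in> B" and G: "G \<in> B"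
  and le: "!!X. norm (H X) <= norm (F X) + norm (G X)"
 shows "N H powr r <= (K powr r)\<^sup>2 * (N F powr r + N G powr r)"
proof -
 let ?F = "%X. complex_of_real (norm (F X))" and ?G = "%X. complex_of_real (norm (G X))"
 have B: "(%X. ?F X + ?G X) \<in> B" by (intro B_add abs_in_B F G)
 have "N H powr r <= K powr r * N (%X. ?F X + ?G X) powr r"
  by (rule solid_powr[OF H B]) (use le in \<open>simp add: of_real_add[symmetric] del: of_real_add\<close>)
 also have "... <= K powr r * (N ?F powr r + N ?G powr r)"
  by (intro mult_left_mono N_triangle abs_in_B F G) auto
 also have "... <= K powr r * (K powr r * N F powr r + K powr r * N G powr r)"
  by (intro mult_left_mono add_mono abs_in_B F G) auto
 finally show ?thesis by (simp add: power2_eq_square algebra_simps)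
qed

text \<open>
 Both terms of the net inequality are controlled by translates: the sum over the net by the
 short-time Fourier transform itself, the lattice sum by the local maximal function, with a factor
 that is small with the mesh and can be absorbed, as the left-hand side is finite a priori.
\<close>

lemma wiener_estimate:
 "\<exists>C\<ge>0. \<forall>g\<in>Sigma1. N (%X. of_real (loc_max g X) * of_real (omega X)) powr r <= C * q g powr r"
proof -
 obtain C1 k1 where C1: "C1 > 0" "k1 > 0" "!!x y. omega (x + y) <= C1 * exp (k1 * norm y) * omega x"
  using P_E_exp_moderate[OF omega_P_E] by blast
 obtain C2 k2 where C2: "C2 > 0" "k2 > 0" "!!x y. v0 (x + y) <= C2 * exp (k2 * norm y) * v0 x"
  using P_E_exp_moderate[OF v0_P_E] by blast
 \<comment> \<open>\<open>k1 + k2\<close> is the exponential cost of a translation in the weighted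
   quasi-norm; the additional 1 makes the lattice sum converge.\<close>
 define k where "k = k1 + k2 + 1"
 have k: "k > 0" using C1 C2 by (simp add: k_def)
 obtain C where C: "C >= 0" "!!delta. 0 < delta ==> delta <= 1 ==> (\<exists>T. finite T \<and> (\<forall>g\<in>Sigma1. \<forall>X. loc_max g X
  <= (\<Sum>u\<in>T. norm (stft phi g (X - u))) + C * sqrt delta * infsum (%l. decay k l * loc_max g (X - l)) int_lattice))"
  using loc_max_le_net[OF k] by blast
 define A where "A = K\<^sup>2 * C1 * C2 * v0 0"
 have A: "A > 0" using K(1) C1 C2 v0_pos[of 0] by (simp add: A_def)
 have shift: "omega X <= C1 * exp (k1 * norm U) * omega (X - U)" for X U using C1(3)[of "X - U" U] by simp
 have tr: "(%X. F (X - U) * of_real (omega X)) \<in> B"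
  "N (%X. F (X - U) * of_real (omega X)) <= A * exp ((k1 + k2) * norm U) * N (%X. F X * of_real (omega X))"
  if F: "F \<in> borel_measurable borel" "(%X. F X * of_real (omega X)) \<in> B" for F U
 proof -
  show "(%X. F (X - U) * of_real (omega X)) \<in> B" by (rule weighted_translate(1)[OF omega_meas omega_pos shift F])
  have "N (%X. F (X - U) * of_real (omega X)) <= K\<^sup>2 * (C1 * exp (k1 * norm U)) * v0 U * N (%X. F X * of_real (omega X))"
   by (rule weighted_translate(2)[OF omega_meas omega_pos shift F])
  also have "... <= K\<^sup>2 * (C1 * exp (k1 * norm U)) * (C2 * exp (k2 * norm U) * v0 0) * N (%X. F X * of_real (omega X))"
   using C2(3)[of 0 U] C1(1) N_nonneg[OF F(2)] by (intro mult_right_mono mult_left_mono) auto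
  also have "... = A * (exp (k1 * norm U) * exp (k2 * norm U)) * N (%X. F X * of_real (omega X))"
   by (simp add: A_def mult_ac)
  also have "exp (k1 * norm U) * exp (k2 * norm U) = exp ((k1 + k2) * norm U)"
   unfolding mult_exp_exp by (simp add: algebra_simps)
  finally show "N (%X. F (X - U) * of_real (omega X)) <= A * exp ((k1 + k2) * norm U) * N (%X. F X * of_real (omega X))" .
 qed
 let ?M = "%g X. complex_of_real (loc_max g X) * of_real (omega X)"
 define S where "S = infsum (%l::'a\<times>'a. decay r l) int_lattice"
 have S: "S >= 0" unfolding S_def by (intro infsum_nonneg) auto
 define c where "c = (K powr r)\<^sup>2 * ((K powr r)\<^sup>2 * ((C * A) powr r * S))"
 have c: "c >= 0" using S by (simp add: c_def)
 \<comment> \<open>Solves \<open>c * sqrt delta powr r <= 1 / 2\<close>; the denominator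
   \<open>2 * c + 2\<close> also covers \<open>c = 0\<close>.\<close>
 define delta where "delta = min 1 (((1 / (2 * c + 2)) powr (1 / r))\<^sup>2)"
 have delta: "0 < delta" "delta <= 1" using c by (auto simp: delta_def)
 have "sqrt delta <= (1 / (2 * c + 2)) powr (1 / r)"
 proof -
  have "sqrt delta <= sqrt (((1 / (2 * c + 2)) powr (1 / r))\<^sup>2)" by (intro real_sqrt_le_mono) (simp add: delta_def)
  then show ?thesis by simp
 qed
 then have "sqrt delta powr r <= ((1 / (2 * c + 2)) powr (1 / r)) powr r" using r_pos delta by (intro powr_mono2) auto
 also have "... = 1 / (2 * c + 2)" using r_pos c by (simp add: powr_powr)
 finally have "c * sqrt delta powr r <= c * (1 / (2 * c + 2))" using c by (intro mult_left_mono)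
 also have "... <= 1 / 2" using c by (simp add: field_simps)
 finally have small: "c * sqrt delta powr r <= 1 / 2" .
 obtain T where T: "finite T" "!!g X. g \<in> Sigma1 ==> loc_max g X
  <= (\<Sum>u\<in>T. norm (stft phi g (X - u))) + C * sqrt delta * infsum (%l. decay k l * loc_max g (X - l)) int_lattice"
  using C(2)[OF delta] by blast
 define E where "E = (K powr r)\<^sup>2 * (\<Sum>u\<in>T. K powr r * (A * exp ((k1 + k2) * norm u)) powr r)"
 have E: "E >= 0" unfolding E_def by (intro mult_nonneg_nonneg sum_nonneg) auto
 show ?thesis
 proof (intro exI[of _ "2 * E"] conjI ballI)
  fix g assume g: "g \<in> (Sigma1 :: ('a => complex) set)"
  let ?V = "%X. stft phi g X * of_real (omega X)"
  have VB: "?V \<in> B" by (rule stft_in_B[OF g])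
  have MB: "?M g \<in> B" by (rule loc_max_in_B[OF g])
  have mm: "(%X. complex_of_real (loc_max g X)) \<in> borel_measurable borel" using loc_max_borel[OF g] by measurable
  define P where "P X = (\<Sum>u\<in>T. complex_of_real (norm (stft phi g (X - u) * of_real (omega X))))" for X
  have u: "(%X. complex_of_real (norm (stft phi g (X - u) * of_real (omega X)))) \<in> B"
   "N (%X. complex_of_real (norm (stft phi g (X - u) * of_real (omega X)))) powr r <= K powr r * (A * exp ((k1 + k2) * norm u)) powr r * q g powr r" for u
  proof -
   note t = tr[OF stft_borel[OF g] VB, of u]
   show "(%X. complex_of_real (norm (stft phi g (X - u) * of_real (omega X)))) \<in> B" by (rule abs_in_B(1)[OF t(1)])
   have "N (%X. stft phi g (X - u) * of_real (omega X)) powr r <= (A * exp ((k1 + k2) * norm u) * q g) powr r"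
    unfolding q_def by (rule powr_mono2[OF less_imp_le[OF r_pos] N_nonneg[OF t(1)] t(2)])
   also have "... = (A * exp ((k1 + k2) * norm u)) powr r * q g powr r" by (rule powr_mult)
   finally have "K powr r * N (%X. stft phi g (X - u) * of_real (omega X)) powr r <= K powr r * ((A * exp ((k1 + k2) * norm u)) powr r * q g powr r)"
    by (intro mult_left_mono) auto
   then show "N (%X. complex_of_real (norm (stft phi g (X - u) * of_real (omega X)))) powr r <= K powr r * (A * exp ((k1 + k2) * norm u)) powr r * q g powr r"
    using abs_in_B(2)[OF t(1)] by (simp only: mult.assoc)
  qed
  have PB: "P \<in> B" unfolding P_def by (rule N_sum(1)[OF T(1)]) (rule u)
  have "N P powr r <= (\<Sum>u\<in>T. N (%X. complex_of_real (norm (stft phi g (X - u) * of_real (omega X)))) powr r)"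
   unfolding P_def by (rule N_sum(2)[OF T(1)]) (rule u)
  also have "... <= (\<Sum>u\<in>T. K powr r * (A * exp ((k1 + k2) * norm u)) powr r * q g powr r)" by (intro sum_mono u)
  also have "... = (\<Sum>u\<in>T. K powr r * (A * exp ((k1 + k2) * norm u)) powr r) * q g powr r" by (simp add: sum_distrib_right)
  finally have NP: "(K powr r)\<^sup>2 * N P powr r <= E * q g powr r"
   unfolding E_def using mult_left_mono[of _ _ "(K powr r)\<^sup>2"] by (simp add: mult.assoc)
  define Q where "Q X = complex_of_real (C * sqrt delta * infsum (%l. decay k l * loc_max g (X - l)) int_lattice) * of_real (omega X)" for X
  define G where "G l X = complex_of_real (C * sqrt delta * decay k l) * (of_real (loc_max g (X - l)) * of_real (omega X))" for l X
  have GB: "G l \<in> B" for l unfolding G_def by (rule B_cmult[OF tr(1)[OF mm MB]])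
  have NG: "N (G l) powr r <= ((C * A) powr r * (sqrt delta powr r * N (?M g) powr r)) * decay r l" for l
  proof -
   have "N (G l) = (C * sqrt delta * decay k l) * N (%X. of_real (loc_max g (X - l)) * of_real (omega X))"
    unfolding G_def using C(1) delta by (subst N_cmult[OF tr(1)[OF mm MB]]) (simp add: norm_mult)
   also have "... <= (C * sqrt delta * decay k l) * (A * exp ((k1 + k2) * norm l) * N (?M g))"
    using C(1) delta by (intro mult_left_mono tr(2)[OF mm MB]) auto
   also have "... = (C * A) * (sqrt delta * N (?M g)) * (decay k l * exp ((k1 + k2) * norm l))" by (simp only: mult_ac)
   also have "decay k l * exp ((k1 + k2) * norm l) = exp (- norm l)"
    unfolding mult_exp_exp by (simp add: k_def algebra_simps)
   finally have "N (G l) powr r <= ((C * A) * (sqrt delta * N (?M g)) * exp (- norm l)) powr r"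
    by (rule powr_mono2[OF less_imp_le[OF r_pos] N_nonneg[OF GB]])
   also have "... = ((C * A) powr r * (sqrt delta powr r * N (?M g) powr r)) * exp (- norm l) powr r" by (simp only: powr_mult)
   also have "exp (- norm l) powr r = decay r l" by (simp add: powr_def)
   finally show ?thesis .
  qed
  have ss: "(%l. decay k l * loc_max g (X - l)) summable_on int_lattice" for X by (rule stft_conv_exp_le_sum(2)[OF g k])
  have nG: "norm (G l X) = (C * sqrt delta * omega X) * (decay k l * loc_max g (X - l))" for l X
   using C(1) delta loc_max_nonneg[OF g] less_imp_le[OF omega_pos] by (simp add: G_def norm_mult abs_mult mult_ac)
  have sNG: "(%l. N (G l) powr r) summable_on int_lattice"
   by (rule summable_on_comparison_test[OF summable_on_cmult_right[OF summable_exp_lattice[OF r_pos]]]) (rule NG powr_ge_zero)+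
  \<comment> \<open>The unordered sum is rewritten as a series along an enumeration, which shows
    that it is measurable.\<close>
  have Qm: "Q \<in> borel_measurable lebesgue"
  proof -
   obtain e :: "'a\<times>'a => nat" where "bij_betw e int_lattice UNIV" by (rule countableE_infinite[OF countable_int_lattice infinite_int_lattice])
   then have e: "bij_betw (inv_into int_lattice e) UNIV (int_lattice :: ('a\<times>'a) set)" by (rule bij_betw_inv_into)
   have "(\<Sum>n. decay k (inv_into int_lattice e n) * loc_max g (X - inv_into int_lattice e n)) = infsum (%l. decay k l * loc_max g (X - l)) int_lattice" for X
    using summable_nonneg_lattice_enum(2)[OF e ss] loc_max_nonneg[OF g] by simp
   then have eq: "infsum (%l. decay k l * loc_max g (X - l)) int_lattice = (\<Sum>n. decay k (inv_into int_lattice e n) * loc_max g (X - inv_into int_lattice e n))" for X by simp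
   have mt: "(%X. loc_max g (X - l)) \<in> borel_measurable borel" for l by (rule measurable_compose[OF _ loc_max_borel[OF g]]) simp
   have "(%X. infsum (%l. decay k l * loc_max g (X - l)) int_lattice) \<in> borel_measurable borel"
    unfolding eq by (intro borel_measurable_suminf borel_measurable_times borel_measurable_const mt)
   then have "(%X. infsum (%l. decay k l * loc_max g (X - l)) int_lattice) \<in> borel_measurable lebesgue"
    by (intro measurable_completion) simp
   then show ?thesis unfolding Q_def using omega_meas by measurable
  qed
  have nQ: "norm (Q X) = infsum (%l. norm (G l X)) int_lattice" for X
  proof -
   have nn: "0 <= infsum (%l. decay k l * loc_max g (X - l)) int_lattice"
    using loc_max_nonneg[OF g] by (intro infsum_nonneg) auto
   have "infsum (%l. norm (G l X)) int_lattice = (C * sqrt delta * omega X) * infsum (%l. decay k l * loc_max g (X - l)) int_lattice"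
    unfolding nG by (rule infsum_cmult_right[OF ss])
   also have "... = norm (Q X)" using C(1) delta nn less_imp_le[OF omega_pos, of X] by (simp add: Q_def norm_mult abs_mult mult_ac)
   finally show ?thesis by simp
  qed
  have sG: "(%l. norm (G l X)) summable_on int_lattice" for X unfolding nG by (intro summable_on_cmult_right ss)
  have Q: "Q \<in> B" "N Q powr r <= (K powr r)\<^sup>2 * infsum (%l. N (G l) powr r) int_lattice"
   using N_infsum[OF countable_int_lattice infinite_int_lattice GB sNG Qm sG] nQ by auto
  have "infsum (%l. N (G l) powr r) int_lattice <= infsum (%l::'a\<times>'a. ((C * A) powr r * (sqrt delta powr r * N (?M g) powr r)) * decay r l) int_lattice"
   by (intro infsum_mono sNG summable_on_cmult_right summable_exp_lattice r_pos NG)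
  also have "... = ((C * A) powr r * (sqrt delta powr r * N (?M g) powr r)) * S"
   unfolding S_def by (rule infsum_cmult_right[OF summable_exp_lattice[OF r_pos]])
  finally have "(K powr r)\<^sup>2 * N Q powr r <= (K powr r)\<^sup>2 * ((K powr r)\<^sup>2 * (((C * A) powr r * (sqrt delta powr r * N (?M g) powr r)) * S))"
   using Q(2) by (intro mult_left_mono order_trans[OF Q(2)]) auto
  also have "... = c * sqrt delta powr r * N (?M g) powr r" by (simp add: c_def mult_ac)
  also have "... <= 1 / 2 * N (?M g) powr r" by (intro mult_right_mono small) auto
  finally have NQ: "(K powr r)\<^sup>2 * N Q powr r <= 1 / 2 * N (?M g) powr r" .
  have "N (?M g) powr r <= (K powr r)\<^sup>2 * (N P powr r + N Q powr r)"
  proof (rule N_triangle_dominated[OF B_meas[OF MB] PB Q(1)])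
   fix X
   let ?I = "infsum (%l. decay k l * loc_max g (X - l)) int_lattice"
   have nn: "0 <= ?I" using loc_max_nonneg[OF g] by (intro infsum_nonneg) auto
   have "norm (?M g X) = loc_max g X * omega X" using loc_max_nonneg[OF g, of X] omega_pos[of X] by (simp add: norm_mult)
   also have "... <= ((\<Sum>u\<in>T. norm (stft phi g (X - u))) + C * sqrt delta * ?I) * omega X"
    using omega_pos[of X] by (intro mult_right_mono T g) auto
   also have "... = (\<Sum>u\<in>T. norm (stft phi g (X - u)) * omega X) + C * sqrt delta * ?I * omega X"
    by (simp add: distrib_right sum_distrib_right)
   also have "(\<Sum>u\<in>T. norm (stft phi g (X - u)) * omega X) = norm (P X)"
   proof -
    have "P X = of_real (\<Sum>u\<in>T. norm (stft phi g (X - u)) * omega X)" using omega_pos[of X] by (simp add: P_def norm_mult)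
    moreover have "0 <= (\<Sum>u\<in>T. norm (stft phi g (X - u)) * omega X)" using less_imp_le[OF omega_pos] by (intro sum_nonneg) auto
    ultimately show ?thesis by (simp only: norm_of_real abs_of_nonneg)
   qed
   also have "C * sqrt delta * ?I * omega X = norm (Q X)"
    using C(1) delta nn omega_pos[of X] by (simp add: Q_def norm_mult abs_mult)
   finally show "norm (?M g X) <= norm (P X) + norm (Q X)" .
  qed
  then have "N (?M g) powr r <= E * q g powr r + 1 / 2 * N (?M g) powr r"
   using NP NQ by (simp add: distrib_left)
  then show "N (?M g) powr r <= 2 * E * q g powr r" by simp
 qed (use E in simp)
qed

end

section \<open>Mollifiers\<close>

text \<open>The Gaussian of width \<open>s\<close>, normalized to integral 1.\<close>

definition mollifier :: "real => 'a::euclidean_space => real" where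
 "mollifier s x = (1 / (gauss_mass TYPE('a) * s ^ DIM('a))) * gauss ((1 / s) *\<^sub>R x)"

lemma mollifier_nonneg: "s > 0 ==> 0 <= mollifier s (x::'a::euclidean_space)"
 using gauss_mass_pos[where 'a='a] by (simp add: mollifier_def)

lemma mollifier_Sigma1:
 assumes "s > 0" shows "(%x::'a::euclidean_space. complex_of_real (mollifier s x)) \<in> Sigma1"
proof -
 have "(%x::'a. complex_of_real (gauss ((1 / s) *\<^sub>R x + 0))) \<in> Sigma1"
  by (rule Sigma1_affine[OF Sigma1_gauss]) (use assms in simp)
 from Sigma1_cmult[OF this, of "of_real (1 / (gauss_mass TYPE('a) * s ^ DIM('a)))"]
 show ?thesis by (simp add: mollifier_def)
qed

lemma mollifier_borel [measurable]: "mollifier s \<in> borel_measurable borel"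
 unfolding mollifier_def[abs_def] by measurable

lemma mollifier_integral:
 fixes h :: "'a::euclidean_space => real"
 assumes s: "s > 0" and h: "h \<in> borel_measurable borel"
 shows "(LINT y|lborel. mollifier s y * h y) = (1 / gauss_mass TYPE('a)) * (LINT z|lborel. gauss z * h (s *\<^sub>R z))"
proof -
 have "(%y. mollifier s y * h y) \<in> borel_measurable borel" using h by measurable
 from lborel_integral_affine[OF this, of s 0]
 have "(LINT y|lborel. mollifier s y * h y) = s ^ DIM('a) * (LINT z|lborel. mollifier s (s *\<^sub>R z) * h (s *\<^sub>R z))"
  using s by simp
 also have "(LINT z|lborel. mollifier s (s *\<^sub>R z) * h (s *\<^sub>R z)) = (LINT z|lborel. (1 / (gauss_mass TYPE('a) * s ^ DIM('a))) * (gauss z * h (s *\<^sub>R z)))"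
  using s by (intro Bochner_Integration.integral_cong refl) (simp add: mollifier_def)
 also have "... = (1 / (gauss_mass TYPE('a) * s ^ DIM('a))) * (LINT z|lborel. gauss z * h (s *\<^sub>R z))"
  by (rule integral_mult_right_zero)
 finally show ?thesis using s by simp
qed

lemma gauss_exp_integrable: "integrable lborel (%z::'a::euclidean_space. gauss z * exp (k * norm z))"
 using Sigma1_exp_integrable[OF Sigma1_gauss, of k, where 'a='a] by (simp add: mult.commute)

text \<open>Bounds the exponential moments of all mollifiers with \<open>s <= 1\<close> at once,
  since narrowing does not increase them.\<close>

definition gauss_moment :: "'a::euclidean_space itself => real => real" where
 "gauss_moment _ k = (1 / gauss_mass TYPE('a)) * (LINT z|lborel. gauss z * exp (k * norm (z::'a)))"

lemma gauss_moment_nonneg: "0 <= gauss_moment TYPE('a::euclidean_space) k"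
 unfolding gauss_moment_def using gauss_mass_pos[where 'a='a]
 by (intro mult_nonneg_nonneg integral_nonneg_AE AE_I2) auto

lemma mollifier_integral_1:
 assumes "s > 0" shows "(LINT y|lborel. mollifier s (y::'a::euclidean_space)) = 1"
proof -
 have "(LINT y|lborel. mollifier s (y::'a) * 1) = 1 / gauss_mass TYPE('a) * (LINT z|lborel. gauss (z::'a) * 1)"
  by (rule mollifier_integral[OF assms]) simp
 then show ?thesis unfolding mult_1_right gauss_integral using gauss_mass_pos[where 'a='a] by simp
qed

lemma mollifier_exp_integrable:
 assumes "s > 0" shows "integrable lborel (%y::'a::euclidean_space. mollifier s y * exp (k * norm y))"
 using Sigma1_exp_integrable[OF mollifier_Sigma1[OF assms], of k, where 'a='a] mollifier_nonneg[OF assms, where 'a='a]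
 by (simp add: mult.commute)

lemma mollifier_exp_moment:
 assumes s: "0 < s" "s <= 1" and k: "k >= 0"
 shows "(LINT y|lborel. mollifier s (y::'a::euclidean_space) * exp (k * norm y)) <= gauss_moment TYPE('a) k"
proof -
 have "(LINT y|lborel. mollifier s (y::'a) * exp (k * norm y)) = (1 / gauss_mass TYPE('a)) * (LINT z|lborel. gauss z * exp (k * norm (s *\<^sub>R (z::'a))))"
  by (rule mollifier_integral[OF s(1)]) measurable
 also have "(LINT z|lborel. gauss z * exp (k * norm (s *\<^sub>R (z::'a)))) <= (LINT z|lborel. gauss z * exp (k * norm (z::'a)))"
 proof (rule integral_mono[OF _ gauss_exp_integrable])
  show "integrable lborel (%z::'a. gauss z * exp (k * norm (s *\<^sub>R z)))"
   using gauss_exp_integrable[of "k * s", where 'a='a] s by (simp add: mult.assoc)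
  fix z :: 'a
  have "k * (s * norm z) <= k * (1 * norm z)" using s k by (intro mult_left_mono mult_right_mono) auto
  then show "gauss z * exp (k * norm (s *\<^sub>R z)) <= gauss z * exp (k * norm z)" using s by simp
 qed
 finally show ?thesis unfolding gauss_moment_def
  using gauss_mass_pos[where 'a='a] by (simp add: divide_right_mono)
qed

text \<open>After rescaling, \<open>norm y\<close> becomes \<open>s * norm z\<close>: the factor
  \<open>s\<close> is the gain, and \<open>norm z\<close> is absorbed into the exponential.\<close>

lemma mollifier_first_moment:
 assumes s: "0 < s" "s <= 1" and k: "k >= 0"
 shows "(LINT y|lborel. mollifier s (y::'a::euclidean_space) * (norm y * exp (k * norm y))) <= s * gauss_moment TYPE('a) (k + 1)"
  "integrable lborel (%y::'a. mollifier s y * (norm y * exp (k * norm y)))"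
proof -
 have le: "norm z * exp (k * norm z) <= exp ((k + 1) * norm z)" for z :: 'a
 proof -
  have "norm z <= exp (norm z)" using exp_ge_add_one_self[of "norm z"] by linarith
  then have "norm z * exp (k * norm z) <= exp (norm z) * exp (k * norm z)" by (intro mult_right_mono) auto
  then show ?thesis unfolding mult_exp_exp by (simp add: algebra_simps)
 qed
 have int: "integrable lborel (%z::'a. gauss z * (norm z * exp (k * norm z)))"
 proof (rule integrable_dominated[OF gauss_exp_integrable[of "k + 1"]])
  show "(%z::'a. gauss z * (norm z * exp (k * norm z))) \<in> borel_measurable lborel" by measurable
  show "AE z::'a in lborel. norm (gauss z * (norm z * exp (k * norm z))) <= norm (gauss z * exp ((k + 1) * norm z))"
   using le by (intro AE_I2) (simp add: abs_mult)
 qed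
 show "integrable lborel (%y::'a. mollifier s y * (norm y * exp (k * norm y)))"
 proof (rule integrable_dominated[OF mollifier_exp_integrable[OF s(1), of "k + 1"]])
  show "(%y::'a. mollifier s y * (norm y * exp (k * norm y))) \<in> borel_measurable lborel" by measurable
  show "AE y::'a in lborel. norm (mollifier s y * (norm y * exp (k * norm y))) <= norm (mollifier s y * exp ((k + 1) * norm y))"
   using le by (intro AE_I2) (simp add: abs_mult mult_left_mono)
 qed
 have "(LINT y|lborel. mollifier s (y::'a) * (norm y * exp (k * norm y)))
  = (1 / gauss_mass TYPE('a)) * (LINT z|lborel. gauss z * (norm (s *\<^sub>R (z::'a)) * exp (k * norm (s *\<^sub>R z))))"
  by (rule mollifier_integral[OF s(1)]) measurable
 also have "... <= (1 / gauss_mass TYPE('a)) * (LINT z|lborel. s * (gauss z * exp ((k + 1) * norm (z::'a))))"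
 proof (intro mult_left_mono)
  show "(LINT z|lborel. gauss z * (norm (s *\<^sub>R (z::'a)) * exp (k * norm (s *\<^sub>R z)))) <= (LINT z|lborel. s * (gauss z * exp ((k + 1) * norm (z::'a))))"
  proof (rule integral_mono_AE')
   show "integrable lborel (%z::'a. s * (gauss z * exp ((k + 1) * norm z)))" by (intro integrable_mult_right gauss_exp_integrable)
   show "AE z::'a in lborel. gauss z * (norm (s *\<^sub>R z) * exp (k * norm (s *\<^sub>R z))) <= s * (gauss z * exp ((k + 1) * norm z))"
   proof (rule AE_I2)
    fix z :: 'a
    have "k * (s * norm z) <= k * (1 * norm z)" using s k by (intro mult_left_mono mult_right_mono) auto
    then have "norm z * exp (k * norm (s *\<^sub>R z)) <= norm z * exp (k * norm z)" using s by (intro mult_left_mono) auto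
    also have "... <= exp ((k + 1) * norm z)" by (rule le)
    finally have "(s * gauss z) * (norm z * exp (k * norm (s *\<^sub>R z))) <= (s * gauss z) * exp ((k + 1) * norm z)"
     using s by (intro mult_left_mono) auto
    then show "gauss z * (norm (s *\<^sub>R z) * exp (k * norm (s *\<^sub>R z))) <= s * (gauss z * exp ((k + 1) * norm z))"
     using s by (simp add: mult_ac)
   qed
  qed (use s in auto)
 qed (use gauss_mass_pos[where 'a='a] in simp)
 also have "... = s * gauss_moment TYPE('a) (k + 1)" by (simp add: gauss_moment_def)
 finally show "(LINT y|lborel. mollifier s (y::'a) * (norm y * exp (k * norm y))) <= s * gauss_moment TYPE('a) (k + 1)" .
qed

abbreviation moll :: "real => 'a::euclidean_space => complex" where
 "moll s \<equiv> (%x. complex_of_real (mollifier s x))"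

text \<open>The Lipschitz hypothesis concerns the single point \<open>x\<close>, so that
  \<open>A\<close> may depend on it; in the next lemma it carries the decay in
  \<open>x\<close>.\<close>

lemma conv_moll_diff:
 fixes u :: "'a::euclidean_space => complex"
 assumes s: "0 < s" "s <= 1" and k: "k >= 0" and u: "u \<in> borel_measurable borel" "!!x. norm (u x) <= B"
  and L: "!!y. norm (u (x - y) - u x) <= A * (norm y * exp (k * norm y))"
 shows "norm (conv (moll s) u x - u x) <= A * (s * gauss_moment TYPE('a) (k + 1))"
proof -
 have im: "integrable lborel (moll s :: 'a => complex)" by (rule Sigma1_integrable[OF mollifier_Sigma1[OF s(1)]])
 have "conv (moll s) u = conv u (moll s)" by (rule conv_commute) (use u in measurable)
 then have "conv (moll s) u x - u x = (LINT y|lborel. u (x - y) * moll s y) - u x * (LINT y|lborel. moll s (y::'a))"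
  using mollifier_integral_1[OF s(1), where 'a='a] by (simp add: conv_def)
 also have "u x * (LINT y|lborel. moll s (y::'a)) = (LINT y|lborel. u x * moll s (y::'a))" by (rule integral_mult_right_zero[symmetric])
 also have "(LINT y|lborel. u (x - y) * moll s y) - ... = (LINT y|lborel. u (x - y) * moll s y - u x * moll s y)"
  by (rule Bochner_Integration.integral_diff[symmetric]) (use integrable_conv[OF u im] im in auto)
 also have "norm ... <= (LINT y|lborel. A * (mollifier s (y::'a) * (norm y * exp (k * norm y))))"
 proof (rule Bochner_Integration.integral_norm_bound_integral)
  show "integrable lborel (%y::'a. u (x - y) * moll s y - u x * moll s y)"
   using integrable_conv[OF u im] im by auto
  show "integrable lborel (%y::'a. A * (mollifier s y * (norm y * exp (k * norm y))))"
   by (intro integrable_mult_right mollifier_first_moment(2) s k)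
  fix y :: 'a
  have "norm (u (x - y) * moll s y - u x * moll s y) = norm (u (x - y) - u x) * mollifier s y"
   using mollifier_nonneg[OF s(1), of y] by (simp add: left_diff_distrib[symmetric] norm_mult)
  also have "... <= (A * (norm y * exp (k * norm y))) * mollifier s y"
   by (intro mult_right_mono L mollifier_nonneg s)
  finally show "norm (u (x - y) * moll s y - u x * moll s y) <= A * (mollifier s y * (norm y * exp (k * norm y)))"
   by (simp add: mult_ac)
 qed
 also have "... = A * (LINT y|lborel. mollifier s (y::'a) * (norm y * exp (k * norm y)))" by (rule integral_mult_right_zero)
 also have "... <= A * (s * gauss_moment TYPE('a) (k + 1))"
 proof (intro mult_left_mono mollifier_first_moment s k)
  \<comment> \<open>The sign of \<open>A\<close> is read off from the hypothesis at one nonzero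
    vector.\<close>
  obtain b :: 'a where b: "b \<in> Basis" using nonempty_Basis by blast
  have "0 <= A * (norm b * exp (k * norm b))" using L[of b] norm_ge_zero order_trans by blast
  then show "0 <= A" using b by (simp add: zero_le_mult_iff)
 qed
 finally show ?thesis .
qed

lemma conv_moll_weighted_diff:
 fixes u :: "'a::euclidean_space => complex"
 assumes k: "k >= 0" and L: "L >= 0" "!!x y. norm (u (x - y) - u x) <= L * norm y * exp (k * norm y) * decay k x"
  and u: "u \<in> borel_measurable borel" "!!x. norm (u x) <= B"
 shows "\<exists>C\<ge>0. \<forall>s x. 0 < s --> s <= 1 --> norm (conv (moll s) u x - u x) <= C * s * decay k x"
proof -
 have "norm (conv (moll s) u x - u x) <= (L * gauss_moment TYPE('a) (k + 1)) * s * decay k x" if s: "0 < s" "s <= 1" for s x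
 proof -
  have "norm (conv (moll s) u x - u x) <= (L * decay k x) * (s * gauss_moment TYPE('a) (k + 1))"
   by (rule conv_moll_diff[OF s k u]) (use L(2)[of x] in \<open>auto simp: mult_ac\<close>)
  then show ?thesis by (simp add: mult_ac)
 qed
 moreover have "0 <= L * gauss_moment TYPE('a) (k + 1)" using L gauss_moment_nonneg[where 'a='a] by simp
 ultimately show ?thesis by blast
qed

lemma conv_moll_Sigma1_diff:
 fixes f :: "'a::euclidean_space => complex"
 assumes f: "f \<in> Sigma1" and k: "k > 0"
 shows "\<exists>C\<ge>0. \<forall>s x. 0 < s --> s <= 1 --> norm (conv (moll s) f x - f x) <= C * s * decay k x"
proof -
 obtain L where L: "L >= 0" "!!x y. norm (f (x - y) - f x) <= L * norm y * exp (k * norm y) * decay k x"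
  using Sigma1_Lipschitz[OF f k] by blast
 obtain B where B: "!!x. norm (f x) <= B" using Sigma1_bounded[OF f] by blast
 show ?thesis using k by (intro conv_moll_weighted_diff[OF _ L Sigma1_borel[OF f] B]) simp
qed

lemma exp_conv_bound:
 fixes x y :: "'a::real_normed_vector"
 assumes "k >= 0" shows "decay k (x - y) <= exp (k * norm y) * decay k x"
proof -
 have "norm x <= norm (x - y) + norm y" using norm_triangle_ineq[of "x - y" y] by simp
 then have "k * norm x <= k * (norm (x - y) + norm y)" using assms by (intro mult_left_mono) auto
 then show ?thesis unfolding mult_exp_exp by (simp add: algebra_simps)
qed

section \<open>Wiener amalgam spaces\<close>

text \<open>After division by \<open>a + b\<close> both terms lie in the unit interval, where
  \<open>t <= t powr r\<close>.\<close>

lemma powr_add_le: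
 fixes a b r :: real
 assumes "0 <= a" "0 <= b" "0 < r" "r <= 1"
 shows "(a + b) powr r <= a powr r + b powr r"
proof (cases "a + b = 0")
 case True then show ?thesis using assms by simp
next
 case False
 then have ab: "a + b > 0" using assms by simp
 have le: "t <= t powr r" if "0 <= t" "t <= 1" for t :: real
 proof (cases "t = 0")
  case False
  then show ?thesis using that assms powr_mono'[of r 1 t] by simp
 qed simp
 have "1 = a / (a + b) + b / (a + b)" using ab by (simp add: add_divide_distrib[symmetric])
 also have "... <= (a / (a + b)) powr r + (b / (a + b)) powr r"
  using assms ab by (intro add_mono le) auto
 also have "... = (a powr r + b powr r) / (a + b) powr r"
  using assms ab by (simp add: powr_divide add_divide_distrib)
 finally show ?thesis using ab by (simp add: pos_le_divide_eq)
qed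

abbreviation cube :: "real^'d => (real^'d) set" where
 "cube k \<equiv> cbox k (\<chi> i. k $ i + 1)"

lemma cube_eq:
 fixes k :: "real^'d" shows "cube k = cbox k (k + One)"
proof -
 have "(One::real^'d) \<bullet> axis i 1 = 1" for i :: 'd by (simp add: axis_in_Basis_iff)
 then have "(One::real^'d) $ i = 1" for i unfolding cart_eq_inner_axis .
 then have "(\<chi> i. k $ i + 1) = k + One" by (simp only: vec_eq_iff vector_add_component vec_lambda_beta simp_thms)
 then show ?thesis by simp
qed

lemma lattice_eq: "lattice = (int_lattice :: (real^'d) set)"
 unfolding lattice_def int_lattice_def by (auto simp: Basis_vec_def inner_axis)

text \<open>The weight is used through its exponential bound: against it, test functions, mollifiers
  and integrable functions of bounded support have controlled norms.\<close>

locale amalgam =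
 fixes r :: real and v :: "real^'d => real" and A kappa :: real
 assumes r: "0 < r" "r <= 1" and v_pos: "!!x. 0 < v x" and v_le: "!!x. v x <= A * exp (kappa * norm x)" and kappa: "kappa > 0"
begin

text \<open>The r-th power of \<open>WL_norm\<close>, for which the ordinary triangle inequality
  holds.\<close>

definition wl :: "(real^'d => complex) => real" where
 "wl f = infsum (WL_term r v f) lattice"

definition mass :: "(real^'d => complex) => real^'d => real" where
 "mass f k = (LINT x:cube k|lebesgue. norm (f x))"

lemma WL_term_eq: "WL_term r v f k = (mass f k * v k) powr r"
 by (simp add: WL_term_def mass_def)

lemma WL_term_nonneg: "0 <= WL_term r v f k"
 by (simp add: WL_term_def)

lemma wl_nonneg: "0 <= wl f"
 unfolding wl_def by (intro infsum_nonneg WL_term_nonneg)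

lemma WL_norm_powr: "WL_norm r v f powr r = wl f"
 using wl_nonneg[of f] r by (simp add: WL_norm_def wl_def[symmetric] powr_powr)

lemma mass_nonneg: "0 <= mass f k"
 unfolding mass_def set_lebesgue_integral_def by (intro integral_nonneg_AE AE_I2) auto

text \<open>Stated by domination, so that sums and differences are covered together.\<close>

lemma WL_memI:
 assumes f: "f \<in> borel_measurable lebesgue" and "g \<in> WL r v" "h \<in> WL r v"
  and le: "!!x. norm (f x) <= norm (g x) + norm (h x)"
 shows "f \<in> WL r v" "wl f <= wl g + wl h"
proof -
 have gi: "set_integrable lebesgue (cube k) g" and hi: "set_integrable lebesgue (cube k) h" if "k \<in> lattice" for k
  using assms(2,3) that by (auto simp: WL_def)
 have gs: "WL_term r v g summable_on lattice" and hs: "WL_term r v h summable_on lattice"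
  using assms(2,3) by (auto simp: WL_def)
 have fi: "set_integrable lebesgue (cube k) f" if k: "k \<in> lattice" for k
 proof (rule set_integrable_bound)
  show "set_integrable lebesgue (cube k) (%x. norm (g x) + norm (h x))"
   by (intro set_integral_add set_integrable_norm gi hi k)
  show "set_borel_measurable lebesgue (cube k) f"
   unfolding set_borel_measurable_def by (intro borel_measurable_scaleR borel_measurable_indicator f) simp
  show "AE x in lebesgue. x \<in> cube k --> norm (f x) <= norm (norm (g x) + norm (h x))"
   using le by (intro AE_I2) auto
 qed
 have mass: "mass f k <= mass g k + mass h k" if k: "k \<in> lattice" for k
 proof -
  have "mass f k <= (LINT x:cube k|lebesgue. norm (g x) + norm (h x))"
   unfolding mass_def by (intro set_integral_mono set_integral_add set_integrable_norm gi hi fi k le)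
  also have "... = mass g k + mass h k"
   unfolding mass_def by (intro set_integral_add set_integrable_norm gi hi k)
  finally show ?thesis .
 qed
 have tm: "WL_term r v f k <= WL_term r v g k + WL_term r v h k" if k: "k \<in> lattice" for k
 proof -
  have "mass f k * v k <= (mass g k + mass h k) * v k" using mass[OF k] v_pos[of k] by (intro mult_right_mono) auto
  then have "(mass f k * v k) powr r <= (mass g k * v k + mass h k * v k) powr r"
   using r mass_nonneg[of f k] v_pos[of k] by (intro powr_mono2) (auto simp: algebra_simps)
  also have "... <= (mass g k * v k) powr r + (mass h k * v k) powr r"
   using mass_nonneg[of g k] mass_nonneg[of h k] v_pos[of k] r by (intro powr_add_le) auto
  finally show ?thesis by (simp add: WL_term_eq)
 qed
 have s: "(%k. WL_term r v g k + WL_term r v h k) summable_on lattice" by (intro summable_on_add gs hs)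
 have fs: "WL_term r v f summable_on lattice"
  by (rule summable_on_comparison_test[OF s]) (auto intro: tm WL_term_nonneg)
 show "f \<in> WL r v" using f fi fs by (auto simp: WL_def)
 have "wl f <= infsum (%k. WL_term r v g k + WL_term r v h k) lattice"
  unfolding wl_def by (intro infsum_mono fs s tm)
 also have "... = wl g + wl h" unfolding wl_def by (rule infsum_add[OF gs hs])
 finally show "wl f <= wl g + wl h" .
qed

lemma WL_meas: "f \<in> WL r v ==> f \<in> borel_measurable lebesgue"
 by (simp add: WL_def)

lemma WL_add: "f \<in> WL r v ==> g \<in> WL r v ==> (%x. f x + g x) \<in> WL r v \<and> wl (%x. f x + g x) <= wl f + wl g"
 using WL_memI[of "%x. f x + g x" f g] WL_meas[of f] WL_meas[of g] norm_triangle_ineq by auto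

lemma WL_diff: "f \<in> WL r v ==> g \<in> WL r v ==> (%x. f x - g x) \<in> WL r v \<and> wl (%x. f x - g x) <= wl f + wl g"
 using WL_memI[of "%x. f x - g x" f g] WL_meas[of f] WL_meas[of g] norm_triangle_ineq4 by auto

lemma wl_triangle:
 assumes "f \<in> WL r v" "g \<in> WL r v" "h \<in> WL r v"
 shows "wl (%x. f x - h x) <= wl (%x. f x - g x) + wl (%x. g x - h x)"
 using WL_add[of "%x. f x - g x" "%x. g x - h x"] WL_diff assms by simp

lemma wl_commute: "wl (%x. f x - g x) = wl (%x. g x - f x)"
 by (simp add: wl_def WL_term_def[abs_def] norm_minus_commute)

lemma wl_zero: "wl (%x. 0) = 0"
 by (simp add: wl_def WL_term_def[abs_def] set_lebesgue_integral_def)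

lemma WL_cmult:
 assumes f: "f \<in> WL r v" shows "(%x. c * f x) \<in> WL r v" "wl (%x. c * f x) = norm c powr r * wl f"
proof -
 have fs: "WL_term r v f summable_on lattice" using f by (auto simp: WL_def)
 have "mass (%x. c * f x) k = norm c * mass f k" for k
  by (simp add: mass_def norm_mult set_lebesgue_integral_def mult.left_commute)
 then have t: "WL_term r v (%x. c * f x) = (%k. norm c powr r * WL_term r v f k)"
  by (simp add: fun_eq_iff WL_term_eq powr_mult mult.assoc)
 show "(%x. c * f x) \<in> WL r v"
  using f fs by (auto simp: WL_def t intro: summable_on_cmult_right set_integrable_mult_right)
 show "wl (%x. c * f x) = norm c powr r * wl f"
  unfolding wl_def t by (rule infsum_cmult_right[OF fs])
qed

text \<open>\<open>W0\<close> and \<open>W\<close> collect what the weight and the comparison of a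
  cube with its corner contribute when exponentially decaying masses are summed.\<close>

definition W0 :: real where
 "W0 = A * exp (2 * kappa * DIM(real^'d))"

definition W :: real where
 "W = W0 powr r * infsum (%k::real^'d. decay (r * kappa) k) lattice"

lemma W_nonneg: "0 <= W"
 unfolding W_def by (intro mult_nonneg_nonneg infsum_nonneg) auto

lemma lattice_exp_summable: "(%k::real^'d. decay (r * kappa) k) summable_on lattice"
 unfolding lattice_eq using r kappa by (intro summable_exp_lattice) simp

text \<open>Masses decaying at rate \<open>2 * kappa\<close> lose \<open>kappa\<close> to the
  weight; the other \<open>kappa\<close> makes the r-th powers summable.\<close>

lemma mass_bound_WL:
 assumes f: "f \<in> borel_measurable lebesgue" and C: "C >= 0"
  and i: "!!k. k \<in> lattice ==> set_integrable lebesgue (cube k) f"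
  and m: "!!k. k \<in> lattice ==> mass f k <= C * (exp (2 * kappa * DIM(real^'d)) * decay (2 * kappa) k)"
 shows "f \<in> WL r v" "wl f <= C powr r * W"
proof -
 have t: "WL_term r v f k <= (C powr r * W0 powr r) * decay (r * kappa) k" if k: "k \<in> lattice" for k
 proof -
  have "mass f k * v k <= (C * (exp (2 * kappa * DIM(real^'d)) * decay (2 * kappa) k)) * (A * exp (kappa * norm k))"
   using C v_pos[of k] mass_nonneg[of f k] by (intro mult_mono m k v_le) auto
  also have "... = (C * W0) * (decay (2 * kappa) k * exp (kappa * norm k))" by (simp add: W0_def mult_ac)
  also have "decay (2 * kappa) k * exp (kappa * norm k) = decay kappa k"
   unfolding mult_exp_exp by (simp add: algebra_simps)
  finally have "WL_term r v f k <= ((C * W0) * decay kappa k) powr r"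
   unfolding WL_term_eq using mass_nonneg[of f k] v_pos[of k] r by (intro powr_mono2) auto
  also have "... = (C powr r * W0 powr r) * decay kappa k powr r" by (simp only: powr_mult)
  also have "decay kappa k powr r = decay (r * kappa) k" by (simp add: powr_def)
  finally show ?thesis .
 qed
 have s: "(%k::real^'d. (C powr r * W0 powr r) * decay (r * kappa) k) summable_on lattice"
  by (intro summable_on_cmult_right lattice_exp_summable)
 have fs: "WL_term r v f summable_on lattice"
  by (rule summable_on_comparison_test[OF s], erule t, rule WL_term_nonneg)
 show "f \<in> WL r v" using f i fs by (auto simp: WL_def)
 have "wl f <= infsum (%k::real^'d. (C powr r * W0 powr r) * decay (r * kappa) k) lattice"
  unfolding wl_def by (intro infsum_mono fs s t)
 also have "... = (C powr r * W0 powr r) * infsum (%k::real^'d. decay (r * kappa) k) lattice"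
  by (rule infsum_cmult_right[OF lattice_exp_summable])
 finally show "wl f <= C powr r * W" by (simp add: W_def mult_ac)
qed

lemma exp_cube:
 fixes x :: "real^'d"
 assumes "c >= 0" "x \<in> cube k"
 shows "decay c x <= exp (c * DIM(real^'d)) * decay c k" "exp (c * norm k) <= exp (c * DIM(real^'d)) * exp (c * norm x)"
proof -
 have "norm (x - k) <= DIM(real^'d)" using assms(2) unfolding cube_eq by (rule norm_diff_cell)
 then have "norm k <= norm x + DIM(real^'d)" using norm_triangle_ineq4[of x "x - k"] by simp
 then have "c * norm k <= c * (norm x + DIM(real^'d))" using assms(1) by (intro mult_left_mono)
 then show "decay c x <= exp (c * DIM(real^'d)) * decay c k" "exp (c * norm k) <= exp (c * DIM(real^'d)) * exp (c * norm x)"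
  unfolding mult_exp_exp by (simp_all add: algebra_simps)
qed

lemma mass_exp_bound:
 assumes c: "c >= 0" and f: "f \<in> borel_measurable lebesgue" and hi: "integrable lebesgue (%x. norm (f x) * exp (c * norm x))"
 shows "set_integrable lebesgue (cube k) f"
  "mass f k <= (LINT x|lebesgue. norm (f x) * exp (c * norm x)) * (exp (c * DIM(real^'d)) * decay c k)"
proof -
 let ?h = "%x. norm (f x) * exp (c * norm x)"
 have fi: "integrable lebesgue f"
 proof (rule integrable_dominated[OF hi f])
  show "AE x in lebesgue. norm (f x) <= norm (norm (f x) * exp (c * norm x))"
   using c by (intro AE_I2) (simp add: mult_le_cancel_left1)
 qed
 show "set_integrable lebesgue (cube k) f"
  unfolding set_integrable_def by (intro integrable_mult_indicator fi) auto
 have "mass f k <= (LINT x|lebesgue. (exp (c * DIM(real^'d)) * decay c k) * ?h x)"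
  unfolding mass_def set_lebesgue_integral_def
 proof (rule integral_mono_AE')
  show "integrable lebesgue (%x. (exp (c * DIM(real^'d)) * decay c k) * ?h x)" by (intro integrable_mult_right hi)
  show "AE x in lebesgue. indicator (cube k) x *\<^sub>R norm (f x) <= (exp (c * DIM(real^'d)) * decay c k) * ?h x"
  proof (rule AE_I2)
   fix x
   show "indicator (cube k) x *\<^sub>R norm (f x) <= (exp (c * DIM(real^'d)) * decay c k) * ?h x"
   proof (cases "x \<in> cube k")
    case True
    have "decay c k * exp (c * norm k) <= decay c k * (exp (c * DIM(real^'d)) * exp (c * norm x))"
     using exp_cube(2)[OF c True] by (intro mult_left_mono) auto
    moreover have "decay c k * exp (c * norm k) = 1" unfolding mult_exp_exp by simp
    ultimately have "1 <= decay c k * (exp (c * DIM(real^'d)) * exp (c * norm x))" by linarith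
    then have "norm (f x) * 1 <= norm (f x) * (decay c k * (exp (c * DIM(real^'d)) * exp (c * norm x)))"
     by (intro mult_left_mono) auto
    then show ?thesis using True by (simp add: mult_ac)
   qed simp
  qed
 qed auto
 also have "... = (exp (c * DIM(real^'d)) * decay c k) * integral\<^sup>L lebesgue ?h"
  by (rule integral_mult_right_zero)
 finally show "mass f k <= integral\<^sup>L lebesgue ?h * (exp (c * DIM(real^'d)) * decay c k)" by (simp only: mult.commute)
qed

lemma integral_bound_WL_lebesgue:
 assumes f: "f \<in> borel_measurable lebesgue" and i: "integrable lebesgue (%x. norm (f x) * exp (2 * kappa * norm x))"
 shows "f \<in> WL r v" "wl f <= (LINT x|lebesgue. norm (f x) * exp (2 * kappa * norm x)) powr r * W"
proof -
 have k: "0 <= 2 * kappa" using kappa by simp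
 have "0 <= (LINT x|lebesgue. norm (f x) * exp (2 * kappa * norm x))" by (intro integral_nonneg_AE AE_I2) auto
 from mass_bound_WL[OF f this mass_exp_bound[OF k f i]]
 show "f \<in> WL r v" "wl f <= (LINT x|lebesgue. norm (f x) * exp (2 * kappa * norm x)) powr r * W" by auto
qed

lemma integral_bound_WL:
 assumes f: "f \<in> borel_measurable borel" and i: "integrable lborel (%x. norm (f x) * exp (2 * kappa * norm x))"
 shows "f \<in> WL r v" "wl f <= (LINT x|lborel. norm (f x) * exp (2 * kappa * norm x)) powr r * W"
proof -
 let ?h = "%x. norm (f x) * exp (2 * kappa * norm x)"
 have f': "f \<in> borel_measurable lebesgue" using f by (intro measurable_completion) simp
 have hm: "?h \<in> borel_measurable lborel" using i by auto
 have hi: "integrable lebesgue ?h" using i hm by (simp add: integrable_completion)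
 show "f \<in> WL r v" "wl f <= integral\<^sup>L lborel ?h powr r * W"
  using integral_bound_WL_lebesgue[OF f' hi] integral_completion[OF hm] by simp_all
qed

lemma Sigma1_WL:
 assumes "f \<in> Sigma1" shows "f \<in> WL r v"
proof (rule integral_bound_WL(1)[OF Sigma1_borel[OF assms]])
 show "integrable lborel (%x. norm (f x) * exp (2 * kappa * norm x))"
  using Sigma1_exp_integrable[OF assms, of "2 * kappa"] by (simp add: mult.commute)
qed

definition J0 :: real where
 "J0 = (LINT x|lborel. decay 1 (x::real^'d))"

lemma exp_decay_WL:
 assumes f: "f \<in> borel_measurable borel" and C: "C >= 0" and le: "!!x. norm (f x) <= C * decay (2 * kappa + 1) x"
 shows "f \<in> WL r v" "wl f <= (C * J0) powr r * W"
proof -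
 have le': "norm (f x) * exp (2 * kappa * norm x) <= C * decay 1 x" for x
 proof -
  have "norm (f x) * exp (2 * kappa * norm x) <= (C * decay (2 * kappa + 1) x) * exp (2 * kappa * norm x)" by (intro mult_right_mono le) auto
  also have "... = C * (decay (2 * kappa + 1) x * exp (2 * kappa * norm x))" by simp
  also have "decay (2 * kappa + 1) x * exp (2 * kappa * norm x) = decay 1 x" unfolding mult_exp_exp by (simp add: algebra_simps)
  finally show ?thesis .
 qed
 have ci: "integrable lborel (%x::real^'d. C * decay 1 x)" by (intro integrable_mult_right integrable_exp_norm) simp
 have i: "integrable lborel (%x. norm (f x) * exp (2 * kappa * norm x))"
 proof (rule integrable_dominated[OF ci])
  show "(%x. norm (f x) * exp (2 * kappa * norm x)) \<in> borel_measurable lborel" using f by measurable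
  show "AE x in lborel. norm (norm (f x) * exp (2 * kappa * norm x)) <= norm (C * decay 1 x)"
   using le' C by (intro AE_I2) simp
 qed
 have "(LINT x|lborel. norm (f x) * exp (2 * kappa * norm x)) <= (LINT x|lborel. C * decay 1 (x::real^'d))"
  by (intro integral_mono i ci le')
 also have "... = C * J0" unfolding J0_def by (rule integral_mult_right_zero)
 finally have I: "(LINT x|lborel. norm (f x) * exp (2 * kappa * norm x)) <= C * J0" .
 have "wl f <= (LINT x|lborel. norm (f x) * exp (2 * kappa * norm x)) powr r * W" by (rule integral_bound_WL(2)[OF f i])
 also have "... <= (C * J0) powr r * W"
  using I r W_nonneg by (intro mult_right_mono powr_mono2 integral_nonneg_AE AE_I2) auto
 finally show "wl f <= (C * J0) powr r * W" .
 show "f \<in> WL r v" by (rule integral_bound_WL(1)[OF f i])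
qed

lemma J0_nonneg: "J0 >= 0"
 unfolding J0_def by (intro integral_nonneg_AE AE_I2) auto

lemma tendsto_powr_zero:
 assumes "F \<longlonglongrightarrow> 0" "!!n. F n >= (0::real)" shows "(%n. F n powr r) \<longlonglongrightarrow> 0"
 using tendsto_powr2[OF assms(1) tendsto_const, of r] assms(2) r by simp

text \<open>The local component of the norm is \<open>L^1\<close>, in which narrow mollifiers stay
  bounded; uniform exponential moments control the sum over the cubes. This is the bounded
  approximate identity of the factorization.\<close>

lemma wl_moll_bounded: "\<exists>M\<ge>0. \<forall>s. 0 < s --> s <= 1 --> wl (moll s) <= M"
proof (intro exI[of _ "gauss_moment TYPE(real^'d) (2 * kappa) powr r * W"] conjI allI impI)
 show "0 <= gauss_moment TYPE(real^'d) (2 * kappa) powr r * W" using W_nonneg by simp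
 fix s :: real assume s: "0 < s" "s <= 1"
 have eq: "norm (moll s x) * exp (2 * kappa * norm x) = mollifier s x * exp (2 * kappa * norm x)" for x :: "real^'d"
  using mollifier_nonneg[OF s(1), of x] by simp
 have "wl (moll s) <= (LINT x|lborel. norm (moll s (x::real^'d)) * exp (2 * kappa * norm x)) powr r * W"
  proof (rule integral_bound_WL(2))
  show "integrable lborel (%x::real^'d. norm (moll s x) * exp (2 * kappa * norm x))"
   unfolding eq by (rule mollifier_exp_integrable[OF s(1)])
 qed measurable
 also have "... <= gauss_moment TYPE(real^'d) (2 * kappa) powr r * W"
  unfolding eq
 proof (intro mult_right_mono powr_mono2 mollifier_exp_moment s W_nonneg integral_nonneg_AE AE_I2)
  show "0 <= mollifier s x * exp (2 * kappa * norm x)" for x :: "real^'d"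
   using mollifier_nonneg[OF s(1), of x] by simp
 qed (use r kappa in auto)
 finally show "wl (moll s) <= gauss_moment TYPE(real^'d) (2 * kappa) powr r * W" .
qed

lemma wl_moll_approx:
 fixes f :: "real^'d => complex"
 assumes f: "f \<in> borel_measurable borel" and cf: "!!s. 0 < s ==> conv (moll s) f \<in> Sigma1" and C0: "C >= 0"
  and C: "!!s x. 0 < s ==> s <= 1 ==> norm (conv (moll s) f x - f x) <= C * s * decay (2 * kappa + 1) x"
  and e: "e > 0"
 shows "\<exists>s0>0. \<forall>s. 0 < s --> s < s0 --> wl (%x. conv (moll s) f x - f x) < e"
proof -
 have "((%s. (C * s * J0) powr r * W) \<longlongrightarrow> (C * 0 * J0) powr r * W) (at_right 0)"
  using C0 J0_nonneg r by (intro tendsto_mult tendsto_const tendsto_powr2 tendsto_ident_at eventually_at_rightI[of 0 1]) auto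
 then have "((%s. (C * s * J0) powr r * W) \<longlongrightarrow> 0) (at_right 0)" using r by simp
 then have "eventually (%s. (C * s * J0) powr r * W < e) (at_right 0)" by (rule order_tendstoD) (rule e)
 then obtain b where b: "b > 0" "!!s. 0 < s ==> s < b ==> (C * s * J0) powr r * W < e"
  unfolding eventually_at_right_field by auto
 show ?thesis
 proof (intro exI[of _ "min b 1"] conjI allI impI)
  fix s assume s: "0 < s" "s < min b 1"
  have "(%x. conv (moll s) f x - f x) \<in> borel_measurable borel"
   using Sigma1_borel[OF cf[OF s(1)]] f by simp
  then have "wl (%x. conv (moll s) f x - f x) <= (C * s * J0) powr r * W"
   by (rule exp_decay_WL(2)) (use C C0 s in auto)
  also have "... < e" using b s by simp
  finally show "wl (%x. conv (moll s) f x - f x) < e" .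
 qed (use b in simp)
qed

lemma wl_moll_approx_Sigma1:
 assumes f: "f \<in> Sigma1" and e: "e > 0"
 shows "\<exists>s0>0. \<forall>s. 0 < s --> s < s0 --> wl (%x. conv (moll s) f x - f x) < e"
proof -
 have k: "2 * kappa + 1 > 0" using kappa by simp
 obtain C where C: "C >= 0" "!!s x. 0 < s ==> s <= 1 ==> norm (conv (moll s) f x - f x) <= C * s * decay (2 * kappa + 1) x"
  using conv_moll_Sigma1_diff[OF f k] by blast
 show ?thesis
  by (rule wl_moll_approx[OF Sigma1_borel[OF f] _ C e]) (intro Sigma1_conv_Sigma1 mollifier_Sigma1 f)
qed

end

section \<open>Completeness of the amalgam space\<close>

text \<open>The inclusion of \<open>l^r\<close> in \<open>l^1\<close>, with norm at most 1.\<close>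

lemma suminf_powr_le:
 fixes a :: "nat => real"
 assumes a: "!!n. 0 <= a n" and r: "0 < r" "r <= 1" and s: "summable (%n. a n powr r)"
 shows "summable a" "suminf a powr r <= (\<Sum>n. a n powr r)"
proof -
 let ?S = "\<Sum>n. a n powr r"
 have S0: "?S >= 0" by (intro suminf_nonneg s) simp
 have "(\<Sum>i<n. a i) powr r <= (\<Sum>i<n. a i powr r)" for n
 proof (induction n)
  case (Suc n)
  have "(\<Sum>i<Suc n. a i) powr r <= (\<Sum>i<n. a i) powr r + a n powr r"
   using powr_add_le[OF sum_nonneg a r, of "{..<n}" a n] a by simp
  then show ?case using Suc by simp
 qed simp
 also have "(\<Sum>i<n. a i powr r) <= ?S" for n by (intro sum_le_suminf s) auto
 finally have le: "(\<Sum>i<n. a i) powr r <= ?S" for n .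
 have le': "(\<Sum>i<n. a i) <= ?S powr (1 / r)" for n
 proof -
  have "((\<Sum>i<n. a i) powr r) powr (1 / r) <= ?S powr (1 / r)" using le r by (intro powr_mono2) auto
  then show ?thesis using r sum_nonneg[of "{..<n}" a] a by (simp add: powr_powr)
 qed
 have sa: "summable a" by (rule summableI_nonneg_bounded[OF a le'])
 then show "summable a" .
 have "suminf a <= ?S powr (1 / r)" by (intro suminf_le_const sa le')
 then have "suminf a powr r <= (?S powr (1 / r)) powr r" using r suminf_nonneg[OF sa a] by (intro powr_mono2) auto
 then show "suminf a powr r <= ?S" using r S0 by (simp add: powr_powr)
qed

lemma infsum_tail_small:
 fixes f :: "'a => real"
 assumes s: "f summable_on A" and e: "e > 0"
 shows "\<exists>F. finite F \<and> F \<subseteq> A \<and> infsum f (A - F) < e"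
proof -
 have "(sum f \<longlongrightarrow> infsum f A) (finite_subsets_at_top A)" using has_sum_infsum[OF s] unfolding has_sum_def .
 then have "eventually (%F. sum f F > infsum f A - e) (finite_subsets_at_top A)"
  by (rule order_tendstoD) (use e in simp)
 then obtain F where F: "finite F" "F \<subseteq> A" "sum f F > infsum f A - e"
  unfolding eventually_finite_subsets_at_top by blast
 have "infsum f (A - F) = infsum f A - infsum f F" using F by (intro infsum_Diff s) auto
 then show ?thesis using F by (intro exI[of _ F]) simp
qed

text \<open>Monotone convergence: the series of norms has a finite integral, hence is finite almost
  everywhere.\<close>

lemma AE_summable_norm:
 fixes u :: "nat => 'a => complex"
 assumes i: "!!n. integrable M (u n)" and s: "summable (%n. LINT x|M. norm (u n x))"
 shows "AE x in M. summable (%n. norm (u n x))"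
proof -
 have "(\<integral>\<^sup>+x. (\<Sum>n. ennreal (norm (u n x))) \<partial>M) = (\<Sum>n. \<integral>\<^sup>+x. ennreal (norm (u n x)) \<partial>M)"
  using i by (intro nn_integral_suminf) auto
 also have "... = (\<Sum>n. ennreal (LINT x|M. norm (u n x)))"
  using i by (intro suminf_cong nn_integral_eq_integral) auto
 also have "... \<noteq> top" by (intro ennreal_suminf_neq_top s integral_nonneg_AE AE_I2) auto
 finally have "(\<integral>\<^sup>+x. (\<Sum>n. ennreal (norm (u n x))) \<partial>M) \<noteq> \<infinity>" by simp
 then have "AE x in M. (\<Sum>n. ennreal (norm (u n x))) \<noteq> \<infinity>"
  using i by (intro nn_integral_PInf_AE) auto
 then show ?thesis
 proof (rule AE_mp, intro AE_I2 impI)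
  fix x assume "(\<Sum>n. ennreal (norm (u n x))) \<noteq> \<infinity>"
  then show "summable (%n. norm (u n x))" by (intro summable_suminf_not_top) auto
 qed
qed

lemma tendsto_zero_le:
 fixes f g :: "nat => real"
 assumes "!!n. 0 <= f n" "!!n. f n <= g n" "g \<longlonglongrightarrow> 0" shows "f \<longlonglongrightarrow> 0"
 by (rule tendsto_sandwich[OF _ _ tendsto_const assms(3)]) (simp_all add: assms(1,2))

lemma borel_measurable_norm_comp:
 "f \<in> borel_measurable M ==> (%x. norm (f x)) \<in> borel_measurable M"
 by (rule measurable_compose[OF _ borel_measurable_norm])

context amalgam begin

lemma WL_term_le_wl:
 assumes f: "f \<in> WL r v" and k: "k \<in> lattice" shows "WL_term r v f k <= wl f"
 using finite_sum_le_infsum[of "WL_term r v f" lattice "{k}"] f k WL_term_nonneg by (simp add: wl_def WL_def)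

lemma wl_cong_AE:
 assumes "f \<in> borel_measurable lebesgue" "g \<in> borel_measurable lebesgue"
  and eq: "!!k. k \<in> lattice ==> AE x in lebesgue. x \<in> cube k --> f x = g x"
 shows "wl f = wl g"
proof -
 have m: "(%x. indicator (cube k) x *\<^sub>R norm (h x)) \<in> borel_measurable lebesgue"
  if "h \<in> borel_measurable lebesgue" for h :: "real^'d => complex" and k
  by (intro borel_measurable_scaleR borel_measurable_indicator borel_measurable_norm_comp that) simp
 have "mass f k = mass g k" if "k \<in> lattice" for k
  unfolding mass_def set_lebesgue_integral_def
 proof (rule integral_cong_AE)
  show "AE x in lebesgue. indicator (cube k) x *\<^sub>R norm (f x) = indicator (cube k) x *\<^sub>R norm (g x)"
   using eq[OF that] by (rule AE_mp) (auto intro!: AE_I2 simp: indicator_def)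
 qed (intro m assms)+
 then show ?thesis unfolding wl_def by (intro infsum_cong) (simp add: WL_term_eq)
qed

text \<open>A Riesz-Fischer argument on every cube: summable r-th powers give summable masses, hence
  absolute convergence almost everywhere. The third conclusion serves to identify limits.\<close>

lemma WL_suminf:
 assumes w: "!!n. w n \<in> WL r v" and s: "summable (%n. wl (w n))"
 shows "(%x. \<Sum>n. w n x) \<in> WL r v" "wl (%x. \<Sum>n. w n x) <= (\<Sum>n. wl (w n))"
  "!!k. k \<in> lattice ==> AE x in lebesgue. x \<in> cube k --> summable (%n. w n x)"
proof -
 let ?f = "%x. \<Sum>n. w n x"
 have wm: "w n \<in> borel_measurable lebesgue" for n using w WL_meas by blast
 have fm: "?f \<in> borel_measurable lebesgue" by (intro borel_measurable_suminf wm)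
 have main: "AE x in lebesgue. x \<in> cube k --> summable (%n. w n x)" "set_integrable lebesgue (cube k) ?f"
  "summable (%n. WL_term r v (w n) k)" "WL_term r v ?f k <= (\<Sum>n. WL_term r v (w n) k)" if k: "k \<in> lattice" for k
 proof -
  let ?u = "%n x. indicator (cube k) x *\<^sub>R w n x"
  have ui: "integrable lebesgue (?u n)" for n
   using w[of n] k unfolding WL_def set_integrable_def by blast
  have mass_eq: "(LINT x|lebesgue. norm (?u n x)) = mass (w n) k" for n
   unfolding mass_def set_lebesgue_integral_def by simp
  show st: "summable (%n. WL_term r v (w n) k)"
   by (rule summable_comparison_test'[OF s, of 0]) (use WL_term_le_wl[OF w k] WL_term_nonneg in simp)
  have sm: "summable (%n. mass (w n) k * v k)" "(\<Sum>n. mass (w n) k * v k) powr r <= (\<Sum>n. WL_term r v (w n) k)"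
   using suminf_powr_le[OF _ r, of "%n. mass (w n) k * v k"] st mass_nonneg v_pos[of k] unfolding WL_term_eq by auto
  have sm': "summable (%n. mass (w n) k)" using summable_mult2[OF sm(1), of "1 / v k"] v_pos[of k] by simp
  have AEs: "AE x in lebesgue. summable (%n. norm (?u n x))"
   by (rule AE_summable_norm[OF ui]) (unfold mass_eq, rule sm')
  then show "AE x in lebesgue. x \<in> cube k --> summable (%n. w n x)"
   by (rule AE_mp) (auto intro!: AE_I2 intro: summable_norm_cancel)
  have "integrable lebesgue (%x. \<Sum>n. ?u n x)"
   by (rule integrable_suminf[OF ui AEs]) (unfold mass_eq, rule sm')
  moreover have ueq: "(\<Sum>n. ?u n x) = indicator (cube k) x *\<^sub>R ?f x" for x by (simp add: indicator_def)
  ultimately show fi: "set_integrable lebesgue (cube k) ?f" unfolding set_integrable_def by simp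
  have nu: "integrable lebesgue (%x. norm (?u n x))" for n using ui by (rule integrable_norm)
  have AEs': "AE x in lebesgue. summable (%n. norm (norm (?u n x)))" using AEs by simp
  have smn: "summable (%n. LINT x|lebesgue. norm (norm (?u n x)))" using sm' by (simp add: mass_eq[simplified])
  have "mass ?f k = (LINT x|lebesgue. norm (\<Sum>n. ?u n x))"
   unfolding mass_def set_lebesgue_integral_def ueq by simp
  also have "... <= (LINT x|lebesgue. (\<Sum>n. norm (?u n x)))"
  proof (rule integral_mono_AE)
   show "integrable lebesgue (%x. norm (\<Sum>n. ?u n x))" unfolding ueq using fi unfolding set_integrable_def by (rule integrable_norm)
   show "integrable lebesgue (%x. \<Sum>n. norm (?u n x))" by (rule integrable_suminf[OF nu AEs' smn])
   show "AE x in lebesgue. norm (\<Sum>n. ?u n x) <= (\<Sum>n. norm (?u n x))"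
    using AEs by (rule AE_mp) (intro AE_I2 impI summable_norm)
  qed
  also have "... = (\<Sum>n. mass (w n) k)" unfolding mass_eq[symmetric] by (rule integral_suminf[OF nu AEs' smn])
  finally have "mass ?f k * v k <= (\<Sum>n. mass (w n) k) * v k" using v_pos[of k] by (intro mult_right_mono) auto
  also have "... = (\<Sum>n. mass (w n) k * v k)" by (rule suminf_mult2[OF sm'])
  finally have "(mass ?f k * v k) powr r <= (\<Sum>n. mass (w n) k * v k) powr r"
   using r mass_nonneg[of ?f k] v_pos[of k] by (intro powr_mono2) auto
  then show "WL_term r v ?f k <= (\<Sum>n. WL_term r v (w n) k)" using sm(2) by (simp add: WL_term_eq)
 qed
 \<comment> \<open>For finitely many cubes the two sums can be interchanged; the bound is uniform in
   \<open>F\<close> and so passes to the whole lattice.\<close>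
 have bd: "sum (WL_term r v ?f) F <= (\<Sum>n. wl (w n))" if F: "finite F" "F \<subseteq> lattice" for F
 proof -
  have "sum (WL_term r v ?f) F <= (\<Sum>k\<in>F. \<Sum>n. WL_term r v (w n) k)" using F main(4) by (intro sum_mono) auto
  also have "... = (\<Sum>n. \<Sum>k\<in>F. WL_term r v (w n) k)" using F main(3) by (intro suminf_sum[symmetric]) auto
  also have "... <= (\<Sum>n. wl (w n))"
  proof (intro suminf_le s)
   fix n
   show "(\<Sum>k\<in>F. WL_term r v (w n) k) <= wl (w n)"
    unfolding wl_def using w[of n] F WL_term_nonneg by (intro finite_sum_le_infsum) (auto simp: WL_def)
   show "summable (%n. \<Sum>k\<in>F. WL_term r v (w n) k)" using F main(3) by (intro summable_sum) auto
  qed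
  finally show ?thesis .
 qed
 have fs: "WL_term r v ?f summable_on lattice"
  by (rule nonneg_bdd_above_summable_on) (use bd WL_term_nonneg in \<open>auto simp: bdd_above_def\<close>)
 show "?f \<in> WL r v" unfolding WL_def using fm main(2) fs by blast
 show "wl ?f <= (\<Sum>n. wl (w n))" unfolding wl_def[of ?f] by (rule infsum_le_finite_sums[OF fs bd])
 show "AE x in lebesgue. x \<in> cube k --> summable (%n. w n x)" if "k \<in> lattice" for k by (rule main(1)[OF that])
qed

text \<open>The limit is the telescoping series, and the error is its tail.\<close>

lemma WL_complete:
 assumes f: "!!n. f n \<in> WL r v" and s: "summable (%n. wl (%x. f (Suc n) x - f n x))"
 shows "\<exists>g\<in>WL r v. (%n. wl (%x. f n x - g x)) \<longlonglongrightarrow> 0"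
proof -
 define w where "w n x = f (Suc n) x - f n x" for n x
 have w: "w n \<in> WL r v" for n unfolding w_def[abs_def] using WL_diff f by blast
 have sw: "summable (%n. wl (w n))" using s by (simp add: w_def[abs_def])
 have sw': "summable (%n. wl (w (n + m)))" for m using sw by (rule summable_ignore_initial_segment)
 define g where "g x = f 0 x + (\<Sum>n. w n x)" for x
 have g: "g \<in> WL r v" unfolding g_def[abs_def] using WL_add f WL_suminf(1)[OF w sw] by blast
 have "wl (%x. f m x - g x) <= (\<Sum>n. wl (w (n + m)))" for m
 proof -
  have "wl (%x. f m x - g x) = wl (%x. g x - f m x)" by (rule wl_commute)
  \<comment> \<open>The functions agree where the series converges, that is, almost everywhere on
    each cube.\<close>
  also have "... = wl (%x. \<Sum>n. w (n + m) x)"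
  proof (rule wl_cong_AE)
   show "(%x. g x - f m x) \<in> borel_measurable lebesgue" using g f WL_meas by (intro borel_measurable_diff) blast+
   show "(%x. \<Sum>n. w (n + m) x) \<in> borel_measurable lebesgue" using w WL_meas by (intro borel_measurable_suminf) blast
   fix k :: "real^'d" assume "k \<in> lattice"
   from WL_suminf(3)[OF w sw this] show "AE x in lebesgue. x \<in> cube k --> g x - f m x = (\<Sum>n. w (n + m) x)"
   proof (rule AE_mp, intro AE_I2 impI)
    fix x assume "x \<in> cube k --> summable (%n. w n x)" "x \<in> cube k"
    then have "(\<Sum>n. w n x) = (\<Sum>n. w (n + m) x) + (\<Sum>i<m. w i x)" by (intro suminf_split_initial_segment) simp
    moreover have "(\<Sum>i<m. w i x) = f m x - f 0 x" unfolding w_def by (rule sum_lessThan_telescope)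
    ultimately show "g x - f m x = (\<Sum>n. w (n + m) x)" by (simp add: g_def)
   qed
  qed
  also have "... <= (\<Sum>n. wl (w (n + m)))" by (rule WL_suminf(2)[OF w sw'])
  finally show ?thesis .
 qed
 moreover have "(%m. \<Sum>n. wl (w (n + m))) \<longlonglongrightarrow> 0"
  using suminf_exist_split2[OF sw] .
 ultimately have "(%n. wl (%x. f n x - g x)) \<longlonglongrightarrow> 0"
  by (intro tendsto_zero_le[OF wl_nonneg])
 then show ?thesis by (rule bexI[of _ g, OF _ g])
qed

text \<open>On functions supported in a fixed ball the amalgam norm is controlled by the
  \<open>L^1\<close> norm, which reduces density to \<open>L^1\<close> approximation inside a
  ball.\<close>

lemma compact_support_WL:
 assumes h: "integrable lebesgue h" and supp: "!!x. norm x > R ==> h x = 0" 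
 shows "h \<in> WL r v" "wl h <= (exp (2 * kappa * R) * (LINT x|lebesgue. norm (h x))) powr r * W"
proof -
 have le: "norm (h x) * exp (2 * kappa * norm x) <= exp (2 * kappa * R) * norm (h x)" for x
 proof (cases "norm x > R")
  case False
  then have "exp (2 * kappa * norm x) <= exp (2 * kappa * R)" using kappa by simp
  then have "norm (h x) * exp (2 * kappa * norm x) <= norm (h x) * exp (2 * kappa * R)" by (intro mult_left_mono) auto
  then show ?thesis by (simp add: mult.commute)
 qed (simp add: supp)
 have hm: "h \<in> borel_measurable lebesgue" by (rule borel_measurable_integrable[OF h])
 have ei: "integrable lebesgue (%x. exp (2 * kappa * R) * norm (h x))" by (intro integrable_mult_right integrable_norm h)
 have em: "(%x::real^'d. exp (2 * kappa * norm x)) \<in> borel_measurable lebesgue" by (intro measurable_completion) simp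
 have i: "integrable lebesgue (%x. norm (h x) * exp (2 * kappa * norm x))"
 proof (rule integrable_dominated[OF ei])
  show "(%x. norm (h x) * exp (2 * kappa * norm x)) \<in> borel_measurable lebesgue" by (rule borel_measurable_times[OF borel_measurable_norm_comp[OF hm] em])
  show "AE x in lebesgue. norm (norm (h x) * exp (2 * kappa * norm x)) <= norm (exp (2 * kappa * R) * norm (h x))"
   using le by (intro AE_I2) simp
 qed
 have I: "(LINT x|lebesgue. norm (h x) * exp (2 * kappa * norm x)) <= exp (2 * kappa * R) * (LINT x|lebesgue. norm (h x))"
  unfolding integral_mult_right_zero[symmetric] by (intro integral_mono i ei le)
 show "h \<in> WL r v" by (rule integral_bound_WL_lebesgue(1)[OF hm i])
 have "wl h <= (LINT x|lebesgue. norm (h x) * exp (2 * kappa * norm x)) powr r * W" by (rule integral_bound_WL_lebesgue(2)[OF hm i])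
 also have "... <= (exp (2 * kappa * R) * (LINT x|lebesgue. norm (h x))) powr r * W"
  using I r W_nonneg by (intro mult_right_mono powr_mono2 integral_nonneg_AE AE_I2) auto
 finally show "wl h <= (exp (2 * kappa * R) * (LINT x|lebesgue. norm (h x))) powr r * W" .
qed

section \<open>Density of test functions\<close>

text \<open>Membership in the closure of the test functions. It is stable under linear combinations
  and limits, which allows the usual ascent from simple to integrable functions.\<close>

definition approximable :: "(real^'d => complex) => bool" where
 "approximable f \<longleftrightarrow> f \<in> WL r v \<and> (\<forall>e>0. \<exists>p\<in>Sigma1. wl (%x. f x - p x) < e)"

lemma approximable_limit:
 assumes f: "f \<in> WL r v" and g: "!!j::nat. approximable (g j)" and lim: "(%j. wl (%x. f x - g j x)) \<longlonglongrightarrow> 0"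
 shows "approximable f"
 unfolding approximable_def
proof (intro conjI f allI impI)
 fix e :: real assume e: "e > 0"
 then have "eventually (%j. wl (%x. f x - g j x) < e / 2) sequentially" by (intro order_tendstoD[OF lim]) simp
 then obtain j where j: "wl (%x. f x - g j x) < e / 2" by (auto simp: eventually_sequentially)
 have "0 < e / 2" using e by simp
 then obtain p where p: "p \<in> Sigma1" "wl (%x. g j x - p x) < e / 2" using g[of j] unfolding approximable_def by blast
 have "g j \<in> WL r v" using g[of j] by (simp add: approximable_def)
 from wl_triangle[OF f this Sigma1_WL[OF p(1)]] show "\<exists>p\<in>Sigma1. wl (%x. f x - p x) < e"
  using j p by (intro bexI[of _ p]) auto
qed

lemma approximable_limit_L1:
 assumes g: "!!j::nat. approximable (g j)" "!!j. integrable lebesgue (g j)" and f: "integrable lebesgue f"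
  and supp: "!!x. norm x > R ==> f x = 0" "!!j x. norm x > R ==> g j x = 0"
  and lim: "(%j. LINT x|lebesgue. norm (f x - g j x)) \<longlonglongrightarrow> 0"
 shows "approximable f"
proof (rule approximable_limit[OF compact_support_WL(1)[OF f supp(1)] g(1)])
 have "wl (%x. f x - g j x) <= (exp (2 * kappa * R) * (LINT x|lebesgue. norm (f x - g j x))) powr r * W" for j
  by (rule compact_support_WL(2)) (use f g supp in auto)
 moreover have "(%j. (exp (2 * kappa * R) * (LINT x|lebesgue. norm (f x - g j x))) powr r * W) \<longlonglongrightarrow> 0"
  by (intro tendsto_mult_left_zero tendsto_powr_zero tendsto_mult_right_zero lim mult_nonneg_nonneg integral_nonneg_AE AE_I2) auto
 ultimately show "(%j. wl (%x. f x - g j x)) \<longlonglongrightarrow> 0"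
  by (intro tendsto_zero_le[OF wl_nonneg])
qed

lemma approximable_cmult:
 assumes f: "approximable f" shows "approximable (%x. c * f x)"
 unfolding approximable_def
proof (intro conjI allI impI)
 have fW: "f \<in> WL r v" using f by (simp add: approximable_def)
 show "(%x. c * f x) \<in> WL r v" by (rule WL_cmult(1)[OF fW])
 fix e :: real assume e: "e > 0"
 have c1: "norm c powr r + 1 > 0" using powr_ge_zero[of "norm c" r] by linarith
 then obtain p where p: "p \<in> Sigma1" "wl (%x. f x - p x) < e / (norm c powr r + 1)"
  using f e unfolding approximable_def by (meson divide_pos_pos)
 have "wl (%x. c * f x - c * p x) = norm c powr r * wl (%x. f x - p x)"
  using WL_cmult(2)[OF conjunct1[OF WL_diff[OF fW Sigma1_WL[OF p(1)]]], of c] by (simp add: right_diff_distrib)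
 also have "... <= (norm c powr r + 1) * wl (%x. f x - p x)" by (intro mult_right_mono wl_nonneg) simp
 also have "... < e" using p(2) c1 by (simp add: pos_less_divide_eq mult.commute)
 finally show "\<exists>p\<in>Sigma1. wl (%x. c * f x - p x) < e" by (rule bexI[OF _ Sigma1_cmult[OF p(1)]])
qed

lemma approximable_add:
 assumes f: "approximable f" and g: "approximable g" shows "approximable (%x. f x + g x)"
 unfolding approximable_def
proof (intro conjI allI impI)
 have W: "f \<in> WL r v" "g \<in> WL r v" using f g by (simp_all add: approximable_def)
 then show "(%x. f x + g x) \<in> WL r v" using WL_add by blast
 fix e :: real assume "e > 0"
 then have "e / 2 > 0" by simp
 with f g obtain p q where p: "p \<in> Sigma1" "wl (%x. f x - p x) < e / 2" and q: "q \<in> Sigma1" "wl (%x. g x - q x) < e / 2"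
  unfolding approximable_def by meson
 have "wl (%x. f x + g x - (p x + q x)) = wl (%x. (f x - p x) + (g x - q x))" by (simp add: algebra_simps)
 also have "... <= wl (%x. f x - p x) + wl (%x. g x - q x)"
  using WL_add[of "%x. f x - p x" "%x. g x - q x"] WL_diff W Sigma1_WL p(1) q(1) by simp
 finally have "wl (%x. f x + g x - (p x + q x)) < e" using p(2) q(2) by simp
 then show "\<exists>p\<in>Sigma1. wl (%x. f x + g x - p x) < e" by (rule bexI[OF _ Sigma1_add[OF p(1) q(1)]])
qed

text \<open>Bounded support turns the plain Lipschitz condition into one with exponential weights,
  so the mollifications, which are test functions, converge in the amalgam norm although
  \<open>u\<close> need not be smooth.\<close>

lemma approximable_Lipschitz:
 fixes u :: "real^'d => complex"
 assumes L: "L >= 0" "!!x y. norm (u x - u y) <= L * norm (x - y)" and supp: "!!x. norm x > R ==> u x = 0" 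
 shows "approximable u"
proof -
 define k where "k = 2 * kappa + 1"
 have k: "k > 0" using kappa by (simp add: k_def)
 have "L-lipschitz_on UNIV u" using L by (intro lipschitz_onI) (auto simp: dist_norm)
 then have cont: "continuous_on UNIV u" by (rule lipschitz_on_continuous_on)
 then have um: "u \<in> borel_measurable borel" by (rule borel_measurable_continuous_onI)
 have "compact (u ` cball 0 R)" using continuous_on_subset[OF cont] by (intro compact_continuous_image compact_cball) auto
 then obtain B0 where "!!z. z \<in> u ` cball 0 R ==> norm z <= B0" using compact_imp_bounded bounded_iff by metis
 then have B: "norm (u x) <= max B0 0" for x
  using supp[of x] by (cases "norm x > R") (auto simp: le_max_iff_disj)
 have dec: "norm (u x) <= (max B0 0 * exp (\<bar>c\<bar> * \<bar>R\<bar>)) * exp (- \<bar>c\<bar> * norm x)" for x c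
 proof (cases "norm x > R")
  case False
  then have "\<bar>c\<bar> * norm x <= \<bar>c\<bar> * \<bar>R\<bar>" by (intro mult_left_mono) auto
  then have "1 <= exp (\<bar>c\<bar> * \<bar>R\<bar>) * exp (- \<bar>c\<bar> * norm x)" unfolding mult_exp_exp by simp
  then have "norm (u x) * 1 <= max B0 0 * (exp (\<bar>c\<bar> * \<bar>R\<bar>) * exp (- \<bar>c\<bar> * norm x))" using B by (intro mult_mono) auto
  then show ?thesis by (simp add: mult.assoc)
 qed (simp add: supp)
 have um_int: "integrable lborel (%x. exp (c * norm x) * norm (u x))" for c
 proof (rule integrable_dominated)
  show "integrable lborel (%x::real^'d. (max B0 0 * exp ((\<bar>c\<bar> + 1) * \<bar>R\<bar>)) * decay 1 x)"
   by (intro integrable_mult_right integrable_exp_norm) simp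
  show "(%x. exp (c * norm x) * norm (u x)) \<in> borel_measurable lborel" using um by measurable
  show "AE x in lborel. norm (exp (c * norm x) * norm (u x)) <= norm ((max B0 0 * exp ((\<bar>c\<bar> + 1) * \<bar>R\<bar>)) * decay 1 x)"
  proof (rule AE_I2)
   fix x :: "real^'d"
   have "c * norm x <= \<bar>c\<bar> * norm x" by (intro mult_right_mono) auto
   then have "exp (c * norm x) * norm (u x) <= exp (\<bar>c\<bar> * norm x) * ((max B0 0 * exp ((\<bar>c\<bar> + 1) * \<bar>R\<bar>)) * decay (\<bar>c\<bar> + 1) x)"
    using dec[of x "\<bar>c\<bar> + 1"] by (intro mult_mono) auto
   also have "... = (max B0 0 * exp ((\<bar>c\<bar> + 1) * \<bar>R\<bar>)) * (exp (\<bar>c\<bar> * norm x) * decay (\<bar>c\<bar> + 1) x)" by (simp only: mult_ac)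
   also have "exp (\<bar>c\<bar> * norm x) * decay (\<bar>c\<bar> + 1) x = decay 1 x" unfolding mult_exp_exp by (simp add: algebra_simps)
   finally show "norm (exp (c * norm x) * norm (u x)) <= norm ((max B0 0 * exp ((\<bar>c\<bar> + 1) * \<bar>R\<bar>)) * decay 1 x)" by simp
  qed
 qed
 \<comment> \<open>If \<open>norm x\<close> exceeds \<open>\<bar>R\<bar> + norm y\<close>, both
   values vanish; otherwise the product of the exponentials on the right is at least 1.\<close>
 have wLip: "norm (u (x - y) - u x) <= (L * exp (k * \<bar>R\<bar>)) * norm y * exp (k * norm y) * decay k x" for x y
 proof (cases "norm x > \<bar>R\<bar> + norm y")
  case True
  then have "norm (x - y) > R" "norm x > R" using norm_triangle_ineq2[of x y] norm_ge_zero[of y] by linarith+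
  then show ?thesis using supp L by simp
 next
  case False
  then have "k * norm x <= k * (\<bar>R\<bar> + norm y)" using k by (intro mult_left_mono) auto
  then have "1 <= exp (k * \<bar>R\<bar>) * exp (k * norm y) * decay k x" unfolding mult_exp_exp by (simp add: algebra_simps)
  then have "(L * norm y) * 1 <= (L * norm y) * (exp (k * \<bar>R\<bar>) * exp (k * norm y) * decay k x)"
   using L by (intro mult_left_mono) auto
  moreover have "norm (u (x - y) - u x) <= L * norm y" using L(2)[of "x - y" x] by simp
  ultimately show ?thesis by (simp add: mult_ac)
 qed
 have "0 <= L * exp (k * \<bar>R\<bar>)" using L by simp
 from conv_moll_weighted_diff[OF less_imp_le[OF k] this wLip um B]
 obtain C where C: "C >= 0" "!!s x. 0 < s ==> s <= 1 ==> norm (conv (moll s) u x - u x) <= C * s * decay (2 * kappa + 1) x"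
  unfolding k_def by blast
 have cS: "conv (moll s) u \<in> Sigma1" if "s > 0" for s by (intro Sigma1_conv mollifier_Sigma1 that um um_int)
 have "integrable lborel (%x. norm (u x) * exp (2 * kappa * norm x))" using um_int[of "2 * kappa"] by (simp add: mult.commute)
 from integral_bound_WL(1)[OF um this] have uW: "u \<in> WL r v" .
 show ?thesis unfolding approximable_def
 proof (intro conjI uW allI impI)
  fix e :: real assume "e > 0"
  from wl_moll_approx[OF um cS C this] obtain s0 where s0: "s0 > 0" "!!s. 0 < s ==> s < s0 ==> wl (%x. conv (moll s) u x - u x) < e" by blast
  then have "wl (%x. u x - conv (moll (s0 / 2)) u x) < e" by (subst wl_commute) simp
  then show "\<exists>p\<in>Sigma1. wl (%x. u x - p x) < e" using cS[of "s0 / 2"] s0(1) by (intro bexI) auto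
 qed
qed

text \<open>Lipschitz cut-offs of the distance to \<open>T\<close> decrease to the indicator, and
  all of them vanish outside the ball of radius \<open>R + 1\<close>.\<close>

lemma approximable_indicator_compact:
 fixes T :: "(real^'d) set"
 assumes T: "compact T" "T \<noteq> {}" "T \<subseteq> cball 0 R"
 shows "approximable (%x. indicator T x)"
proof (rule approximable_limit_L1)
 let ?u = "%j x. complex_of_real (max 0 (1 - real (Suc j) * infdist x T))"
 have Lip: "norm (?u j x - ?u j y) <= real (Suc j) * norm (x - y)" for j x y
 proof -
  have m: "\<bar>max 0 (1 - a) - max 0 (1 - b)\<bar> <= \<bar>a - b\<bar>" for a b :: real by (auto simp: max_def abs_if)
  have "norm (?u j x - ?u j y) = \<bar>max 0 (1 - real (Suc j) * infdist x T) - max 0 (1 - real (Suc j) * infdist y T)\<bar>"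
   unfolding of_real_diff[symmetric] by (rule norm_of_real)
  also have "... <= \<bar>real (Suc j) * infdist x T - real (Suc j) * infdist y T\<bar>" by (rule m)
  also have "... = real (Suc j) * \<bar>infdist x T - infdist y T\<bar>" unfolding right_diff_distrib[symmetric] abs_mult by simp
  also have "... <= real (Suc j) * norm (x - y)" unfolding dist_norm[symmetric] by (intro mult_left_mono infdist_triangle_abs) simp
  finally show ?thesis .
 qed
 have far: "infdist x T >= 1" if "norm x > R + 1" for x
 proof -
  obtain t where t: "t \<in> T" "infdist x T = dist x t" using infdist_attains_inf[OF compact_imp_closed[OF T(1)] T(2)] by blast
  then have "norm t <= R" using T(3) by auto
  then show ?thesis using t that norm_triangle_ineq2[of x t] by (simp add: dist_norm)
 qed
 show supp: "?u j x = 0" if "norm x > R + 1" for j x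
 proof -
  have "1 * 1 <= real (Suc j) * infdist x T" using far[OF that] by (intro mult_mono) auto
  then show ?thesis by simp
 qed
 show suppT: "indicator T x = (0::complex)" if "norm x > R + 1" for x using T(3) that by (auto simp: indicator_def)
 show "approximable (?u j)" for j by (rule approximable_Lipschitz[OF _ Lip supp]) simp
 have cint: "integrable lebesgue (%x::real^'d. indicator (cball 0 (R + 1)) x *\<^sub>R (1::real))"
  using fmeasurableD2[OF lmeasurable_cball[of "0::real^'d" "R + 1"]]
  by (intro integrable_scaleR_left integrable_real_indicator) (auto simp: less_top)
 have cint2: "integrable lebesgue (%x::real^'d. indicator (cball 0 (R + 1)) x *\<^sub>R (2::real))"
  using integrable_mult_right[OF cint, of 2] by (simp add: mult.commute)
 have um: "?u j \<in> borel_measurable lebesgue" for j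
 proof (intro measurable_completion)
  have "?u j \<in> borel_measurable borel" by (intro borel_measurable_continuous_onI continuous_intros)
  then show "?u j \<in> borel_measurable lborel" by simp
 qed
 have Tm: "(%x. indicator T x :: complex) \<in> borel_measurable lebesgue"
  using compact_imp_closed[OF T(1)] by (intro borel_measurable_indicator) auto
 have ub: "norm (?u j x) <= indicator (cball 0 (R + 1)) x *\<^sub>R 1" for j x
 proof (cases "norm x > R + 1")
  case False
  have "0 <= real (Suc j) * infdist x T" using infdist_nonneg[of x T] by simp
  then have "max 0 (1 - real (Suc j) * infdist x T) <= 1" by simp
  then show ?thesis using False by (simp add: indicator_def)
 next
  case True then show ?thesis using supp[OF True] by simp
 qed
 have Tb: "norm (indicator T x :: complex) <= indicator (cball 0 (R + 1)) x *\<^sub>R 1" for x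
  using T(3) by (auto simp: indicator_def)
 show "integrable lebesgue (?u j)" for j
  by (rule integrable_dominated[OF cint um]) (use ub in \<open>auto intro!: AE_I2\<close>)
 show "integrable lebesgue (%x. indicator T x :: complex)"
  by (rule integrable_dominated[OF cint Tm]) (use Tb in \<open>auto intro!: AE_I2\<close>)
 have "(%j. LINT x|lebesgue. norm (indicator T x - ?u j x)) \<longlonglongrightarrow> (LINT x::real^'d|lebesgue. 0)"
 proof (rule integral_dominated_convergence[OF _ _ cint2])
  show "(%x. norm (indicator T x - ?u j x)) \<in> borel_measurable lebesgue" for j
   by (intro borel_measurable_norm_comp borel_measurable_diff Tm um)
  show "AE x in lebesgue. (%j. norm (indicator T x - ?u j x)) \<longlonglongrightarrow> 0"
  proof (rule AE_I2)
   fix x :: "real^'d"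
   show "(%j. norm (indicator T x - ?u j x)) \<longlonglongrightarrow> 0"
   proof (cases "x \<in> T")
    case False
    then have d: "infdist x T > 0" using infdist_pos_not_in_closed compact_imp_closed[OF T(1)] T(2) by blast
    obtain j0 :: nat where "1 / infdist x T < real j0" using reals_Archimedean2 by blast
    then have "1 < real j0 * infdist x T" using d by (simp add: pos_divide_less_eq)
    moreover have "real j0 * infdist x T <= real (Suc j) * infdist x T" if "j >= j0" for j
     using that d by (intro mult_right_mono) auto
    ultimately have "norm (indicator T x - ?u j x) = 0" if "j >= j0" for j using that False by (force simp: max_def)
    then show ?thesis by (intro tendsto_eventually) (auto simp: eventually_sequentially)
   qed simp
  qed
  show "AE x in lebesgue. norm (norm (indicator T x - ?u j x)) <= indicator (cball 0 (R + 1)) x *\<^sub>R 2" for j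
  proof (rule AE_I2)
   fix x :: "real^'d"
   show "norm (norm (indicator T x - ?u j x)) <= indicator (cball 0 (R + 1)) x *\<^sub>R 2"
   proof -
    have "norm (indicator T x - ?u j x) <= norm (indicator T x :: complex) + norm (?u j x)" by (rule norm_triangle_ineq4)
    also have "... <= indicator (cball 0 (R + 1)) x *\<^sub>R 1 + indicator (cball 0 (R + 1)) x *\<^sub>R 1" by (rule add_mono[OF Tb ub])
    finally show ?thesis unfolding real_norm_def abs_norm_cancel by (simp only: real_scaleR_def mult_1_right)
   qed
  qed
 qed measurable
 then show "(%j. LINT x|lebesgue. norm (indicator T x - ?u j x)) \<longlonglongrightarrow> 0" by simp
qed

lemma approximable_zero: "approximable (%x. 0)"
 using approximable_Lipschitz[of 0 "%x. 0" 0] by simp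

text \<open>Inner regularity by closed sets, which are compact here because \<open>S\<close> is
  bounded.\<close>

lemma approximable_indicator:
 fixes S :: "(real^'d) set"
 assumes S: "S \<in> sets lebesgue" "S \<subseteq> cball 0 R"
 shows "approximable (%x. indicator S x)"
proof -
 have "\<exists>T. closed T \<and> T \<subseteq> S \<and> S - T \<in> lmeasurable \<and> emeasure lebesgue (S - T) < ennreal (1 / Suc j)" for j
 proof -
  have "0 < 1 / real (Suc j)" by simp
  from sets_lebesgue_inner_closed[OF S(1) this]
  obtain T where "closed T" "T \<subseteq> S" "S - T \<in> lmeasurable" "emeasure lebesgue (S - T) < ennreal (1 / Suc j)" .
  then show ?thesis by (intro exI[of _ T] conjI)
 qed
 then have "\<exists>T. \<forall>j. closed (T j) \<and> T j \<subseteq> S \<and> S - T j \<in> lmeasurable \<and> emeasure lebesgue (S - T j) < ennreal (1 / Suc j)"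
  by (intro choice allI)
 then obtain T where T': "\<forall>j. closed (T j) \<and> T j \<subseteq> S \<and> S - T j \<in> lmeasurable \<and> emeasure lebesgue (S - T j) < ennreal (1 / Suc j)" ..
 then have T: "closed (T j)" "T j \<subseteq> S" "S - T j \<in> lmeasurable" "emeasure lebesgue (S - T j) < ennreal (1 / Suc j)" for j
  by blast+
 have meas: "measure lebesgue (S - T j) < 1 / Suc j" for j
  using T(3,4)[of j] by (simp add: emeasure_eq_measure2 ennreal_less_iff)
 have ind: "indicator S x - indicator (T j) x = (indicator (S - T j) x :: complex)" for j x
  using T(2)[of j] by (auto simp: indicator_def)
 have fm: "U \<in> lmeasurable" if "U \<in> sets lebesgue" "U \<subseteq> cball 0 R" for U :: "(real^'d) set"
  by (rule bounded_set_imp_lmeasurable[OF bounded_subset[OF bounded_cball that(2)] that(1)])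
 have int: "integrable lebesgue (%x. indicator U x :: complex)" if "U \<in> sets lebesgue" "U \<subseteq> cball 0 R" for U :: "(real^'d) set"
 proof -
  have "integrable lebesgue (%x. indicator U x *\<^sub>R (1::complex))"
   using fmeasurableD[OF fm[OF that]] fmeasurableD2[OF fm[OF that]] by (intro integrable_scaleR_left integrable_real_indicator) (auto simp: less_top)
  moreover have "indicator U x *\<^sub>R (1::complex) = indicator U x" for x by (simp add: indicator_def)
  ultimately show ?thesis by simp
 qed
 have Tl: "T j \<in> sets lebesgue" for j using T(1)[of j] by (simp add: borel_closed)
 show ?thesis
 proof (rule approximable_limit_L1)
  show "approximable (%x. indicator (T j) x)" for j
  proof (cases "T j = {}")
   case False
   have "compact (T j)" using T(1)[of j] bounded_subset[OF bounded_cball subset_trans[OF T(2) S(2)]] by (simp add: compact_eq_bounded_closed)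
   then show ?thesis using False T(2)[of j] S(2) by (intro approximable_indicator_compact) auto
  qed (simp add: approximable_zero)
  show "integrable lebesgue (%x. indicator S x :: complex)" by (rule int[OF S])
  show "integrable lebesgue (%x. indicator (T j) x :: complex)" for j using T(2)[of j] S(2) by (intro int Tl) auto
  show "indicator S x = (0::complex)" "indicator (T j) x = (0::complex)" if "norm x > R" for x j
   using that S(2) T(2)[of j] by (auto simp: indicator_def)
  have "(LINT x|lebesgue. norm (indicator S x - indicator (T j) x :: complex)) = measure lebesgue (S - T j)" for j
  proof -
   have "norm (indicator (S - T j) x :: complex) = indicator (S - T j) x" for x by (simp add: indicator_def)
   then show ?thesis unfolding ind by simp
  qed
  moreover have "(%j. measure lebesgue (S - T j)) \<longlonglongrightarrow> 0"
   using meas by (intro tendsto_zero_le[OF measure_nonneg less_imp_le LIMSEQ_Suc[OF lim_1_over_n]])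
  ultimately show "(%j. LINT x|lebesgue. norm (indicator S x - indicator (T j) x :: complex)) \<longlonglongrightarrow> 0" by simp
 qed
qed

text \<open>Induction over integrable functions. Truncation to one ball gives all functions a common
  support, so that dominated convergence suffices in the limit step.\<close>

lemma approximable_truncation:
 assumes f: "integrable lebesgue f"
 shows "approximable (%x. indicator (cball 0 R) x *\<^sub>R f x)"
 using f
proof (induction rule: integrable_induct)
 case (base A c)
 have eq: "indicator (cball 0 R) x *\<^sub>R indicator A x *\<^sub>R c = c * indicator (A \<inter> cball 0 R) x" for x
  by (auto simp: indicator_def)
 have "A \<inter> cball 0 R \<in> sets lebesgue" using base by (intro sets.Int) auto
 then show ?case unfolding eq by (intro approximable_cmult approximable_indicator[where R=R]) auto
next
 case (add f g)
 then show ?case using approximable_add by (simp add: scaleR_add_right)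
next
 case (lim f s)
 have i: "integrable lebesgue (%x. indicator (cball 0 R) x *\<^sub>R g x)" if "integrable lebesgue g" for g :: "real^'d => complex"
  using that by (intro integrable_mult_indicator) auto
 show ?case
 proof (rule approximable_limit_L1[where R=R])
  have n3: "integrable lebesgue (%x. 3 * norm (f x))" using lim by auto
  have "(%j. LINT x|lebesgue. norm (indicator (cball 0 R) x *\<^sub>R f x - indicator (cball 0 R) x *\<^sub>R s j x)) \<longlonglongrightarrow> (LINT x::real^'d|lebesgue. 0)"
  proof (rule integral_dominated_convergence[OF _ _ n3])
   show "(%x. norm (indicator (cball 0 R) x *\<^sub>R f x - indicator (cball 0 R) x *\<^sub>R s j x)) \<in> borel_measurable lebesgue" for j
    using i[OF lim(4)] i[OF lim(1), of j] by (intro borel_measurable_norm_comp borel_measurable_diff) (drule borel_measurable_integrable, assumption)+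
   show "AE x in lebesgue. (%j. norm (indicator (cball 0 R) x *\<^sub>R f x - indicator (cball 0 R) x *\<^sub>R s j x)) \<longlonglongrightarrow> 0"
   proof (rule AE_I2)
    fix x :: "real^'d"
    have "(%j. s j x) \<longlonglongrightarrow> f x" using lim(2) by simp
    then have "(%j. norm (indicator (cball 0 R) x *\<^sub>R f x - indicator (cball 0 R) x *\<^sub>R s j x)) \<longlonglongrightarrow> norm (indicator (cball 0 R) x *\<^sub>R f x - indicator (cball 0 R) x *\<^sub>R f x)"
     by (intro tendsto_intros)
    then show "(%j. norm (indicator (cball 0 R) x *\<^sub>R f x - indicator (cball 0 R) x *\<^sub>R s j x)) \<longlonglongrightarrow> 0" by simp
   qed
   show "AE x in lebesgue. norm (norm (indicator (cball 0 R) x *\<^sub>R f x - indicator (cball 0 R) x *\<^sub>R s j x)) <= 3 * norm (f x)" for j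
   proof (rule AE_I2)
    fix x :: "real^'d"
    have "norm (s j x) <= 2 * norm (f x)" using lim(3) by simp
    then show "norm (norm (indicator (cball 0 R) x *\<^sub>R f x - indicator (cball 0 R) x *\<^sub>R s j x)) <= 3 * norm (f x)"
     using norm_triangle_ineq4[of "f x" "s j x"] by (simp add: indicator_def)
   qed
  qed measurable
  then show "(%j. LINT x|lebesgue. norm (indicator (cball 0 R) x *\<^sub>R f x - indicator (cball 0 R) x *\<^sub>R s j x)) \<longlonglongrightarrow> 0" by simp
  show "approximable (%x. indicator (cball 0 R) x *\<^sub>R s j x)" for j by (rule lim(5))
  show "integrable lebesgue (%x. indicator (cball 0 R) x *\<^sub>R s j x)" for j by (intro i lim(1))
  show "integrable lebesgue (%x. indicator (cball 0 R) x *\<^sub>R f x)" by (intro i lim(4))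
 qed (simp_all add: indicator_def)
qed

text \<open>Summability over the lattice leaves a small tail outside finitely many cubes; on their
  union, which is bounded, \<open>f\<close> is integrable.\<close>

theorem Sigma1_dense_WL:
 assumes f: "f \<in> WL r v" and e: "e > 0"
 shows "\<exists>p\<in>Sigma1. wl (%x. f x - p x) < e"
proof -
 have fs: "WL_term r v f summable_on lattice" and fm: "f \<in> borel_measurable lebesgue"
  and fi: "!!k. k \<in> lattice ==> set_integrable lebesgue (cube k) f" using f by (auto simp: WL_def)
 have "e / 2 > 0" using e by simp
 from infsum_tail_small[OF fs this] obtain F where F: "finite F" "F \<subseteq> lattice" "infsum (WL_term r v f) (lattice - F) < e / 2" by blast
 have Um: "(\<Union>k\<in>F. cube k) \<in> sets lebesgue" using F(1) by (intro sets.finite_UN) auto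
 have "bounded (\<Union>k\<in>F. cube k)" using F(1) by (intro bounded_UN) auto
 then obtain R where R: "!!x. x \<in> (\<Union>k\<in>F. cube k) ==> norm x <= R" unfolding bounded_iff by blast
 define h where "h x = indicator (\<Union>k\<in>F. cube k) x *\<^sub>R f x" for x
 have h: "integrable lebesgue h"
 proof -
  have "set_integrable lebesgue (\<Union>k\<in>F. cube k) f" using F(1,2)
   by (intro set_integrable_UN fi) (auto)
  then show ?thesis by (simp add: h_def[abs_def] set_integrable_def)
 qed
 have hR: "indicator (cball 0 R) x *\<^sub>R h x = h x" for x
  using R[of x] by (cases "x \<in> (\<Union>k\<in>F. cube k)") (auto simp: h_def indicator_def)
 have "approximable h" using approximable_truncation[OF h, of R] unfolding hR .
 then obtain p where p: "p \<in> Sigma1" "wl (%x. h x - p x) < e / 2" and hW: "h \<in> WL r v"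
  unfolding approximable_def using \<open>e / 2 > 0\<close> by blast
 have dW: "(%x. f x - h x) \<in> WL r v" using WL_diff[OF f hW] by blast
 \<comment> \<open>The closed cubes overlap, so on a cube outside \<open>F\<close> the difference
   need not be \<open>f\<close> itself; it is dominated by it.\<close>
 have le: "mass (%x. f x - h x) k <= mass f k" if "k \<in> lattice" for k
  unfolding mass_def
 proof (rule set_integral_mono)
  show "set_integrable lebesgue (cube k) (%x. norm (f x - h x))"
   using dW that by (intro set_integrable_norm) (auto simp: WL_def)
  show "set_integrable lebesgue (cube k) (%x. norm (f x))" by (intro set_integrable_norm fi that)
  show "norm (f x - h x) <= norm (f x)" for x by (simp add: h_def indicator_def)
 qed
 have zero: "WL_term r v (%x. f x - h x) k = 0" if "k \<in> F" for k
 proof -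
  have "mass (%x. f x - h x) k = (LINT x:cube k|lebesgue. 0)"
   unfolding mass_def using that by (intro set_lebesgue_integral_cong) (auto simp: h_def indicator_def)
  then show ?thesis by (simp add: WL_term_eq set_lebesgue_integral_def)
 qed
 have "wl (%x. f x - h x) <= infsum (WL_term r v f) (lattice - F)"
  unfolding wl_def
 proof (rule infsum_mono_neutral)
  show "WL_term r v (%x. f x - h x) summable_on lattice" using dW by (simp add: WL_def)
  show "WL_term r v f summable_on lattice - F" by (rule summable_on_subset_banach[OF fs]) auto
  show "WL_term r v (%x. f x - h x) k <= WL_term r v f k" if "k \<in> lattice \<inter> (lattice - F)" for k
   unfolding WL_term_eq using that le[of k] mass_nonneg[of "%x. f x - h x" k] v_pos[of k] r
   by (intro powr_mono2 mult_right_mono) auto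
 qed (use zero in auto)
 then have "wl (%x. f x - p x) < e"
  using wl_triangle[OF f hW Sigma1_WL[OF p(1)]] F(3) p(2) by simp
 then show ?thesis using p(1) by blast
qed

end

lemma tendsto_powr_zero_iff:
 fixes F :: "nat => real"
 assumes "!!n. 0 <= F n" "0 < r" shows "(%n. F n powr r) \<longlonglongrightarrow> 0 \<longleftrightarrow> F \<longlonglongrightarrow> 0"
proof
 assume "(%n. F n powr r) \<longlonglongrightarrow> 0"
 from tendsto_powr2[OF this tendsto_const, of "1 / r"] show "F \<longlonglongrightarrow> 0" using assms by (simp add: powr_powr)
next
 assume "F \<longlonglongrightarrow> 0"
 from tendsto_powr2[OF this tendsto_const, of r] show "(%n. F n powr r) \<longlonglongrightarrow> 0" using assms by simp
qed

lemma powr_less_cancel_left: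
 fixes a b r :: real
 assumes "a powr r < b powr r" "0 < r" "0 <= b" shows "a < b"
proof (rule ccontr)
 assume "\<not> a < b"
 then have "b powr r <= a powr r" using assms by (intro powr_mono2) auto
 then show False using assms by simp
qed

section \<open>Quasi-distances and completions\<close>

text \<open>The topologies \<open>WL_top\<close> and \<open>M0_top\<close> come from quasi-norms,
  for which the triangle inequality holds for the r-th power of the distance. The topology, however,
  is formed with \<open>d\<close> itself.\<close>

locale qdist =
 fixes S :: "'a set" and d :: "'a => 'a => real" and r :: real
 assumes r0: "0 < r" and d_nonneg: "!!x y. x \<in> S ==> y \<in> S ==> 0 <= d x y"
  and d_refl: "!!x. x \<in> S ==> d x x = 0"
  and d_sym: "!!x y. x \<in> S ==> y \<in> S ==> d x y = d y x"
  and d_tri: "!!x y z. x \<in> S ==> y \<in> S ==> z \<in> S ==> d x z powr r <= d x y powr r + d y z powr r"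
begin

lemma openin_ball:
 assumes x: "x \<in> S" shows "openin (distance_topology S {d}) {y\<in>S. d x y < e}"
 unfolding openin_distance_topology
proof (intro conjI ballI)
 fix y assume "y \<in> {y\<in>S. d x y < e}"
 then have y: "y \<in> S" "d x y < e" by auto
 have gap: "0 < e powr r - d x y powr r" using powr_less_mono2[OF r0 d_nonneg[OF x y(1)] y(2)] by simp
 \<comment> \<open>The room that is left is measured in r-th powers.\<close>
 let ?epsilon = "(e powr r - d x y powr r) powr (1 / r)"
 have "d x z < e" if z: "z \<in> S" "d y z < ?epsilon" for z
 proof -
  have "d y z powr r < ?epsilon powr r" using r0 d_nonneg[OF y(1) z(1)] z(2) by (intro powr_less_mono2)
  also have "?epsilon powr r = e powr r - d x y powr r" using r0 gap by (simp add: powr_powr)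
  finally have "d x z powr r < e powr r" using d_tri[OF x y(1) z(1)] by simp
  moreover have "0 <= e" using y(2) d_nonneg[OF x y(1)] by linarith
  ultimately show ?thesis by (rule powr_less_cancel_left[OF _ r0])
 qed
 then show "\<exists>F epsilon. F \<subseteq> {d} \<and> finite F \<and> epsilon > 0 \<and> (\<forall>z\<in>S. (\<forall>d\<in>F. d y z < epsilon) --> z \<in> {y\<in>S. d x y < e})"
  using gap by (intro exI[of _ "{d}"] exI[of _ ?epsilon]) auto
qed auto

end

lemma open_contains_ball:
 assumes "openin (distance_topology S {d}) U" "x \<in> U"
 shows "\<exists>e>0. \<forall>y\<in>S. d x y < (e::real) --> y \<in> U"
proof -
 obtain F e where F: "F \<subseteq> {d}" "e > 0" "\<forall>y\<in>S. (\<forall>d\<in>F. d x y < e) --> y \<in> U"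
  using assms unfolding openin_distance_topology by blast
 then show ?thesis by (intro exI[of _ e]) auto
qed

text \<open>One distance on each factor reduces continuity in the abstract topologies to the
  epsilon-delta condition, in which all later arguments are carried out.\<close>

lemma continuous_map_dist_prod:
 assumes q: "qdist S1 d1 r1" "qdist S2 d2 r2" "qdist S3 d3 r3"
 shows "continuous_map (prod_topology (distance_topology S1 {d1}) (distance_topology S2 {d2})) (distance_topology S3 {d3}) c
  \<longleftrightarrow> (\<forall>x\<in>S1. \<forall>y\<in>S2. c (x, y) \<in> S3 \<and>
     (\<forall>e>0. \<exists>delta>0. \<forall>x'\<in>S1. \<forall>y'\<in>S2. d1 x x' < delta --> d2 y y' < delta --> d3 (c (x, y)) (c (x', y')) < e))"
  (is "?L \<longleftrightarrow> ?R")
proof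
 assume L: ?L
 show ?R
 proof (intro ballI conjI allI impI)
  fix x y assume x: "x \<in> S1" and y: "y \<in> S2"
  show cS: "c (x, y) \<in> S3" using L x y unfolding continuous_map_def by (auto simp: Pi_iff)
  fix e :: real assume e: "e > 0"
  let ?B = "{z\<in>S3. d3 (c (x, y)) z < e}"
  have oB: "openin (distance_topology S3 {d3}) ?B" by (rule qdist.openin_ball[OF q(3) cS])
  from openin_continuous_map_preimage[OF L oB]
  have op: "openin (prod_topology (distance_topology S1 {d1}) (distance_topology S2 {d2})) {p \<in> S1 \<times> S2. c p \<in> ?B}" by simp
  have m: "(x, y) \<in> {p \<in> S1 \<times> S2. c p \<in> ?B}" using x y cS e qdist.d_refl[OF q(3) cS] by simp
  from op[unfolded openin_prod_topology_alt, rule_format, OF m] obtain U V where UV: "openin (distance_topology S1 {d1}) U" "openin (distance_topology S2 {d2}) V" "x \<in> U" "y \<in> V"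
   "U \<times> V \<subseteq> {p \<in> S1 \<times> S2. c p \<in> ?B}"
   by (elim exE conjE) (rule that)
  obtain e1 where e1: "e1 > 0" "\<forall>x'\<in>S1. d1 x x' < e1 --> x' \<in> U" using open_contains_ball[OF UV(1,3)] by blast
  obtain e2 where e2: "e2 > 0" "\<forall>y'\<in>S2. d2 y y' < e2 --> y' \<in> V" using open_contains_ball[OF UV(2,4)] by blast
  show "\<exists>delta>0. \<forall>x'\<in>S1. \<forall>y'\<in>S2. d1 x x' < delta --> d2 y y' < delta --> d3 (c (x, y)) (c (x', y')) < e"
   using e1 e2 UV(5) by (intro exI[of _ "min e1 e2"]) auto
 qed
next
 assume R: ?R
 show ?L unfolding continuous_map_def
 proof (intro conjI allI impI)
  show "c \<in> topspace (prod_topology (distance_topology S1 {d1}) (distance_topology S2 {d2})) \<rightarrow> topspace (distance_topology S3 {d3})"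
   using R by auto
  fix U assume U: "openin (distance_topology S3 {d3}) U"
  show "openin (prod_topology (distance_topology S1 {d1}) (distance_topology S2 {d2})) {p \<in> topspace (prod_topology (distance_topology S1 {d1}) (distance_topology S2 {d2})). c p \<in> U}"
   unfolding openin_prod_topology_alt
  proof (intro allI impI)
   fix x y assume "(x, y) \<in> {p \<in> topspace (prod_topology (distance_topology S1 {d1}) (distance_topology S2 {d2})). c p \<in> U}"
   then have x: "x \<in> S1" and y: "y \<in> S2" and cU: "c (x, y) \<in> U" by auto
   obtain e where e: "e > 0" "\<forall>z\<in>S3. d3 (c (x, y)) z < e --> z \<in> U" using open_contains_ball[OF U cU] by blast
   obtain delta where delta: "delta > 0" "\<forall>x'\<in>S1. \<forall>y'\<in>S2. d1 x x' < delta --> d2 y y' < delta --> d3 (c (x, y)) (c (x', y')) < e"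
    using R[THEN bspec, OF x, THEN bspec, OF y, THEN conjunct2, rule_format, OF e(1)] by (elim exE conjE) (rule that)
   let ?U = "{x'\<in>S1. d1 x x' < delta}" and ?V = "{y'\<in>S2. d2 y y' < delta}"
   have "openin (distance_topology S1 {d1}) ?U" "openin (distance_topology S2 {d2}) ?V"
    using qdist.openin_ball[OF q(1) x] qdist.openin_ball[OF q(2) y] by auto
   moreover have "x \<in> ?U" "y \<in> ?V" using x y delta(1) qdist.d_refl[OF q(1) x] qdist.d_refl[OF q(2) y] by simp_all
   moreover have "?U \<times> ?V \<subseteq> {p \<in> topspace (prod_topology (distance_topology S1 {d1}) (distance_topology S2 {d2})). c p \<in> U}"
   proof (rule subsetI)
    fix p assume "p \<in> ?U \<times> ?V"
    then obtain x' y' where p: "p = (x', y')" "x' \<in> S1" "y' \<in> S2" "d1 x x' < delta" "d2 y y' < delta" by auto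
    have "c p \<in> S3" unfolding p(1) using R p(2,3) by blast
    then have "c p \<in> U" using delta(2)[rule_format, OF p(2-5)] e(2) unfolding p(1) by blast
    then show "p \<in> {p \<in> topspace (prod_topology (distance_topology S1 {d1}) (distance_topology S2 {d2})). c p \<in> U}"
     using p(1-3) by simp
   qed
   ultimately show "\<exists>A B. openin (distance_topology S1 {d1}) A \<and> openin (distance_topology S2 {d2}) B \<and> x \<in> A \<and> y \<in> B
     \<and> A \<times> B \<subseteq> {p \<in> topspace (prod_topology (distance_topology S1 {d1}) (distance_topology S2 {d2})). c p \<in> U}"
    by (intro exI[of _ ?U] exI[of _ ?V] conjI)
  qed
 qed
qed

context qdist begin

abbreviation D :: "'a => 'a => real" where "D x y \<equiv> d x y powr r"

lemma D_sym: "x \<in> S ==> y \<in> S ==> D x y = D y x"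
 by (simp add: d_sym)

lemma D_refl: "x \<in> S ==> D x x = 0"
 by (simp add: d_refl)

lemma D_diff:
 assumes "x \<in> S" "y \<in> S" "x' \<in> S" "y' \<in> S" shows "\<bar>D x y - D x' y'\<bar> <= D x x' + D y y'"
 using d_tri[of x x' y] d_tri[of x' y' y] d_tri[of x' x y'] d_tri[of x y y'] D_sym[of x x'] D_sym[of y y'] assms by linarith

lemma Cauchy_in_S: "s \<in> Cauchy_in S d ==> s n \<in> S"
 by (auto simp: Cauchy_in_def)

lemma Cauchy_D: 
 assumes "s \<in> Cauchy_in S d" "e > 0" shows "\<exists>n0. \<forall>m\<ge>n0. \<forall>n\<ge>n0. D (s m) (s n) < e"
proof -
 have "e powr (1 / r) > 0" using assms(2) by simp
 then obtain n0 where n0: "!!m n. m >= n0 ==> n >= n0 ==> d (s m) (s n) < e powr (1 / r)"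
  using conjunct2[OF assms(1)[unfolded Cauchy_in_def mem_Collect_eq], THEN spec, THEN mp, OF \<open>e powr (1 / r) > 0\<close>]
  by (elim exE) (use that in blast)
 have "D (s m) (s n) < e" if mn: "m >= n0" "n >= n0" for m n
 proof -
  have "D (s m) (s n) < (e powr (1 / r)) powr r"
   by (rule powr_less_mono2[OF r0 d_nonneg[OF Cauchy_in_S[OF assms(1)] Cauchy_in_S[OF assms(1)]] n0[OF mn]])
  then show ?thesis using r0 assms(2) by (simp add: powr_powr)
 qed
 then show ?thesis by blast
qed

lemma Cauchy_inI:
 assumes "!!n. s n \<in> S" "!!e. e > 0 ==> \<exists>n0. \<forall>m\<ge>n0. \<forall>n\<ge>n0. D (s m) (s n) < e"
 shows "s \<in> Cauchy_in S d"
 unfolding Cauchy_in_def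
proof (intro CollectI conjI allI impI)
 fix e :: real assume e: "e > 0"
 then obtain n0 where "\<forall>m\<ge>n0. \<forall>n\<ge>n0. D (s m) (s n) < e powr r" using assms(2)[of "e powr r"] by auto
 then show "\<exists>n0. \<forall>m\<ge>n0. \<forall>n\<ge>n0. d (s m) (s n) < e"
  using less_imp_le[OF e] by (intro exI[of _ n0] allI impI) (rule powr_less_cancel_left[OF _ r0], blast+)
qed (use assms(1) in auto)

text \<open>The r-th powers form a real Cauchy sequence; the root is taken afterwards.\<close>

lemma dist_convergent:
 assumes s: "s \<in> Cauchy_in S d" and t: "t \<in> Cauchy_in S d"
 shows "convergent (%n. d (s n) (t n))"
proof -
 have "Cauchy (%n. D (s n) (t n))"
  unfolding Cauchy_def
 proof (intro allI impI)
  fix e :: real assume "e > 0"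
  then have e: "e / 2 > 0" by simp
  obtain a where a: "\<forall>m\<ge>a. \<forall>n\<ge>a. D (s m) (s n) < e / 2" using Cauchy_D[OF s e] by blast
  obtain b where b: "\<forall>m\<ge>b. \<forall>n\<ge>b. D (t m) (t n) < e / 2" using Cauchy_D[OF t e] by blast
  show "\<exists>M. \<forall>m\<ge>M. \<forall>n\<ge>M. dist (D (s m) (t m)) (D (s n) (t n)) < e"
  proof (intro exI[of _ "max a b"] allI impI)
   fix m n assume mn: "m >= max a b" "n >= max a b"
   have "\<bar>D (s m) (t m) - D (s n) (t n)\<bar> <= D (s m) (s n) + D (t m) (t n)"
    by (intro D_diff Cauchy_in_S s t)
   also have "... < e / 2 + e / 2" using a b mn by (intro add_strict_mono) auto
   finally show "dist (D (s m) (t m)) (D (s n) (t n)) < e" by (simp add: dist_real_def)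
  qed
 qed
 then obtain L where L: "(%n. D (s n) (t n)) \<longlonglongrightarrow> L" using convergent_eq_Cauchy by blast
 have "(%n. D (s n) (t n) powr (1 / r)) \<longlonglongrightarrow> L powr (1 / r)"
  by (rule tendsto_powr2[OF L tendsto_const]) (use r0 in auto)
 moreover have "D (s n) (t n) powr (1 / r) = d (s n) (t n)" for n
  using r0 d_nonneg[OF Cauchy_in_S[OF s] Cauchy_in_S[OF t], of n n] by (simp add: powr_powr)
 ultimately show ?thesis unfolding convergent_def by auto
qed

lemma null_rel_iff:
 "(s, t) \<in> null_rel S d \<longleftrightarrow> s \<in> Cauchy_in S d \<and> t \<in> Cauchy_in S d \<and> (%n. D (s n) (t n)) \<longlonglongrightarrow> 0"
proof (cases "s \<in> Cauchy_in S d \<and> t \<in> Cauchy_in S d")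
 case True
 then have "0 <= d (s n) (t n)" for n using d_nonneg Cauchy_in_S by blast
 then show ?thesis using tendsto_powr_zero_iff[OF _ r0, of "%n. d (s n) (t n)"] by (auto simp: null_rel_def)
qed (auto simp: null_rel_def)

lemma equiv_null_rel: "equiv (Cauchy_in S d) (null_rel S d)"
proof (rule equivI)
 show "null_rel S d \<subseteq> Cauchy_in S d \<times> Cauchy_in S d" by (auto simp: null_rel_def)
 show "refl_on (Cauchy_in S d) (null_rel S d)"
  by (rule refl_onI) (auto simp: null_rel_def Cauchy_in_S d_refl)
 show "sym (null_rel S d)"
  by (rule symI) (auto simp: null_rel_iff D_sym[OF Cauchy_in_S Cauchy_in_S])
 show "trans (null_rel S d)"
 proof (rule transI)
  fix s t u assume a: "(s, t) \<in> null_rel S d" "(t, u) \<in> null_rel S d"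
  then have C: "s \<in> Cauchy_in S d" "t \<in> Cauchy_in S d" "u \<in> Cauchy_in S d" by (auto simp: null_rel_iff)
  have "(%n. D (s n) (t n) + D (t n) (u n)) \<longlonglongrightarrow> 0 + 0" using a by (intro tendsto_add) (auto simp: null_rel_iff)
  then have "(%n. D (s n) (u n)) \<longlonglongrightarrow> 0"
   using d_tri Cauchy_in_S C by (intro tendsto_zero_le[of "%n. D (s n) (u n)" "%n. D (s n) (t n) + D (t n) (u n)"]) auto
  then show "(s, u) \<in> null_rel S d" using C by (simp add: null_rel_iff)
 qed
qed

definition cls :: "(nat => 'a) => (nat => 'a) set" where
 "cls s = null_rel S d `` {s}"

abbreviation E :: "(nat => 'a) set => (nat => 'a) set => real" where
 "E \<equiv> completion_dist d"

lemma completion_eq: "completion S d = cls ` Cauchy_in S d"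
 by (auto simp: completion_def quotient_def cls_def)

lemma cls_in_completion: "s \<in> Cauchy_in S d ==> cls s \<in> completion S d"
 by (simp add: completion_eq)

lemma cls_eq_iff: "s \<in> Cauchy_in S d ==> t \<in> Cauchy_in S d ==> cls s = cls t \<longleftrightarrow> (%n. D (s n) (t n)) \<longlonglongrightarrow> 0"
 unfolding cls_def using eq_equiv_class_iff[OF equiv_null_rel, of s t] by (simp add: null_rel_iff)

lemma some_cls:
 assumes s: "s \<in> Cauchy_in S d"
 shows "(s, SOME t. t \<in> cls s) \<in> null_rel S d"
proof -
 have "s \<in> cls s" unfolding cls_def using equiv_class_self[OF equiv_null_rel s] .
 then have "(SOME t. t \<in> cls s) \<in> cls s" by (rule someI[of "%t. t \<in> cls s"])
 then show ?thesis by (simp add: cls_def)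
qed

text \<open>\<open>completion_dist\<close> evaluates chosen representatives. They differ from
  \<open>s\<close> and \<open>t\<close> by null sequences, which do not affect the limit of the r-th
  powers.\<close>

lemma E_tendsto_D:
 assumes s: "s \<in> Cauchy_in S d" and t: "t \<in> Cauchy_in S d"
 shows "(%n. D (s n) (t n)) \<longlonglongrightarrow> E (cls s) (cls t) powr r"
proof -
 define s' where "s' = (SOME x. x \<in> cls s)"
 define t' where "t' = (SOME x. x \<in> cls t)"
 have s': "s' \<in> Cauchy_in S d" "(%n. D (s n) (s' n)) \<longlonglongrightarrow> 0" and t': "t' \<in> Cauchy_in S d" "(%n. D (t n) (t' n)) \<longlonglongrightarrow> 0"
  using some_cls[OF s] some_cls[OF t] by (auto simp: s'_def t'_def null_rel_iff)
 have "(%n. d (s' n) (t' n)) \<longlonglongrightarrow> E (cls s) (cls t)"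
  using dist_convergent[OF s'(1) t'(1)] by (simp add: completion_dist_def s'_def t'_def convergent_LIMSEQ_iff)
 from tendsto_powr2[OF this tendsto_const, of r] have l: "(%n. D (s' n) (t' n)) \<longlonglongrightarrow> E (cls s) (cls t) powr r"
  using r0 d_nonneg Cauchy_in_S s'(1) t'(1) by (auto intro: always_eventually)
 have "(%n. D (s n) (s' n) + D (t n) (t' n)) \<longlonglongrightarrow> 0 + 0" by (intro tendsto_add s' t')
 then have "(%n. \<bar>D (s n) (t n) - D (s' n) (t' n)\<bar>) \<longlonglongrightarrow> 0"
  using D_diff Cauchy_in_S s t s'(1) t'(1)
  by (intro tendsto_zero_le[of "%n. \<bar>D (s n) (t n) - D (s' n) (t' n)\<bar>" "%n. D (s n) (s' n) + D (t n) (t' n)"]) auto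
 then have "(%n. D (s n) (t n) - D (s' n) (t' n)) \<longlonglongrightarrow> 0" by (simp add: tendsto_rabs_zero_iff)
 from tendsto_add[OF this l] show ?thesis by simp
qed

lemma E_nonneg:
 assumes s: "s \<in> Cauchy_in S d" and t: "t \<in> Cauchy_in S d" shows "0 <= E (cls s) (cls t)"
proof -
 have C: "(SOME x. x \<in> cls s) \<in> Cauchy_in S d" "(SOME x. x \<in> cls t) \<in> Cauchy_in S d"
  using some_cls[OF s] some_cls[OF t] by (auto simp: null_rel_iff)
 have "(%n. d ((SOME x. x \<in> cls s) n) ((SOME x. x \<in> cls t) n)) \<longlonglongrightarrow> E (cls s) (cls t)"
  using dist_convergent[OF C] by (simp add: completion_dist_def convergent_LIMSEQ_iff)
 then show ?thesis using d_nonneg Cauchy_in_S C by (intro LIMSEQ_le_const) auto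
qed

lemma E_zero_iff:
 assumes s: "s \<in> Cauchy_in S d" and t: "t \<in> Cauchy_in S d"
 shows "E (cls s) (cls t) = 0 \<longleftrightarrow> cls s = cls t"
proof
 assume "E (cls s) (cls t) = 0"
 then show "cls s = cls t" using E_tendsto_D[OF s t] by (simp add: cls_eq_iff[OF s t])
next
 assume "cls s = cls t"
 then have "E (cls s) (cls t) powr r = 0" using E_tendsto_D[OF s t] unfolding cls_eq_iff[OF s t] by (rule LIMSEQ_unique[rotated])
 then show "E (cls s) (cls t) = 0" by simp
qed

lemma completion_qdist: "qdist (completion S d) E r"
proof
 show "0 < r" by (rule r0)
 fix a b assume "a \<in> completion S d" "b \<in> completion S d"
 then obtain s t where st: "s \<in> Cauchy_in S d" "t \<in> Cauchy_in S d" and ab: "a = cls s" "b = cls t"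
  unfolding completion_eq by blast
 show "0 <= E a b" unfolding ab by (rule E_nonneg[OF st])
 show "E a a = 0" unfolding ab using E_zero_iff[OF st(1) st(1)] by simp
 have "(%n. D (s n) (t n)) = (%n. D (t n) (s n))" using D_sym Cauchy_in_S st by blast
 then have "E a b powr r = E b a powr r" unfolding ab
  using E_tendsto_D[OF st] E_tendsto_D[OF st(2,1)] by (auto intro: LIMSEQ_unique)
 then show "E a b = E b a" unfolding ab using r0 E_nonneg[OF st] E_nonneg[OF st(2,1)] by (metis powr_less_cancel_left linorder_neq_iff order_less_irrefl powr_less_mono2)
 fix c assume "c \<in> completion S d"
 then obtain u where u: "u \<in> Cauchy_in S d" "c = cls u" unfolding completion_eq by blast
 show "E a c powr r <= E a b powr r + E b c powr r" unfolding ab u(2)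
  using d_tri Cauchy_in_S st u(1)
  by (intro LIMSEQ_le[OF E_tendsto_D[OF st(1) u(1)] tendsto_add[OF E_tendsto_D[OF st] E_tendsto_D[OF st(2) u(1)]]]) blast
qed

lemma const_Cauchy: "x \<in> S ==> (%_. x) \<in> Cauchy_in S d"
 by (auto simp: Cauchy_in_def d_refl)

lemma embed_eq: "completion_embed S d x = cls (%_. x)"
 by (simp add: completion_embed_def cls_def)

lemma embed_dist: "x \<in> S ==> y \<in> S ==> E (cls (%_. x)) (cls (%_. y)) powr r = D x y"
 using E_tendsto_D[OF const_Cauchy const_Cauchy, of x y] by (simp add: LIMSEQ_const_iff)

lemma embed_tendsto:
 assumes s: "s \<in> Cauchy_in S d" shows "(%n. E (cls (%_. s n)) (cls s) powr r) \<longlonglongrightarrow> 0"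
proof (rule LIMSEQ_I)
 fix e :: real assume e: "e > 0"
 then have "e / 2 > 0" by simp
 from Cauchy_D[OF s this] obtain n0 where n0: "\<forall>m\<ge>n0. \<forall>n\<ge>n0. D (s m) (s n) < e / 2" by blast
 have "E (cls (%_. s m)) (cls s) powr r <= e / 2" if "m >= n0" for m
  using n0 that by (intro LIMSEQ_le_const2[OF E_tendsto_D[OF const_Cauchy[OF Cauchy_in_S[OF s]] s]] exI[of _ n0]) (auto intro: less_imp_le)
 then show "\<exists>n0. \<forall>m\<ge>n0. norm (E (cls (%_. s m)) (cls s) powr r - 0) < e"
  using e by (intro exI[of _ n0]) force
qed

end

section \<open>Extension of a bounded action to the completion\<close>

text \<open>The abstract situation of the convolution: a dense set \<open>P\<close> acts on
  \<open>Y\<close>, and \<open>A\<close> and \<open>Q\<close> stand for r-th powers of norms. The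
  estimate \<open>bound\<close> has the shape of a product rule for differences and takes the place
  of bilinearity.\<close>

locale bounded_action = X: qdist X dX r + Y: qdist Y d r for X dX Y d and r :: real +
 fixes P :: "'a set" and b :: "'a => 'b => 'b" and A :: "'a => real" and Q :: "'b => real" and C :: real
 assumes P: "P \<subseteq> X" and dense: "!!f e. f \<in> X ==> e > 0 ==> \<exists>p\<in>P. dX f p powr r < e"
  and b: "!!p x. p \<in> P ==> x \<in> Y ==> b p x \<in> Y"
  and A: "!!f. 0 <= A f" "!!f g. f \<in> X ==> g \<in> X ==> A f <= A g + dX g f powr r"
  and Q: "!!x. 0 <= Q x" "!!x y. x \<in> Y ==> y \<in> Y ==> Q x <= Q y + d y x powr r"
  and C: "C >= 0" and bound: "!!p p' x x'. p \<in> P ==> p' \<in> P ==> x \<in> Y ==> x' \<in> Y ==>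
   d (b p x) (b p' x') powr r <= C * (dX p p' powr r * Q x + A p' * d x x' powr r)"
begin

sublocale YC: qdist "completion Y d" "completion_dist d" r
 by (rule Y.completion_qdist)

lemma Q_bounded:
 assumes s: "s \<in> Cauchy_in Y d" shows "\<exists>M\<ge>0. \<forall>n. Q (s n) <= M"
proof -
 from Y.Cauchy_D[OF s zero_less_one] obtain n0 where n0: "\<forall>m\<ge>n0. \<forall>n\<ge>n0. d (s m) (s n) powr r < 1" ..
 have "Q (s n) <= (\<Sum>i\<le>n0. Q (s i)) + 1" for n
 proof (cases "n >= n0")
  case True
  have "Q (s n) <= Q (s n0) + d (s n0) (s n) powr r" by (intro Q Y.Cauchy_in_S s)
  also have "d (s n0) (s n) powr r <= 1" using n0 True by (simp add: less_imp_le)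
  also have "Q (s n0) <= (\<Sum>i\<le>n0. Q (s i))" by (rule member_le_sum) (auto simp: Q)
  finally show ?thesis by simp
 next
  case False
  then have "Q (s n) <= (\<Sum>i\<le>n0. Q (s i))" by (intro member_le_sum) (auto simp: Q)
  then show ?thesis by simp
 qed
 moreover have "0 <= (\<Sum>i\<le>n0. Q (s i)) + 1" by (simp add: sum_nonneg Q add_nonneg_nonneg)
 ultimately show ?thesis by blast
qed

definition appr :: "'a => nat => 'a" where
 "appr f n = (SOME p. p \<in> P \<and> dX f p powr r < 1 / real (Suc n))"

lemma appr:
 assumes f: "f \<in> X" shows "appr f n \<in> P" "dX f (appr f n) powr r < 1 / real (Suc n)"
proof -
 have "1 / real (Suc n) > 0" by simp
 from dense[OF f this] have "\<exists>p. p \<in> P \<and> dX f p powr r < 1 / real (Suc n)" unfolding Bex_def .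
 from someI_ex[OF this] show "appr f n \<in> P" "dX f (appr f n) powr r < 1 / real (Suc n)"
  unfolding appr_def by (rule conjunct1, rule conjunct2)
qed

lemma appr_X: "f \<in> X ==> appr f n \<in> X"
 using appr(1) P by blast

lemma A_appr: 
 assumes f: "f \<in> X" shows "A (appr f n) <= A f + 1"
proof -
 have "1 / real (Suc n) <= 1" by simp
 then show ?thesis using A(2)[OF appr_X[OF f] f, of n] appr(2)[OF f, of n] by linarith
qed

lemma appr_dist:
 assumes f: "f \<in> X" "g \<in> X"
 shows "dX (appr f m) (appr g n) powr r <= dX f g powr r + (1 / real (Suc m) + 1 / real (Suc n))"
 using X.d_tri[OF appr_X[OF f(1)] f(1) appr_X[OF f(2)], of m n] X.d_tri[OF f(1) f(2) appr_X[OF f(2)], of n]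
  appr(2)[OF f(1), of m] appr(2)[OF f(2), of n] X.D_sym[OF f(1) appr_X[OF f(1)], of m] by linarith

text \<open>The \<open>n\<close>-th approximation of \<open>f\<close> is applied to the
  \<open>n\<close>-th term of the Cauchy sequence, so that one diagonal sequence represents the
  product.\<close>

definition act :: "'a => (nat => 'b) => nat => 'b" where
 "act f s n = b (appr f n) (s n)"

text \<open>Two indices are kept apart: different ones yield the Cauchy property, equal ones the
  estimate in the limit.\<close>

lemma act_bound:
 assumes f: "f \<in> X" "g \<in> X" and s: "s \<in> Cauchy_in Y d" "t \<in> Cauchy_in Y d"
  and M: "!!n. Q (s n) <= M"
 shows "d (act f s m) (act g t n) powr r <= C * ((dX f g powr r + (1 / real (Suc m) + 1 / real (Suc n))) * M + (A g + 1) * d (s m) (t n) powr r)"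
proof -
 have "d (act f s m) (act g t n) powr r <= C * (dX (appr f m) (appr g n) powr r * Q (s m) + A (appr g n) * d (s m) (t n) powr r)"
  unfolding act_def by (intro bound appr f Y.Cauchy_in_S s)
 also have "... <= C * ((dX f g powr r + (1 / real (Suc m) + 1 / real (Suc n))) * M + (A g + 1) * d (s m) (t n) powr r)"
  by (intro mult_left_mono[OF _ C] add_mono mult_mono appr_dist A_appr f M order_refl) (auto simp: Q A add_nonneg_nonneg)
 finally show ?thesis .
qed

lemma act_Cauchy:
 assumes f: "f \<in> X" and s: "s \<in> Cauchy_in Y d" shows "act f s \<in> Cauchy_in Y d"
proof (rule Y.Cauchy_inI)
 show "act f s n \<in> Y" for n unfolding act_def by (intro b appr f Y.Cauchy_in_S s)
 fix e :: real assume e: "e > 0"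
 obtain M where M: "M >= 0" "!!n. Q (s n) <= M" using Q_bounded[OF s] by blast
 \<comment> \<open>Collects the coefficients of \<open>eta\<close> in the estimate below; the added
   1 makes \<open>K\<close> positive and the final inequality strict.\<close>
 define K where "K = C * (2 * M + (A f + 1)) + 1"
 have K: "K > 0" using C M A(1)[of f] by (simp add: K_def add_nonneg_pos)
 define eta where "eta = e / K"
 have eta: "eta > 0" using e K by (simp add: eta_def)
 obtain n1 where n1: "\<forall>m\<ge>n1. \<forall>n\<ge>n1. d (s m) (s n) powr r < eta" using Y.Cauchy_D[OF s eta] by blast
 obtain n2 :: nat where n2': "inverse (real (Suc n2)) < eta" using reals_Archimedean[OF eta] by blast
 have n2: "1 / real (Suc n) <= eta" if "n >= n2" for n
 proof -
  have "inverse (real (Suc n)) <= inverse (real (Suc n2))" using that by (intro le_imp_inverse_le) auto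
  then show ?thesis using n2' by (simp add: inverse_eq_divide)
 qed
 show "\<exists>n0. \<forall>m\<ge>n0. \<forall>n\<ge>n0. d (act f s m) (act f s n) powr r < e"
 proof (intro exI[of _ "max n1 n2"] allI impI)
  fix m n assume mn: "m >= max n1 n2" "n >= max n1 n2"
  have "d (act f s m) (act f s n) powr r <= C * ((dX f f powr r + (1 / real (Suc m) + 1 / real (Suc n))) * M + (A f + 1) * d (s m) (s n) powr r)"
   by (rule act_bound[OF f f s s M(2)])
  also have "... <= C * ((0 + (eta + eta)) * M + (A f + 1) * eta)"
   using n1 mn M(1) A(1)[of f] X.d_refl[OF f] less_imp_le[OF eta]
   by (intro mult_left_mono[OF _ C] add_mono mult_mono n2) (auto simp: less_imp_le)
  also have "... = eta * (K - 1)" by (simp add: K_def algebra_simps)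
  also have "... < eta * K" using eta by simp
  also have "eta * K = e" using K by (simp add: eta_def)
  finally show "d (act f s m) (act f s n) powr r < e" .
 qed
qed

definition ext :: "'a \<times> (nat => 'b) set => (nat => 'b) set" where
 "ext = (%(f, c). Y.cls (act f (SOME s. s \<in> c)))"

lemma ext_rep:
 assumes "c \<in> completion Y d"
 obtains s where "s \<in> Cauchy_in Y d" "c = Y.cls s" "!!f. ext (f, c) = Y.cls (act f s)"
proof -
 obtain t where t: "t \<in> Cauchy_in Y d" "c = Y.cls t" using assms unfolding Y.completion_eq by blast
 define s where "s = (SOME s. s \<in> c)"
 have r: "(t, s) \<in> null_rel Y d" unfolding s_def t(2) by (rule Y.some_cls[OF t(1)])
 then have s: "s \<in> Cauchy_in Y d" by (simp add: Y.null_rel_iff)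
 moreover have "c = Y.cls s" unfolding t(2) Y.cls_eq_iff[OF t(1) s] using r by (simp add: Y.null_rel_iff)
 moreover have "ext (f, c) = Y.cls (act f s)" for f by (simp add: ext_def s_def)
 ultimately show thesis by (rule that)
qed

text \<open>The estimate \<open>act_bound\<close> holds along representatives and passes to the
  limit; near \<open>f\<close> the size \<open>A f'\<close> exceeds \<open>A f\<close> by at most
  1.\<close>

lemma ext_continuous:
 "continuous_map (prod_topology (distance_topology X {dX}) (distance_topology (completion Y d) {Y.E})) (distance_topology (completion Y d) {Y.E}) ext"
 unfolding continuous_map_dist_prod[OF X.qdist_axioms YC.qdist_axioms YC.qdist_axioms]
proof (intro ballI conjI allI impI)
 fix f c assume f: "f \<in> X" and c: "c \<in> completion Y d"
 obtain s where s: "s \<in> Cauchy_in Y d" "c = Y.cls s" "!!f. ext (f, c) = Y.cls (act f s)" by (rule ext_rep[OF c]) (rule that)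
 show "ext (f, c) \<in> completion Y d" unfolding s(3) by (intro Y.cls_in_completion act_Cauchy f s)
 fix e :: real assume e: "e > 0"
 obtain M where M: "M >= 0" "!!n. Q (s n) <= M" using Q_bounded[OF s(1)] by blast
 define K where "K = C * (M + (A f + 2)) + 1"
 have K: "K > 0" using C M A(1)[of f] by (simp add: K_def add_nonneg_pos)
 \<comment> \<open>Capped at 1 to ensure \<open>A f' + 1 <= A f + 2\<close>.\<close>
 define eta where "eta = min 1 (e powr r / K)"
 have eta: "eta > 0" "eta <= 1" "eta * K <= e powr r" using e K by (auto simp: eta_def min_def field_simps)
 have delta: "eta powr (1 / r) > 0" using eta by simp
 have pw: "x powr r <= eta" if "0 <= x" "x < eta powr (1 / r)" for x
 proof -
  have "x powr r <= (eta powr (1 / r)) powr r" using that X.r0 by (intro powr_mono2) auto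
  then show ?thesis using eta X.r0 by (simp add: powr_powr)
 qed
 show "\<exists>delta>0. \<forall>f'\<in>X. \<forall>c'\<in>completion Y d. dX f f' < delta --> Y.E c c' < delta --> Y.E (ext (f, c)) (ext (f', c')) < e"
 proof (intro exI[of _ "eta powr (1 / r)"] conjI delta ballI impI)
  fix f' c' assume f': "f' \<in> X" and c': "c' \<in> completion Y d" and df: "dX f f' < eta powr (1 / r)" and dc: "Y.E c c' < eta powr (1 / r)"
  obtain t where t: "t \<in> Cauchy_in Y d" "c' = Y.cls t" "!!f. ext (f, c') = Y.cls (act f t)" by (rule ext_rep[OF c']) (rule that)
  have df': "dX f f' powr r <= eta" by (rule pw[OF X.d_nonneg[OF f f'] df])
  have dc': "Y.E c c' powr r <= eta" by (rule pw[OF YC.d_nonneg[OF c c'] dc])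
  have l1: "(%n. d (act f s n) (act f' t n) powr r) \<longlonglongrightarrow> Y.E (ext (f, c)) (ext (f', c')) powr r"
   unfolding s(3) t(3) by (intro Y.E_tendsto_D act_Cauchy f f' s t)
  have l2: "(%n. C * ((dX f f' powr r + (1 / real (Suc n) + 1 / real (Suc n))) * M + (A f' + 1) * d (s n) (t n) powr r))
   \<longlonglongrightarrow> C * ((dX f f' powr r + (0 + 0)) * M + (A f' + 1) * Y.E c c' powr r)"
   unfolding s(2) t(2) by (intro tendsto_intros Y.E_tendsto_D s(1) t(1) LIMSEQ_Suc[OF lim_1_over_n])
  have "Y.E (ext (f, c)) (ext (f', c')) powr r <= C * ((dX f f' powr r + (0 + 0)) * M + (A f' + 1) * Y.E c c' powr r)"
   by (rule LIMSEQ_le[OF l1 l2]) (use act_bound[OF f f' s(1) t(1) M(2)] in blast)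
  also have "... <= C * (eta * M + (A f + 2) * eta)"
  proof (intro mult_left_mono[OF _ C] add_mono)
   have "A f' + 1 <= A f + 2" using A(2)[OF f' f] df' eta(2) by linarith
   then show "(A f' + 1) * Y.E c c' powr r <= (A f + 2) * eta" using dc' A(1)[of f] by (intro mult_mono) auto
   show "(dX f f' powr r + (0 + 0)) * M <= eta * M" using df' M(1) by (intro mult_right_mono) auto
  qed
  also have "... = eta * (K - 1)" by (simp add: K_def algebra_simps)
  also have "... < eta * K" using eta by simp
  also have "... <= e powr r" by (rule eta)
  finally show "Y.E (ext (f, c)) (ext (f', c')) < e" using less_imp_le[OF e] by (rule powr_less_cancel_left[OF _ X.r0])
 qed
qed

text \<open>The representative chosen for an embedded point need not be the constant sequence, so
  the equality of classes requires a limit.\<close>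

lemma ext_embed:
 assumes p: "p \<in> P" and x: "x \<in> Y"
 shows "ext (p, completion_embed Y d x) = completion_embed Y d (b p x)"
proof -
 have pX: "p \<in> X" using p P by blast
 have xC: "(%_. x) \<in> Cauchy_in Y d" and bC: "(%_. b p x) \<in> Cauchy_in Y d" by (intro Y.const_Cauchy x b p)+
 have "Y.cls (%_. x) \<in> completion Y d" by (rule Y.cls_in_completion[OF xC])
 then obtain s where s: "s \<in> Cauchy_in Y d" "Y.cls (%_. x) = Y.cls s"
   "!!f. ext (f, Y.cls (%_. x)) = Y.cls (act f s)" by (rule ext_rep) (rule that)
 have sx: "(%n. d (s n) x powr r) \<longlonglongrightarrow> 0" using s(2)[symmetric] Y.cls_eq_iff[OF s(1) xC] by simp
 obtain M where M: "M >= 0" "!!n. Q (s n) <= M" using Q_bounded[OF s(1)] by blast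
 have "d (act p s n) (b p x) powr r <= C * (1 / real (Suc n) * M + A p * d (s n) x powr r)" for n
 proof -
  have "d (act p s n) (b p x) powr r <= C * (dX (appr p n) p powr r * Q (s n) + A p * d (s n) x powr r)"
   unfolding act_def by (intro bound appr pX p x Y.Cauchy_in_S s)
  also have "... <= C * (1 / real (Suc n) * M + A p * d (s n) x powr r)"
   using appr(2)[OF pX, of n] X.D_sym[OF pX appr_X[OF pX], of n]
   by (intro mult_left_mono[OF _ C] add_mono mult_mono M order_refl) (auto simp: Q A M)
  finally show ?thesis .
 qed
 moreover have "(%n. C * (1 / real (Suc n) * M + A p * d (s n) x powr r)) \<longlonglongrightarrow> C * (0 * M + A p * 0)"
  by (intro tendsto_intros sx LIMSEQ_Suc[OF lim_1_over_n])
 ultimately have "(%n. d (act p s n) (b p x) powr r) \<longlonglongrightarrow> 0"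
  by (intro tendsto_zero_le[of "%n. d (act p s n) (b p x) powr r" "%n. C * (1 / real (Suc n) * M + A p * d (s n) x powr r)"]) auto
 then have "Y.cls (act p s) = Y.cls (%_. b p x)" using Y.cls_eq_iff[OF act_Cauchy[OF pX s(1)] bC] by simp
 then show ?thesis unfolding Y.embed_eq s(3) .
qed

text \<open>Continuity determines an extension on limits: this is all that is used of the chosen extension.\<close>

lemma extension_limit:
 assumes cont: "continuous_map (prod_topology (distance_topology X {dX}) (distance_topology (completion Y d) {Y.E})) (distance_topology (completion Y d) {Y.E}) c"
  and ext: "!!p x. p \<in> P ==> x \<in> Y ==> c (p, completion_embed Y d x) = completion_embed Y d (b p x)"
  and f: "f \<in> X" "!!n. p n \<in> P" "(%n. dX f (p n)) \<longlonglongrightarrow> 0"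
  and g: "g \<in> Cauchy_in Y d" and h: "h \<in> Cauchy_in Y d" and lim: "(%n. d (b (p n) (g n)) (h n)) \<longlonglongrightarrow> 0"
 shows "c (f, Y.cls g) = Y.cls h"
proof -
 note iff = continuous_map_dist_prod[OF X.qdist_axioms YC.qdist_axioms YC.qdist_axioms]
 have gc: "Y.cls g \<in> completion Y d" and hc: "Y.cls h \<in> completion Y d" by (intro Y.cls_in_completion g h)+
 note cfg = cont[unfolded iff, THEN bspec, OF f(1), THEN bspec, OF gc]
 have cc: "c (f, Y.cls g) \<in> completion Y d" using cfg by (rule conjunct1)
 have bY: "b (p n) (g n) \<in> Y" for n by (intro b f Y.Cauchy_in_S g)
 let ?e = "%x. Y.cls (%_. x)"
 have eg: "?e (g n) \<in> completion Y d" "?e (h n) \<in> completion Y d" "?e (b (p n) (g n)) \<in> completion Y d" for n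
  by (rule Y.cls_in_completion[OF Y.const_Cauchy] Y.Cauchy_in_S[OF g] Y.Cauchy_in_S[OF h] bY)+
 have l1: "(%n. Y.E (Y.cls g) (?e (g n))) \<longlonglongrightarrow> 0"
  using Y.embed_tendsto[OF g] tendsto_powr_zero_iff[OF YC.d_nonneg[OF eg(1) gc] X.r0] YC.d_sym[OF eg(1) gc] by simp
 have l2: "(%n. Y.E (c (f, Y.cls g)) (?e (b (p n) (g n)))) \<longlonglongrightarrow> 0"
 proof (rule LIMSEQ_I)
  fix e :: real assume e: "e > 0"
  obtain delta where delta: "delta > 0" "\<forall>x'\<in>X. \<forall>y'\<in>completion Y d. dX f x' < delta --> Y.E (Y.cls g) y' < delta --> Y.E (c (f, Y.cls g)) (c (x', y')) < e"
   using cfg[THEN conjunct2, rule_format, OF e] by (elim exE conjE) (rule that)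
  have "eventually (%n. dX f (p n) < delta) sequentially" "eventually (%n. Y.E (Y.cls g) (?e (g n)) < delta) sequentially"
   using order_tendstoD(2)[OF f(3) delta(1)] order_tendstoD(2)[OF l1 delta(1)] by auto
  then have "eventually (%n. Y.E (c (f, Y.cls g)) (?e (b (p n) (g n))) < e) sequentially"
  proof eventually_elim
   case (elim n)
   have "c (p n, ?e (g n)) = ?e (b (p n) (g n))" using ext[OF f(2) Y.Cauchy_in_S[OF g]] by (simp add: Y.embed_eq)
   then show ?case using delta(2) elim f(2) P eg(1) by force
  qed
  then show "\<exists>n0. \<forall>n\<ge>n0. norm (Y.E (c (f, Y.cls g)) (?e (b (p n) (g n))) - 0) < e"
   using YC.d_nonneg[OF cc eg(3)] by (simp add: eventually_sequentially)
 qed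
 \<comment> \<open>A chain from \<open>c (f, Y.cls g)\<close> over the embedded products and the
   embedded \<open>h n\<close> to \<open>Y.cls h\<close>.\<close>
 have "(%n. Y.E (c (f, Y.cls g)) (?e (b (p n) (g n))) powr r + (d (b (p n) (g n)) (h n) powr r + Y.E (?e (h n)) (Y.cls h) powr r)) \<longlonglongrightarrow> 0 + (0 + 0)"
  using l2 lim Y.embed_tendsto[OF h] tendsto_powr_zero_iff[OF YC.d_nonneg[OF cc eg(3)] X.r0]
   tendsto_powr_zero_iff[OF Y.d_nonneg[OF bY Y.Cauchy_in_S[OF h]] X.r0]
  by (intro tendsto_add) auto
 moreover have "Y.E (c (f, Y.cls g)) (Y.cls h) powr r <= Y.E (c (f, Y.cls g)) (?e (b (p n) (g n))) powr r + (d (b (p n) (g n)) (h n) powr r + Y.E (?e (h n)) (Y.cls h) powr r)" for n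
  using YC.d_tri[OF cc eg(3) hc, of n] YC.d_tri[OF eg(3) eg(2) hc, of n n] Y.embed_dist[OF bY Y.Cauchy_in_S[OF h], of n n] by linarith
 ultimately have "Y.E (c (f, Y.cls g)) (Y.cls h) powr r <= 0" by (intro LIMSEQ_le_const[of _ 0]) auto
 then have z: "Y.E (c (f, Y.cls g)) (Y.cls h) = 0" using powr_ge_zero by (metis order_antisym powr_eq_0_iff)
 obtain u where u: "u \<in> Cauchy_in Y d" "c (f, Y.cls g) = Y.cls u" using cc unfolding Y.completion_eq by blast
 show ?thesis using z unfolding u(2) Y.E_zero_iff[OF u(1) h] .
qed

end

section \<open>Convolution on modulation spaces\<close>

lemma conv_assoc:
 fixes f g h :: "'a::euclidean_space => complex"
 assumes f: "f \<in> Sigma1" and g: "g \<in> Sigma1" and h: "h \<in> Sigma1"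
 shows "conv f (conv g h) = conv (conv f g) h"
proof
 fix x
 obtain K where K: "K >= 0" "!!x. norm (g x) <= K" using Sigma1_bounded[OF g] by blast
 define G where "G z = f (x - fst z) * g (fst z - snd z) * h (snd z)" for z :: "'a \<times> 'a"
 have Gi: "integrable lborel G"
 proof (rule lborel_integrable_prod_bound)
  have "continuous_on UNIV G" unfolding G_def
   by (intro continuous_intros continuous_on_compose2[OF Sigma1_continuous[OF f]] continuous_on_compose2[OF Sigma1_continuous[OF g]] continuous_on_compose2[OF Sigma1_continuous[OF h]]) auto
  then show "G \<in> borel_measurable borel" by (rule borel_measurable_continuous_onI)
  have "integrable lborel (%t. norm (f (x + (- 1) *\<^sub>R t)))"
   by (rule integrable_norm, rule lborel_integrable_affine[OF Sigma1_integrable[OF f]]) simp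
  then show "integrable lborel (%y. norm (f (x - y)))" by simp
  show "integrable lborel (%z. K * norm (h z))" by (intro integrable_mult_right integrable_norm Sigma1_integrable h)
  fix y z
  have "norm (G (y, z)) = norm (f (x - y)) * (norm (g (y - z)) * norm (h z))" by (simp add: G_def norm_mult)
  also have "... <= norm (f (x - y)) * (K * norm (h z))" by (intro mult_left_mono mult_right_mono K) auto
  finally show "norm (G (y, z)) <= norm (f (x - y)) * (K * norm (h z))" .
 qed
 have "conv f (conv g h) x = (LINT y|lborel. (LINT z|lborel. G (y, z)))"
  unfolding conv_def G_def fst_conv snd_conv
  by (intro Bochner_Integration.integral_cong refl) (simp add: mult.assoc)
 also have "... = (LINT z|lborel. (LINT y|lborel. G (y, z)))" using lborel_Fubini[OF Gi] by simp
 also have "... = conv (conv f g) h x"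
  unfolding conv_def[of "conv f g"]
 proof (intro Bochner_Integration.integral_cong refl)
  fix z
  let ?h = "%y. f (x - y) * g (y - z) * h z"
  have "?h \<in> borel_measurable borel" using Sigma1_borel[OF g] Sigma1_borel[OF f] by measurable
  from lborel_integral_affine[OF this, of 1 z]
  have "(LINT y|lborel. G (y, z)) = (LINT y|lborel. ?h (z + y))" by (simp add: G_def)
  also have "... = (LINT y|lborel. f (x - z - y) * g y * h z)"
   by (intro Bochner_Integration.integral_cong refl) (simp add: algebra_simps)
  also have "... = conv f g (x - z) * h z" unfolding conv_def by (rule integral_mult_left_zero)
  finally show "(LINT y|lborel. G (y, z)) = conv f g (x - z) * h z" .
 qed
 finally show "conv f (conv g h) x = conv (conv f g) h x" .
qed

lemma conv_integrable_Sigma1: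
 assumes "f \<in> Sigma1" "g \<in> Sigma1" shows "integrable lborel (%y. f (x - y) * g y)"
proof -
 obtain C where "!!x. norm (f x) <= C" using Sigma1_bounded[OF assms(1)] by blast
 from integrable_conv[OF Sigma1_borel[OF assms(1)] this Sigma1_integrable[OF assms(2)]] show ?thesis .
qed

lemma conv_linear:
 assumes "f \<in> Sigma1" "g \<in> Sigma1" "h \<in> Sigma1"
 shows "conv (%x. f x + g x) h x = conv f h x + conv g h x" "conv (%x. f x - g x) h x = conv f h x - conv g h x"
  "conv f (%x. g x + h x) x = conv f g x + conv f h x" "conv f (%x. g x - h x) x = conv f g x - conv f h x"
  "conv (%x. c * f x) g x = c * conv f g x" "conv f (%x. c * g x) x = c * conv f g x"
 using conv_integrable_Sigma1[OF assms(1,2), of x] conv_integrable_Sigma1[OF assms(1,3), of x] conv_integrable_Sigma1[OF assms(2,3), of x]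
 by (simp_all add: conv_def distrib_left distrib_right left_diff_distrib right_diff_distrib mult.assoc mult.left_commute[of _ c])

lemma stft_linear:
 assumes "phi \<in> Sigma1" "f \<in> Sigma1" "g \<in> Sigma1"
 shows "stft phi (%x. f x + g x) X = stft phi f X + stft phi g X" "stft phi (%x. f x - g x) X = stft phi f X - stft phi g X"
  "stft phi (%x. c * f x) X = c * stft phi f X"
 using stft_integrable[OF Sigma1_integrable[OF assms(2)] assms(1)] stft_integrable[OF Sigma1_integrable[OF assms(3)] assms(1)]
 by (simp_all add: stft_def distrib_right left_diff_distrib mult.assoc)

context modulation begin

text \<open>Subadditive, in contrast to \<open>q\<close>, and therefore the quantity in which all
  estimates of the factorization are made.\<close>

definition qr :: "('a => complex) => real" where
 "qr g = q g powr r"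

lemma qr_nonneg: "0 <= qr g"
 by (simp add: qr_def)

lemma q_nonneg: "g \<in> Sigma1 ==> 0 <= q g"
 unfolding q_def by (intro N_nonneg stft_in_B)

lemma q_cmult: "g \<in> Sigma1 ==> q (%x. c * g x) = norm c * q g"
 unfolding q_def using N_cmult[OF stft_in_B, of g c] by (simp add: stft_linear(3)[OF phi] mult.assoc)

lemma qr_cmult: "g \<in> Sigma1 ==> qr (%x. c * g x) = norm c powr r * qr g"
 unfolding qr_def by (simp add: q_cmult powr_mult)

lemma qr_scale: "g \<in> Sigma1 ==> 0 <= a ==> qr (%x. of_real a * g x) = a powr r * qr g"
 using qr_cmult[of g "of_real a"] by (simp add: norm_of_real)

lemma qr_add: "f \<in> Sigma1 ==> g \<in> Sigma1 ==> qr (%x. f x + g x) <= qr f + qr g"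
 unfolding qr_def q_def using N_triangle[OF stft_in_B stft_in_B, of f g] by (simp add: stft_linear(1)[OF phi] distrib_right)

lemma q_commute: "f \<in> Sigma1 ==> g \<in> Sigma1 ==> q (%x. f x - g x) = q (%x. g x - f x)"
 unfolding q_def using N_minus_commute[OF stft_in_B stft_in_B, of f g] by (simp add: stft_linear(2)[OF phi] left_diff_distrib)

lemma qr_commute: "f \<in> Sigma1 ==> g \<in> Sigma1 ==> qr (%x. f x - g x) = qr (%x. g x - f x)"
 using q_commute[of f g] by (simp add: qr_def)

lemma qr_diff: "f \<in> Sigma1 ==> g \<in> Sigma1 ==> qr (%x. f x - g x) <= qr f + qr g"
 using qr_add[OF _ Sigma1_cmult[of g "-1"], of f] qr_cmult[of g "-1"] by simp

lemma qr_triangle: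
 "f \<in> Sigma1 ==> g \<in> Sigma1 ==> h \<in> Sigma1 ==> qr (%x. f x - h x) <= qr (%x. f x - g x) + qr (%x. g x - h x)"
 using qr_add[OF Sigma1_diff Sigma1_diff, of f g g h] by simp

lemma Sigma1_0: "(%x. 0) \<in> (Sigma1 :: ('a => complex) set)"
 using Sigma1_cmult[OF phi, of 0] by simp

lemma q_zero: "q (%x. 0) = 0"
 using q_cmult[OF phi, of 0] by simp

lemma qr_zero: "qr (%x. 0) = 0"
 by (simp add: qr_def q_zero)

text \<open>Continuity of translations is not among the axioms of \<open>B\<close>, so convergence
  is obtained from a majorant. The transform of the difference is of order \<open>s\<close>, and it
  also decays at rate \<open>2 * kappa'\<close> uniformly in \<open>s\<close>; the geometric mean is
  \<open>sqrt s\<close> times an exponential whose product with \<open>omega\<close> lies in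
  \<open>B\<close>.\<close>

lemma q_moll_approx:
 assumes f: "f \<in> Sigma1" and e: "e > 0"
 shows "\<exists>s0>0. \<forall>s. 0 < s --> s < s0 --> qr (%x. conv (moll s) f x - f x) < e"
proof -
 obtain kappa' where kappa': "kappa' > 0" "(%X. complex_of_real (decay kappa' X * omega X)) \<in> B" using exp_weight_in_B[OF omega_P_E] by blast
 have k2: "2 * kappa' > 0" using kappa' by simp
 obtain C0 where C0: "C0 >= 0" "!!X. norm (stft phi f X) <= C0 * decay (2 * kappa') X" using stft_exp_decay[OF f phi k2] by blast
 obtain C1 where C1: "C1 >= 0" "!!s x. 0 < s ==> s <= 1 ==> norm (conv (moll s) f x - f x) <= C1 * s * decay 1 x"
  using conv_moll_Sigma1_diff[OF f zero_less_one] by blast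
 obtain C2 where C2: "C2 >= 0" "!!x. norm (phi x) <= C2" using Sigma1_bounded[OF phi] by blast
 define J where "J = (LINT x|lborel. decay 1 (x::'a))"
 define gamma where "gamma = gauss_moment TYPE('a) (2 * kappa')"
 have J0: "J >= 0" unfolding J_def by (intro integral_nonneg_AE AE_I2) auto
 have g0: "gamma >= 0" unfolding gamma_def by (rule gauss_moment_nonneg)
 let ?h = "%s x. conv (moll s) f x - f x"
 define D where "D = sqrt (C2 * C1 * J) * sqrt (C0 * gamma + C0)"
 have hS: "?h s \<in> Sigma1" "conv (moll s) f \<in> Sigma1" if "s > 0" for s
  using that by (auto intro: Sigma1_diff Sigma1_conv_Sigma1 mollifier_Sigma1 f)
 have pt: "norm (stft phi (?h s) X) <= D * sqrt s * decay kappa' X" if s: "0 < s" "s <= 1" for s X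
 proof -
  obtain x xi where X: "X = (x, xi)" by (cases X)
  have "(LINT t|lborel. norm (?h s t)) <= (LINT t|lborel. C1 * s * decay 1 (t::'a))"
   by (intro integral_mono integrable_norm Sigma1_integrable hS s C1 integrable_mult_right integrable_exp_norm) simp
  also have "... = C1 * s * J" unfolding J_def by (rule integral_mult_right_zero)
  finally have "C2 * (LINT t|lborel. norm (?h s t)) <= C2 * (C1 * s * J)" using C2(1) by (rule mult_left_mono)
  with stft_bound[OF Sigma1_integrable[OF hS(1)[OF s(1)]] phi C2(2), of X]
  have b1: "norm (stft phi (?h s) X) <= (C2 * C1 * J) * s" by (simp add: mult_ac)
  \<comment> \<open>The second bound: the convolution shifts the position only, and the exponential
    moments of the mollifiers are bounded for \<open>s <= 1\<close>.\<close>
  have "norm (stft phi (conv (moll s) f) X) <= (LINT y|lborel. norm (moll s y) * norm (stft phi f (x - y, xi)))"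
   unfolding X by (rule stft_conv_bound[OF mollifier_Sigma1[OF s(1)] f phi])
  also have "... <= (LINT y|lborel. (C0 * decay (2 * kappa') X) * (mollifier s (y::'a) * exp (2 * kappa' * norm y)))"
  proof (rule integral_mono[OF stft_conv_integrable[OF mollifier_Sigma1[OF s(1)] f phi]])
   show "integrable lborel (%y. (C0 * decay (2 * kappa') X) * (mollifier s (y::'a) * exp (2 * kappa' * norm y)))"
    by (intro integrable_mult_right mollifier_exp_integrable s)
   fix y :: 'a
   have "X - (y, 0) = (x - y, xi)" by (simp add: X)
   then have "decay (2 * kappa') (x - y, xi) <= exp (2 * kappa' * norm y) * decay (2 * kappa') X"
    using exp_conv_bound[of "2 * kappa'" X "(y, 0)"] k2 by (simp add: norm_Pair)
   then have "C0 * decay (2 * kappa') (x - y, xi) <= C0 * (exp (2 * kappa' * norm y) * decay (2 * kappa') X)"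
    using C0(1) by (intro mult_left_mono) auto
   with C0(2)[of "(x - y, xi)"] have "norm (stft phi f (x - y, xi)) <= C0 * (exp (2 * kappa' * norm y) * decay (2 * kappa') X)" by linarith
   then have "mollifier s y * norm (stft phi f (x - y, xi)) <= mollifier s y * (C0 * (exp (2 * kappa' * norm y) * decay (2 * kappa') X))"
    using mollifier_nonneg[OF s(1)] by (rule mult_left_mono)
   then show "norm (moll s y) * norm (stft phi f (x - y, xi)) <= (C0 * decay (2 * kappa') X) * (mollifier s y * exp (2 * kappa' * norm y))"
    using mollifier_nonneg[OF s(1), of y] by (simp add: mult_ac)
  qed
  also have "... = (C0 * decay (2 * kappa') X) * (LINT y|lborel. mollifier s (y::'a) * exp (2 * kappa' * norm y))" by (rule integral_mult_right_zero)
  also have "... <= (C0 * decay (2 * kappa') X) * gamma"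
   unfolding gamma_def using C0(1) k2 by (intro mult_left_mono mollifier_exp_moment s) auto
  finally have "norm (stft phi (conv (moll s) f) X) <= C0 * decay (2 * kappa') X * gamma" .
  moreover have "stft phi (?h s) X = stft phi (conv (moll s) f) X - stft phi f X" by (rule stft_linear(2)[OF phi hS(2)[OF s(1)] f])
  moreover have "norm (stft phi (?h s) X) <= norm (stft phi (conv (moll s) f) X) + norm (stft phi f X)"
   unfolding calculation(2) by (rule norm_triangle_ineq4)
  ultimately have "norm (stft phi (?h s) X) <= C0 * decay (2 * kappa') X * gamma + C0 * decay (2 * kappa') X"
   using C0(2)[of X] by linarith
  also have "... = (C0 * gamma + C0) * exp (2 * (- kappa' * norm X))" by (simp add: algebra_simps)
  finally have b2: "norm (stft phi (?h s) X) <= (C0 * gamma + C0) * exp (2 * (- kappa' * norm X))" .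
  have "norm (stft phi (?h s) X) <= sqrt ((C2 * C1 * J) * s) * sqrt ((C0 * gamma + C0) * exp (2 * (- kappa' * norm X)))"
   by (rule sqrt_bound_of_two_bounds[OF norm_ge_zero b1 b2])
  also have "... = D * sqrt s * decay kappa' X" unfolding D_def real_sqrt_mult[of _ s] real_sqrt_mult[of _ "exp _"] sqrt_exp by (simp only: mult_ac)
  finally show ?thesis .
 qed
 have D0: "D >= 0" using C0(1) C1(1) C2(1) J0 g0 by (simp add: D_def)
 let ?w = "%X. complex_of_real (decay kappa' X * omega X)"
 have qb: "qr (?h s) <= (K * (D * sqrt s * N ?w)) powr r" if s: "0 < s" "s <= 1" for s
 proof -
  have "q (?h s) <= K * N (%X. of_real (D * sqrt s) * ?w X)"
   unfolding q_def
  proof (rule K(5)[OF B_meas[OF stft_in_B[OF hS(1)[OF s(1)]]] B_cmult[OF kappa'(2)]], rule AE_I2)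
   fix X
   have "norm (stft phi (?h s) X) * omega X <= (D * sqrt s * decay kappa' X) * omega X"
    using pt[OF s] omega_pos[of X] by (intro mult_right_mono) auto
   then show "norm (stft phi (?h s) X * of_real (omega X)) <= norm (of_real (D * sqrt s) * ?w X)"
    using omega_pos[of X] D0 s by (simp add: norm_mult abs_mult mult.assoc)
  qed
  also have "N (%X. of_real (D * sqrt s) * ?w X) = D * sqrt s * N ?w"
   unfolding N_cmult[OF kappa'(2)] using D0 s by (simp add: norm_mult)
  finally show ?thesis unfolding qr_def using q_nonneg[OF hS(1)[OF s(1)]] r_pos by (intro powr_mono2) auto
 qed
 have "((%s. (K * (D * sqrt s * N ?w)) powr r) \<longlongrightarrow> (K * (D * sqrt 0 * N ?w)) powr r) (at_right 0)"
  using K(1) D0 N_nonneg[OF kappa'(2)] r_pos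
  by (intro tendsto_powr2 tendsto_mult tendsto_const tendsto_real_sqrt tendsto_ident_at eventually_at_rightI[of 0 1]) auto
 then have "((%s. (K * (D * sqrt s * N ?w)) powr r) \<longlongrightarrow> 0) (at_right 0)" using r_pos by simp
 then have "eventually (%s. (K * (D * sqrt s * N ?w)) powr r < e) (at_right 0)" by (rule order_tendstoD) (rule e)
 then obtain b where b: "b > 0" "!!s. 0 < s ==> s < b ==> (K * (D * sqrt s * N ?w)) powr r < e"
  unfolding eventually_at_right_field by auto
 show ?thesis
 proof (intro exI[of _ "min b 1"] conjI allI impI)
  fix s :: real assume s: "0 < s" "s < min b 1"
  then show "qr (?h s) < e" using qb[of s] b(2)[of s] by linarith
 qed (use b in simp)
qed

end

text \<open>The identity \<open>v_eq\<close> matches the weight of the amalgam space with the cost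
  of a translation by \<open>(x, 0)\<close> in the weighted quasi-norm.\<close>

locale conv_module = amalgam r v A kappa + modulation B N v0 r omega phi
 for r :: real and v :: "real^'d => real" and A kappa :: real
  and B :: "((real^'d) \<times> (real^'d) => complex) set" and N :: "((real^'d) \<times> (real^'d) => complex) => real"
  and v0 omega :: "(real^'d) \<times> (real^'d) => real" and phi :: "real^'d => complex" +
 fixes v1 :: "(real^'d) \<times> (real^'d) => real" and C1 :: real
 assumes C1: "C1 > 0" and omega_moderate: "!!X Y. omega (X + Y) <= C1 * omega X * v1 Y"
  and v_eq: "!!x. v x = v1 (x, 0) * v0 (x, 0)"
begin

text \<open>The part of the convolution integral over the cube at \<open>k\<close> sees
  \<open>g\<close> only through its maximal function at \<open>X - (k, 0)\<close>, because points of
  the cube lie within \<open>R\<close> of \<open>k\<close>.\<close>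

lemma stft_conv_le_lattice:
 assumes f: "f \<in> Sigma1" and g: "g \<in> Sigma1"
 shows "(%k. mass f k * loc_max g (X - (k, 0))) summable_on int_lattice"
  "norm (stft phi (conv f g) X) <= infsum (%k. mass f k * loc_max g (X - (k, 0))) int_lattice"
proof -
 obtain x xi where X: "X = (x, xi)" by (cases X)
 obtain C where C: "!!X. norm (stft phi g X) <= C" using stft_bounded[OF g] by blast
 have fm: "f \<in> borel_measurable lebesgue" by (intro measurable_completion) (simp add: Sigma1_borel f)
 have fe: "integrable lebesgue (%x. norm (f x) * exp (1 * norm x))"
 proof -
  have i: "integrable lborel (%x. norm (f x) * exp (1 * norm x))" using Sigma1_exp_integrable[OF f, of 1] by (simp add: mult.commute)
  moreover have "(%x. norm (f x) * exp (1 * norm x)) \<in> borel_measurable lborel" using i by (rule borel_measurable_integrable)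
  ultimately show ?thesis by (simp add: integrable_completion)
 qed
 note me = mass_exp_bound[OF zero_le_one fm fe]
 show sm: "(%k. mass f k * loc_max g (X - (k, 0))) summable_on int_lattice"
 proof (rule summable_on_comparison_test)
  show "(%k. (LINT x|lebesgue. norm (f x) * exp (1 * norm x)) * exp ((1::real) * DIM(real^'d)) * C * decay 1 k) summable_on (int_lattice :: (real^'d) set)"
   by (intro summable_on_cmult_right summable_exp_lattice) simp
  fix k :: "real^'d"
  have "mass f k * loc_max g (X - (k, 0)) <= ((LINT x|lebesgue. norm (f x) * exp (1 * norm x)) * (exp ((1::real) * DIM(real^'d)) * decay 1 k)) * C"
   by (intro mult_mono' me(2) loc_max_le C mass_nonneg loc_max_nonneg g)
  then show "mass f k * loc_max g (X - (k, 0)) <= (LINT x|lebesgue. norm (f x) * exp (1 * norm x)) * exp ((1::real) * DIM(real^'d)) * C * decay 1 k"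
   by (simp only: mult_ac)
  show "0 <= mass f k * loc_max g (X - (k, 0))" by (intro mult_nonneg_nonneg mass_nonneg loc_max_nonneg g)
 qed
 let ?u = "%y. norm (f y) * norm (stft phi g (x - y, xi))"
 have ui: "integrable lborel ?u" by (rule stft_conv_integrable[OF f g phi])
 then have um: "?u \<in> borel_measurable lborel" by (rule borel_measurable_integrable)
 then have uml: "?u \<in> borel_measurable lebesgue" by (rule measurable_completion)
 have cellb: "(\<integral>\<^sup>+y. ennreal (?u y) * indicator (cell k) y \<partial>lebesgue) <= ennreal (mass f k * loc_max g (X - (k, 0)))"
  if k: "k \<in> int_lattice" for k
 proof -
  let ?L = "loc_max g (X - (k, 0))"
  have "(\<integral>\<^sup>+y. ennreal (?u y) * indicator (cell k) y \<partial>lebesgue) <= (\<integral>\<^sup>+y. ennreal ((indicator (cube k) y *\<^sub>R norm (f y)) * ?L) \<partial>lebesgue)"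
  proof (rule nn_integral_mono)
   fix y
   show "ennreal (?u y) * indicator (cell k) y <= ennreal ((indicator (cube k) y *\<^sub>R norm (f y)) * ?L)"
   proof (cases "y \<in> cell k")
    case True
    then have y: "y \<in> cube k" using cell_subset_cbox unfolding cube_eq by blast
    have "norm (y - k) <= DIM(real^'d)" using y unfolding cube_eq by (rule norm_diff_cell)
    then have "norm ((x - y, xi) - (X - (k, 0))) < R" by (simp add: X R_def norm_Pair norm_minus_commute)
    from loc_max_ge[OF g this] have "?u y <= norm (f y) * ?L" by (intro mult_left_mono) auto
    then show ?thesis using True y by (simp add: ennreal_leI)
   qed simp
  qed
  also have "... = ennreal (LINT y|lebesgue. (indicator (cube k) y *\<^sub>R norm (f y)) * ?L)"
  proof (rule nn_integral_eq_integral)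
   show "integrable lebesgue (%y. (indicator (cube k) y *\<^sub>R norm (f y)) * ?L)"
    using set_integrable_norm[OF me(1)[of k]] unfolding set_integrable_def by (rule integrable_mult_left)
   show "AE y in lebesgue. 0 <= (indicator (cube k) y *\<^sub>R norm (f y)) * ?L"
    using loc_max_nonneg[OF g] by (intro AE_I2) simp
  qed
  also have "(LINT y|lebesgue. (indicator (cube k) y *\<^sub>R norm (f y)) * ?L) = mass f k * ?L"
   unfolding mass_def set_lebesgue_integral_def by (rule integral_mult_left_zero)
  finally show ?thesis .
 qed
 have "norm (stft phi (conv f g) X) <= integral\<^sup>L lborel ?u" unfolding X by (rule stft_conv_bound[OF f g phi])
 also have "... = integral\<^sup>L lebesgue ?u" by (rule integral_completion[OF um, symmetric])
 also have "... <= infsum (%k. mass f k * loc_max g (X - (k, 0))) int_lattice"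
  by (rule integral_le_sum_cells(2)[OF uml _ cellb _ sm]) (auto intro!: mult_nonneg_nonneg mass_nonneg loc_max_nonneg g)
 finally show "norm (stft phi (conv f g) X) <= infsum (%k. mass f k * loc_max g (X - (k, 0))) int_lattice" .
qed

text \<open>Translating the maximal function by \<open>(k, 0)\<close> costs
  \<open>v1 (k, 0) * v0 (k, 0) = v k\<close>, so the r-th powers of the summands add up to a
  multiple of \<open>wl f\<close>; \<open>wiener_estimate\<close> then removes the maximal
  function.\<close>

lemma conv_estimate: "\<exists>C\<ge>0. \<forall>f\<in>Sigma1. \<forall>g\<in>Sigma1. qr (conv f g) <= C * (wl f * qr g)"
proof -
 obtain Cw where Cw: "Cw >= 0" "!!g. g \<in> Sigma1 ==> N (%X. of_real (loc_max g X) * of_real (omega X)) powr r <= Cw * q g powr r"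
  using wiener_estimate by blast
 have "qr (conv f g) <= ((K powr r)\<^sup>2 * (K\<^sup>2 * C1) powr r * Cw) * (wl f * qr g)" if f: "f \<in> Sigma1" and g: "g \<in> Sigma1" for f g
 proof -
  let ?NL = "N (%X. of_real (loc_max g X) * of_real (omega X))"
  let ?L = "%k X. complex_of_real (loc_max g (X - (k, 0))) * of_real (omega X)"
  let ?G = "%k X. of_real (mass f k) * ?L k X"
  have tr: "?L k \<in> B" "N (?L k) <= K\<^sup>2 * (C1 * v1 (k, 0)) * v0 (k, 0) * ?NL" for k
  proof -
   have c: "omega X <= (C1 * v1 (k, 0)) * omega (X - (k, 0))" for X using omega_moderate[of "X - (k, 0)" "(k, 0)"] by (simp add: mult_ac)
   have m: "(%X. complex_of_real (loc_max g X)) \<in> borel_measurable borel" using loc_max_borel[OF g] by measurable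
   show "?L k \<in> B" "N (?L k) <= K\<^sup>2 * (C1 * v1 (k, 0)) * v0 (k, 0) * ?NL"
    using weighted_translate[OF omega_meas omega_pos c m loc_max_in_B[OF g]] by auto
  qed
  have GB: "?G k \<in> B" for k by (intro B_cmult tr)
  have NG: "N (?G k) powr r <= ((K\<^sup>2 * C1) powr r * ?NL powr r) * WL_term r v f k" for k
  proof -
   have "N (?G k) = mass f k * N (?L k)" using N_cmult[OF tr(1), of "of_real (mass f k)"] mass_nonneg[of f k] by simp
   also have "... <= mass f k * (K\<^sup>2 * (C1 * v1 (k, 0)) * v0 (k, 0) * ?NL)" by (intro mult_left_mono tr mass_nonneg)
   also have "... = (K\<^sup>2 * C1) * ?NL * (mass f k * v k)" by (simp only: v_eq mult_ac)
   finally have "N (?G k) powr r <= ((K\<^sup>2 * C1) * ?NL * (mass f k * v k)) powr r" using r N_nonneg[OF GB] by (intro powr_mono2) auto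
   then show ?thesis by (simp only: WL_term_eq powr_mult)
  qed
  have ts: "WL_term r v f summable_on int_lattice" using Sigma1_WL[OF f] by (simp add: WL_def lattice_eq[symmetric])
  have s1: "(%k. ((K\<^sup>2 * C1) powr r * ?NL powr r) * WL_term r v f k) summable_on int_lattice" by (rule summable_on_cmult_right[OF ts])
  have s2: "(%k. N (?G k) powr r) summable_on int_lattice" by (rule summable_on_comparison_test[OF s1 NG]) simp
  have nG: "norm (?G k X) = (mass f k * loc_max g (X - (k, 0))) * omega X" for k X
   using mass_nonneg[of f k] loc_max_nonneg[OF g] omega_pos[of X] by (simp add: norm_mult)
  have H: "(%X. stft phi (conv f g) X * of_real (omega X)) \<in> borel_measurable lebesgue" by (intro B_meas stft_in_B Sigma1_conv_Sigma1 f g)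
  have s3: "(%k. norm (?G k X)) summable_on int_lattice" for X
   unfolding nG by (intro summable_on_cmult_left stft_conv_le_lattice f g)
  have le: "norm (stft phi (conv f g) X * of_real (omega X)) <= infsum (%k. norm (?G k X)) int_lattice" for X
  proof -
   have "norm (stft phi (conv f g) X * of_real (omega X)) = norm (stft phi (conv f g) X) * omega X" using omega_pos[of X] by (simp add: norm_mult)
   also have "... <= infsum (%k. mass f k * loc_max g (X - (k, 0))) int_lattice * omega X"
    using omega_pos[of X] by (intro mult_right_mono stft_conv_le_lattice f g) auto
   also have "... = infsum (%k. norm (?G k X)) int_lattice" unfolding nG by (rule infsum_cmult_left[OF stft_conv_le_lattice(1)[OF f g], symmetric])
   finally show ?thesis .
  qed
  have "qr (conv f g) <= (K powr r)\<^sup>2 * infsum (%k. N (?G k) powr r) int_lattice"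
   unfolding qr_def q_def by (rule N_infsum(2)[OF countable_int_lattice infinite_int_lattice GB s2 H s3 le])
  also have "... <= (K powr r)\<^sup>2 * infsum (%k. ((K\<^sup>2 * C1) powr r * ?NL powr r) * WL_term r v f k) int_lattice"
   by (intro mult_left_mono infsum_mono s1 s2 NG) simp
  also have "infsum (%k. ((K\<^sup>2 * C1) powr r * ?NL powr r) * WL_term r v f k) int_lattice = ((K\<^sup>2 * C1) powr r * ?NL powr r) * wl f"
   unfolding wl_def lattice_eq by (rule infsum_cmult_right[OF ts])
  also have "(K powr r)\<^sup>2 * (((K\<^sup>2 * C1) powr r * ?NL powr r) * wl f) <= (K powr r)\<^sup>2 * (((K\<^sup>2 * C1) powr r * (Cw * qr g)) * wl f)"
   unfolding qr_def by (intro mult_left_mono mult_right_mono Cw g wl_nonneg) auto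
  finally show ?thesis by (simp only: mult_ac)
 qed
 moreover have "0 <= (K powr r)\<^sup>2 * (K\<^sup>2 * C1) powr r * Cw" using Cw(1) by simp
 ultimately show ?thesis by blast
qed

definition Cc :: real where
 "Cc = (SOME C. C >= 0 \<and> (\<forall>f\<in>Sigma1. \<forall>g\<in>Sigma1. qr (conv f g) <= C * (wl f * qr g)))"

lemma Cc: "Cc >= 0" "!!f g. f \<in> Sigma1 ==> g \<in> Sigma1 ==> qr (conv f g) <= Cc * (wl f * qr g)"
 using someI_ex[OF conv_estimate] unfolding Cc_def[symmetric] by auto

text \<open>The normalizing factor in \<open>STFT\<close>, by which \<open>mod_dist\<close> differs
  from \<open>q\<close>.\<close>

definition c0 :: real where
 "c0 = (2 * pi) powr (- (real CARD('d) / 2))"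

lemma c0_pos: "c0 > 0"
 by (simp add: c0_def)

lemma mod_dist_eq:
 assumes f: "f \<in> Sigma1" and g: "g \<in> Sigma1" shows "mod_dist phi omega N f g = c0 * q (%x. f x - g x)"
proof -
 have "mod_dist phi omega N f g = N (%X. of_real c0 * (stft phi (%x. f x - g x) X * of_real (omega X)))"
  unfolding mod_dist_def mod_norm_def STFT_distr[OF phi] c0_def by (simp only: mult.assoc)
 also have "... = c0 * q (%x. f x - g x)"
  using N_cmult[OF stft_in_B[OF Sigma1_diff[OF f g]], of "of_real c0"] c0_pos by (simp add: q_def)
 finally show ?thesis .
qed

lemma mod_dist_powr:
 "f \<in> Sigma1 ==> g \<in> Sigma1 ==> mod_dist phi omega N f g powr r = c0 powr r * qr (%x. f x - g x)"
 by (simp add: mod_dist_eq qr_def powr_mult)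

lemma WL_norm_eq: "WL_norm r v f = wl f powr (1 / r)"
 by (simp add: WL_norm_def wl_def)

sublocale act: bounded_action "WL r v" "%f g. WL_norm r v (%x. f x - g x)" Sigma1 "mod_dist phi omega N" r
 Sigma1 conv wl "%x. c0 powr r * qr x" Cc
proof unfold_locales
 show "0 < r" by (rule r(1))
 show "0 <= WL_norm r v (%x. f x - g x)" for f g by (simp add: WL_norm_eq)
 show "WL_norm r v (%x. f x - f x) = 0" for f by (simp add: WL_norm_eq wl_zero)
 show "WL_norm r v (%x. f x - g x) = WL_norm r v (%x. g x - f x)" for f g by (simp only: WL_norm_eq wl_commute[of f g])
 show "WL_norm r v (%x. f x - h x) powr r <= WL_norm r v (%x. f x - g x) powr r + WL_norm r v (%x. g x - h x) powr r"
  if "f \<in> WL r v" "g \<in> WL r v" "h \<in> WL r v" for f g h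
  unfolding WL_norm_powr by (rule wl_triangle[OF that])
 show "0 <= mod_dist phi omega N f g" if "f \<in> Sigma1" "g \<in> Sigma1" for f g
  using that c0_pos q_nonneg[OF Sigma1_diff] by (simp add: mod_dist_eq)
 show "mod_dist phi omega N f f = 0" if "f \<in> Sigma1" for f using that by (simp add: mod_dist_eq q_zero)
 show "mod_dist phi omega N f g = mod_dist phi omega N g f" if "f \<in> Sigma1" "g \<in> Sigma1" for f g
  using that q_commute[OF that] by (simp add: mod_dist_eq)
 show "mod_dist phi omega N f h powr r <= mod_dist phi omega N f g powr r + mod_dist phi omega N g h powr r"
  if "f \<in> Sigma1" "g \<in> Sigma1" "h \<in> Sigma1" for f g h
  using mult_left_mono[OF qr_triangle[OF that], of "c0 powr r"] that by (simp add: mod_dist_powr distrib_left)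
 show "Sigma1 \<subseteq> WL r v" using Sigma1_WL by blast
 show "\<exists>p\<in>Sigma1. WL_norm r v (%x. f x - p x) powr r < e" if "f \<in> WL r v" "e > 0" for f e
  unfolding WL_norm_powr by (rule Sigma1_dense_WL[OF that])
 show "conv p x \<in> Sigma1" if "p \<in> Sigma1" "x \<in> Sigma1" for p x :: "real^'d => complex" by (rule Sigma1_conv_Sigma1[OF that])
 show "0 <= wl f" for f by (rule wl_nonneg)
 show "wl f <= wl g + WL_norm r v (%x. g x - f x) powr r" if "f \<in> WL r v" "g \<in> WL r v" for f g
  unfolding WL_norm_powr using WL_diff[OF that(2) conjunct1[OF WL_diff[OF that(2,1)]]] by simp
 show "0 <= c0 powr r * qr x" for x by (simp add: qr_nonneg)
 show "c0 powr r * qr x <= c0 powr r * qr y + mod_dist phi omega N y x powr r" if "x \<in> Sigma1" "y \<in> Sigma1" for x y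
  using mult_left_mono[OF qr_diff[OF that(2) Sigma1_diff[OF that(2,1)]], of "c0 powr r"] that
  by (simp add: mod_dist_powr distrib_left)
 show "Cc >= 0" by (rule Cc)
 fix p p' x x' :: "real^'d => complex" assume S: "p \<in> Sigma1" "p' \<in> Sigma1" "x \<in> Sigma1" "x' \<in> Sigma1"
 \<comment> \<open>One argument changes at a time, which produces the two terms of
   \<open>bound\<close>.\<close>
 have eq: "conv p x t - conv p' x' t = conv (%t. p t - p' t) x t + conv p' (%t. x t - x' t) t" for t
  using S by (simp add: conv_linear)
 have "qr (%t. conv p x t - conv p' x' t) <= qr (conv (%t. p t - p' t) x) + qr (conv p' (%t. x t - x' t))"
  unfolding eq by (intro qr_add Sigma1_conv_Sigma1 Sigma1_diff S)
 also have "... <= Cc * (wl (%t. p t - p' t) * qr x) + Cc * (wl p' * qr (%t. x t - x' t))"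
  by (intro add_mono Cc Sigma1_diff S)
 finally have "c0 powr r * qr (%t. conv p x t - conv p' x' t) <= c0 powr r * (Cc * (wl (%t. p t - p' t) * qr x) + Cc * (wl p' * qr (%t. x t - x' t)))"
  by (rule mult_left_mono) simp
 then show "mod_dist phi omega N (conv p x) (conv p' x') powr r
   <= Cc * (WL_norm r v (%x. p x - p' x) powr r * (c0 powr r * qr x) + wl p' * mod_dist phi omega N x x' powr r)"
  using S by (simp add: mod_dist_powr Sigma1_conv_Sigma1 WL_norm_powr distrib_left mult.left_commute mult.assoc)
qed

section \<open>Factorization\<close>

text \<open>An exact solution of \<open>T z = x\<close> would in general be found only in the
  completion. Here \<open>z\<close> stays a test function, the error is as small as desired, and the
  bound \<open>L\<close> does not depend on the accuracy.\<close>

definition approx_inv :: "((real^'d => complex) => real^'d => complex) => real => bool" where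
 "approx_inv T L \<longleftrightarrow> (\<forall>x\<in>Sigma1. \<forall>delta>0. \<exists>z\<in>Sigma1. qr (%t. T z t - x t) < delta \<and> qr z <= L * qr x)"

text \<open>The Neumann series: each round solves for the current residual and halves it, so the
  costs form a geometric series and \<open>L\<close> doubles.\<close>

lemma approx_inv_half:
 assumes T: "!!x. x \<in> Sigma1 ==> T x \<in> Sigma1" "!!x y. x \<in> Sigma1 ==> y \<in> Sigma1 ==> T (%t. x t + y t) = (%t. T x t + T y t)"
  and L: "L >= 0" and half: "!!x. x \<in> Sigma1 ==> \<exists>z\<in>Sigma1. qr (%t. T z t - x t) <= qr x / 2 \<and> qr z <= L * qr x"
 shows "approx_inv T (2 * L)"
 unfolding approx_inv_def
proof (intro ballI allI impI)
 fix x :: "real^'d => complex" and delta :: real assume x: "x \<in> Sigma1" and delta: "delta > 0"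
 have it: "\<exists>z\<in>Sigma1. qr (%t. T z t - x t) <= (1 / 2) ^ n * qr x \<and> qr z <= 2 * L * (1 - (1 / 2) ^ n) * qr x" for n
 proof (induction n)
  case 0
  have "T (%t. 0) = (%t. 0)" using T(2)[OF Sigma1_0 Sigma1_0] by (simp add: fun_eq_iff)
  then have "qr (%t. T (%t. 0) t - x t) = qr x" using qr_commute[OF Sigma1_0 x] by simp
  then show ?case by (intro bexI[OF _ Sigma1_0]) (simp add: qr_zero)
 next
  case (Suc n)
  then obtain z where z: "z \<in> Sigma1" "qr (%t. T z t - x t) <= (1 / 2) ^ n * qr x" "qr z <= 2 * L * (1 - (1 / 2) ^ n) * qr x" by blast
  define y where "y t = x t - T z t" for t
  have y: "y \<in> Sigma1" unfolding y_def[abs_def] by (intro Sigma1_diff x T z)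
  have qy: "qr y <= (1 / 2) ^ n * qr x" unfolding y_def[abs_def] using z(2) qr_commute[OF x T(1)[OF z(1)]] by simp
  obtain w where w: "w \<in> Sigma1" "qr (%t. T w t - y t) <= qr y / 2" "qr w <= L * qr y" using half[OF y] by blast
  show ?case
  proof (intro bexI[of _ "%t. z t + w t"] conjI Sigma1_add z w)
   have "T (%t. z t + w t) t - x t = T w t - y t" for t using T(2)[OF z(1) w(1)] by (simp add: y_def fun_eq_iff)
   then show "qr (%t. T (%t. z t + w t) t - x t) <= (1 / 2) ^ Suc n * qr x" using w(2) qy by simp
   have "qr (%t. z t + w t) <= 2 * L * (1 - (1 / 2) ^ n) * qr x + L * ((1 / 2) ^ n * qr x)"
    using qr_add[OF z(1) w(1)] z(3) w(3) mult_left_mono[OF qy L] by linarith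
   also have "... = 2 * L * (1 - (1 / 2) ^ Suc n) * qr x" by (simp add: algebra_simps)
   finally show "qr (%t. z t + w t) <= 2 * L * (1 - (1 / 2) ^ Suc n) * qr x" .
  qed
 qed
 have "(%n. (1 / 2) ^ n * qr x) \<longlonglongrightarrow> 0 * qr x" by (intro tendsto_mult tendsto_const LIMSEQ_power_zero) simp
 then have "eventually (%n. (1 / 2) ^ n * qr x < delta) sequentially" by (intro order_tendstoD(2)[of _ 0]) (use delta in simp_all)
 then obtain n where n: "(1 / 2) ^ n * qr x < delta" by (auto simp: eventually_sequentially)
 obtain z where z: "z \<in> Sigma1" "qr (%t. T z t - x t) <= (1 / 2) ^ n * qr x" "qr z <= 2 * L * (1 - (1 / 2) ^ n) * qr x"
  using it[of n] by blast
 have "2 * L * (1 - (1 / 2) ^ n) * qr x <= 2 * L * 1 * qr x" using L qr_nonneg[of x] by (intro mult_right_mono mult_left_mono) auto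
 then have "qr (%t. T z t - x t) < delta \<and> qr z <= 2 * L * qr x" using z n by simp
 then show "\<exists>z\<in>Sigma1. qr (%t. T z t - x t) < delta \<and> qr z <= 2 * L * qr x" using z(1) by (rule bexI)
qed

text \<open>The outer equation is solved first, and the inner one so accurately that the bound
  \<open>c\<close> of \<open>T\<close> does no harm; hence \<open>c\<close> does not enter the
  cost.\<close>

lemma approx_inv_comp:
 assumes T: "!!x. x \<in> Sigma1 ==> T x \<in> Sigma1" "!!x y. x \<in> Sigma1 ==> y \<in> Sigma1 ==> T (%t. x t - y t) = (%t. T x t - T y t)"
  "!!x. x \<in> Sigma1 ==> qr (T x) <= c * qr x" "c > 0"
  and S: "!!x. x \<in> Sigma1 ==> S x \<in> Sigma1" and L: "L >= 0" "L' >= 0" "approx_inv T L" "approx_inv S L'"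
 shows "approx_inv (%x. T (S x)) (L' * L)"
 unfolding approx_inv_def
proof (intro ballI allI impI)
 fix x :: "real^'d => complex" and delta :: real assume x: "x \<in> Sigma1" and delta: "delta > 0"
 have d2: "delta / 2 > 0" "delta / (2 * c) > 0" using delta T(4) by auto
 obtain y where y: "y \<in> Sigma1" "qr (%t. T y t - x t) < delta / 2" "qr y <= L * qr x"
  using L(3) x d2(1) unfolding approx_inv_def by blast
 obtain z where z: "z \<in> Sigma1" "qr (%t. S z t - y t) < delta / (2 * c)" "qr z <= L' * qr y"
  using L(4) y(1) d2(2) unfolding approx_inv_def by blast
 have "qr (%t. T (S z) t - x t) <= qr (%t. T (S z) t - T y t) + qr (%t. T y t - x t)" by (intro qr_triangle T(1) S z(1) y(1) x)
 also have "qr (%t. T (S z) t - T y t) <= c * qr (%t. S z t - y t)"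
  using T(3)[OF Sigma1_diff[OF S[OF z(1)] y(1)]] unfolding T(2)[OF S[OF z(1)] y(1)] .
 also have "c * qr (%t. S z t - y t) <= c * (delta / (2 * c))" using z(2) T(4) by (intro mult_left_mono) auto
 also have "c * (delta / (2 * c)) = delta / 2" using T(4) by simp
 finally have "qr (%t. T (S z) t - x t) < delta" using y(2) by simp
 moreover have "qr z <= L' * L * qr x" using z(3) mult_left_mono[OF y(3) L(2)] by (simp add: mult.assoc)
 ultimately show "\<exists>z\<in>Sigma1. qr (%t. T (S z) t - x t) < delta \<and> qr z <= L' * L * qr x" using z(1) by blast
qed

definition Qop :: "real => real => (real^'d => complex) => real^'d => complex" where
 "Qop l s x t = of_real (1 - l) * x t + of_real l * conv (moll s) x t"

text \<open>The identity is not a convolution with a function, so a product of operators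
  \<open>Qop\<close> is recorded by its scalar part \<open>(1 - l) ^ n\<close> and its convolution
  part \<open>f\<close>.\<close>

definition aop :: "real => nat => (real^'d => complex) => (real^'d => complex) => real^'d => complex" where
 "aop l n f x t = of_real ((1 - l) ^ n) * x t + conv f x t"

lemma Qop_Sigma1: "s > 0 ==> x \<in> Sigma1 ==> Qop l s x \<in> Sigma1"
 unfolding Qop_def[abs_def] by (intro Sigma1_add Sigma1_cmult Sigma1_conv_Sigma1 mollifier_Sigma1)

lemma aop_Sigma1: "f \<in> Sigma1 ==> x \<in> Sigma1 ==> aop l n f x \<in> Sigma1"
 unfolding aop_def[abs_def] by (intro Sigma1_add Sigma1_cmult Sigma1_conv_Sigma1)

text \<open>For small \<open>l\<close> the operator is a perturbation of the scalar
  \<open>1 - l\<close>. As \<open>wl (moll s)\<close> is bounded uniformly in \<open>s\<close>, the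
  same \<open>l\<close> and the same cost 4 serve for mollifiers of every width up to 1.\<close>

lemma Qop_approx_inv:
 "\<exists>l M. 0 < l \<and> l < 1 \<and> 0 <= M \<and> (\<forall>s. 0 < s --> s <= 1 --> wl (moll s) <= M \<and> approx_inv (Qop l s) 4)"
proof -
 obtain M where M: "M >= 0" "!!s. 0 < s ==> s <= 1 ==> wl (moll s) <= M" using wl_moll_bounded by blast
 define C2 where "C2 = max 1 (Cc * M)"
 \<comment> \<open>Solves \<open>b powr r * C2 = 1 / 2\<close>. With \<open>l = b / 2\<close> the
   ratio \<open>l / (1 - l)\<close> is at most \<open>b\<close>, which yields the halving of the
   residual.\<close>
 define b where "b = (1 / (2 * C2)) powr (1 / r)"
 have C2: "C2 >= 1" "Cc * M <= C2" by (auto simp: C2_def)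
 have b: "b > 0" "b <= 1" using C2 r by (auto simp: b_def intro: powr_le1)
 have bC: "b powr r * C2 = 1 / 2" using C2 r by (simp add: b_def powr_powr)
 define l where "l = b / 2"
 have l: "0 < l" "l <= 1 / 2" "2 * l = b" using b by (auto simp: l_def)
 have "approx_inv (Qop l s) (2 * 2)" if s: "0 < s" "s <= 1" for s
 proof (rule approx_inv_half)
  have m: "moll s \<in> Sigma1" by (rule mollifier_Sigma1[OF s(1)])
  show "Qop l s x \<in> Sigma1" if "x \<in> Sigma1" for x by (rule Qop_Sigma1[OF s(1) that])
  show "Qop l s (%t. x t + y t) = (%t. Qop l s x t + Qop l s y t)" if "x \<in> Sigma1" "y \<in> Sigma1" for x y
   by (simp add: Qop_def fun_eq_iff conv_linear(3)[OF m that] algebra_simps)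
  fix x :: "real^'d => complex" assume x: "x \<in> Sigma1"
  have cx: "conv (moll s) x \<in> Sigma1" by (intro Sigma1_conv_Sigma1 m x)
  \<comment> \<open>First term of the Neumann series: division by the scalar part.\<close>
  let ?z = "%t. of_real (1 / (1 - l)) * x t"
  have ll: "1 / (1 - l) <= 2" "l / (1 - l) <= b" "1 - l > 0" using l by (auto simp: field_simps)
  have zS: "?z \<in> Sigma1" by (rule Sigma1_cmult[OF x])
  have "Qop l s ?z t - x t = of_real (l / (1 - l)) * conv (moll s) x t" for t
  proof -
   have "complex_of_real (1 - l) * of_real (1 / (1 - l)) = 1" using ll(3) by (simp flip: of_real_mult)
   then show ?thesis unfolding Qop_def conv_linear(6)[OF m x x] using ll(3) by (simp flip: mult.assoc of_real_mult)
  qed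
  then have "(%t. Qop l s ?z t - x t) = (%t. of_real (l / (1 - l)) * conv (moll s) x t)" by (rule ext)
  moreover have "qr (%t. of_real (l / (1 - l)) * conv (moll s) x t) = (l / (1 - l)) powr r * qr (conv (moll s) x)"
   using l ll(3) by (intro qr_scale cx) simp
  ultimately have "qr (%t. Qop l s ?z t - x t) = (l / (1 - l)) powr r * qr (conv (moll s) x)" by simp
  also have "... <= b powr r * (C2 * qr x)"
  proof (intro mult_mono powr_mono2)
   have "qr (conv (moll s) x) <= Cc * (M * qr x)"
    using Cc(2)[OF m x] mult_left_mono[OF mult_right_mono[OF M(2)[OF s] qr_nonneg[of x]] Cc(1)] by linarith
   also have "... <= C2 * qr x" using mult_right_mono[OF C2(2) qr_nonneg[of x]] by (simp add: mult.assoc)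
   finally show "qr (conv (moll s) x) <= C2 * qr x" .
  qed (use l ll r qr_nonneg in auto)
  also have "... = qr x / 2" using bC by (simp flip: mult.assoc)
  finally have h: "qr (%t. Qop l s ?z t - x t) <= qr x / 2" .
  have "(1 / (1 - l)) powr r <= 2 powr r" using ll r by (intro powr_mono2) auto
  also have "... <= 2 powr 1" using r by (intro powr_mono) auto
  finally have "(1 / (1 - l)) powr r * qr x <= 2 * qr x" by (intro mult_right_mono qr_nonneg) simp
  moreover have "qr ?z = (1 / (1 - l)) powr r * qr x" using ll(3) by (intro qr_scale x) simp
  ultimately have "qr ?z <= 2 * qr x" by simp
  with h zS show "\<exists>z\<in>Sigma1. qr (%t. Qop l s z t - x t) <= qr x / 2 \<and> qr z <= 2 * qr x" by blast
 qed simp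
 then show ?thesis using l M by (intro exI[of _ l] exI[of _ M]) auto
qed

lemma power_powr: "0 <= x ==> (x ^ n) powr p = (x powr p) ^ n" for x p :: real
 by (induction n) (simp_all add: powr_mult)

lemma aop_diff:
 assumes "f \<in> Sigma1" "x \<in> Sigma1" "y \<in> Sigma1"
 shows "aop l n f (%t. x t - y t) = (%t. aop l n f x t - aop l n f y t)" "aop l n f (%t. x t + y t) = (%t. aop l n f x t + aop l n f y t)"
 by (simp_all add: aop_def fun_eq_iff conv_linear[OF assms] algebra_simps)

lemma aop_bound:
 assumes l: "0 < l" "l < 1" and f: "f \<in> Sigma1" and x: "x \<in> Sigma1"
 shows "qr (aop l n f x) <= (1 + Cc * wl f) * qr x"
proof -
 have "qr (aop l n f x) <= qr (%t. of_real ((1 - l) ^ n) * x t) + qr (conv f x)"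
  unfolding aop_def[abs_def] by (intro qr_add Sigma1_cmult Sigma1_conv_Sigma1 f x)
 also have "... <= 1 * qr x + Cc * (wl f * qr x)"
 proof (intro add_mono Cc f x)
  have "(1 - l) ^ n <= 1" using l by (intro power_le_one) auto
  then have "((1 - l) ^ n) powr r <= 1" using l r by (intro powr_le1) auto
  moreover have "0 <= (1 - l) ^ n" using l by simp
  ultimately show "qr (%t. of_real ((1 - l) ^ n) * x t) <= 1 * qr x"
   unfolding qr_scale[OF x \<open>0 <= (1 - l) ^ n\<close>] by (intro mult_right_mono qr_nonneg)
 qed
 finally show ?thesis by (simp add: algebra_simps)
qed

text \<open>The target changes by at most \<open>(1 / 16) ^ n\<close>, and the correction of
  \<open>g\<close> costs \<open>4 ^ n\<close> times as much, which leaves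
  \<open>(1 / 4) ^ n\<close>. A further factor \<open>Qop l s\<close> with a narrow mollifier then
  raises the operator to \<open>n + 1\<close> while disturbing the equation and \<open>f\<close>
  only slightly.\<close>

lemma factor_step:
 assumes l: "0 < l" "l < 1" and M: "!!s. 0 < s ==> s <= 1 ==> wl (moll s) <= M \<and> approx_inv (Qop l s) 4"
  and h: "h \<in> Sigma1" "h' \<in> Sigma1" "qr (%t. h' t - h t) <= (1 / 16) ^ n"
  and f: "f \<in> Sigma1" and g: "g \<in> Sigma1" and inv: "qr (%t. aop l n f g t - h t) <= (1 / 16) ^ n" "approx_inv (aop l n f) (4 ^ n)"
 shows "\<exists>f'\<in>Sigma1. \<exists>g'\<in>Sigma1. qr (%t. aop l (Suc n) f' g' t - h' t) <= (1 / 16) ^ Suc n \<and> approx_inv (aop l (Suc n) f') (4 ^ Suc n)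
  \<and> wl (%t. f' t - f t) <= (1 / 2) ^ n + ((1 - l) powr r) ^ n * M \<and> qr (%t. g' t - g t) <= 2 * (1 / 4) ^ n"
proof -
 note aS = aop_Sigma1[OF f]
 define epsilon :: real where "epsilon = (1 / 16) ^ Suc n"
 have e: "epsilon > 0" by (simp add: epsilon_def)
 \<comment> \<open>The residual for the new target: change of target plus old error, hence the
   factor 2 in \<open>qx\<close>.\<close>
 define x where "x t = h' t - aop l n f g t" for t
 have x: "x \<in> Sigma1" unfolding x_def[abs_def] by (intro Sigma1_diff h aS g)
 have "qr x <= qr (%t. h' t - h t) + qr (%t. h t - aop l n f g t)" unfolding x_def[abs_def] by (intro qr_triangle h aS g)
 also have "... <= 2 * (1 / 16) ^ n" using h(3) inv(1) qr_commute[OF h(1) aS[OF g]] by simp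
 finally have qx: "qr x <= 2 * (1 / 16) ^ n" .
 have "epsilon / 2 > 0" using e by simp
 then obtain z where z: "z \<in> Sigma1" "qr (%t. aop l n f z t - x t) < epsilon / 2" "qr z <= 4 ^ n * qr x"
  using inv(2) x unfolding approx_inv_def by blast
 define g' where "g' t = g t + z t" for t
 have g': "g' \<in> Sigma1" unfolding g'_def[abs_def] by (intro Sigma1_add g z)
 have "4 ^ n * qr x <= 4 ^ n * (2 * (1 / 16) ^ n)" by (intro mult_left_mono qx) simp
 with z(3) have "qr z <= 4 ^ n * (2 * (1 / 16) ^ n)" by (rule order_trans)
 also have "4 ^ n * (2 * (1 / 16) ^ n) = 2 * ((4 * (1 / 16)) ^ n :: real)" unfolding power_mult_distrib by simp
 finally have qz: "qr (%t. g' t - g t) <= 2 * (1 / 4) ^ n" by (simp add: g'_def)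
 have "aop l n f g' t - h' t = aop l n f z t - x t" for t
  using aop_diff(2)[OF f g z(1), of l n] by (simp add: g'_def[abs_def] x_def)
 then have ag: "qr (%t. aop l n f g' t - h' t) < epsilon / 2" using z(2) by simp
 define c where "c = 1 + Cc * wl f"
 have c: "c > 0" using Cc(1) wl_nonneg[of f] by (simp add: c_def add_pos_nonneg)
 have "epsilon / (2 * c) > 0" using e c by simp
 from q_moll_approx[OF g' this] obtain s1 where s1: "s1 > 0" "!!s. 0 < s ==> s < s1 ==> qr (%t. conv (moll s) g' t - g' t) < epsilon / (2 * c)" by blast
 have "(1 / 2) ^ n > (0::real)" by simp
 from wl_moll_approx_Sigma1[OF f this] obtain s2 where s2: "s2 > 0" "!!s. 0 < s ==> s < s2 ==> wl (%t. conv (moll s) f t - f t) < (1 / 2) ^ n" by blast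
 \<comment> \<open>The width is chosen after \<open>f\<close> and \<open>g'\<close>: small enough
   for the mollifier to move both by little, the tolerance for \<open>g'\<close> being reduced by
   the bound \<open>c\<close> of the operator.\<close>
 define s where "s = min 1 (min s1 s2) / 2"
 have s: "0 < s" "s <= 1" "s < s1" "s < s2" using s1 s2 by (auto simp: s_def)
 let ?p = "moll s :: real^'d => complex"
 have p: "?p \<in> Sigma1" by (rule mollifier_Sigma1[OF s(1)])
 have pf: "conv ?p f \<in> Sigma1" by (rule Sigma1_conv_Sigma1[OF p f])
 \<comment> \<open>The convolution part of the product of \<open>(1 - l) ^ n + f\<close> and
   \<open>(1 - l) + l p\<close>; its scalar part is \<open>(1 - l) ^ (n + 1)\<close>.\<close>
 define f' where "f' t = of_real (1 - l) * f t + (of_real l * conv ?p f t + of_real (l * (1 - l) ^ n) * ?p t)" for t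
 have f': "f' \<in> Sigma1" unfolding f'_def[abs_def] by (intro Sigma1_add Sigma1_cmult f p pf)
 have convQ: "conv f (Qop l s w) t = of_real (1 - l) * conv f w t + of_real l * conv f (conv ?p w) t" if w: "w \<in> Sigma1" for w t
 proof -
  have pw: "conv ?p w \<in> Sigma1" by (rule Sigma1_conv_Sigma1[OF p w])
  show ?thesis
   unfolding Qop_def[abs_def] by (simp only: conv_linear(3)[OF f Sigma1_cmult[OF w] Sigma1_cmult[OF pw]] conv_linear(6)[OF f w w] conv_linear(6)[OF f pw w])
 qed
 have rec: "aop l (Suc n) f' w = aop l n f (Qop l s w)" if w: "w \<in> Sigma1" for w
 proof
  fix t
  have e1: "conv f (conv ?p w) = conv (conv ?p f) w"
   unfolding conv_assoc[OF f p w] conv_commute[OF Sigma1_borel[OF f] Sigma1_borel[OF p]] ..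
  have e2: "conv f' w t = of_real (1 - l) * conv f w t + (of_real l * conv (conv ?p f) w t + of_real (l * (1 - l) ^ n) * conv ?p w t)"
   unfolding f'_def[abs_def] by (simp only: conv_linear(1)[OF Sigma1_cmult[OF f] Sigma1_add[OF Sigma1_cmult[OF pf] Sigma1_cmult[OF p]] w]
    conv_linear(1)[OF Sigma1_cmult[OF pf] Sigma1_cmult[OF p] w] conv_linear(5)[OF _ w w] f pf p)
  show "aop l (Suc n) f' w t = aop l n f (Qop l s w) t"
   unfolding aop_def e2 convQ[OF w] e1 by (simp add: Qop_def algebra_simps)
 qed
 have "approx_inv (%w. aop l n f (Qop l s w)) (4 * 4 ^ n)"
  by (rule approx_inv_comp[OF aS aop_diff(1)[OF f] aop_bound[OF l f] _ Qop_Sigma1[OF s(1)] _ _ inv(2) conjunct2[OF M[OF s(1,2)]]])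
   (use c in \<open>auto simp: c_def\<close>)
 then have ai: "approx_inv (aop l (Suc n) f') (4 ^ Suc n)" unfolding approx_inv_def using rec by simp
 \<comment> \<open>The new factor differs from the identity by \<open>l\<close> times mollification
   minus identity, so only the mollification error of \<open>g'\<close> enters.\<close>
 have "aop l (Suc n) f' g' t - aop l n f g' t = of_real l * aop l n f (%t. conv ?p g' t - g' t) t" for t
  unfolding rec[OF g'] aop_def convQ[OF g'] conv_linear(4)[OF f Sigma1_conv_Sigma1[OF p g'] g'] Qop_def by (simp add: algebra_simps)
 then have "(%t. aop l (Suc n) f' g' t - aop l n f g' t) = (%t. of_real l * aop l n f (%t. conv ?p g' t - g' t) t)" by (rule ext)
 moreover have dS: "(%t. conv ?p g' t - g' t) \<in> Sigma1" by (intro Sigma1_diff Sigma1_conv_Sigma1 p g')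
 ultimately have "qr (%t. aop l (Suc n) f' g' t - aop l n f g' t) = l powr r * qr (aop l n f (%t. conv ?p g' t - g' t))"
  using qr_scale[OF aS[OF dS], of l l n] l by simp
 also have "... <= 1 * (c * qr (%t. conv ?p g' t - g' t))"
  unfolding c_def using l r by (intro mult_mono aop_bound f dS powr_le1 qr_nonneg) auto
 also have "... <= c * (epsilon / (2 * c))" unfolding mult_1_left by (rule mult_left_mono[OF less_imp_le[OF s1(2)[OF s(1,3)]] less_imp_le[OF c]])
 also have "... = epsilon / 2" using c by simp
 finally have "qr (%t. aop l (Suc n) f' g' t - h' t) <= epsilon"
  using qr_triangle[OF aop_Sigma1[OF f' g'] aS[OF g'] h(2), of l "Suc n" l n] ag by linarith
 \<comment> \<open>The difference consists of the mollification error of \<open>f\<close> and of the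
   new mollifier with its geometrically small coefficient.\<close>
 moreover have "wl (%t. f' t - f t) <= (1 / 2) ^ n + ((1 - l) powr r) ^ n * M"
 proof -
  let ?d = "%t. conv ?p f t - f t"
  have dW: "?d \<in> WL r v" by (intro Sigma1_WL Sigma1_diff pf f)
  have "wl (%t. f' t - f t) = wl (%t. of_real l * ?d t + of_real (l * (1 - l) ^ n) * ?p t)"
   by (simp add: f'_def algebra_simps)
  also have "... <= wl (%t. of_real l * ?d t) + wl (%t. of_real (l * (1 - l) ^ n) * ?p t)"
   by (rule conjunct2[OF WL_add[OF WL_cmult(1)[OF dW] WL_cmult(1)[OF Sigma1_WL[OF p]]]])
  also have "... = l powr r * wl ?d + (l powr r * ((1 - l) powr r) ^ n) * wl ?p"
  proof -
   have "norm (complex_of_real l) = l" "norm (complex_of_real (l * (1 - l) ^ n)) = l * (1 - l) ^ n"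
    using l unfolding norm_of_real by simp_all
   then show ?thesis unfolding WL_cmult(2)[OF dW] WL_cmult(2)[OF Sigma1_WL[OF p]] using l by (simp only: powr_mult power_powr)
  qed
  also have "... <= 1 * (1 / 2) ^ n + (1 * ((1 - l) powr r) ^ n) * M"
   using l r s2(2)[OF s(1,4)] M[OF s(1,2)] wl_nonneg by (intro add_mono mult_mono powr_le1) auto
  finally show ?thesis by simp
 qed
 ultimately show ?thesis using f' g' ai qz unfolding epsilon_def by blast
qed

text \<open>The scalar parts \<open>(1 - l) ^ n\<close> tend to 0 and the \<open>g n\<close> stay
  bounded, so in the limit the convolution parts alone reproduce the \<open>h n\<close>.\<close>

lemma factorization:
 assumes h: "!!n. h n \<in> Sigma1" "!!n. qr (%t. h (Suc n) t - h n t) <= (1 / 16) ^ n"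
 shows "\<exists>f g. (\<forall>n. f n \<in> Sigma1 \<and> g n \<in> Sigma1) \<and> summable (%n. wl (%t. f (Suc n) t - f n t)) \<and> summable (%n. qr (%t. g (Suc n) t - g n t))
  \<and> (%n. qr (%t. conv (f n) (g n) t - h n t)) \<longlonglongrightarrow> 0"
proof -
 obtain l M where l: "0 < l" "l < 1" "0 <= M" and M: "!!s. 0 < s ==> s <= 1 ==> wl (moll s) <= M \<and> approx_inv (Qop l s) 4"
  using Qop_approx_inv by blast
 define rho where "rho = (1 - l) powr r"
 have rho: "0 <= rho" "rho < 1" using l r powr_less_mono2[of r "1 - l" 1] by (auto simp: rho_def)
 let ?P = "%n (f, g). f \<in> Sigma1 \<and> g \<in> Sigma1 \<and> qr (%t. aop l n f g t - h n t) <= (1 / 16) ^ n \<and> approx_inv (aop l n f) (4 ^ n)"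
 let ?R = "%n (f, g) (f', g'). wl (%t. f' t - f t) <= (1 / 2) ^ n + rho ^ n * M \<and> qr (%t. g' t - g t) <= 2 * (1 / 4) ^ n"
 have "\<exists>F. \<forall>n. ?P n (F n) \<and> ?R n (F n) (F (Suc n))"
 proof (rule dependent_nat_choice)
  \<comment> \<open>The start is the empty product: scalar part 1, \<open>f = 0\<close> and
    \<open>g = h 0\<close>.\<close>
  have "aop l 0 (%t. 0) = (%x. x)" by (simp add: aop_def fun_eq_iff conv_def)
  moreover have "approx_inv (%x. x) 1"
   unfolding approx_inv_def
  proof (intro ballI allI impI)
   fix x :: "real^'d => complex" and delta :: real assume "x \<in> Sigma1" "delta > 0"
   then show "\<exists>z\<in>Sigma1. qr (%t. z t - x t) < delta \<and> qr z <= 1 * qr x" by (intro bexI[of _ x]) (simp_all add: qr_zero)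
  qed
  ultimately have "?P 0 (%t. 0, h 0)" by (simp add: Sigma1_0 h qr_zero)
  then show "\<exists>x. ?P 0 x" by blast
  fix x n assume "?P n x"
  then obtain f g where x: "x = (f, g)" and P: "f \<in> Sigma1" "g \<in> Sigma1" "qr (%t. aop l n f g t - h n t) <= (1 / 16) ^ n" "approx_inv (aop l n f) (4 ^ n)"
   by (cases x) auto
  from factor_step[OF l(1,2) M h(1) h(1) h(2) P]
  obtain f' g' where "?P (Suc n) (f', g')" "?R n x (f', g')" unfolding x rho_def by auto
  then show "\<exists>y. ?P (Suc n) y \<and> ?R n x y" by blast
 qed
 then obtain F where F0: "\<forall>n. ?P n (F n) \<and> ?R n (F n) (F (Suc n))" ..
 have F: "?P n (F n)" for n by (rule conjunct1[OF spec[OF F0]])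
 have FR: "?R n (F n) (F (Suc n))" for n by (rule conjunct2[OF spec[OF F0]])
 define f where "f n = fst (F n)" for n
 define g where "g n = snd (F n)" for n
 have fS: "f n \<in> Sigma1" and gS: "g n \<in> Sigma1" and ap: "qr (%t. aop l n (f n) (g n) t - h n t) <= (1 / 16) ^ n"
  and wf: "wl (%t. f (Suc n) t - f n t) <= (1 / 2) ^ n + rho ^ n * M" and qg: "qr (%t. g (Suc n) t - g n t) <= 2 * (1 / 4) ^ n" for n
  using F[of n] FR[of n] by (simp_all add: f_def g_def case_prod_beta)
 have sf: "summable (%n. wl (%t. f (Suc n) t - f n t))"
 proof (rule summable_comparison_test'[of "%n. (1 / 2) ^ n + rho ^ n * M" 0])
  show "summable (%n. (1 / 2) ^ n + rho ^ n * M)" using rho by (intro summable_add summable_mult2 summable_geometric) auto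
 qed (use wf wl_nonneg in simp)
 have sq: "summable (%n. 2 * (1 / 4) ^ n :: real)" by (intro summable_mult summable_geometric) simp
 have sg: "summable (%n. qr (%t. g (Suc n) t - g n t))"
  by (rule summable_comparison_test'[OF sq, of 0]) (use qg qr_nonneg in simp)
 have gb: "qr (g n) <= qr (g 0) + (\<Sum>n. 2 * (1 / 4) ^ n)" for n
 proof -
  have "qr (g n) <= qr (g 0) + (\<Sum>i<n. 2 * (1 / 4) ^ i)"
  proof (induction n)
   case (Suc n)
   have "qr (g (Suc n)) <= qr (%t. g (Suc n) t - g n t) + qr (g n)" using qr_add[OF Sigma1_diff[OF gS gS] gS, of "Suc n" n n] by simp
   then show ?case using Suc qg[of n] by simp
  qed simp
  also have "(\<Sum>i<n. 2 * (1 / 4) ^ i :: real) <= (\<Sum>n. 2 * (1 / 4) ^ n)" by (intro sum_le_suminf sq) auto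
  finally show ?thesis by simp
 qed
 have "qr (%t. conv (f n) (g n) t - h n t) <= (1 / 16) ^ n + rho ^ n * (qr (g 0) + (\<Sum>n. 2 * (1 / 4) ^ n))" for n
 proof -
  let ?y = "%t. of_real ((1 - l) ^ n) * g n t"
  have "qr (%t. conv (f n) (g n) t - h n t) = qr (%t. (aop l n (f n) (g n) t - h n t) - ?y t)" by (simp add: aop_def)
  also have "... <= qr (%t. aop l n (f n) (g n) t - h n t) + qr ?y"
   by (intro qr_diff Sigma1_diff Sigma1_cmult aop_Sigma1 fS gS h)
  also have "qr ?y = rho ^ n * qr (g n)" using qr_scale[OF gS, of "(1 - l) ^ n" n] l by (simp add: rho_def power_powr)
  also have "... <= rho ^ n * (qr (g 0) + (\<Sum>n. 2 * (1 / 4) ^ n))" using rho by (intro mult_left_mono gb) auto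
  finally show ?thesis using ap[of n] by linarith
 qed
 moreover have "(%n. (1 / 16) ^ n + rho ^ n * (qr (g 0) + (\<Sum>n. 2 * (1 / 4) ^ n))) \<longlonglongrightarrow> 0 + 0 * (qr (g 0) + (\<Sum>n. 2 * (1 / 4) ^ n))"
  using rho by (intro tendsto_add tendsto_mult tendsto_const LIMSEQ_power_zero) auto
 ultimately have "(%n. qr (%t. conv (f n) (g n) t - h n t)) \<longlonglongrightarrow> 0"
  by (intro tendsto_zero_le[OF qr_nonneg, of "%n t. conv (f n) (g n) t - h n t" "%n. (1 / 16) ^ n + rho ^ n * (qr (g 0) + (\<Sum>n. 2 * (1 / 4) ^ n))"]) auto
 then show ?thesis using fS gS sf sg by blast
qed

end

section \<open>Passage to the completion\<close>

lemma (in qdist) Cauchy_summable: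
 assumes S: "!!n. s n \<in> S" and b: "!!n. D (s n) (s (Suc n)) <= b n" and sb: "summable b"
 shows "s \<in> Cauchy_in S d"
proof (rule Cauchy_inI[OF S])
 have b0: "0 <= b n" for n using b[of n] powr_ge_zero[of "d (s n) (s (Suc n))" r] by linarith
 have tail: "D (s m) (s (m + k)) <= (\<Sum>i. b (i + m))" for m k
 proof -
  have "D (s m) (s (m + k)) <= (\<Sum>i<k. b (i + m))"
  proof (induction k)
   case (Suc k)
   have "D (s m) (s (Suc (m + k))) <= D (s m) (s (m + k)) + D (s (m + k)) (s (Suc (m + k)))" by (intro d_tri S)
   then show ?case using Suc b[of "m + k"] by (simp add: add.commute)
  qed (simp add: D_refl S)
  also have "... <= (\<Sum>i. b (i + m))" by (intro sum_le_suminf summable_ignore_initial_segment sb) (auto simp: b0)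
  finally show ?thesis .
 qed
 fix e :: real assume "e > 0"
 then have "e / 2 > 0" by simp
 from order_tendstoD(2)[OF suminf_exist_split2[OF sb] this]
 obtain n0 where n0: "(\<Sum>i. b (i + n0)) < e / 2" by (auto simp: eventually_sequentially)
 have "D (s m) (s n) < e" if "m >= n0" "n >= n0" for m n
 proof -
  have "D (s m) (s n) <= D (s m) (s n0) + D (s n0) (s n)" by (intro d_tri S)
  moreover have "D (s m) (s n0) <= (\<Sum>i. b (i + n0))" using tail[of n0 "m - n0"] that(1) D_sym[OF S S, of m n0] by simp
  moreover have "D (s n0) (s n) <= (\<Sum>i. b (i + n0))" using tail[of n0 "n - n0"] that(2) by simp
  ultimately show ?thesis using n0 by linarith
 qed
 then show "\<exists>n0. \<forall>m\<ge>n0. \<forall>n\<ge>n0. D (s m) (s n) < e" by blast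
qed

text \<open>Used with steps of order \<open>(1 / 16) ^ n\<close>, to outweigh the growth
  \<open>4 ^ n\<close> of the cost of inversion; the class stays the same.\<close>

lemma (in qdist) fast_subsequence:
 assumes s: "s \<in> Cauchy_in S d" and e: "!!n. e n > 0"
 shows "\<exists>u. (%n. s (u n)) \<in> Cauchy_in S d \<and> cls (%n. s (u n)) = cls s \<and> (\<forall>n. D (s (u n)) (s (u (Suc n))) <= e n)"
proof -
 have "\<forall>n. \<exists>n0. \<forall>m\<ge>n0. \<forall>k\<ge>n0. D (s m) (s k) < e n" using Cauchy_D[OF s e] by blast
 then obtain M where M: "\<forall>n. \<forall>m\<ge>M n. \<forall>k\<ge>M n. D (s m) (s k) < e n" using choice by metis
 \<comment> \<open>Summing the \<open>M i\<close> makes both \<open>u n\<close> and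
   \<open>u (Suc n)\<close> at least \<open>M n\<close>; adding \<open>n\<close> keeps
   \<open>u n\<close> at least \<open>n\<close>.\<close>
 define u where "u n = (\<Sum>i\<le>n. M i) + n" for n
 have u: "M n <= u n" "M n <= u (Suc n)" "n <= u n" for n
  using member_le_sum[of n "{..n}" M] by (auto simp: u_def)
 have uC: "(%n. s (u n)) \<in> Cauchy_in S d"
 proof (rule Cauchy_inI)
  fix delta :: real assume "delta > 0"
  from Cauchy_D[OF s this] obtain n0 where "\<forall>m\<ge>n0. \<forall>n\<ge>n0. D (s m) (s n) < delta" ..
  then show "\<exists>n0. \<forall>m\<ge>n0. \<forall>n\<ge>n0. D (s (u m)) (s (u n)) < delta" using u(3) order_trans by blast
 qed (rule Cauchy_in_S[OF s])
 have "(%n. D (s (u n)) (s n)) \<longlonglongrightarrow> 0"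
 proof (rule LIMSEQ_I)
  fix delta :: real assume "delta > 0"
  from Cauchy_D[OF s this] obtain n0 where n0: "\<forall>m\<ge>n0. \<forall>n\<ge>n0. D (s m) (s n) < delta" ..
  have "norm (D (s (u n)) (s n) - 0) < delta" if "n >= n0" for n
   using n0[rule_format, of "u n" n] that order_trans[OF that u(3)] by simp
  then show "\<exists>n0. \<forall>n\<ge>n0. norm (D (s (u n)) (s n) - 0) < delta" by blast
 qed
 then have "cls (%n. s (u n)) = cls s" using cls_eq_iff[OF uC s] by simp
 moreover have "D (s (u n)) (s (u (Suc n))) <= e n" for n using M u(1,2) by (intro less_imp_le) blast
 ultimately show ?thesis using uC by blast
qed

context conv_module begin

abbreviation is_extension :: "((real^'d => complex) \<times> (nat => real^'d => complex) set => (nat => real^'d => complex) set) => bool" where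
 "is_extension c \<equiv> continuous_map (prod_topology (WL_top r v) (M0_top phi omega N)) (M0_top phi omega N) c \<and>
  (\<forall>f\<in>Sigma1. \<forall>g\<in>Sigma1. c (f, M0_embed phi omega N g) = M0_embed phi omega N (conv f g))"

text \<open>Stated for every continuous extension: it applies to the one picked by
  \<open>SOME\<close> and, after swapping the arguments, to the one for the other order of the
  factors.\<close>

lemma products_extension:
 assumes c: "is_extension c" shows "products c (WL r v) (M0 phi omega N) = M0 phi omega N"
proof
 have cont: "continuous_map (prod_topology (WL_top r v) (M0_top phi omega N)) (M0_top phi omega N) c" using c by (rule conjunct1)
 have "c (f, x) \<in> M0 phi omega N" if "f \<in> WL r v" "x \<in> M0 phi omega N" for f x
  using continuous_map_image_subset_topspace[OF cont] that by (auto simp: WL_top_def M0_top_def)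
 then show "products c (WL r v) (M0 phi omega N) \<subseteq> M0 phi omega N" by (auto simp: products_def)
 show "M0 phi omega N \<subseteq> products c (WL r v) (M0 phi omega N)"
 proof
  fix x assume "x \<in> M0 phi omega N"
  then obtain h0 where h0: "h0 \<in> Cauchy_in Sigma1 (mod_dist phi omega N)" "x = act.Y.cls h0"
   unfolding M0_def act.Y.completion_eq by blast
  have cp: "c0 powr r > 0" using c0_pos by simp
  \<comment> \<open>The factor \<open>c0 powr r\<close> converts \<open>mod_dist\<close> into
    \<open>qr\<close>, in which the steps become at most \<open>(1 / 16) ^ n\<close>.\<close>
  have "c0 powr r * (1 / 16) ^ n > 0" for n :: nat using cp by simp
  from act.Y.fast_subsequence[OF h0(1), of "%n. c0 powr r * (1 / 16) ^ n", OF this] obtain u where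
   u: "(%n. h0 (u n)) \<in> Cauchy_in Sigma1 (mod_dist phi omega N)" "act.Y.cls (%n. h0 (u n)) = act.Y.cls h0"
    "\<forall>n. mod_dist phi omega N (h0 (u n)) (h0 (u (Suc n))) powr r <= c0 powr r * (1 / 16) ^ n" by blast
  define h where "h n = h0 (u n)" for n
  have hC: "h \<in> Cauchy_in Sigma1 (mod_dist phi omega N)" using u(1) by (simp add: h_def[abs_def])
  have xh: "x = act.Y.cls h" using u(2) h0(2) by (simp add: h_def[abs_def])
  have hS: "h n \<in> Sigma1" for n by (rule act.Y.Cauchy_in_S[OF hC])
  have hq: "qr (%t. h (Suc n) t - h n t) <= (1 / 16) ^ n" for n
  proof -
   have "c0 powr r * qr (%t. h n t - h (Suc n) t) <= c0 powr r * (1 / 16) ^ n"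
    using u(3)[rule_format, of n] unfolding h_def[symmetric] mod_dist_powr[OF hS hS] .
   then have "qr (%t. h n t - h (Suc n) t) <= (1 / 16) ^ n" using cp by simp
   then show ?thesis using qr_commute[OF hS hS, of n "Suc n"] by simp
  qed
  from factorization[OF hS hq] obtain f g where fS: "!!n. f n \<in> Sigma1" and gS: "!!n. g n \<in> Sigma1"
   and sf: "summable (%n. wl (%t. f (Suc n) t - f n t))" and sg: "summable (%n. qr (%t. g (Suc n) t - g n t))"
   and lim: "(%n. qr (%t. conv (f n) (g n) t - h n t)) \<longlonglongrightarrow> 0" by blast
  from WL_complete[OF Sigma1_WL[OF fS] sf] obtain F where F: "F \<in> WL r v" "(%n. wl (%x. f n x - F x)) \<longlonglongrightarrow> 0" by blast
  have gC: "g \<in> Cauchy_in Sigma1 (mod_dist phi omega N)"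
  proof (rule act.Y.Cauchy_summable[OF gS])
   show "mod_dist phi omega N (g n) (g (Suc n)) powr r <= c0 powr r * qr (%t. g (Suc n) t - g n t)" for n
    unfolding mod_dist_powr[OF gS gS] qr_commute[OF gS gS, of n] by simp
   show "summable (%n. c0 powr r * qr (%t. g (Suc n) t - g n t))" by (intro summable_mult sg)
  qed
  have Fl: "(%n. WL_norm r v (%x. F x - f n x)) \<longlonglongrightarrow> 0"
   using F(2) tendsto_powr_zero_iff[of "%n. WL_norm r v (%x. F x - f n x)" r] r(1)
   unfolding WL_norm_powr wl_commute[of F] by (simp add: WL_norm_eq)
  have "(%n. mod_dist phi omega N (conv (f n) (g n)) (h n) powr r) \<longlonglongrightarrow> c0 powr r * 0"
   unfolding mod_dist_powr[OF Sigma1_conv_Sigma1[OF fS gS] hS] by (intro tendsto_mult tendsto_const lim)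
  then have dl: "(%n. mod_dist phi omega N (conv (f n) (g n)) (h n)) \<longlonglongrightarrow> 0"
   using tendsto_powr_zero_iff[of "%n. mod_dist phi omega N (conv (f n) (g n)) (h n)" r] r(1)
    act.Y.d_nonneg[OF Sigma1_conv_Sigma1[OF fS gS] hS] by simp
  \<comment> \<open>The \<open>f n\<close> converge to \<open>F\<close>, \<open>g\<close> is Cauchy,
    and the products \<open>conv (f n) (g n)\<close> are asymptotic to \<open>h\<close>; continuity
    of \<open>c\<close> forces its value at the limit.\<close>
  have "c (F, act.Y.cls g) = act.Y.cls h"
   by (rule act.extension_limit[OF cont[unfolded WL_top_def M0_top_def M0_def] _ F(1) fS Fl gC hC dl])
    (use c in \<open>simp add: M0_embed_def\<close>)
  moreover have "act.Y.cls g \<in> M0 phi omega N" unfolding M0_def by (rule act.Y.cls_in_completion[OF gC])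
  ultimately show "x \<in> products c (WL r v) (M0 phi omega N)" unfolding products_def xh using F(1) by force
 qed
qed

lemma is_extension_ext: "is_extension act.ext"
 using act.ext_continuous act.ext_embed by (simp add: WL_top_def M0_top_def M0_def M0_embed_def)

text \<open>The map picked by \<open>SOME\<close> is an extension because \<open>act.ext\<close> is
  one.\<close>

lemma products_WL_M0: "products (WL_M0_conv phi omega N r v) (WL r v) (M0 phi omega N) = M0 phi omega N"
proof (rule products_extension)
 show "is_extension (WL_M0_conv phi omega N r v)"
  unfolding WL_M0_conv_def by (rule someI[of is_extension, OF is_extension_ext])
qed

text \<open>Convolution of test functions commutes, so swapping the arguments turns extensions for
  one order into extensions for the other. The swap is used twice: for the existence of an extension
  and for reducing the chosen one to the first case.\<close>

lemma products_M0_WL: "products (M0_WL_conv phi omega N r v) (M0 phi omega N) (WL r v) = M0 phi omega N"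
proof -
 let ?P = "%c. continuous_map (prod_topology (M0_top phi omega N) (WL_top r v)) (M0_top phi omega N) c \<and>
  (\<forall>f\<in>Sigma1. \<forall>g\<in>Sigma1. c (M0_embed phi omega N f, g) = M0_embed phi omega N (conv f g))"
 have comm: "conv f g = conv g f" if "f \<in> Sigma1" "g \<in> Sigma1" for f g :: "real^'d => complex"
  by (intro conv_commute Sigma1_borel that)
 have swap: "continuous_map (prod_topology X Y) (prod_topology Y X) (%p. (snd p, fst p))" for X :: "'x topology" and Y :: "'y topology"
  by (intro continuous_map_pairedI continuous_map_fst continuous_map_snd)
 have "?P (act.ext \<circ> (%p. (snd p, fst p)))"
  using continuous_map_compose[OF swap conjunct1[OF is_extension_ext]] conjunct2[OF is_extension_ext] comm by simp
 then have c: "?P (M0_WL_conv phi omega N r v)" unfolding M0_WL_conv_def by (rule someI[of ?P])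
 let ?c = "M0_WL_conv phi omega N r v \<circ> (%p. (snd p, fst p))"
 have "is_extension ?c"
  using continuous_map_compose[OF swap conjunct1[OF c]] conjunct2[OF c] comm by simp
 from products_extension[OF this] have "products ?c (WL r v) (M0 phi omega N) = M0 phi omega N" .
 moreover have "products ?c (WL r v) (M0 phi omega N) = products (M0_WL_conv phi omega N r v) (M0 phi omega N) (WL r v)"
  unfolding products_def by auto
 ultimately show ?thesis by simp
qed

end

theorem theorem4p3:
  fixes \<omega> v\<^sub>0 v\<^sub>1 :: "(real^'d) \<times> (real^'d) \<Rightarrow> real"
    and B :: "((real^'d) \<times> (real^'d) \<Rightarrow> complex) set"
    and N :: "((real^'d) \<times> (real^'d) \<Rightarrow> complex) \<Rightarrow> real"
    and r :: real
    and \<phi> :: "real^'d \<Rightarrow> complex"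
    and v :: "real^'d \<Rightarrow> real"
  assumes "\<phi> \<in> Sigma1" and "\<phi> \<noteq> (\<lambda>_. 0)"
    and "\<omega> \<in> P_E" and "v\<^sub>1 \<in> P_E"
    and "submultiplicative v\<^sub>1" and "moderate v\<^sub>1 \<omega>"
    and "v\<^sub>0 \<in> P_E" and "0 < r" and "r \<le> 1"
    and "invariant_QBF B N v\<^sub>0 r"
    and "\<And>x. v x = v\<^sub>1 (x, 0) * v\<^sub>0 (x, 0)"
  shows "products (WL_M0_conv \<phi> \<omega> N r v) (WL r v) (M0 \<phi> \<omega> N)
           = products (M0_WL_conv \<phi> \<omega> N r v) (M0 \<phi> \<omega> N) (WL r v)
       \<and> products (M0_WL_conv \<phi> \<omega> N r v) (M0 \<phi> \<omega> N) (WL r v) = M0 \<phi> \<omega> N"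
proof -
 obtain A0 k0 where A0: "A0 > 0" "k0 > 0" "!!x y. v\<^sub>0 (x + y) <= A0 * exp (k0 * norm y) * v\<^sub>0 x"
  using P_E_exp_moderate[OF assms(7)] by blast
 obtain A1 k1 where A1: "A1 > 0" "k1 > 0" "!!x y. v\<^sub>1 (x + y) <= A1 * exp (k1 * norm y) * v\<^sub>1 x"
  using P_E_exp_moderate[OF assms(4)] by blast
 obtain C1 where C1: "C1 > 0" "!!x y. \<omega> (x + y) <= C1 * \<omega> x * v\<^sub>1 y" using assms(6) unfolding moderate_def by blast
 have pos: "v\<^sub>0 X > 0" "v\<^sub>1 X > 0" for X using assms(4,7) unfolding P_E_def weight_def by blast+
 \<comment> \<open>Both weights are compared with their values at the origin;
   \<open>norm (x, 0) = norm x\<close>.\<close>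
 have le: "v x <= (A1 * v\<^sub>1 0 * (A0 * v\<^sub>0 0)) * exp ((k1 + k0) * norm x)" for x
 proof -
  have "v x <= (A1 * exp (k1 * norm x) * v\<^sub>1 0) * (A0 * exp (k0 * norm x) * v\<^sub>0 0)"
   using A1(3)[of 0 "(x, 0)"] A0(3)[of 0 "(x, 0)"] pos[of "(x, 0)"] pos[of 0] A0(1) A1(1)
   unfolding assms(11) by (intro mult_mono) (auto simp: norm_Pair)
  also have "... = (A1 * v\<^sub>1 0 * (A0 * v\<^sub>0 0)) * (exp (k1 * norm x) * exp (k0 * norm x))" by (simp only: mult_ac)
  also have "exp (k1 * norm x) * exp (k0 * norm x) = exp ((k1 + k0) * norm x)" unfolding mult_exp_exp by (simp add: algebra_simps)
  finally show ?thesis .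
 qed
 interpret conv_module r v "A1 * v\<^sub>1 0 * (A0 * v\<^sub>0 0)" "k1 + k0" B N v\<^sub>0 \<omega> \<phi> v\<^sub>1 C1
 proof
  show "0 < v x" for x using pos by (simp add: assms(11))
  show "k1 + k0 > 0" using A0(2) A1(2) by simp
 qed (use assms C1 le in auto)
 show ?thesis using products_WL_M0 products_M0_WL by simp
qed

end
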